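(* Assume that $C\in L^1(\mathbb{R}^2)$ and $C(\mathbf 0)<\infty$. Let $u^\varepsilon$ be the field defined in the context. For $z\ge0$ and $r\in\mathbb{R}^2$ define the scintillation index $$S^\varepsilon(z,r):=\frac{\mathbb E\big[|u^\varepsilon(\frac z\varepsilon,\frac r\varepsilon)|^4\big]-\mathbb E\big[|u^\varepsilon(\frac z\varepsilon,\frac r\varepsilon)|^2\big]^2}{\mathbb E\big[|u^\varepsilon(\frac z\varepsilon,\frac r\varepsilon)|^2\big]^2}.$$ Then, as $\varepsilon\to0$, $$S^\varepsilon(z,r)\longrightarrow 1-\frac{\exp\big(-\frac{2|r|^2}{r_0^2}\big)}{\Big|\frac1{4\pi}\int_{\mathbb{R}^2}\exp\Big(\frac{k_0^2}{4}\int_0^zC\big(w\frac{z'}{k_0r_0}\big)dz'-\frac{|w|^2}{4}+iw\cdot\frac r{r_0}\Big)dw\Big|^2}.$$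
   Context: Fix $k_0>0$ and $r_0>0$. $C:\mathbb{R}^2\to\mathbb{R}$ is a covariance function of a real stationary field (real, even, positive definite). Under the assumption $C\in L^1(\mathbb{R}^2)$, $C(\mathbf 0)<\infty$, its Fourier transform $\hat C$ is continuous, bounded, nonnegative and integrable, and $C$ is continuous and bounded. For $\varepsilon>0$, $B^\varepsilon(z,x)$ is a real-valued Brownian field on $[0,\infty)\times\mathbb{R}^2$ with covariance $\mathbb E[B^\varepsilon(z,x)B^\varepsilon(z',x')]=\min\{z,z'\}\,\varepsilon\,C(x-x')$, and $u^\varepsilon$ is the ($L^2(\mathbb{R}^2)$-valued) solution of the Itô–Schrödinger equation $$du^\varepsilon(z,x)=\frac{i}{2k_0}\Delta_xu^\varepsilon(z,x)\,dz+\frac{ik_0}{2}u^\varepsilon(z,x)\circ dB^\varepsilon(z,x),\qquad u^\varepsilon(0,x)=\exp\Big(-\frac{\varepsilon^2|x|^2}{2r_0^2}\Big),$$ where $\circ$ denotes the Stratonovich integral. The moments of $u^\varepsilon$ are the continuous functions solving the closed moment equations: for $p=1,2$, $m_{2p}(z,(x_j)_{j\le p},(y_l)_{l\le p})=\mathbb E[\prod_ju^\varepsilon(z,x_j)\prod_l\overline{u^\varepsilon(z,y_l)}]$ solves, in $L^2((\mathbb{R}^2)^{2p})$, $$\partial_zm_{2p}=\frac{i}{2k_0}\Big(\sum_j\Delta_{x_j}-\sum_l\Delta_{y_l}\Big)m_{2p}+\frac{k_0^2\varepsilon}{4}\Big(\sum_{j,l}C(x_j-y_l)-\sum_{j<j'}C(x_j-x_{j'})-\sum_{l<l'}C(y_l-y_{l'})-pC(\mathbf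 0)\Big)m_{2p},$$ with initial conditions given by the corresponding products of the initial field. In particular $\mathbb E[|u^\varepsilon(z,x)|^2]=m_2(z,x,x)$ and $\mathbb E[|u^\varepsilon(z,x)|^4]=m_4(z,x,x,x,x)$. *)

theory Defs
  imports "HOL-Probability.Probability"
begin

type_synonym plane = "real ^ 2"


section \<open>Covariance functions and Brownian fields\<close>

text \<open>For even real functions, positive definiteness over real and over complex coefficients
  coincide.  Continuity is part of the definition because positive definiteness and integrability
  alone do not give it (take the indicator of the origin).\<close>

definition covariance_function :: "(plane \<Rightarrow> real) \<Rightarrow> bool" where
  "covariance_function C \<longleftrightarrow>
     continuous_on UNIV C \<and>
     (\<forall>x. C (- x) = C x) \<and>
     (\<forall>(n::nat) (x :: nat \<Rightarrow> plane) (a :: nat \<Rightarrow> real).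
        0 \<le> (\<Sum>i<n. \<Sum>j<n. a i * a j * C (x i - x j)))"

definition centered_gaussian :: "'a measure \<Rightarrow> ('a \<Rightarrow> real) \<Rightarrow> bool" where
  "centered_gaussian M X \<longleftrightarrow>
     X \<in> borel_measurable M \<and>
     ((AE \<omega> in M. X \<omega> = 0) \<or> (\<exists>\<sigma>>0. distributed M lborel X (normal_density 0 \<sigma>)))"

definition brownian_field ::
    "'a measure \<Rightarrow> (plane \<Rightarrow> real) \<Rightarrow> (real \<Rightarrow> plane \<Rightarrow> 'a \<Rightarrow> real) \<Rightarrow> bool" where
  "brownian_field M K B \<longleftrightarrow>
     prob_space M \<and>
     (\<forall>(n::nat) (z :: nat \<Rightarrow> real) (x :: nat \<Rightarrow> plane) (a :: nat \<Rightarrow> real).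
        (\<forall>i<n. 0 \<le> z i) \<longrightarrow> centered_gaussian M (\<lambda>\<omega>. \<Sum>i<n. a i * B (z i) (x i) \<omega>)) \<and>
     (\<forall>z\<ge>0. \<forall>z'\<ge>0. \<forall>x x'. (LINT \<omega>|M. B z x \<omega> * B z' x' \<omega>) = min z z' * K (x - x')) \<and>
     (\<forall>x. AE \<omega> in M. continuous_on {0..} (\<lambda>z. B z x \<omega>))"

text \<open>\<open>F\<close> is a filtration to which \<open>B\<close> is adapted and with respect to which the increments of
  \<open>B\<close> are independent of the past; \<open>B\<close> is jointly measurable in space and chance.\<close>

definition brownian_filtration ::
    "'a measure \<Rightarrow> (real \<Rightarrow> 'a measure) \<Rightarrow> (real \<Rightarrow> plane \<Rightarrow> 'a \<Rightarrow> real) \<Rightarrow> bool" where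
  "brownian_filtration M F B \<longleftrightarrow>
     filtration (space M) F \<and>
     (\<forall>z. subalgebra M (F z)) \<and>
     (\<forall>z\<ge>0. (\<lambda>(x, \<omega>). B z x \<omega>) \<in> borel_measurable (lborel \<Otimes>\<^sub>M F z)) \<and>
     (\<forall>z\<ge>0. prob_space.indep_set M (sets (F z))
        (sigma_sets (space M)
          {(\<lambda>\<omega>. B z' x \<omega> - B z x \<omega>) -` A \<inter> space M | z' x A. z \<le> z' \<and> A \<in> sets borel}))"


section \<open>Laplacians and test functions\<close>

definition laplacian :: "('a::euclidean_space \<Rightarrow> complex) \<Rightarrow> 'a \<Rightarrow> complex" where
  "laplacian f x = (\<Sum>b\<in>Basis.
     vector_derivative
       (\<lambda>s. vector_derivative (\<lambda>t. f (x + t *\<^sub>R b)) (at s)) (at 0))"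

text \<open>Twice continuously differentiable functions with compact support; by mollification, testing
  second-order equations against these is the same as testing against smooth ones.\<close>

definition test_function :: "('a::euclidean_space \<Rightarrow> complex) \<Rightarrow> bool" where
  "test_function \<phi> \<longleftrightarrow>
     bounded {x. \<phi> x \<noteq> 0} \<and>
     (\<exists>(D :: 'a \<Rightarrow> 'a \<Rightarrow>\<^sub>L complex) (D2 :: 'a \<Rightarrow> 'a \<Rightarrow>\<^sub>L ('a \<Rightarrow>\<^sub>L complex)).
        (\<forall>x. (\<phi> has_derivative blinfun_apply (D x)) (at x)) \<and>
        (\<forall>x. (D has_derivative blinfun_apply (D2 x)) (at x)) \<and>
        continuous_on UNIV D2)"

definition square_integrable :: "('a::euclidean_space \<Rightarrow> complex) \<Rightarrow> bool" where
  "square_integrable f \<longleftrightarrow>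
     f \<in> borel_measurable lborel \<and> integrable lborel (\<lambda>x. (norm (f x))\<^sup>2)"

definition L2_continuous :: "(real \<Rightarrow> 'a::euclidean_space \<Rightarrow> complex) \<Rightarrow> bool" where
  "L2_continuous f \<longleftrightarrow>
     (\<forall>z\<ge>0. square_integrable (f z)) \<and>
     (\<forall>z\<ge>0. ((\<lambda>z'. LINT x|lborel. (norm (f z' x - f z x))\<^sup>2) \<longlongrightarrow> 0) (at z within {0..}))"

text \<open>The duality pairing is bilinear: there is no complex conjugation.\<close>

definition pairing ::
    "('a::euclidean_space \<Rightarrow> complex) \<Rightarrow> ('a \<Rightarrow> complex) \<Rightarrow> complex" where
  "pairing f \<phi> = (LINT x|lborel. f x * \<phi> x)"


section \<open>The Ito--Schroedinger equation\<close>

text \<open>The Stratonovich integral of \<open>X\<close> against \<open>B\<close> over \<open>[0, z]\<close>, integrated over space: the limit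
  in probability of the trapezoidal sums over deterministic partitions whose mesh tends to
  \<open>0\<close>.  Convergence in probability is expressed through exceptional events, so that the
  set where the error exceeds \<open>\<delta>\<close> need not itself be measurable.\<close>

definition has_stratonovich_integral ::
    "'a measure \<Rightarrow> (real \<Rightarrow> plane \<Rightarrow> 'a \<Rightarrow> real) \<Rightarrow> real \<Rightarrow>
     (real \<Rightarrow> plane \<Rightarrow> 'a \<Rightarrow> complex) \<Rightarrow> ('a \<Rightarrow> complex) \<Rightarrow> bool" where
  "has_stratonovich_integral M B z X I \<longleftrightarrow>
     (\<forall>\<delta>>0. \<exists>\<eta>>0. \<forall>(n::nat) (t :: nat \<Rightarrow> real).
        t 0 = 0 \<and> t n = z \<and> (\<forall>i<n. t i \<le> t (Suc i) \<and> t (Suc i) - t i \<le> \<eta>) \<longrightarrow>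
        (\<exists>A\<in>sets M. measure M A \<le> \<delta> \<and>
           (\<forall>\<omega>\<in>space M - A.
              norm ((\<Sum>i<n. LINT x|lborel.
                       (X (t i) x \<omega> + X (t (Suc i)) x \<omega>) / 2 *
                       of_real (B (t (Suc i)) x \<omega> - B (t i) x \<omega>)) - I \<omega>) \<le> \<delta>)))"

definition initial_field :: "real \<Rightarrow> real \<Rightarrow> plane \<Rightarrow> complex" where
  "initial_field r0 \<epsilon> x = of_real (exp (- (\<epsilon>\<^sup>2 * (norm x)\<^sup>2 / (2 * r0\<^sup>2))))"

text \<open>Adapted solutions with paths in $C([0,\infty); L^2)$, the equation being understood weakly
  in space:
  $u(z) - u(0) = \frac{i}{2 k_0} \int_0^z \Delta u\,ds + \frac{i k_0}{2} \int_0^z u \circ dB$.\<close>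

definition ito_schroedinger_solution ::
    "'a measure \<Rightarrow> real \<Rightarrow> (plane \<Rightarrow> complex) \<Rightarrow> (real \<Rightarrow> plane \<Rightarrow> 'a \<Rightarrow> real) \<Rightarrow>
     (real \<Rightarrow> plane \<Rightarrow> 'a \<Rightarrow> complex) \<Rightarrow> bool" where
  "ito_schroedinger_solution M k0 u0 B u \<longleftrightarrow>
     (\<exists>F. brownian_filtration M F B \<and>
        (\<forall>z\<ge>0. (\<lambda>(x, \<omega>). u z x \<omega>) \<in> borel_measurable (lborel \<Otimes>\<^sub>M F z))) \<and>
     (AE \<omega> in M. L2_continuous (\<lambda>z x. u z x \<omega>)) \<and>
     (\<forall>x. AE \<omega> in M. u 0 x \<omega> = u0 x) \<and>
     (\<forall>\<phi>. test_function \<phi> \<longrightarrow> (\<forall>z\<ge>0.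
        \<exists>I. has_stratonovich_integral M B z (\<lambda>s x \<omega>. \<phi> x * u s x \<omega>) I \<and>
          (AE \<omega> in M.
             pairing (\<lambda>x. u z x \<omega>) \<phi> - pairing (\<lambda>x. u 0 x \<omega>) \<phi> =
               \<i> / (2 * of_real k0) *
                 (LINT s:{0..z}|lborel. pairing (\<lambda>x. u s x \<omega>) (laplacian \<phi>)) +
               \<i> * of_real k0 / 2 * I \<omega>)))"


section \<open>Moments and the moment equations\<close>

definition moment2 ::
    "'a measure \<Rightarrow> (real \<Rightarrow> plane \<Rightarrow> 'a \<Rightarrow> complex) \<Rightarrow> real \<Rightarrow> plane \<times> plane \<Rightarrow> complex" where
  "moment2 M u z = (\<lambda>(x, y). LINT \<omega>|M. u z x \<omega> * cnj (u z y \<omega>))"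

definition moment4 ::
    "'a measure \<Rightarrow> (real \<Rightarrow> plane \<Rightarrow> 'a \<Rightarrow> complex) \<Rightarrow> real \<Rightarrow>
     plane \<times> plane \<times> plane \<times> plane \<Rightarrow> complex" where
  "moment4 M u z = (\<lambda>(x1, x2, y1, y2).
     LINT \<omega>|M. u z x1 \<omega> * u z x2 \<omega> * cnj (u z y1 \<omega>) * cnj (u z y2 \<omega>))"

text \<open>The right-hand sides of the moment equations, as operators on functions of
  \<open>(x, y)\<close> and of \<open>(x1, x2, y1, y2)\<close>.\<close>

definition generator2 ::
    "real \<Rightarrow> (plane \<Rightarrow> real) \<Rightarrow> real \<Rightarrow>
     (plane \<times> plane \<Rightarrow> complex) \<Rightarrow> plane \<times> plane \<Rightarrow> complex" where
  "generator2 k0 C \<epsilon> f = (\<lambda>(x, y).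
     \<i> / (2 * of_real k0) * (laplacian (\<lambda>\<xi>. f (\<xi>, y)) x - laplacian (\<lambda>\<xi>. f (x, \<xi>)) y) +
     of_real (k0\<^sup>2 * \<epsilon> / 4 * (C (x - y) - C 0)) * f (x, y))"

definition generator4 ::
    "real \<Rightarrow> (plane \<Rightarrow> real) \<Rightarrow> real \<Rightarrow>
     (plane \<times> plane \<times> plane \<times> plane \<Rightarrow> complex) \<Rightarrow> plane \<times> plane \<times> plane \<times> plane \<Rightarrow> complex" where
  "generator4 k0 C \<epsilon> f = (\<lambda>(x1, x2, y1, y2).
     \<i> / (2 * of_real k0) *
       (laplacian (\<lambda>\<xi>. f (\<xi>, x2, y1, y2)) x1 + laplacian (\<lambda>\<xi>. f (x1, \<xi>, y1, y2)) x2
        - laplacian (\<lambda>\<xi>. f (x1, x2, \<xi>, y2)) y1 - laplacian (\<lambda>\<xi>. f (x1, x2, y1, \<xi>)) y2) +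
     of_real (k0\<^sup>2 * \<epsilon> / 4 *
       (C (x1 - y1) + C (x1 - y2) + C (x2 - y1) + C (x2 - y2)
        - C (x1 - x2) - C (y1 - y2) - 2 * C 0)) * f (x1, x2, y1, y2))"

text \<open>Solutions in $L^2$ of $\partial_z m = G m$, $m(0) = m_0$.  The equation is tested
  against \<open>\<phi>\<close>; the operator acts on \<open>\<phi>\<close> unchanged because
  \<open>generator2\<close> and \<open>generator4\<close> are formally symmetric for the bilinear pairing.\<close>

definition solves_in_L2 ::
    "(('a::euclidean_space \<Rightarrow> complex) \<Rightarrow> 'a \<Rightarrow> complex) \<Rightarrow> ('a \<Rightarrow> complex) \<Rightarrow>
     (real \<Rightarrow> 'a \<Rightarrow> complex) \<Rightarrow> bool" where
  "solves_in_L2 G m0 m \<longleftrightarrow>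
     L2_continuous m \<and>
     m 0 = m0 \<and>
     (\<forall>\<phi>. test_function \<phi> \<longrightarrow> (\<forall>z\<ge>0.
        ((\<lambda>z. pairing (m z) \<phi>) has_vector_derivative pairing (m z) (G \<phi>)) (at z within {0..})))"

definition moments_solve_equations ::
    "'a measure \<Rightarrow> real \<Rightarrow> (plane \<Rightarrow> real) \<Rightarrow> real \<Rightarrow> (plane \<Rightarrow> complex) \<Rightarrow>
     (real \<Rightarrow> plane \<Rightarrow> 'a \<Rightarrow> complex) \<Rightarrow> bool" where
  "moments_solve_equations M k0 C \<epsilon> u0 u \<longleftrightarrow>
     (\<forall>z\<ge>0. \<forall>x. integrable M (\<lambda>\<omega>. (norm (u z x \<omega>)) ^ 4)) \<and>
     continuous_on ({0..} \<times> UNIV) (\<lambda>(z, X). moment2 M u z X) \<and>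
     continuous_on ({0..} \<times> UNIV) (\<lambda>(z, X). moment4 M u z X) \<and>
     solves_in_L2 (generator2 k0 C \<epsilon>) (\<lambda>(x, y). u0 x * cnj (u0 y)) (moment2 M u) \<and>
     solves_in_L2 (generator4 k0 C \<epsilon>)
       (\<lambda>(x1, x2, y1, y2). u0 x1 * u0 x2 * cnj (u0 y1) * cnj (u0 y2)) (moment4 M u)"


section \<open>The scintillation index\<close>

definition scintillation_index ::
    "'a measure \<Rightarrow> (real \<Rightarrow> plane \<Rightarrow> 'a \<Rightarrow> complex) \<Rightarrow> real \<Rightarrow> plane \<Rightarrow> real" where
  "scintillation_index M u z x =
     ((LINT \<omega>|M. (norm (u z x \<omega>)) ^ 4) - (LINT \<omega>|M. (norm (u z x \<omega>))\<^sup>2)\<^sup>2)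
       / (LINT \<omega>|M. (norm (u z x \<omega>))\<^sup>2)\<^sup>2"

end

theory Submission
 imports Defs
begin

text \<open>The moments are computed from their equations.  By Bochner's theorem
  (\<open>spectral_representation\<close>) the covariance is the Fourier transform of a nonnegative integrable
  density, so the potential in the equation for the moment of order \<open>2p\<close> is a superposition of
  plane waves.  In Fourier space the vector of the \<open>2p\<close> frequencies therefore moves freely,
  picking up the phase \<open>cis (- Om P * t)\<close>, and is interrupted by kicks that shift two of its
  components by \<open>k\<close> and \<open>-k\<close>.  Summing over the number of kicks gives a Dyson series; after the
  harmless factor \<open>exp (p k0^2 C 0 z / 4)\<close> has been split off, the moment at a point is the
  integral of that series against the Fourier transform of the initial data
  (\<open>pointwise_expansion\<close>).

  After the rescaling the initial frequencies are \<open>eps * xi\<close> with \<open>xi\<close> Gaussian, kicks are of order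
  one, and \<open>Om\<close> is a quadratic form divided by \<open>eps\<close>.  A kick that changes the value of the form
  makes the phase oscillate at rate \<open>1 / eps\<close> and contributes nothing in the limit, by the
  Riemann--Lebesgue mechanism (\<open>dyson_step_limit\<close>).  For two particles the form is unchanged by
  every kick.  For four particles almost surely only those histories survive in which each of the
  two factors \<open>u\<close> exchanges frequency with one and the same conjugate factor.  There are two such
  pairings, and they have only the history without kicks in common.  Along a surviving history the
  phases add up linearly, and the series sums to \<open>exp\<close> of an integral of the covariance.

  Hence, with the Gaussian average \<open>D\<close> of this exponential, the second moment tends to \<open>D\<close> and the
  fourth to \<open>2 D^2 - exp (- 2 |r|^2 / r0^2)\<close>, both up to exponential factors that cancel in the
  index.  Finally \<open>D\<close> is positive, because each term of its exponential series is a Gaussian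
  average of a positive definite function (\<open>positive_definite_exp\<close>).\<close>

lemmas integral_cong_fun = Bochner_Integration.integral_cong[OF refl]

section \<open>Dyson series of a kicked free evolution\<close>

lemma borel_measurable_cis [measurable (raw)]:
 "f \<in> borel_measurable M ==> (%x. cis (f x)) \<in> borel_measurable M"
 by (rule borel_measurable_continuous_on[where f = cis]) (auto intro!: continuous_intros)

lemma pred_Icc [measurable (raw)]:
 fixes f g :: "'a => real"
 assumes [measurable]: "f \<in> borel_measurable M" "g \<in> borel_measurable M"
 shows "Measurable.pred M (%x. g x \<in> {0..f x})"
 by simp

lemma norm_set_integral_le:
 fixes f :: "real => complex"
 assumes "!!x. x \<in> {a..b} ==> norm (f x) <= g x"
  and "set_integrable lborel {a..b} g"
 shows "norm (LINT x:{a..b}|lborel. f x) <= (LINT x:{a..b}|lborel. g x)"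
 unfolding set_lebesgue_integral_def
proof -
 have "norm (LINT x|lborel. indicator {a..b} x *\<^sub>R f x) <= (LINT x|lborel. norm (indicator {a..b} x *\<^sub>R f x))"
  by (rule integral_norm_bound)
 also have "\<dots> <= (LINT x|lborel. indicator {a..b} x *\<^sub>R g x)"
  using assms(2) by (intro integral_mono') (auto simp: set_integrable_def indicator_def assms(1) intro: order_trans[OF norm_ge_zero assms(1)])
 finally show "norm (LINT x|lborel. indicator {a..b} x *\<^sub>R f x) <= (LINT x|lborel. indicator {a..b} x *\<^sub>R g x)" .
qed

lemma set_integrable_bounded_Icc:
 fixes f :: "real => complex"
 assumes "f \<in> borel_measurable borel" "!!x. x \<in> {a..b} ==> norm (f x) <= B"
 shows "set_integrable lborel {a..b} f"
 unfolding set_integrable_def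
 using assms by (intro integrableI_bounded_set_indicator[where B=B]) (auto simp: emeasure_lborel_Icc_eq)

lemma set_integral_reflect:
 fixes f :: "real => complex"
 shows "(LINT x:{0..t}|lborel. f (t - x)) = (LINT x:{0..t}|lborel. f x)"
proof -
 have "(LINT x|lborel. indicator {0..t} x *\<^sub>R f x) =
   \<bar>-1\<bar> *\<^sub>R (LINT x|lborel. indicator {0..t} (t + (-1) * x) *\<^sub>R f (t + (-1) * x))"
  by (rule lborel_integral_real_affine) simp
 also have "\<dots> = (LINT x|lborel. indicator {0..t} x *\<^sub>R f (t - x))"
  by (auto intro!: Bochner_Integration.integral_cong simp: indicator_def)
 finally show ?thesis by (simp add: set_lebesgue_integral_def)
qed

lemma set_integral_power:
 fixes T :: real
 assumes "0 <= T"
 shows "(LINT u:{0..T}|lborel. c * u ^ n) = c * T ^ Suc n / Suc n"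
  and "set_integrable lborel {0..T} (%u. c * u ^ n)"
proof -
 show "set_integrable lborel {0..T} (%u. c * u ^ n)"
  by (rule borel_integrable_compact[unfolded set_integrable_def[symmetric]]) (auto intro!: continuous_intros)
 have "(LINT u:{0..T}|lborel. c * u ^ n) = c * T ^ Suc n / Suc n - c * 0 ^ Suc n / Suc n"
  unfolding set_lebesgue_integral_def
  by (rule integral_FTC_Icc)
   (use assms in \<open>auto intro!: derivative_eq_intros continuous_intros
     simp: has_real_derivative_iff_has_vector_derivative[symmetric] simp del: power_Suc of_nat_Suc\<close>)
 then show "(LINT u:{0..T}|lborel. c * u ^ n) = c * T ^ Suc n / Suc n" by simp
qed

lemma norm_integral_cis_le:
 fixes c d :: real
 assumes "c ~= 0"
 shows "norm (LINT u:{0..T}|lborel. cis (c * u + d)) <= 2 / \<bar>c\<bar>"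
proof (cases "0 <= T")
 case True
 let ?F = "%u. cis (c * u + d) / (\<i> * c)"
 have "(LINT u:{0..T}|lborel. cis (c * u + d)) = ?F T - ?F 0"
  unfolding set_lebesgue_integral_def
 proof (rule integral_FTC_Icc)
  show "continuous_on {0..T} (%u. cis (c * u + d))" by (intro continuous_intros)
  fix u
  have "((%u. exp (\<i> * of_real (c * u + d)) / (\<i> * c)) has_vector_derivative exp (\<i> * of_real (c * u + d)))
    (at u within {0..T})"
   using assms
   by (auto intro!: derivative_eq_intros has_vector_derivative_real_field simp: field_simps)
  then show "(?F has_vector_derivative cis (c * u + d)) (at u within {0..T})"
   by (simp add: cis_conv_exp)
 qed (use True in auto)
 also have "norm \<dots> <= norm (?F T) + norm (?F 0)" by (rule norm_triangle_ineq4)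
 also have "\<dots> = 2 / \<bar>c\<bar>" by (simp add: norm_divide norm_mult)
 finally show ?thesis .
qed (simp add: set_lebesgue_integral_def)

text \<open>A kick of type \<open>k\<close> displaces the frequency vector by \<open>A k\<close> and multiplies the amplitude by
 \<open>s k\<close>; \<open>K\<close> is the rate measure of the kicks.\<close>

locale kicks = finite_measure K for K :: "'k measure" +
 fixes A :: "'k => 'a::euclidean_space" and s :: "'k => real"
 assumes A_measurable [measurable]: "A \<in> borel_measurable K"
  and s_measurable [measurable]: "s \<in> borel_measurable K"
  and s_le_1: "\<bar>s k\<bar> <= 1"
begin

abbreviation rate :: real where "rate \<equiv> measure K (space K)"

text \<open>The amplitude collected from \<open>h\<close> by all histories with exactly \<open>n\<close> kicks before time \<open>t\<close>,
 started at frequency \<open>p\<close>.  The recursion splits off the first kick, at time \<open>\<sigma>\<close>.\<close>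

primrec dyson :: "('a => real) => ('a => complex) => nat => real => 'a => complex" where
 "dyson Om h 0 t p = cis (- Om p * t) * h p"
| "dyson Om h (Suc n) t p =
  (LINT \<sigma>:{0..t}|lborel. cis (- Om p * \<sigma>) * (LINT k|K. s k * dyson Om h n (t - \<sigma>) (p + A k)))"

lemma norm_scatter_le:
 fixes f :: "'k => complex"
 assumes "!!k. norm (f k) <= B"
 shows "norm (LINT k|K. s k * f k) <= rate * B"
proof -
 have B: "0 <= B" using assms[of undefined] norm_ge_zero order_trans by blast
 have "norm (s k * f k) <= B" for k
 proof -
  have "\<bar>s k\<bar> * norm (f k) <= 1 * B" by (intro mult_mono) (use s_le_1 assms in auto)
  then show ?thesis by (simp add: norm_mult)
 qed
 then have "norm (LINT k|K. s k * f k) <= (LINT k|K. B)"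
  by (intro order_trans[OF integral_norm_bound] integral_mono') (auto intro: B)
 then show ?thesis by simp
qed

lemma borel_measurable_dyson:
 assumes [measurable]: "(%(y, p). h y p) \<in> borel_measurable (N \<Otimes>\<^sub>M borel)"
  "Om \<in> borel_measurable borel"
 shows "(%(y, t, p). dyson Om (h y) n t p) \<in> borel_measurable (N \<Otimes>\<^sub>M (borel \<Otimes>\<^sub>M borel))"
proof (induction n)
 case 0
 then show ?case by simp
next
 case (Suc n)
 have [measurable]: "(%x. dyson Om (h (fst (fst (fst x)))) n (fst (snd (fst (fst x))) - snd (fst x))
   (snd (snd (fst (fst x))) + A (snd x))) \<in> borel_measurable (((N \<Otimes>\<^sub>M (borel \<Otimes>\<^sub>M borel)) \<Otimes>\<^sub>M lborel) \<Otimes>\<^sub>M K)"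
  (is "_ \<in> borel_measurable ?M")
 proof -
  have "(%x. (fst (fst (fst x)), fst (snd (fst (fst x))) - snd (fst x), snd (snd (fst (fst x))) + A (snd x)))
    \<in> ?M \<rightarrow>\<^sub>M N \<Otimes>\<^sub>M (borel \<Otimes>\<^sub>M borel)"
   by measurable
  from measurable_compose[OF this Suc] show ?thesis by (simp only: split_conv)
 qed
 show ?case unfolding dyson.simps set_lebesgue_integral_def
  by measurable
qed

lemma borel_measurable_dyson' [measurable (raw)]:
 assumes [measurable]: "Om \<in> borel_measurable borel" "h \<in> borel_measurable borel"
  "f \<in> borel_measurable M" "g \<in> borel_measurable M"
 shows "(%x. dyson Om h n (f x) (g x)) \<in> borel_measurable M"
proof -
 have 1: "(%(y::unit, p). h p) \<in> borel_measurable (count_space UNIV \<Otimes>\<^sub>M borel)"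
  by measurable
 have 2: "(%x. ((), f x, g x)) \<in> M \<rightarrow>\<^sub>M count_space UNIV \<Otimes>\<^sub>M (borel \<Otimes>\<^sub>M borel)"
  by measurable
 from measurable_compose[OF 2 borel_measurable_dyson[OF 1 assms(1)]]
 show ?thesis by (simp only: split_conv)
qed

lemma norm_dyson_le:
 assumes "!!p. norm (h p) <= H" "0 <= t"
 shows "norm (dyson Om h n t p) <= H * (rate * t) ^ n / fact n"
 using assms(2)
proof (induction n arbitrary: t p)
 case 0
 then show ?case using assms(1) by (simp add: norm_mult)
next
 case (Suc n)
 have H: "0 <= H" using assms(1)[of 0] norm_ge_zero order_trans by blast
 have "norm (dyson Om h (Suc n) t p) <=
   (LINT \<sigma>:{0..t}|lborel. H * rate ^ Suc n / fact n * (t - \<sigma>) ^ n)"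
  unfolding dyson.simps
 proof (rule norm_set_integral_le)
  fix \<sigma> assume sg: "\<sigma> \<in> {0..t}"
  have "norm (cis (- Om p * \<sigma>) * (LINT k|K. s k * dyson Om h n (t - \<sigma>) (p + A k)))
    <= rate * (H * (rate * (t - \<sigma>)) ^ n / fact n)"
   unfolding norm_mult norm_cis mult_1
   using sg by (intro norm_scatter_le Suc.IH) auto
  then show "norm (cis (- Om p * \<sigma>) * (LINT k|K. s k * dyson Om h n (t - \<sigma>) (p + A k)))
    <= H * rate ^ Suc n / fact n * (t - \<sigma>) ^ n"
   by (simp add: power_mult_distrib mult_ac)
 next
  show "set_integrable lborel {0..t} (%\<sigma>. H * rate ^ Suc n / fact n * (t - \<sigma>) ^ n)"
   by (rule borel_integrable_compact[unfolded set_integrable_def[symmetric]]) (auto intro!: continuous_intros)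
 qed
 also have "\<dots> = H * rate ^ Suc n / fact n * t ^ Suc n / Suc n"
 proof -
  have "complex_of_real (LINT \<sigma>:{0..t}|lborel. H * rate ^ Suc n / fact n * (t - \<sigma>) ^ n) =
   (LINT \<sigma>:{0..t}|lborel. complex_of_real (H * rate ^ Suc n / fact n * (t - \<sigma>) ^ n))"
   unfolding set_lebesgue_integral_def
   by (subst integral_complex_of_real[symmetric]) (simp add: scaleR_conv_of_real)
  also have "\<dots> = (LINT \<sigma>:{0..t}|lborel. complex_of_real (H * rate ^ Suc n / fact n * \<sigma> ^ n))"
   by (rule set_integral_reflect)
  also have "\<dots> = complex_of_real (LINT \<sigma>:{0..t}|lborel. (H * rate ^ Suc n / fact n * \<sigma> ^ n))"
   unfolding set_lebesgue_integral_def
   by (subst integral_complex_of_real[symmetric]) (simp add: scaleR_conv_of_real)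
  also note set_integral_power(1)[OF Suc.prems]
  finally show ?thesis by (simp only: of_real_eq_iff)
 qed
 also have "\<dots> = H * (rate * t) ^ Suc n / fact (Suc n)"
  by (simp add: power_mult_distrib field_simps)
 finally show ?case .
qed

end

context kicks
begin

sublocale slab: pair_sigma_finite "lborel :: real measure" K
 by unfold_locales

lemma slab_integrable:
 fixes f :: "real => 'k => complex"
 assumes [measurable]: "(%(u, k). f u k) \<in> borel_measurable (lborel \<Otimes>\<^sub>M K)"
  and B: "!!u k. u \<in> {0..t} ==> norm (f u k) <= B"
 shows "integrable (lborel \<Otimes>\<^sub>M K) (%(u, k). indicator {0..t} u *\<^sub>R f u k)"
proof (rule integrableI_bounded_set[where A = "{0..t} \<times> space K" and B = B])
 show "emeasure (lborel \<Otimes>\<^sub>M K) ({0..t} \<times> space K) < \<infinity>"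
  by (simp add: emeasure_pair_measure_Times emeasure_lborel_Icc_eq ennreal_mult_eq_top_iff less_top[symmetric])
 show "AE x in lborel \<Otimes>\<^sub>M K. x \<in> {0..t} \<times> space K \<longrightarrow>
   norm (case x of (u, k) => indicator {0..t} u *\<^sub>R f u k) <= B"
  using B by (auto intro!: AE_I2)
 show "AE x in lborel \<Otimes>\<^sub>M K. x \<notin> {0..t} \<times> space K \<longrightarrow>
   (case x of (u, k) => indicator {0..t} u *\<^sub>R f u k) = 0"
  by (auto intro!: AE_I2 simp: space_pair_measure indicator_def)
qed auto

lemma slab_Fubini:
 fixes f :: "real => 'k => complex"
 assumes [measurable]: "(%(u, k). f u k) \<in> borel_measurable (lborel \<Otimes>\<^sub>M K)"
  and B: "!!u k. u \<in> {0..t} ==> norm (f u k) <= B"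
 shows "(LINT u:{0..t}|lborel. (LINT k|K. f u k)) =
   (LINT x|(lborel \<Otimes>\<^sub>M K). indicator {0..t} (fst x) *\<^sub>R f (fst x) (snd x))"
  and "(LINT u:{0..t}|lborel. (LINT k|K. f u k)) = (LINT k|K. (LINT u:{0..t}|lborel. f u k))"
proof -
 have int: "integrable (lborel \<Otimes>\<^sub>M K) (%(u, k). indicator {0..t} u *\<^sub>R f u k)"
  using assms by (rule slab_integrable)
 show "(LINT u:{0..t}|lborel. (LINT k|K. f u k)) =
   (LINT x|(lborel \<Otimes>\<^sub>M K). indicator {0..t} (fst x) *\<^sub>R f (fst x) (snd x))"
  unfolding set_lebesgue_integral_def
  using slab.integral_fst'[OF int] by (simp add: case_prod_beta')
 show "(LINT u:{0..t}|lborel. (LINT k|K. f u k)) = (LINT k|K. (LINT u:{0..t}|lborel. f u k))"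
  unfolding set_lebesgue_integral_def
  using slab.Fubini_integral[OF int] by simp
qed

lemma norm_s_mult_le: "norm z <= B ==> norm (complex_of_real (s k) * z) <= B"
 using mult_mono[OF s_le_1[of k], of "norm z" B] by (simp add: norm_mult)

lemma dyson_bound_uniform:
 assumes "!!p. norm (h p) <= H" "0 <= u" "u <= t"
 shows "norm (dyson Om h n u p) <= H * (rate * t) ^ n / fact n"
proof -
 have H: "0 <= H" using assms(1)[of 0] norm_ge_zero order_trans by blast
 have "norm (dyson Om h n u p) <= H * (rate * u) ^ n / fact n"
  by (rule norm_dyson_le) (use assms in auto)
 also have "\<dots> <= H * (rate * t) ^ n / fact n"
  using assms H by (intro divide_right_mono mult_left_mono power_mono) auto
 finally show ?thesis .
qed

lemma dyson_Suc_pair: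
 assumes [measurable]: "Om \<in> borel_measurable borel" "h \<in> borel_measurable borel"
  and H: "!!p. norm (h p) <= H"
 shows "dyson Om h (Suc n) t p = (LINT x|(lborel \<Otimes>\<^sub>M K). indicator {0..t} (fst x) *\<^sub>R
   (cis (- Om p * fst x) * (s (snd x) * dyson Om h n (t - fst x) (p + A (snd x)))))"
proof -
 have "dyson Om h (Suc n) t p =
   (LINT u:{0..t}|lborel. (LINT k|K. cis (- Om p * u) * (s k * dyson Om h n (t - u) (p + A k))))"
  by (simp add: mult.assoc)
 also have "\<dots> = (LINT x|(lborel \<Otimes>\<^sub>M K). indicator {0..t} (fst x) *\<^sub>R
   (cis (- Om p * fst x) * (s (snd x) * dyson Om h n (t - fst x) (p + A (snd x)))))"
  by (rule slab_Fubini(1)[where B = "H * (rate * t) ^ n / fact n"])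
   (auto simp: norm_mult[of "cis _"] intro!: norm_s_mult_le dyson_bound_uniform H)
 finally show ?thesis .
qed

definition kicked :: "('a => real) => ('a => complex) => 'k => real => 'a => complex" where
 "kicked Om h k l p = cis (- Om (p + A k) * l) * h (p + A k)"

lemma norm_kicked [simp]: "norm (kicked Om h k l p) = norm (h (p + A k))"
 by (simp add: kicked_def norm_mult)

lemma borel_measurable_kicked [measurable (raw)]:
 assumes [measurable]: "Om \<in> borel_measurable borel" "h \<in> borel_measurable borel"
  "f \<in> N \<rightarrow>\<^sub>M K" "g \<in> borel_measurable N" "q \<in> borel_measurable N"
 shows "(%x. kicked Om h (f x) (g x) (q x)) \<in> borel_measurable N"
 unfolding kicked_def by measurable

lemma borel_measurable_dyson_kicked [measurable (raw)]:
 assumes [measurable]: "Om \<in> borel_measurable borel" "h \<in> borel_measurable borel"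
  "f \<in> N \<rightarrow>\<^sub>M K" "g \<in> borel_measurable N" "u \<in> borel_measurable N" "q \<in> borel_measurable N"
 shows "(%x. dyson Om (kicked Om h (f x) (g x)) n (u x) (q x)) \<in> borel_measurable N"
proof -
 have 1: "(%(y, p). (%y. kicked Om h (fst y) (snd y)) y p) \<in> borel_measurable ((K \<Otimes>\<^sub>M borel) \<Otimes>\<^sub>M borel)"
  by measurable
 have 2: "(%x. ((f x, g x), u x, q x)) \<in> N \<rightarrow>\<^sub>M (K \<Otimes>\<^sub>M borel) \<Otimes>\<^sub>M (borel \<Otimes>\<^sub>M borel)"
  by measurable
 from measurable_compose[OF 2 borel_measurable_dyson[OF 1 assms(1)]]
 show ?thesis by (simp only: split_conv fst_conv snd_conv)
qed

sublocale slab2: pair_sigma_finite "(lborel :: real measure) \<Otimes>\<^sub>M K" "(lborel :: real measure) \<Otimes>\<^sub>M K"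
 by unfold_locales

text \<open>Splitting off the last kick instead of the first is what matches Duhamel's formula for
 the evolution: the factor in front of the series is then applied to the final function \<open>h\<close>.\<close>

lemma dyson_last_kick:
 assumes [measurable]: "Om \<in> borel_measurable borel" "h \<in> borel_measurable borel"
  and H: "!!p. norm (h p) <= H" and "0 <= t"
 shows "dyson Om h (Suc n) t p =
   (LINT l:{0..t}|lborel. (LINT k|K. s k * dyson Om (kicked Om h k l) n (t - l) p))"
 using assms(4)
proof (induction n arbitrary: t p)
 case 0
 have "dyson Om h (Suc 0) t p =
   (LINT l:{0..t}|lborel. (LINT k|K. s k * dyson Om (kicked Om h k (t - l)) 0 l p))"
  by (simp add: kicked_def mult_ac flip: integral_mult_right_zero)
 also have "\<dots> = (LINT l:{0..t}|lborel. (LINT k|K. s k * dyson Om (kicked Om h k l) 0 (t - l) p))"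
  using set_integral_reflect[of t "%l. LINT k|K. s k * dyson Om (kicked Om h k l) 0 (t - l) p"]
  by simp
 finally show ?case .
next
 case (Suc n)
 let ?L = "(lborel :: real measure) \<Otimes>\<^sub>M K"
 define F where "F x y = (if 0 <= fst x \<and> 0 <= fst y \<and> fst x + fst y <= t then
   cis (- Om p * fst x) * (s (snd x) * (s (snd y) *
    dyson Om (kicked Om h (snd y) (fst y)) n (t - fst x - fst y) (p + A (snd x)))) else 0)" for x y
 have F_meas [measurable]: "(%(x, y). F x y) \<in> borel_measurable (?L \<Otimes>\<^sub>M ?L)"
  unfolding F_def by measurable
 have F_bound: "norm (F x y) <= H * (rate * t) ^ n / fact n" for x y
 proof -
  have "0 <= H" using H[of 0] norm_ge_zero order_trans by blast
  then show ?thesis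
   unfolding F_def using Suc.prems
   by (auto simp: norm_mult[of "cis _"] intro!: norm_s_mult_le dyson_bound_uniform H)
 qed
 have int: "integrable (?L \<Otimes>\<^sub>M ?L) (%(x, y). F x y)"
 proof (rule integrableI_bounded_set[where A = "({0..t} \<times> space K) \<times> ({0..t} \<times> space K)"
    and B = "H * (rate * t) ^ n / fact n"])
  show "emeasure (?L \<Otimes>\<^sub>M ?L) (({0..t} \<times> space K) \<times> ({0..t} \<times> space K)) < \<infinity>"
   by (simp add: sigma_finite_measure.emeasure_pair_measure_Times[OF slab.sigma_finite_measure_axioms]
     emeasure_pair_measure_Times emeasure_lborel_Icc_eq ennreal_mult_eq_top_iff less_top[symmetric])
 qed (use F_bound in \<open>auto intro!: AE_I2 simp: space_pair_measure, auto simp: F_def split: if_splits\<close>)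
 have "dyson Om h (Suc (Suc n)) t p = (LINT x|?L. (LINT y|?L. F x y))"
  unfolding dyson_Suc_pair[OF assms(1-3), of "Suc n"]
 proof (intro integral_cong_fun)
  fix x
  show "indicator {0..t} (fst x) *\<^sub>R (cis (- Om p * fst x) *
    (s (snd x) * dyson Om h (Suc n) (t - fst x) (p + A (snd x)))) = (LINT y|?L. F x y)"
  proof (cases "fst x \<in> {0..t}")
   case True
   have "dyson Om h (Suc n) (t - fst x) (p + A (snd x)) =
     (LINT y|?L. indicator {0..t - fst x} (fst y) *\<^sub>R (s (snd y) *
      dyson Om (kicked Om h (snd y) (fst y)) n (t - fst x - fst y) (p + A (snd x))))"
    using True by (subst Suc.IH)
     (auto intro!: slab_Fubini(1)[where B = "H * (rate * t) ^ n / fact n"]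
      norm_s_mult_le dyson_bound_uniform H)
   then have "indicator {0..t} (fst x) *\<^sub>R (cis (- Om p * fst x) *
     (s (snd x) * dyson Om h (Suc n) (t - fst x) (p + A (snd x)))) =
     (LINT y|?L. cis (- Om p * fst x) * (s (snd x) * (indicator {0..t - fst x} (fst y) *\<^sub>R (s (snd y) *
      dyson Om (kicked Om h (snd y) (fst y)) n (t - fst x - fst y) (p + A (snd x))))))"
    using True by (simp del: dyson.simps mult_scaleR_right)
   also have "\<dots> = (LINT y|?L. F x y)"
    using True
    by (intro integral_cong_fun) (auto simp: F_def indicator_def algebra_simps)
   finally show ?thesis .
  next
   case False
   then have "(LINT y|?L. F x y) = (LINT y|?L. 0)"
    by (intro integral_cong_fun) (auto simp: F_def)
   with False show ?thesis by simp
  qed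
 qed
 also have "\<dots> = (LINT y|?L. (LINT x|?L. F x y))"
  by (rule slab2.Fubini_integral[OF int, symmetric])
 also have "\<dots> = (LINT y|?L. indicator {0..t} (fst y) *\<^sub>R
   (s (snd y) * dyson Om (kicked Om h (snd y) (fst y)) (Suc n) (t - fst y) p))"
 proof (intro integral_cong_fun)
  fix y :: "real \<times> 'k" assume y: "y \<in> space ?L"
  show "(LINT x|?L. F x y) = indicator {0..t} (fst y) *\<^sub>R
   (s (snd y) * dyson Om (kicked Om h (snd y) (fst y)) (Suc n) (t - fst y) p)"
  proof (cases "fst y \<in> {0..t}")
   case True
   have [measurable]: "kicked Om h (snd y) (fst y) \<in> borel_measurable borel"
    unfolding kicked_def by measurable
   have "indicator {0..t} (fst y) *\<^sub>R
     (s (snd y) * dyson Om (kicked Om h (snd y) (fst y)) (Suc n) (t - fst y) p) =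
     (LINT x|?L. s (snd y) * (indicator {0..t - fst y} (fst x) *\<^sub>R (cis (- Om p * fst x) * (s (snd x) *
      dyson Om (kicked Om h (snd y) (fst y)) n (t - fst y - fst x) (p + A (snd x))))))"
    using True by (subst dyson_Suc_pair[where H = H]) (auto intro!: H simp del: mult_scaleR_right)
   also have "\<dots> = (LINT x|?L. F x y)"
    using True
    by (intro integral_cong_fun) (auto simp: F_def indicator_def algebra_simps)
   finally show ?thesis ..
  next
   case False
   then have "(LINT x|?L. F x y) = (LINT x|?L. 0)"
    by (intro integral_cong_fun) (auto simp: F_def)
   with False show ?thesis by simp
  qed
 qed
 also have "\<dots> = (LINT l:{0..t}|lborel. (LINT k|K. s k * dyson Om (kicked Om h k l) (Suc n) (t - l) p))"
  by (rule slab_Fubini(1)[where B = "H * (rate * t) ^ Suc n / fact (Suc n)", symmetric])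
   (auto intro!: norm_s_mult_le dyson_bound_uniform H simp del: dyson.simps power_Suc fact_Suc)
 finally show ?case .
qed

end

context kicks
begin

section \<open>Limits of the Dyson terms\<close>

lemma tendsto_scatter:
 fixes f :: "nat => 'k => complex" and g :: "'k => complex"
 assumes [measurable]: "!!j. f j \<in> borel_measurable K" "g \<in> borel_measurable K"
  and B: "!!j k. norm (f j k) <= B"
  and lim: "AE k in K. (%j. f j k) \<longlonglongrightarrow> g k"
 shows "(%j. LINT k|K. s k * f j k) \<longlonglongrightarrow> (LINT k|K. s k * g k)"
proof (rule integral_dominated_convergence[where w = "%_. B"])
 show "AE k in K. (%j. s k * f j k) \<longlonglongrightarrow> s k * g k"
  using lim by eventually_elim (intro tendsto_intros)
qed (auto intro!: AE_I2 norm_s_mult_le B)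

lemma tendsto_set_integral_Icc:
 fixes f :: "nat => real => complex" and g :: "real => complex"
 assumes [measurable]: "!!j. f j \<in> borel_measurable borel" "g \<in> borel_measurable borel"
  and B: "!!j u. u \<in> {0..t} ==> norm (f j u) <= B"
  and lim: "!!u. u \<in> {0..t} ==> (%j. f j u) \<longlonglongrightarrow> g u"
 shows "(%j. LINT u:{0..t}|lborel. f j u) \<longlonglongrightarrow> (LINT u:{0..t}|lborel. g u)"
 unfolding set_lebesgue_integral_def
proof (rule integral_dominated_convergence[where w = "%u. indicator {0..t} u *\<^sub>R B"])
 show "integrable lborel (%u. indicator {0..t} u *\<^sub>R B)"
  by (rule integrableI_bounded_set_indicator[where B="\<bar>B\<bar>"]) (auto simp: emeasure_lborel_Icc_eq)
 show "AE u in lborel. (%j. indicator {0..t} u *\<^sub>R f j u) \<longlonglongrightarrow> indicator {0..t} u *\<^sub>R g u"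
  using lim by (auto intro!: AE_I2 simp: indicator_def)
qed (use B in \<open>auto simp: indicator_def\<close>)

lemma tendsto_dyson:
 assumes [measurable]: "Om \<in> borel_measurable borel" "!!j. h j \<in> borel_measurable borel"
  "h' \<in> borel_measurable borel"
  and H: "!!j p. norm (h j p) <= H"
  and lim: "!!p. (%j. h j p) \<longlonglongrightarrow> h' p" and "0 <= t"
 shows "(%j. dyson Om (h j) n t p) \<longlonglongrightarrow> dyson Om h' n t p"
 using \<open>0 <= t\<close>
proof (induction n arbitrary: t p)
 case 0
 show ?case using lim by (auto intro!: tendsto_intros)
next
 case (Suc n)
 have H': "norm (h' p) <= H" for p
  by (rule tendsto_upperbound[OF tendsto_norm[OF lim]]) (auto simp: H)
 show ?case unfolding dyson.simps
 proof (rule tendsto_set_integral_Icc[where B = "rate * (H * (rate * t) ^ n / fact n)"])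
  fix u assume u: "u \<in> {0..t}"
  show "(%j. cis (- Om p * u) * (LINT k|K. s k * dyson Om (h j) n (t - u) (p + A k)))
    \<longlonglongrightarrow> cis (- Om p * u) * (LINT k|K. s k * dyson Om h' n (t - u) (p + A k))"
   using u Suc.IH
   by (intro tendsto_mult tendsto_const tendsto_scatter[where B = "H * (rate * (t - u)) ^ n / fact n"]
     AE_I2 norm_dyson_le H) auto
  show "norm (cis (- Om p * u) * (LINT k|K. s k * dyson Om (h j) n (t - u) (p + A k)))
    <= rate * (H * (rate * t) ^ n / fact n)" for j
   unfolding norm_mult norm_cis mult_1
   using u by (intro norm_scatter_le dyson_bound_uniform H) auto
 qed measurable
qed

lemma dyson_coefficient_rearrange:
 fixes D a H t :: real
 shows "D * a * H * a ^ m / fact m * t ^ Suc m / real (Suc m) = D * (H * (a * t) ^ Suc m / fact (Suc m))"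
 by (simp only: power_mult_distrib fact_Suc power_Suc of_nat_mult times_divide_eq_right
   times_divide_eq_left divide_divide_eq_left mult_ac)

text \<open>The quantitative Riemann--Lebesgue lemma: before and after the kick the phases rotate
 at different rates, and integrating over the time of the kick gains the inverse of their
 difference.  The term after the kick varies with its own later kicks; these are bounded by
 moving the time integral inside.\<close>

lemma norm_nonresonant_le:
 assumes [measurable]: "Om \<in> borel_measurable borel" "h \<in> borel_measurable borel"
  and H: "!!p. norm (h p) <= H" and "0 <= t" and ne: "w ~= Om p"
 shows "norm (LINT u:{0..t}|lborel. cis (- w * u) * dyson Om h n (t - u) p)
  <= 2 / \<bar>w - Om p\<bar> * (H * (rate * t) ^ n / fact n)"
proof (cases n)
 case 0
 have "(LINT u:{0..t}|lborel. cis (- w * u) * dyson Om h n (t - u) p) =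
  (LINT u:{0..t}|lborel. cis ((Om p - w) * u + (- Om p * t)) * h p)"
  unfolding 0 dyson.simps mult.assoc[symmetric] cis_mult
  by (simp add: algebra_simps)
 also have "\<dots> = (LINT u:{0..t}|lborel. cis ((Om p - w) * u + (- Om p * t))) * h p"
  unfolding set_lebesgue_integral_def by (simp flip: integral_mult_left_zero)
 also have "norm \<dots> <= 2 / \<bar>Om p - w\<bar> * H"
  unfolding norm_mult using ne by (intro mult_mono norm_integral_cis_le H) auto
 finally show ?thesis by (simp add: 0 abs_minus_commute)
next
 case (Suc m)
 define b where "b u = (LINT k|K. s k * dyson Om h m u (p + A k))" for u
 have [measurable]: "b \<in> borel_measurable borel" unfolding b_def by measurable
 have b: "norm (b u) <= rate * (H * (rate * u) ^ m / fact m)" if "0 <= u" for u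
  unfolding b_def using that by (intro norm_scatter_le norm_dyson_le H) auto
 have H0: "0 <= H" using H[of 0] norm_ge_zero order_trans by blast
 have b': "norm (b u) <= rate * (H * (rate * t) ^ m / fact m)" if "0 <= u" "u <= t" for u
  unfolding b_def using that by (intro norm_scatter_le dyson_bound_uniform H) auto
 define F where "F u v = (if 0 <= u \<and> 0 <= v \<and> u + v <= t then
  cis (- w * u) * (cis (- Om p * (t - u - v)) * b v) else 0)" for u v
 have [measurable]: "(%(u, v). F u v) \<in> borel_measurable (lborel \<Otimes>\<^sub>M lborel)"
  unfolding F_def by measurable
 have int: "integrable (lborel \<Otimes>\<^sub>M lborel) (%(u, v). F u v)"
 proof (rule integrableI_bounded_set[where A = "{0..t} \<times> {0..t}"
    and B = "rate * (H * (rate * t) ^ m / fact m)"])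
  show "emeasure (lborel \<Otimes>\<^sub>M lborel) ({0..t} \<times> {0..t}) < \<infinity>"
   by (simp add: lborel.emeasure_pair_measure_Times emeasure_lborel_Icc_eq
     ennreal_mult_eq_top_iff less_top[symmetric])
  show "AE x in lborel \<Otimes>\<^sub>M lborel. x \<in> {0..t} \<times> {0..t} \<longrightarrow>
    norm (case x of (u, v) => F u v) <= rate * (H * (rate * t) ^ m / fact m)"
   using b' \<open>0 <= t\<close> H0 by (auto intro!: AE_I2 simp: F_def norm_mult)
  show "AE x in lborel \<Otimes>\<^sub>M lborel. x \<notin> {0..t} \<times> {0..t} \<longrightarrow> (case x of (u, v) => F u v) = 0"
   by (auto intro!: AE_I2 simp: F_def split: if_splits)
 qed measurable
 have "(LINT u:{0..t}|lborel. cis (- w * u) * dyson Om h n (t - u) p) = (LINT u|lborel. (LINT v|lborel. F u v))"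
  unfolding set_lebesgue_integral_def
 proof (intro integral_cong_fun)
  fix u
  show "indicator {0..t} u *\<^sub>R (cis (- w * u) * dyson Om h n (t - u) p) = (LINT v|lborel. F u v)"
  proof (cases "u \<in> {0..t}")
   case True
   have "dyson Om h n (t - u) p = (LINT v:{0..t-u}|lborel. cis (- Om p * (t - u - v)) * b v)"
    using set_integral_reflect[of "t - u" "%v. cis (- Om p * (t - u - v)) * b v"]
    by (simp add: Suc b_def)
   then have "indicator {0..t} u *\<^sub>R (cis (- w * u) * dyson Om h n (t - u) p) =
    (LINT v|lborel. cis (- w * u) * (indicator {0..t-u} v *\<^sub>R (cis (- Om p * (t - u - v)) * b v)))"
    using True by (simp add: set_lebesgue_integral_def del: dyson.simps mult_scaleR_right)
   also have "\<dots> = (LINT v|lborel. F u v)"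
    using True by (intro integral_cong_fun)
     (auto simp: F_def indicator_def algebra_simps)
   finally show ?thesis .
  next
   case False
   then have "(%v. F u v) = (%_. 0)" by (auto simp: F_def fun_eq_iff)
   then show ?thesis using False by simp
  qed
 qed
 also have "\<dots> = (LINT v|lborel. (LINT u|lborel. F u v))"
  by (rule lborel_pair.Fubini_integral[OF int, symmetric])
 also have "\<dots> = (LINT v:{0..t}|lborel. b v * (LINT u:{0..t-v}|lborel. cis ((Om p - w) * u + (- Om p * (t - v)))))"
  unfolding set_lebesgue_integral_def
 proof (intro integral_cong_fun)
  fix v
  show "(LINT u|lborel. F u v) = indicator {0..t} v *\<^sub>R
    (b v * (LINT u|lborel. indicator {0..t-v} u *\<^sub>R cis ((Om p - w) * u + (- Om p * (t - v)))))"
  proof (cases "v \<in> {0..t}")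
   case True
   have "(LINT u|lborel. F u v) =
    (LINT u|lborel. b v * (indicator {0..t-v} u *\<^sub>R cis ((Om p - w) * u + (- Om p * (t - v)))))"
   proof (intro integral_cong_fun)
    fix u
    show "F u v = b v * (indicator {0..t-v} u *\<^sub>R cis ((Om p - w) * u + (- Om p * (t - v))))"
     using True unfolding F_def mult.assoc[symmetric] cis_mult
     by (auto simp: indicator_def algebra_simps)
   qed
   then show ?thesis using True by (simp del: mult_scaleR_right)
  next
   case False
   then have "(%u. F u v) = (%_. 0)" by (auto simp: F_def fun_eq_iff)
   then show ?thesis using False by simp
  qed
 qed
 finally have eq: "(LINT u:{0..t}|lborel. cis (- w * u) * dyson Om h n (t - u) p) =
  (LINT v:{0..t}|lborel. b v * (LINT u:{0..t-v}|lborel. cis ((Om p - w) * u + (- Om p * (t - v)))))" .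
 have "norm (LINT u:{0..t}|lborel. cis (- w * u) * dyson Om h n (t - u) p)
   <= (LINT v:{0..t}|lborel. 2 / \<bar>w - Om p\<bar> * rate * H * rate ^ m / fact m * v ^ m)"
  unfolding eq
 proof (rule norm_set_integral_le)
  show "set_integrable lborel {0..t} (%v. 2 / \<bar>w - Om p\<bar> * rate * H * rate ^ m / fact m * v ^ m)"
   by (rule set_integral_power) (use \<open>0 <= t\<close> in auto)
  fix v assume v: "v \<in> {0..t}"
  have "norm (b v * (LINT u:{0..t-v}|lborel. cis ((Om p - w) * u + (- Om p * (t - v)))))
   <= (rate * (H * (rate * v) ^ m / fact m)) * (2 / \<bar>Om p - w\<bar>)"
   unfolding norm_mult using v ne H0 by (intro mult_mono norm_integral_cis_le b) auto
  then show "norm (b v * (LINT u:{0..t-v}|lborel. cis ((Om p - w) * u + (- Om p * (t - v)))))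
   <= 2 / \<bar>w - Om p\<bar> * rate * H * rate ^ m / fact m * v ^ m"
   by (simp add: power_mult_distrib mult_ac abs_minus_commute)
 qed
 also have "\<dots> = 2 / \<bar>w - Om p\<bar> * (H * (rate * t) ^ n / fact n)"
  unfolding set_integral_power(1)[OF \<open>0 <= t\<close>] Suc by (rule dyson_coefficient_rearrange)
 finally show ?thesis .
qed

text \<open>One kick at a time: almost every kick either leads to a state where the limit is known,
 or changes the free frequency by an amount that tends to infinity and so drops out.\<close>

lemma dyson_step_limit:
 fixes Om :: "nat => 'a => real" and q :: "nat => 'a" and h :: "nat => 'a => complex"
  and L :: "real => 'k => complex"
 assumes [measurable]: "!!j. Om j \<in> borel_measurable borel" "!!j. h j \<in> borel_measurable borel"
   "(%(u, k). L u k) \<in> borel_measurable (lborel \<Otimes>\<^sub>M K)"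
  and H: "!!j p. norm (h j p) <= H" and "0 <= t"
  and w: "(%j. Om j (q j)) \<longlonglongrightarrow> w"
  and kick: "AE k in K.
   (\<forall>u\<in>{0..t}. (%j. dyson (Om j) (h j) n u (q j + A k)) \<longlonglongrightarrow> L u k) \<or>
   ((\<forall>u\<in>{0..t}. L u k = 0) \<and> filterlim (%j. Om j (q j) - Om j (q j + A k)) at_infinity sequentially)"
 shows "(%j. dyson (Om j) (h j) (Suc n) t (q j)) \<longlonglongrightarrow>
  (LINT k|K. s k * (LINT u:{0..t}|lborel. cis (- w * u) * L (t - u) k))"
proof -
 let ?B = "H * (rate * t) ^ n / fact n"
 define J where "J j k = (LINT u:{0..t}|lborel. cis (- Om j (q j) * u) * dyson (Om j) (h j) n (t - u) (q j + A k))" for j k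
 have meas [measurable]: "J j \<in> borel_measurable K" for j
  unfolding J_def set_lebesgue_integral_def by measurable
 have [measurable]: "(%k. LINT u:{0..t}|lborel. cis (- w * u) * L (t - u) k) \<in> borel_measurable K"
 proof -
  have "(%x. (t - snd x, fst x)) \<in> K \<Otimes>\<^sub>M lborel \<rightarrow>\<^sub>M lborel \<Otimes>\<^sub>M K" by measurable
  from measurable_compose[OF this assms(3)]
  have [measurable]: "(%x. L (t - snd x) (fst x)) \<in> borel_measurable (K \<Otimes>\<^sub>M lborel)"
   by (simp only: split_conv)
  show ?thesis unfolding set_lebesgue_integral_def by measurable
 qed
 have bound: "norm (cis a * dyson (Om j) (h j) n (t - u) p) <= ?B" if "u \<in> {0..t}" for a j u p
  using that by (auto simp: norm_mult intro!: dyson_bound_uniform H)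
 have swap: "dyson (Om j) (h j) (Suc n) t (q j) = (LINT k|K. s k * J j k)" for j
 proof -
  have "dyson (Om j) (h j) (Suc n) t (q j) = (LINT u:{0..t}|lborel. (LINT k|K.
    s k * (cis (- Om j (q j) * u) * dyson (Om j) (h j) n (t - u) (q j + A k))))"
   by (simp add: mult_ac flip: integral_mult_right_zero)
  also have "\<dots> = (LINT k|K. (LINT u:{0..t}|lborel.
    s k * (cis (- Om j (q j) * u) * dyson (Om j) (h j) n (t - u) (q j + A k))))"
   by (rule slab_Fubini(2)[where B = ?B]) (auto intro!: norm_s_mult_le bound)
  also have "\<dots> = (LINT k|K. s k * J j k)"
   unfolding J_def set_integral_mult_right ..
  finally show ?thesis .
 qed
 have tB: "norm (J j k) <= t * ?B" for j k
 proof -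
  have "norm (J j k) <= (LINT u:{0..t}|lborel. ?B * u ^ 0)"
   unfolding J_def by (rule norm_set_integral_le) (use bound set_integral_power(2)[OF \<open>0 <= t\<close>, of _ 0] in auto)
  also have "\<dots> = t * ?B" by (subst set_integral_power) (use \<open>0 <= t\<close> in auto)
  finally show ?thesis .
 qed
 have lim: "AE k in K. (%j. J j k) \<longlonglongrightarrow> (LINT u:{0..t}|lborel. cis (- w * u) * L (t - u) k)"
  using kick
 proof eventually_elim
  case (elim k)
  then show ?case
  proof
   assume good: "\<forall>u\<in>{0..t}. (%j. dyson (Om j) (h j) n u (q j + A k)) \<longlonglongrightarrow> L u k"
   have "(%j. LINT u:{0..t}|lborel. cis (- Om j (q j) * u) * dyson (Om j) (h j) n (t - u) (q j + A k))
     \<longlonglongrightarrow> (LINT u:{0..t}|lborel. cis (- w * u) * (indicator {0..t} (t - u) *\<^sub>R L (t - u) k))"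
   proof (rule tendsto_set_integral_Icc[where B = ?B])
    fix u assume u: "u \<in> {0..t}"
    have "(%j. dyson (Om j) (h j) n (t - u) (q j + A k)) \<longlonglongrightarrow> L (t - u) k"
     using good u by auto
    with u show "(%j. cis (- Om j (q j) * u) * dyson (Om j) (h j) n (t - u) (q j + A k)) \<longlonglongrightarrow>
      cis (- w * u) * (indicator {0..t} (t - u) *\<^sub>R L (t - u) k)"
     by (auto intro!: tendsto_intros w simp: cis_conv_exp)
   next
    have "(%u. indicator {0..t} u *\<^sub>R L u k) \<in> borel_measurable borel"
    proof (rule borel_measurable_LIMSEQ_metric[where f = "%j u. indicator {0..t} u *\<^sub>R dyson (Om j) (h j) n u (q j + A k)"])
     show "(%j. indicator {0..t} u *\<^sub>R dyson (Om j) (h j) n u (q j + A k)) \<longlonglongrightarrow> indicator {0..t} u *\<^sub>R L u k" for u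
      using good by (auto simp: indicator_def)
    qed measurable
    then have [measurable]: "(%u. indicator {0..t} (t - u) *\<^sub>R L (t - u) k) \<in> borel_measurable borel"
     by (rule measurable_compose[rotated]) measurable
    show "(%u. cis (- w * u) * (indicator {0..t} (t - u) *\<^sub>R L (t - u) k)) \<in> borel_measurable borel"
     by measurable
   qed (auto intro!: bound)
   also have "(LINT u:{0..t}|lborel. cis (- w * u) * (indicator {0..t} (t - u) *\<^sub>R L (t - u) k)) =
    (LINT u:{0..t}|lborel. cis (- w * u) * L (t - u) k)"
    by (rule set_lebesgue_integral_cong) (auto simp: indicator_def)
   finally show ?thesis unfolding J_def .
  next
   assume bad: "(\<forall>u\<in>{0..t}. L u k = 0) \<and> filterlim (%j. Om j (q j) - Om j (q j + A k)) at_infinity sequentially"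
   have "(LINT u:{0..t}|lborel. cis (- w * u) * L (t - u) k) = (LINT u:{0..t}|lborel. 0)"
    by (rule set_lebesgue_integral_cong) (use bad in auto)
   moreover have "(%j. J j k) \<longlonglongrightarrow> 0"
   proof (rule Lim_null_comparison)
    have inf: "filterlim (%j. \<bar>Om j (q j) - Om j (q j + A k)\<bar>) at_top sequentially"
     using bad filterlim_at_infinity_imp_norm_at_top by fastforce
    have "eventually (%j. \<bar>Om j (q j) - Om j (q j + A k)\<bar> > 0) sequentially"
     using inf unfolding filterlim_at_top_dense by blast
    then show "eventually (%j. norm (J j k) <= 2 / \<bar>Om j (q j) - Om j (q j + A k)\<bar> * ?B) sequentially"
    proof eventually_elim
     case (elim j)
     then show ?case
      unfolding J_def by (intro norm_nonresonant_le) (use H \<open>0 <= t\<close> in auto)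
    qed
    show "(%j. 2 / \<bar>Om j (q j) - Om j (q j + A k)\<bar> * ?B) \<longlonglongrightarrow> 0"
     using tendsto_mult[OF real_tendsto_divide_at_top[OF tendsto_const inf, of 2] tendsto_const[of ?B]]
     by simp
   qed
   ultimately show ?thesis by (simp add: set_lebesgue_integral_def)
  qed
 qed
 show ?thesis unfolding swap
  by (rule tendsto_scatter[OF _ _ tB lim]) measurable
qed

end

section \<open>Gaussian integrals with complex parameters\<close>

lemma has_vector_derivative_iff_sequentially:
 fixes f :: "real => 'b::real_normed_vector"
 shows "(f has_vector_derivative D) (at t within S) \<longleftrightarrow>
  (\<forall>X. (\<forall>j. X j \<in> S - {t}) \<and> X \<longlonglongrightarrow> t \<longrightarrow>
   (%j. (f (X j) - f t) /\<^sub>R (X j - t)) \<longlonglongrightarrow> D)"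
proof -
 have "(f has_vector_derivative D) (at t within S) \<longleftrightarrow>
   ((%y. (f y - f t) /\<^sub>R (y - t)) \<longlongrightarrow> D) (at t within S)"
 proof -
  have "norm ((f y - f t - (y - t) *\<^sub>R D) /\<^sub>R norm (y - t)) = norm ((f y - f t) /\<^sub>R (y - t) - D)"
   if "y ~= t" for y
  proof -
   have "norm ((f y - f t) /\<^sub>R (y - t) - D) = norm ((f y - f t - (y - t) *\<^sub>R D) /\<^sub>R (y - t))"
    using that by (simp add: scaleR_right_diff_distrib)
   then show ?thesis by simp
  qed
  then have ev: "eventually (%y. norm ((f y - f t - (y - t) *\<^sub>R D) /\<^sub>R norm (y - t)) =
    norm ((f y - f t) /\<^sub>R (y - t) - D)) (at t within S)"
   by (auto simp: eventually_at_filter)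
  have "(f has_vector_derivative D) (at t within S) \<longleftrightarrow>
    ((%y. norm ((f y - f t - (y - t) *\<^sub>R D) /\<^sub>R norm (y - t))) \<longlongrightarrow> 0) (at t within S)"
   unfolding has_vector_derivative_def has_derivative_within tendsto_norm_zero_iff
   by (simp add: bounded_linear_scaleR_left diff_diff_eq divide_inverse)
  also have "\<dots> \<longleftrightarrow> ((%y. norm ((f y - f t) /\<^sub>R (y - t) - D)) \<longlongrightarrow> 0) (at t within S)"
   using ev by (rule tendsto_cong)
  finally show ?thesis by (simp add: tendsto_norm_zero_iff Lim_null[symmetric])
 qed
 also have "\<dots> \<longleftrightarrow> (\<forall>X. (\<forall>j. X j \<in> S - {t}) \<and> X \<longlonglongrightarrow> t \<longrightarrow>
   (%j. (f (X j) - f t) /\<^sub>R (X j - t)) \<longlonglongrightarrow> D)"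
  by (auto simp: tendsto_at_iff_sequentially o_def)
 finally show ?thesis .
qed

lemma norm_difference_quotient_le:
 fixes f :: "real => 'b::real_normed_vector"
 assumes "!!u. u \<in> S ==> (f has_vector_derivative f' u) (at u within S)" "convex S"
  and "!!u. u \<in> S ==> norm (f' u) <= B" "x \<in> S" "y \<in> S" "x ~= y"
 shows "norm ((f x - f y) /\<^sub>R (x - y)) <= B"
proof -
 have "norm (f x - f y) <= B * norm (x - y)"
 proof (rule differentiable_bound[of S f "%u h. h *\<^sub>R f' u"])
  show "onorm (%h. h *\<^sub>R f' u) <= B" if "u \<in> S" for u
   using assms(3)[OF that]
   by (intro onorm_bound) (auto simp: mult.commute[of B] intro: mult_left_mono order_trans[OF norm_ge_zero])
 qed (use assms in \<open>auto simp: has_vector_derivative_def\<close>)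
 then have "norm (f x - f y) / \<bar>x - y\<bar> <= B" using assms(6) by (simp add: pos_divide_le_eq)
 then show ?thesis by (simp only: norm_scaleR abs_inverse divide_inverse mult.commute)
qed

lemma has_vector_derivative_integral:
 fixes f :: "real => 'x => complex"
 assumes deriv: "!!u x. u \<in> S ==> ((%u. f u x) has_vector_derivative f' u x) (at u within S)"
  and "convex S" "t \<in> S"
  and bound: "!!u x. u \<in> S ==> norm (f' u x) <= g x" and g: "integrable M g"
  and int: "!!u. u \<in> S ==> integrable M (f u)"
  and [measurable]: "f' t \<in> borel_measurable M"
 shows "((%u. LINT x|M. f u x) has_vector_derivative (LINT x|M. f' t x)) (at t within S)"
 unfolding has_vector_derivative_iff_sequentially
proof (intro allI impI)
 fix X assume X: "(\<forall>j. X j \<in> S - {t}) \<and> X \<longlonglongrightarrow> t"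
 have [measurable]: "f (X j) \<in> borel_measurable M" "f t \<in> borel_measurable M" for j
  using int X \<open>t \<in> S\<close> by auto
 have "(%j. LINT x|M. (f (X j) x - f t x) /\<^sub>R (X j - t)) \<longlonglongrightarrow> (LINT x|M. f' t x)"
 proof (rule integral_dominated_convergence[OF _ _ g])
  show "AE x in M. (%j. (f (X j) x - f t x) /\<^sub>R (X j - t)) \<longlonglongrightarrow> f' t x"
   using deriv[OF \<open>t \<in> S\<close>] X unfolding has_vector_derivative_iff_sequentially by auto
  show "AE x in M. norm ((f (X j) x - f t x) /\<^sub>R (X j - t)) <= g x" for j
   using X \<open>t \<in> S\<close> \<open>convex S\<close> deriv bound
   by (intro AE_I2 norm_difference_quotient_le[where S = S]) auto
 qed measurable
 moreover have "(LINT x|M. (f (X j) x - f t x) /\<^sub>R (X j - t)) =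
   ((LINT x|M. f (X j) x) - (LINT x|M. f t x)) /\<^sub>R (X j - t)" for j
  using int X \<open>t \<in> S\<close> by simp
 ultimately show "(%j. ((LINT x|M. f (X j) x) - (LINT x|M. f t x)) /\<^sub>R (X j - t)) \<longlonglongrightarrow> (LINT x|M. f' t x)"
  by (simp only:)
qed

lemma power_exp_gaussian_le:
 assumes "c > 0" "b \<ge> 0"
 obtains B where "B > 0" "!!x::real. \<bar>x\<bar> ^ n * exp (b * \<bar>x\<bar> - c * x^2) <= B * exp (- (c / 2) * x^2)"
proof
 let ?B = "fact n * exp ((b + 1)^2 / (2 * c))"
 show "0 < ?B" by simp
 fix x :: real
 have "\<bar>x\<bar> ^ n / fact n <= exp \<bar>x\<bar>"
 proof -
  have "(\<Sum>k<Suc n. \<bar>x\<bar> ^ k /\<^sub>R fact k) <= exp \<bar>x\<bar>"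
   unfolding exp_def by (intro sum_le_suminf summable_exp_generic) auto
  moreover have "\<bar>x\<bar> ^ n /\<^sub>R fact n <= (\<Sum>k<Suc n. \<bar>x\<bar> ^ k /\<^sub>R fact k)"
   by (intro member_le_sum) auto
  ultimately show ?thesis by (simp add: field_simps)
 qed
 moreover have "(b + 1) * \<bar>x\<bar> <= c / 2 * x^2 + (b + 1)^2 / (2 * c)"
 proof -
  have "0 <= (c * \<bar>x\<bar> - (b + 1))^2 / (2 * c)" using assms by simp
  also have "\<dots> = c / 2 * x^2 + (b + 1)^2 / (2 * c) - (b + 1) * \<bar>x\<bar>"
   using assms by (simp add: power2_diff field_simps power2_eq_square)
  finally show ?thesis by simp
 qed
 ultimately show "\<bar>x\<bar> ^ n * exp (b * \<bar>x\<bar> - c * x^2) <= ?B * exp (- (c / 2) * x^2)"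
 proof -
  assume 1: "\<bar>x\<bar> ^ n / fact n <= exp \<bar>x\<bar>"
   and 2: "(b + 1) * \<bar>x\<bar> <= c / 2 * x^2 + (b + 1)^2 / (2 * c)"
  have "\<bar>x\<bar> ^ n * exp (b * \<bar>x\<bar> - c * x^2) <= (fact n * exp \<bar>x\<bar>) * exp (b * \<bar>x\<bar> - c * x^2)"
   using 1 by (intro mult_right_mono) (auto simp: field_simps)
  also have "\<dots> = fact n * exp ((b + 1) * \<bar>x\<bar> - c * x^2)"
   by (simp add: algebra_simps flip: exp_add)
  also have "\<dots> <= fact n * exp ((b + 1)^2 / (2 * c) - (c / 2) * x^2)"
   using 2 by simp
  also have "\<dots> = ?B * exp (- (c / 2) * x^2)" by (simp flip: exp_add)
  finally show ?thesis .
 qed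
qed

lemma integrable_gaussian:
 assumes "c > 0"
 shows "integrable lborel (%x::real. exp (- c * x^2))"
  and "(LINT x|lborel. exp (- c * x^2)) = sqrt (pi / c)"
proof -
 let ?s = "1 / sqrt (2 * c)"
 have *: "exp (- c * x^2) = sqrt (pi / c) * normal_density 0 ?s x" for x
  using assms by (simp add: normal_density_def power_divide real_sqrt_divide real_sqrt_mult field_simps)
 show "integrable lborel (%x::real. exp (- c * x^2))"
  unfolding * using assms by simp
 show "(LINT x|lborel. exp (- c * x^2)) = sqrt (pi / c)"
  unfolding * using assms by simp
qed

lemma integrable_gaussian_bound:
 fixes f :: "real => complex"
 assumes [measurable]: "f \<in> borel_measurable borel" and "c > 0" "b \<ge> 0"
  and B: "!!x. norm (f x) <= B * (\<bar>x\<bar> ^ n * exp (b * \<bar>x\<bar> - c * x^2))"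
 shows "integrable lborel f"
proof -
 obtain B' where B': "!!x::real. \<bar>x\<bar> ^ n * exp (b * \<bar>x\<bar> - c * x^2) <= B' * exp (- (c / 2) * x^2)"
  using power_exp_gaussian_le[OF \<open>c > 0\<close> \<open>b \<ge> 0\<close>] by metis
 have "integrable lborel (%x. \<bar>B\<bar> * (B' * exp (- (c / 2) * x^2)))"
  using \<open>c > 0\<close> by (intro integrable_mult_right integrable_gaussian) simp
 then show ?thesis
 proof (rule Bochner_Integration.integrable_bound)
  show "AE x in lborel. norm (f x) <= norm (\<bar>B\<bar> * (B' * exp (- (c / 2) * x^2)))"
  proof (intro AE_I2)
   fix x
   have "norm (f x) <= \<bar>B\<bar> * (\<bar>x\<bar> ^ n * exp (b * \<bar>x\<bar> - c * x^2))"
    using B[of x] by (rule order_trans) (auto intro!: mult_right_mono)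
   also have "\<dots> <= \<bar>B\<bar> * (B' * exp (- (c / 2) * x^2))"
    by (intro mult_left_mono B') auto
   finally show "norm (f x) <= norm (\<bar>B\<bar> * (B' * exp (- (c / 2) * x^2)))" by simp
  qed
 qed simp
qed

lemma tendsto_gaussian_infinity:
 fixes f :: "real => complex"
 assumes "c > 0" "b \<ge> 0"
  and B: "!!x. norm (f x) <= B * (\<bar>x\<bar> ^ n * exp (b * \<bar>x\<bar> - c * x^2))"
 shows "(f \<longlongrightarrow> 0) at_infinity"
proof -
 obtain B' where B': "!!x::real. \<bar>x\<bar> ^ n * exp (b * \<bar>x\<bar> - c * x^2) <= B' * exp (- (c / 2) * x^2)"
  using power_exp_gaussian_le[OF \<open>c > 0\<close> \<open>b \<ge> 0\<close>] by metis
 have 1: "\<forall>\<^sub>F x in at_infinity. norm (f x) <= \<bar>B\<bar> * (B' * exp (- (c / 2) * (norm x)^2))"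
 proof (intro always_eventually allI)
  fix x
  have "norm (f x) <= \<bar>B\<bar> * (\<bar>x\<bar> ^ n * exp (b * \<bar>x\<bar> - c * x^2))"
   using B[of x] by (rule order_trans) (auto intro!: mult_right_mono)
  also have "\<dots> <= \<bar>B\<bar> * (B' * exp (- (c / 2) * x^2))"
   by (intro mult_left_mono B') auto
  finally show "norm (f x) <= \<bar>B\<bar> * (B' * exp (- (c / 2) * (norm x)^2))" by simp
 qed
 have "((%y::real. \<bar>B\<bar> * (B' * exp (- (c / 2) * y^2))) \<longlongrightarrow> \<bar>B\<bar> * (B' * 0)) at_top"
 proof (intro tendsto_mult tendsto_const)
  have "filterlim (%y::real. - (c / 2) * y^2) at_bot at_top"
   by (rule filterlim_tendsto_neg_mult_at_bot[OF tendsto_const])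
    (use assms(1) in \<open>auto intro!: filterlim_pow_at_top filterlim_ident\<close>)
  then show "((%y. exp (- (c / 2) * y^2)) \<longlongrightarrow> 0) at_top"
   by (rule filterlim_compose[OF exp_at_bot])
 qed
 from filterlim_compose[OF this filterlim_norm_at_top]
 have 2: "((%x::real. \<bar>B\<bar> * (B' * exp (- (c / 2) * (norm x)^2))) \<longlongrightarrow> 0) at_infinity"
  by (simp only: mult_zero_right)
 show ?thesis by (rule Lim_null_comparison[OF 1 2])
qed

lemma integral_derivative_eq_0:
 fixes f f' :: "real => complex"
 assumes "!!x. (f has_vector_derivative f' x) (at x)" "continuous_on UNIV f'"
  and "integrable lborel f'" and lim: "(f \<longlongrightarrow> 0) at_infinity"
 shows "(LINT x|lborel. f' x) = 0"
proof -
 have "(LBINT x=-\<infinity>..\<infinity>. f' x) = 0 - 0"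
 proof (rule interval_integral_FTC_integrable)
  show "((f \<circ> real_of_ereal) \<longlongrightarrow> 0) (at_right (- \<infinity>))" "((f \<circ> real_of_ereal) \<longlongrightarrow> 0) (at_left \<infinity>)"
   using lim by (auto simp: ereal_tendsto_simps1 intro: tendsto_mono[OF at_bot_le_at_infinity]
     tendsto_mono[OF at_top_le_at_infinity])
 qed (use assms in \<open>auto simp: set_integrable_def continuous_on_eq_continuous_at\<close>)
 then show ?thesis
  by (simp add: interval_lebesgue_integral_def set_lebesgue_integral_def)
qed

text \<open>The Fourier transform of \<open>p \<mapsto> exp (- a p^2 / 2)\<close>, continued to complex argument.\<close>

definition cgauss :: "complex => complex => complex" where
 "cgauss a z = of_real (sqrt (2 * pi)) / csqrt a * exp (- z\<^sup>2 / (2 * a))"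

abbreviation gauss_wave :: "complex => complex => real => complex" where
 "gauss_wave a z p \<equiv> exp (- a * of_real p ^ 2 / 2 - \<i> * of_real p * z)"

lemma norm_gauss_wave_le:
 assumes "c <= Re a" "\<bar>Im z\<bar> <= b"
 shows "norm (gauss_wave a z p) <= exp (b * \<bar>p\<bar> - c / 2 * p^2)"
proof -
 have "Re (- a * of_real p ^ 2 / 2 - \<i> * of_real p * z) = p * Im z - Re a / 2 * p^2"
  by (simp add: Re_power2 Im_power2 power2_eq_square)
 moreover have "p * Im z <= \<bar>p\<bar> * b"
  using mult_mono[OF order_refl assms(2), of "\<bar>p\<bar>"] abs_le_iff[of "p * Im z" "\<bar>p\<bar> * b"] by (auto simp: abs_mult)
 moreover have "c / 2 * p^2 <= Re a / 2 * p^2" using assms(1) by (intro mult_right_mono) auto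
 ultimately show ?thesis by (simp add: mult.commute)
qed

lemma integrable_power_gauss_wave:
 assumes "Re a > 0"
 shows "integrable lborel (%p. of_real p ^ n * gauss_wave a z p)"
proof (rule integrable_gaussian_bound[where c = "Re a / 2" and b = "\<bar>Im z\<bar>" and n = n and B = 1])
 show "norm (of_real p ^ n * gauss_wave a z p) <= 1 * (\<bar>p\<bar> ^ n * exp (\<bar>Im z\<bar> * \<bar>p\<bar> - Re a / 2 * p^2))" for p
  unfolding norm_mult norm_power norm_of_real mult_1
  by (intro mult_left_mono norm_gauss_wave_le) auto
qed (use assms in auto)

text \<open>Integrals of total derivatives vanish; these are the two relations that determine the
 Fourier integral of a complex Gaussian through differential equations in its parameters.\<close>

lemma gauss_wave_parts:
 assumes "Re a > 0"
 shows "a * (LINT p|lborel. of_real p * gauss_wave a z p) = - \<i> * z * (LINT p|lborel. gauss_wave a z p)"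
  and "a * (LINT p|lborel. of_real p ^ 2 * gauss_wave a 0 p) = (LINT p|lborel. gauss_wave a 0 p)"
proof -
 note int = integrable_power_gauss_wave[OF assms, of 0 z] integrable_power_gauss_wave[OF assms, of 1 z]
  integrable_power_gauss_wave[OF assms, of 0 0] integrable_power_gauss_wave[OF assms, of 2 0]
 have "(LINT p|lborel. (- a * of_real p - \<i> * z) * gauss_wave a z p) = 0"
 proof (rule integral_derivative_eq_0)
  show "((%p. gauss_wave a z p) has_vector_derivative (- a * of_real p - \<i> * z) * gauss_wave a z p) (at p)" for p
   by (rule has_vector_derivative_real_field) (auto intro!: derivative_eq_intros)
  show "((%p. gauss_wave a z p) \<longlongrightarrow> 0) at_infinity"
   by (rule tendsto_gaussian_infinity[where c = "Re a / 2" and b = "\<bar>Im z\<bar>" and n = 0 and B = 1])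
    (use assms norm_gauss_wave_le[of "Re a" a z "\<bar>Im z\<bar>"] in auto)
  show "integrable lborel (%p. (- a * of_real p - \<i> * z) * gauss_wave a z p)"
   using int by (simp add: left_diff_distrib mult.assoc)
 qed (auto intro!: continuous_intros)
 also have "(LINT p|lborel. (- a * of_real p - \<i> * z) * gauss_wave a z p) =
  (LINT p|lborel. - a * (of_real p * gauss_wave a z p) - \<i> * z * gauss_wave a z p)"
  by (simp add: left_diff_distrib mult.assoc)
 also have "\<dots> = - a * (LINT p|lborel. of_real p * gauss_wave a z p) - \<i> * z * (LINT p|lborel. gauss_wave a z p)"
  using int by (subst Bochner_Integration.integral_diff) auto
 finally show "a * (LINT p|lborel. of_real p * gauss_wave a z p) = - \<i> * z * (LINT p|lborel. gauss_wave a z p)"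
  by (simp add: algebra_simps, drule_tac arg_cong[where f = uminus], simp)
 have "(LINT p|lborel. (1 - a * of_real p ^ 2) * gauss_wave a 0 p) = 0"
 proof (rule integral_derivative_eq_0)
  show "((%p. of_real p * gauss_wave a 0 p) has_vector_derivative (1 - a * of_real p ^ 2) * gauss_wave a 0 p) (at p)" for p
   by (rule has_vector_derivative_real_field) (auto intro!: derivative_eq_intros simp: algebra_simps power2_eq_square)
  show "((%p. of_real p * gauss_wave a 0 p) \<longlongrightarrow> 0) at_infinity"
  proof (rule tendsto_gaussian_infinity[where c = "Re a / 2" and b = "0" and n = 1 and B = 1])
   show "norm (of_real p * gauss_wave a 0 p) <= 1 * (\<bar>p\<bar> ^ 1 * exp (0 * \<bar>p\<bar> - Re a / 2 * p^2))" for p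
    unfolding norm_mult norm_power norm_of_real mult_1 power_one_right
    by (intro mult_left_mono norm_gauss_wave_le) auto
  qed (use assms in auto)
  show "integrable lborel (%p. (1 - a * of_real p ^ 2) * gauss_wave a 0 p)"
   using int by (simp add: left_diff_distrib mult.assoc)
 qed (auto intro!: continuous_intros)
 also have "(LINT p|lborel. (1 - a * of_real p ^ 2) * gauss_wave a 0 p) =
  (LINT p|lborel. gauss_wave a 0 p - a * (of_real p ^ 2 * gauss_wave a 0 p))"
  by (simp add: left_diff_distrib mult.assoc)
 also have "\<dots> = (LINT p|lborel. gauss_wave a 0 p) - a * (LINT p|lborel. of_real p ^ 2 * gauss_wave a 0 p)"
  using int by (subst Bochner_Integration.integral_diff) auto
 finally show "a * (LINT p|lborel. of_real p ^ 2 * gauss_wave a 0 p) = (LINT p|lborel. gauss_wave a 0 p)"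
  by (simp add: algebra_simps)
qed

lemma ode_cancel: "x * (q * y) + (- q * x) * y = (0 :: complex)"
 by simp

lemma ode_coefficient: "- x / 2 * (f / A) = - (x / (2 * A)) * (f :: complex)"
 by simp

text \<open>As functions of the parameter along the segment from \<open>1\<close> to \<open>a\<close>, the integral and the
 principal value of the square root solve the same linear equation, so the branch is right.\<close>

lemma integral_gauss_wave_0:
 assumes "Re a > 0"
 shows "(LINT p|lborel. gauss_wave a 0 p) = of_real (sqrt (2 * pi)) / csqrt a"
proof -
 define A where "A t = 1 + of_real t * (a - 1)" for t :: real
 define c where "c = min 1 (Re a)"
 have c: "0 < c" "c <= Re a" "c <= 1" using assms by (auto simp: c_def)
 have A: "c <= Re (A t)" if "t \<in> {0..1}" for t
 proof -
  have "Re (A t) = (1 - t) * 1 + t * Re a" by (simp add: A_def algebra_simps)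
  moreover have "(1 - t) * c + t * c <= (1 - t) * 1 + t * Re a"
   using that c by (intro add_mono mult_left_mono) auto
  ultimately show ?thesis by (simp add: algebra_simps)
 qed
 define F where "F t = (LINT p|lborel. gauss_wave (A t) 0 p)" for t
 have F': "(F has_vector_derivative - ((a - 1) / (2 * A t)) * F t) (at t within {0..1})" if t: "t \<in> {0..1}" for t
 proof -
  have "(F has_vector_derivative (LINT p|lborel. - (a - 1) / 2 * (of_real p ^ 2 * gauss_wave (A t) 0 p))) (at t within {0..1})"
   unfolding F_def
  proof (rule has_vector_derivative_integral[where g = "%p. norm (a - 1) / 2 * (p^2 * exp (- (c / 2) * p^2))"])
   fix u p assume u: "u \<in> {0..1::real}"
   have "((%u. exp (- A u * of_real p ^ 2 / 2 - \<i> * of_real p * 0)) has_vector_derivative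
    - (a - 1) / 2 * (of_real p ^ 2 * gauss_wave (A u) 0 p)) (at u)"
    unfolding A_def
    by (rule has_vector_derivative_real_field) (auto intro!: derivative_eq_intros simp: algebra_simps add_divide_distrib diff_divide_distrib)
   then show "((%u. gauss_wave (A u) 0 p) has_vector_derivative
    - (a - 1) / 2 * (of_real p ^ 2 * gauss_wave (A u) 0 p)) (at u within {0..1})"
    by (rule has_vector_derivative_at_within)
   have "norm (- (a - 1) / 2 * (of_real p ^ 2 * gauss_wave (A u) 0 p)) =
    norm (a - 1) / 2 * (p^2 * norm (gauss_wave (A u) 0 p))"
    by (simp add: norm_mult norm_divide norm_power norm_minus_commute del: norm_exp_eq_Re)
   also have "\<dots> <= norm (a - 1) / 2 * (p^2 * exp (0 * \<bar>p\<bar> - c / 2 * p^2))"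
    using A[OF u] by (intro mult_left_mono norm_gauss_wave_le) auto
   finally show "norm (- (a - 1) / 2 * (of_real p ^ 2 * gauss_wave (A u) 0 p)) <=
    norm (a - 1) / 2 * (p^2 * exp (- (c / 2) * p^2))" by simp
  next
   have "integrable lborel (%p. of_real p ^ 2 * gauss_wave (of_real c) 0 p)"
    using c by (intro integrable_power_gauss_wave) auto
   from integrable_norm[OF this]
   have "integrable lborel (%p. p^2 * exp (- (c / 2) * p^2))"
    by (simp add: norm_mult norm_power Re_power2)
   then show "integrable lborel (%p. norm (a - 1) / 2 * (p^2 * exp (- (c / 2) * p^2)))" by simp
  next
   show "integrable lborel (gauss_wave (A u) 0)" if "u \<in> {0..1}" for u
    using integrable_power_gauss_wave[of "A u" 0 0] A[OF that] c by simp
  qed (use t in auto)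
  moreover
  have "A t ~= 0" using A[OF t] c by auto
  then have "(LINT p|lborel. of_real p ^ 2 * gauss_wave (A t) 0 p) = F t / A t"
   using gauss_wave_parts(2)[of "A t"] A[OF t] c by (simp add: F_def field_simps)
  then have "(LINT p|lborel. - (a - 1) / 2 * (of_real p ^ 2 * gauss_wave (A t) 0 p)) = - (a - 1) / 2 * (F t / A t)"
   by (simp only: integral_mult_right_zero)
  also have "\<dots> = - ((a - 1) / (2 * A t)) * F t"
   by (rule ode_coefficient)
  ultimately show ?thesis by (simp only:)
 qed
 have S': "((%t. csqrt (A t)) has_vector_derivative (a - 1) / (2 * A t) * csqrt (A t)) (at t within {0..1})"
  if t: "t \<in> {0..1}" for t
 proof -
  have nz: "A t \<notin> \<real>\<^sub>\<le>\<^sub>0" "A t ~= 0" using A[OF t] c by (auto simp: complex_nonpos_Reals_iff)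
  have "(a - 1) / (2 * csqrt (A t)) = (a - 1) / (2 * A t) * csqrt (A t)"
  proof -
   define s where "s = csqrt (A t)"
   have s: "A t = s * s" "s ~= 0" using nz by (simp_all add: s_def flip: power2_eq_square)
   from s(2) have "(a - 1) / (2 * s) = (a - 1) / (2 * (s * s)) * s" by (simp add: field_simps)
   then show ?thesis by (simp only: s(1)[symmetric] s_def[symmetric])
  qed
  moreover have "((%t. csqrt (A t)) has_vector_derivative (a - 1) / (2 * csqrt (A t))) (at t)"
   using nz unfolding A_def
   by (intro has_vector_derivative_real_field) (auto intro!: derivative_eq_intros simp: field_simps)
  ultimately show ?thesis by (simp add: has_vector_derivative_at_within)
 qed
 have "((%t. F t * csqrt (A t)) has_vector_derivative 0) (at t within {0..1})" if t: "t \<in> {0..1}" for t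
  by (rule has_vector_derivative_eq_rhs[OF has_vector_derivative_mult[OF F'[OF t] S'[OF t]]])
   (rule ode_cancel)
 then obtain k where k: "!!t. t \<in> {0..1} ==> F t * csqrt (A t) = k"
  using has_vector_derivative_zero_constant[of "{0..1}" "%t. F t * csqrt (A t)"] by auto
 have "F 0 = of_real (LINT p|lborel. exp (- (1 / 2) * p^2))"
  unfolding F_def by (subst integral_complex_of_real[symmetric]) (simp add: A_def exp_of_real[symmetric])
 then have "F 0 = of_real (sqrt (2 * pi))" by (subst (asm) integrable_gaussian(2)) (auto simp: mult.commute)
 with k[of 0] k[of 1] have "F 1 * csqrt a = of_real (sqrt (2 * pi))" by (simp add: A_def)
 moreover have "csqrt a ~= 0" using assms by auto
 ultimately show ?thesis by (simp add: F_def A_def nonzero_eq_divide_eq)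
qed

theorem integral_gauss_wave:
 assumes "Re a > 0"
 shows "(LINT p|lborel. gauss_wave a z p) = cgauss a z"
proof -
 define F where "F t = (LINT p|lborel. gauss_wave a (of_real t * z) p)" for t
 have a: "a ~= 0" using assms by auto
 have F': "(F has_vector_derivative - (of_real t * z^2 / a) * F t) (at t within {0..1})" if t: "t \<in> {0..1}" for t
 proof -
  have "(F has_vector_derivative (LINT p|lborel. - \<i> * z * (of_real p * gauss_wave a (of_real t * z) p))) (at t within {0..1})"
   unfolding F_def
  proof (rule has_vector_derivative_integral[where
    g = "%p. norm z * norm (of_real p * gauss_wave (of_real (Re a)) (\<i> * norm z) p) +
        norm z * norm (of_real p * gauss_wave (of_real (Re a)) (- \<i> * norm z) p)"])
   fix u p assume u: "u \<in> {0..1::real}"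
   have "((%u. exp (- a * of_real p ^ 2 / 2 - \<i> * of_real p * (of_real u * z))) has_vector_derivative
    - \<i> * z * (of_real p * gauss_wave a (of_real u * z) p)) (at u)"
    by (rule has_vector_derivative_real_field) (auto intro!: derivative_eq_intros simp: algebra_simps)
   then show "((%u. gauss_wave a (of_real u * z) p) has_vector_derivative
    - \<i> * z * (of_real p * gauss_wave a (of_real u * z) p)) (at u within {0..1})"
    by (rule has_vector_derivative_at_within)
   have "\<bar>Im (of_real u * z)\<bar> <= norm z"
    using u abs_Im_le_cmod[of z] mult_mono[of u 1 "\<bar>Im z\<bar>" "norm z"] by (simp add: abs_mult)
   then have "norm (gauss_wave a (of_real u * z) p) <= exp (norm z * \<bar>p\<bar> - Re a / 2 * p^2)"
    by (intro norm_gauss_wave_le) auto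
   also have "\<dots> <= norm (gauss_wave (of_real (Re a)) (\<i> * norm z) p) + norm (gauss_wave (of_real (Re a)) (- \<i> * norm z) p)"
    by (cases "0 <= p") (auto simp: Re_power2 mult.commute)
   finally have "norm (- \<i> * z * (of_real p * gauss_wave a (of_real u * z) p)) <= norm z * (\<bar>p\<bar> *
    (norm (gauss_wave (of_real (Re a)) (\<i> * norm z) p) + norm (gauss_wave (of_real (Re a)) (- \<i> * norm z) p)))"
    unfolding norm_mult by (auto intro!: mult_left_mono)
   then show "norm (- \<i> * z * (of_real p * gauss_wave a (of_real u * z) p)) <=
    norm z * norm (of_real p * gauss_wave (of_real (Re a)) (\<i> * norm z) p) +
        norm z * norm (of_real p * gauss_wave (of_real (Re a)) (- \<i> * norm z) p)"
    by (simp only: norm_mult norm_of_real distrib_left)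
  next
   show "integrable lborel (%p. norm z * norm (of_real p * gauss_wave (of_real (Re a)) (\<i> * norm z) p) +
        norm z * norm (of_real p * gauss_wave (of_real (Re a)) (- \<i> * norm z) p))"
    using integrable_power_gauss_wave[of "of_real (Re a)" 1] assms
    by (intro Bochner_Integration.integrable_add integrable_mult_right integrable_norm)
     (simp_all only: power_one_right Re_complex_of_real)
  next
   show "integrable lborel (gauss_wave a (of_real u * z))" if "u \<in> {0..1}" for u
    using integrable_power_gauss_wave[of a 0] assms by simp
  qed (use t in auto)
  moreover have "(LINT p|lborel. of_real p * gauss_wave a (of_real t * z) p) = - \<i> * of_real t * z / a * F t"
   using gauss_wave_parts(1)[of a "of_real t * z"] assms a by (simp add: F_def field_simps)
  ultimately show ?thesis by (simp add: power2_eq_square algebra_simps)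
 qed
 have E': "((%t. exp (of_real t ^ 2 * z^2 / (2 * a))) has_vector_derivative
   of_real t * z^2 / a * exp (of_real t ^ 2 * z^2 / (2 * a))) (at t within {0..1})" for t
  using a by (intro has_vector_derivative_real_field)
   (auto intro!: derivative_eq_intros simp: field_simps)
 have "((%t. F t * exp (of_real t ^ 2 * z^2 / (2 * a))) has_vector_derivative 0) (at t within {0..1})"
  if t: "t \<in> {0..1}" for t
  by (rule has_vector_derivative_eq_rhs[OF has_vector_derivative_mult[OF F'[OF t] E']])
   (rule ode_cancel)
 then obtain k where k: "!!t. t \<in> {0..1} ==> F t * exp (of_real t ^ 2 * z^2 / (2 * a)) = k"
  using has_vector_derivative_zero_constant[of "{0..1}" "%t. F t * exp (of_real t ^ 2 * z^2 / (2 * a))"] by auto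
 from k[of 0] k[of 1] have "F 1 * exp (z^2 / (2 * a)) = of_real (sqrt (2 * pi)) / csqrt a"
  by (simp add: F_def integral_gauss_wave_0[OF assms, simplified])
 moreover have "F 1 = F 1 * exp (z^2 / (2 * a)) * exp (- (z^2 / (2 * a)))"
  by (simp add: exp_minus)
 ultimately have "F 1 = of_real (sqrt (2 * pi)) / csqrt a * exp (- z\<^sup>2 / (2 * a))"
  by simp
 then show ?thesis by (simp add: F_def cgauss_def)
qed

definition cgauss1 :: "complex => complex => complex" where
 "cgauss1 a z = - (z / a) * cgauss a z"

definition cgauss2 :: "complex => complex => complex" where
 "cgauss2 a z = (z^2 / a^2 - 1 / a) * cgauss a z"

lemma cgauss_derivs:
 assumes "Re a > 0"
 shows "((%x. cgauss a (of_real x - b)) has_vector_derivative cgauss1 a (of_real x - b)) (at x)"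
  and "((%x. cgauss1 a (of_real x - b)) has_vector_derivative cgauss2 a (of_real x - b)) (at x)"
proof -
 have a: "a ~= 0" using assms by auto
 show 1: "((%x. cgauss a (of_real x - b)) has_vector_derivative cgauss1 a (of_real x - b)) (at x)"
  unfolding cgauss_def cgauss1_def using a
  by (intro has_vector_derivative_real_field) (auto intro!: derivative_eq_intros simp: field_simps)
 have "((%x. - ((of_real x - b) / a)) has_vector_derivative - (1 / a)) (at x)"
  using a by (intro has_vector_derivative_real_field) (auto intro!: derivative_eq_intros)
 from has_vector_derivative_mult[OF this 1]
 have "((%x. - ((of_real x - b) / a) * cgauss a (of_real x - b)) has_vector_derivative
   - ((of_real x - b) / a) * (- ((of_real x - b) / a) * cgauss a (of_real x - b)) + - (1 / a) * cgauss a (of_real x - b)) (at x)"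
  by (simp only: cgauss1_def)
 moreover have "- (Z / a) * (- (Z / a) * G) + - (1 / a) * G = (Z^2 / a^2 - 1 / a) * G" for Z G
  by (simp add: power2_eq_square left_diff_distrib)
 ultimately show "((%x. cgauss1 a (of_real x - b)) has_vector_derivative cgauss2 a (of_real x - b)) (at x)"
  by (simp only: cgauss1_def cgauss2_def)
qed

lemma DERIV_neg_divide:
 fixes f :: "complex => complex"
 assumes "(f has_field_derivative d) (at x)" "f x ~= 0"
 shows "((%u. - w / (2 * f u)) has_field_derivative w * d / (2 * (f x)^2)) (at x)"
 using assms by (auto intro!: derivative_eq_intros simp: field_simps power2_eq_square)

text \<open>Rotating the parameter \<open>a\<close> in the imaginary direction is the free Schroedinger flow.\<close>

lemma cgauss_heat:
 assumes "Re a > 0" "Re d = 0"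
 shows "((%u. cgauss (a + of_real u * d) z) has_vector_derivative
  d / 2 * cgauss2 (a + of_real u * d) z) (at u)"
proof -
 let ?A = "a + of_real u * d"
 have nz: "?A ~= 0" "?A \<notin> \<real>\<^sub>\<le>\<^sub>0"
  using assms by (auto simp: complex_nonpos_Reals_iff complex_eq_iff)
 define s where "s = csqrt ?A"
 have s: "?A = s * s" "s ~= 0" using nz by (simp_all add: s_def flip: power2_eq_square)
 have 1: "((%u. csqrt (a + u * d)) has_field_derivative d / (2 * s)) (at (of_real u))"
  unfolding s_def using nz by (auto intro!: derivative_eq_intros simp: field_simps)
 have 2: "((%u. exp (- z\<^sup>2 / (2 * (a + u * d)))) has_field_derivative
   (z^2 * d / (2 * ?A^2)) * exp (- z\<^sup>2 / (2 * ?A))) (at (of_real u))"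
 proof -
  have "((%u. a + u * d) has_field_derivative d) (at (of_real u))"
   by (auto intro!: derivative_eq_intros)
  from DERIV_chain2[OF DERIV_exp DERIV_neg_divide[OF this nz(1), of "z^2"]] show ?thesis
   by (simp only: mult.commute)
 qed
 define c where "c = complex_of_real (sqrt (2 * pi))"
 have 3: "((%u. c / csqrt (a + u * d)) has_field_derivative - (c * (d / (2 * s))) / (s * s)) (at (of_real u))"
  by (rule DERIV_cong[OF DERIV_divide[OF DERIV_const 1]]) (simp_all add: s(2) flip: s_def)
 have alg: "- (c * (d / (2 * s))) / (s * s) * E + (Z * d / (2 * Q) * E) * (c / s) =
   d / 2 * ((Z / Q - 1 / (s * s)) * (c / s * E))" for E Z Q
 proof -
  have "- (c * (d / (2 * s))) / (s * s) = - (d / 2 * (1 / (s * s) * (c / s)))" by (simp add: mult_ac)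
  moreover have "Z * d / (2 * Q) * E * (c / s) = d / 2 * (Z / Q * (c / s * E))" by (simp add: mult_ac)
  moreover have "- (x * (w * v)) * E + x * (y * (v * E)) = x * ((y - w) * (v * E))" for x y w v :: complex
   by (simp add: algebra_simps)
  ultimately show ?thesis by (simp only:)
 qed
 define E where "E = exp (- z\<^sup>2 / (2 * ?A))"
 have c2: "cgauss2 ?A z = (z^2 / ?A^2 - 1 / (s * s)) * (c / s * E)"
  unfolding cgauss2_def cgauss_def E_def c_def s_def[symmetric] s(1)[symmetric] ..
 have "((%u. cgauss (a + u * d) z) has_field_derivative
   - (c * (d / (2 * s))) / (s * s) * E + (z^2 * d / (2 * ?A^2) * E) * (c / s)) (at (of_real u))"
  using DERIV_mult[OF 3 2] unfolding cgauss_def c_def[symmetric] E_def s_def[symmetric] .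
 then have "((%u. cgauss (a + u * d) z) has_field_derivative d / 2 * cgauss2 ?A z) (at (of_real u))"
  unfolding alg c2 .
 then show ?thesis by (rule has_vector_derivative_real_field)
qed

lemma Re_inverse_gauss:
 assumes "Re a = \<delta>" "\<delta> > 0"
 shows "Re ((of_real x - bt)^2 / a) = \<delta> * (x - (Re bt + Im a * Im bt / \<delta>))^2 / (norm a)^2 - (Im bt)^2 / \<delta>"
proof -
 have n: "(norm a)^2 = \<delta>\<^sup>2 + (Im a)^2" using assms by (simp add: cmod_power2)
 have n0: "\<delta>\<^sup>2 + (Im a)^2 ~= 0" using assms(2) by (simp add: sum_power2_eq_zero_iff)
 have "Re ((of_real x - bt)^2 / a) =
  (((x - Re bt)^2 - (Im bt)^2) * \<delta> - 2 * (x - Re bt) * Im bt * Im a) / (\<delta>\<^sup>2 + (Im a)^2)"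
  using assms by (simp add: Re_divide cmod_power2 Re_power2 Im_power2)
 also have "\<dots> = \<delta> * (x - (Re bt + Im a * Im bt / \<delta>))^2 / (norm a)^2 - (Im bt)^2 / \<delta>"
 proof -
  have *: "((y^2 - i^2) * \<delta> - 2 * y * i * e) / D = \<delta> * (y - e * i / \<delta>)^2 / D - i^2 / \<delta>"
   if "D = \<delta>\<^sup>2 + e^2" "D ~= 0" for y i e D
  proof -
   have "\<delta> * (y - e * i / \<delta>)^2 = (y^2 - i^2) * \<delta> - 2 * y * i * e + D * (i^2 / \<delta>)"
    unfolding that(1) using assms(2) by (simp add: power2_eq_square field_simps)
   then show ?thesis using that(2) by (simp add: add_divide_distrib)
  qed
  show ?thesis
   using *[OF refl n0, of "x - Re bt" "Im bt"] by (simp only: n diff_diff_eq)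
 qed
 finally show ?thesis .
qed

lemma norm_cgauss:
 assumes "Re a = \<delta>" "\<delta> > 0"
 shows "(norm (cgauss a (of_real x - bt)))^2 = 2 * pi / norm a * exp ((Im bt)^2 / \<delta>) *
  exp (- (\<delta> / (norm a)^2) * (x - (Re bt + Im a * Im bt / \<delta>))^2)"
proof -
 have "(norm (exp (- (of_real x - bt)\<^sup>2 / (2 * a))))^2 = exp (- Re ((of_real x - bt)^2 / a))"
 proof -
  have "- (of_real x - bt)\<^sup>2 / (2 * a) = - ((of_real x - bt)^2 / a) / 2" by simp
  then have "Re (- (of_real x - bt)\<^sup>2 / (2 * a)) = - Re ((of_real x - bt)^2 / a) / 2"
   by (simp only: Re_divide_numeral uminus_complex.sel)
  then show ?thesis unfolding norm_exp_eq_Re power2_eq_square[of "exp _"] exp_add[symmetric] by simp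
 qed
 also have "\<dots> = exp ((Im bt)^2 / \<delta>) * exp (- (\<delta> / (norm a)^2) * (x - (Re bt + Im a * Im bt / \<delta>))^2)"
  unfolding Re_inverse_gauss[OF assms] by (simp flip: exp_add)
 finally have e1: "(norm (exp (- (of_real x - bt)\<^sup>2 / (2 * a))))^2 =
   exp ((Im bt)^2 / \<delta>) * exp (- (\<delta> / (norm a)^2) * (x - (Re bt + Im a * Im bt / \<delta>))^2)" .
 have e2: "(norm (of_real (sqrt (2 * pi)) / csqrt a))^2 = 2 * pi / norm a"
  by (simp add: norm_divide power_divide norm_csqrt)
 show ?thesis
  unfolding cgauss_def norm_mult power_mult_distrib e1 e2 by (simp only: mult.assoc)
qed

lemma integral_norm_cgauss:
 assumes "Re a = \<delta>" "\<delta> > 0"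
 shows "integrable lborel (%x. (norm (cgauss a (of_real x - bt)))^2)"
  and "(LINT x|lborel. (norm (cgauss a (of_real x - bt)))^2) = 2 * pi * sqrt (pi / \<delta>) * exp ((Im bt)^2 / \<delta>)"
proof -
 define c m where "c = \<delta> / (norm a)^2" and "m = Re bt + Im a * Im bt / \<delta>"
 have na: "norm a > 0" using assms by auto
 then have c: "c > 0" using assms by (simp add: c_def)
 note norm_cgauss = norm_cgauss[OF assms, where bt = bt, folded c_def m_def]
 have 1: "integrable lborel (%x. exp (- c * (x - m)^2))"
  using lborel_integrable_real_affine[OF integrable_gaussian(1)[OF c], of 1 "- m"] by simp
 then show "integrable lborel (%x. (norm (cgauss a (of_real x - bt)))^2)"
  unfolding norm_cgauss by (intro integrable_mult_right)
 have "(LINT x|lborel. exp (- c * (x - m)^2)) = sqrt (pi / c)"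
  using lborel_integral_real_affine[of 1 "%x. exp (- c * (x - m)^2)" m] integrable_gaussian(2)[OF c] by simp
 then have "(LINT x|lborel. (norm (cgauss a (of_real x - bt)))^2) = 2 * pi / norm a * exp ((Im bt)^2 / \<delta>) * sqrt (pi / c)"
  unfolding norm_cgauss by (simp only: integral_mult_right_zero)
 also have "sqrt (pi / c) = norm a * sqrt (pi / \<delta>)"
  using na by (simp add: c_def real_sqrt_mult real_sqrt_divide)
 finally show "(LINT x|lborel. (norm (cgauss a (of_real x - bt)))^2) = 2 * pi * sqrt (pi / \<delta>) * exp ((Im bt)^2 / \<delta>)"
  using na by simp
qed

lemma borel_measurable_prod_Basis:
 fixes f :: "'a::euclidean_space => real => 'b::{real_normed_field,banach,second_countable_topology}"
 assumes "!!b. b \<in> Basis ==> f b \<in> borel_measurable borel"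
 shows "(%X::'a. \<Prod>b\<in>Basis. f b (X \<bullet> b)) \<in> borel_measurable borel"
 apply (rule borel_measurable_prod)
 apply (rule measurable_compose[OF _ assms])
 apply simp
 apply assumption
 done
lemma integral_prod_Basis:
 fixes f :: "'a::euclidean_space => real => 'b::{real_normed_field,banach,second_countable_topology}"
 assumes "!!b. b \<in> Basis ==> integrable lborel (f b)"
 shows "integrable lborel (%X::'a. \<Prod>b\<in>Basis. f b (X \<bullet> b))"
  and "(LINT X|lborel. (\<Prod>b\<in>Basis. f b (X \<bullet> b))) = (\<Prod>b\<in>Basis. LINT x|lborel. f b x)"
proof -
 interpret P: product_sigma_finite "%_::'a. lborel :: real measure" by standard
 have fm: "f b \<in> borel_measurable borel" if "b \<in> Basis" for b
  using borel_measurable_integrable[OF assms[OF that]] by simp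
 have T: "(%g::'a => real. \<Sum>b\<in>Basis. g b *\<^sub>R b) \<in> (\<Pi>\<^sub>M b\<in>Basis. lborel) \<rightarrow>\<^sub>M borel"
  by (intro borel_measurable_sum borel_measurable_scaleR borel_measurable_const) simp
 have m: "(%X::'a. \<Prod>b\<in>Basis. f b (X \<bullet> b)) \<in> borel_measurable borel"
  by (rule borel_measurable_prod_Basis) (rule fm)
 have eq: "(\<Prod>b\<in>Basis. f b ((\<Sum>b'\<in>Basis. g b' *\<^sub>R b') \<bullet> b)) = (\<Prod>b\<in>Basis. f b (g b))" for g :: "'a => real"
  by (intro prod.cong refl) simp
 note i = integrable_distr_eq[OF T m]
 show "integrable lborel (%X::'a. \<Prod>b\<in>Basis. f b (X \<bullet> b))"
  apply (subst lborel_eq)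
  apply (subst i)
  unfolding eq
  apply (rule P.product_integrable_prod)
  apply simp
  apply (rule assms)
  apply assumption
  done
 show "(LINT X|lborel. (\<Prod>b\<in>Basis. f b (X \<bullet> b))) = (\<Prod>b\<in>Basis. LINT x|lborel. f b x)"
  apply (subst lborel_eq)
  apply (subst integral_distr[OF T m])
  unfolding eq
  apply (rule P.product_integral_prod)
  apply simp
  apply (rule assms)
  apply assumption
  done
qed

section \<open>Square integrable functions and the pairing\<close>

abbreviation L2_sq :: "('a::euclidean_space => complex) => real" where
 "L2_sq f \<equiv> LINT x|lborel. (norm (f x))^2"

lemma square_integrable_bound:
 fixes g :: "'a::euclidean_space => real"
 assumes "f \<in> borel_measurable lborel" "integrable lborel (%x. (g x)^2)" "!!x. norm (f x) <= g x"
 shows "square_integrable f"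
 unfolding square_integrable_def
proof
 show "integrable lborel (%x. (norm (f x))^2)"
  using assms(2)
 proof (rule Bochner_Integration.integrable_bound)
  show "AE x in lborel. norm ((norm (f x))^2) <= norm ((g x)^2)"
   using assms(3) by (auto intro!: AE_I2 power_mono)
 qed (use assms(1) in measurable)
qed (rule assms(1))

text \<open>The weight \<open>l\<close> replaces the Cauchy--Schwarz inequality: it is chosen large, which makes the
 second term small, before \<open>f\<close> becomes small in norm.\<close>

lemma pairing_bound:
 assumes f: "square_integrable f" and g: "square_integrable g" and "l > 0"
 shows "integrable lborel (%x. f x * g x)"
  and "norm (pairing f g) <= (l * L2_sq f + L2_sq g / l) / 2"
proof -
 have [measurable]: "f \<in> borel_measurable lborel" "g \<in> borel_measurable lborel"
  using f g by (auto simp: square_integrable_def)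
 have int: "integrable lborel (%x. (l * (norm (f x))^2 + (norm (g x))^2 / l) / 2)"
  using f g by (auto simp: square_integrable_def)
 have le: "norm (f x * g x) <= (l * (norm (f x))^2 + (norm (g x))^2 / l) / 2" for x
 proof -
  have "0 <= (l * norm (f x) - norm (g x))^2 / l" using \<open>l > 0\<close> by simp
  also have "\<dots> = l * (norm (f x))^2 + (norm (g x))^2 / l - 2 * (norm (f x) * norm (g x))"
   using \<open>l > 0\<close> by (simp add: power2_eq_square field_simps)
  finally show ?thesis by (simp add: norm_mult)
 qed
 show "integrable lborel (%x. f x * g x)"
  using int
 proof (rule Bochner_Integration.integrable_bound)
  show "AE x in lborel. norm (f x * g x) <= norm ((l * (norm (f x))^2 + (norm (g x))^2 / l) / 2)"
   by (intro AE_I2, rule order_trans[OF le]) (simp only: real_norm_def abs_ge_self)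
 qed measurable
 have "norm (pairing f g) <= (LINT x|lborel. (l * (norm (f x))^2 + (norm (g x))^2 / l) / 2)"
  unfolding pairing_def
  by (rule order_trans[OF integral_norm_bound integral_mono'[OF int]])
   (use le \<open>l > 0\<close> in auto)
 also have "\<dots> = (l * L2_sq f + L2_sq g / l) / 2"
  using f g by (simp add: square_integrable_def)
 finally show "norm (pairing f g) <= (l * L2_sq f + L2_sq g / l) / 2" .
qed

lemma square_integrable_diff:
 assumes "square_integrable f" "square_integrable g"
 shows "square_integrable (%x. f x - g x)"
  and "L2_sq f <= 2 * L2_sq (%x. f x - g x) + 2 * L2_sq g"
proof -
 have [measurable]: "f \<in> borel_measurable lborel" "g \<in> borel_measurable lborel"
  using assms by (auto simp: square_integrable_def)
 have sq: "(norm (x + y))^2 <= 2 * (norm x)^2 + 2 * (norm y)^2" for x y :: complex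
 proof -
  have "(norm (x + y))^2 <= (norm x + norm y)^2" by (intro power_mono norm_triangle_ineq) auto
  also have "\<dots> <= 2 * (norm x)^2 + 2 * (norm y)^2"
   using zero_le_power2[of "norm x - norm y"] by (simp add: power2_eq_square algebra_simps)
  finally show ?thesis .
 qed
 have int: "integrable lborel (%x. 2 * (norm (f x))^2 + 2 * (norm (g x))^2)"
  using assms by (auto simp: square_integrable_def)
 show d: "square_integrable (%x. f x - g x)"
  unfolding square_integrable_def
 proof
  show "integrable lborel (%x. (norm (f x - g x))^2)"
   using int
  proof (rule Bochner_Integration.integrable_bound)
   show "AE x in lborel. norm ((norm (f x - g x))^2) <= norm (2 * (norm (f x))^2 + 2 * (norm (g x))^2)"
    using sq[of "f x" "- g x" for x] by (intro AE_I2) simp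
  qed measurable
 qed measurable
 have "L2_sq f <= (LINT x|lborel. 2 * (norm (f x - g x))^2 + 2 * (norm (g x))^2)"
  using assms d sq[of "f x - g x" "g x" for x]
  by (intro integral_mono) (auto simp: square_integrable_def)
 also have "\<dots> = 2 * L2_sq (%x. f x - g x) + 2 * L2_sq g"
  using assms d by (simp add: square_integrable_def)
 finally show "L2_sq f <= 2 * L2_sq (%x. f x - g x) + 2 * L2_sq g" .
qed

lemma L2_continuousD:
 assumes "L2_continuous \<nu>" "0 <= t"
 shows "square_integrable (\<nu> t)"
  and "(!!j. 0 <= X j) ==> X \<longlonglongrightarrow> t ==> (%j. L2_sq (%x. \<nu> (X j) x - \<nu> t x)) \<longlonglongrightarrow> 0"
proof -
 show "square_integrable (\<nu> t)" using assms by (auto simp: L2_continuous_def)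
 assume X: "!!j. 0 <= X j" "X \<longlonglongrightarrow> t"
 have "((%u. L2_sq (%x. \<nu> u x - \<nu> t x)) \<longlongrightarrow> L2_sq (%x. \<nu> t x - \<nu> t x)) (at t within {0..})"
  using assms by (auto simp: L2_continuous_def)
 then have "continuous (at t within {0..}) (%u. L2_sq (%x. \<nu> u x - \<nu> t x))"
  by (simp add: continuous_within)
 then have "(%j. L2_sq (%x. \<nu> (X j) x - \<nu> t x)) \<longlonglongrightarrow> L2_sq (%x. \<nu> t x - \<nu> t x)"
  using X unfolding continuous_within_sequentially by (auto simp: o_def)
 then show "(%j. L2_sq (%x. \<nu> (X j) x - \<nu> t x)) \<longlonglongrightarrow> 0" by simp
qed

lemma pairing_tendsto:
 fixes \<nu> :: "real => 'a::euclidean_space => complex" and g :: "'a => real"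
 assumes L2: "L2_continuous \<nu>" and s: "!!j. 0 <= s j" "s \<longlonglongrightarrow> t" "0 <= t"
  and [measurable]: "!!j. \<psi> j \<in> borel_measurable lborel" "\<phi> \<in> borel_measurable lborel"
  and g: "!!j x. norm (\<psi> j x) <= g x" "integrable lborel (%x. (g x)^2)"
  and lim: "!!x. (%j. \<psi> j x) \<longlonglongrightarrow> \<phi> x" and [measurable]: "g \<in> borel_measurable lborel"
 shows "(%j. pairing (\<nu> (s j)) (\<psi> j)) \<longlonglongrightarrow> pairing (\<nu> t) \<phi>"
proof -
 note sq = L2_continuousD(1)[OF L2]
 have \<psi>: "square_integrable (\<psi> j)" for j by (rule square_integrable_bound) (use g in auto)
 have gsq: "square_integrable (%x. complex_of_real (g x))"
  using g(2) by (simp add: square_integrable_def)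
 have g0: "0 <= g x" for x using g(1)[of 0 x] norm_ge_zero order_trans by blast
 have [measurable]: "\<nu> t \<in> borel_measurable lborel" using sq[OF s(3)] by (simp add: square_integrable_def)
 have 1: "(%j. pairing (\<nu> t) (\<psi> j)) \<longlonglongrightarrow> pairing (\<nu> t) \<phi>"
  unfolding pairing_def
 proof (rule integral_dominated_convergence[where w = "%x. norm (\<nu> t x * complex_of_real (g x))"])
  show "integrable lborel (%x. norm (\<nu> t x * complex_of_real (g x)))"
   by (rule integrable_norm[OF pairing_bound(1)[OF sq[OF s(3)] gsq zero_less_one]])
  show "AE x in lborel. (%j. \<nu> t x * \<psi> j x) \<longlonglongrightarrow> \<nu> t x * \<phi> x"
   by (intro AE_I2 tendsto_intros lim)
  show "AE x in lborel. norm (\<nu> t x * \<psi> j x) <= norm (\<nu> t x * complex_of_real (g x))" for j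
   using g(1) g0 by (intro AE_I2) (auto simp: norm_mult intro!: mult_left_mono)
 qed measurable
 define G where "G = (LINT x|lborel. (g x)^2)"
 have G: "L2_sq (\<psi> j) <= G" "0 <= G" for j
  using \<psi>[of j] g g0 unfolding G_def square_integrable_def
  by (auto intro!: integral_mono power_mono)
 have 2: "(%j. pairing (%x. \<nu> (s j) x - \<nu> t x) (\<psi> j)) \<longlonglongrightarrow> 0"
 proof (rule LIMSEQ_I)
  fix e :: real assume "e > 0"
  define l where "l = (G + 1) / e"
  have l: "l > 0" using G(2) \<open>e > 0\<close> by (simp add: l_def)
  have "(%j. l * L2_sq (%x. \<nu> (s j) x - \<nu> t x)) \<longlonglongrightarrow> l * 0"
   by (intro tendsto_intros L2_continuousD(2)[OF L2]) (use s in auto)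
  then have "eventually (%j. l * L2_sq (%x. \<nu> (s j) x - \<nu> t x) < e) sequentially"
   using \<open>e > 0\<close> by (auto dest: order_tendstoD)
  then obtain N where N: "!!j. j \<ge> N ==> l * L2_sq (%x. \<nu> (s j) x - \<nu> t x) < e"
   by (auto simp: eventually_sequentially)
  have "norm (pairing (%x. \<nu> (s j) x - \<nu> t x) (\<psi> j) - 0) < e" if "j \<ge> N" for j
  proof -
   have "norm (pairing (%x. \<nu> (s j) x - \<nu> t x) (\<psi> j)) <=
     (l * L2_sq (%x. \<nu> (s j) x - \<nu> t x) + L2_sq (\<psi> j) / l) / 2"
    by (rule pairing_bound(2)[OF square_integrable_diff(1)[OF sq[OF s(1)] sq[OF s(3)]] \<psi> l])
   moreover have "L2_sq (\<psi> j) / l <= G / l" using G l by (simp add: divide_right_mono)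
   moreover have "G / l <= e" using G(2) \<open>e > 0\<close> by (simp add: l_def field_simps)
   ultimately show ?thesis using N[OF that] by simp
  qed
  then show "\<exists>N. \<forall>j\<ge>N. norm (pairing (%x. \<nu> (s j) x - \<nu> t x) (\<psi> j) - 0) < e" by blast
 qed
 have "pairing (\<nu> (s j)) (\<psi> j) = pairing (%x. \<nu> (s j) x - \<nu> t x) (\<psi> j) + pairing (\<nu> t) (\<psi> j)" for j
  unfolding pairing_def left_diff_distrib
  using pairing_bound(1)[OF sq[OF s(1)] \<psi> zero_less_one] pairing_bound(1)[OF sq[OF s(3)] \<psi> zero_less_one]
  by (subst Bochner_Integration.integral_diff) auto
 then show ?thesis using tendsto_add[OF 2 1] by simp
qed

lemma L2_bounded_on_Icc:
 assumes "L2_continuous \<nu>"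
 obtains N where "N > 0" "!!u. u \<in> {0..t} ==> L2_sq (\<nu> u) <= N"
proof -
 have "\<exists>N::nat. \<forall>u\<in>{0..t}. L2_sq (\<nu> u) <= N"
 proof (rule ccontr)
  assume "\<not> ?thesis"
  then have "\<forall>N::nat. \<exists>u\<in>{0..t}. L2_sq (\<nu> u) > N" by (auto simp: not_le)
  then obtain X where X: "!!N::nat. X N \<in> {0..t}" "!!N. L2_sq (\<nu> (X N)) > real N" by metis
  have "seq_compact {0..t}" by (simp add: compact_imp_seq_compact)
  then obtain l r where l: "l \<in> {0..t}" "strict_mono r" "(X \<circ> r) \<longlonglongrightarrow> l"
   using X(1) unfolding seq_compact_def by blast
  have "(%j. 2 * L2_sq (%x. \<nu> ((X \<circ> r) j) x - \<nu> l x) + 2 * L2_sq (\<nu> l)) \<longlonglongrightarrow> 2 * 0 + 2 * L2_sq (\<nu> l)"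
   by (intro tendsto_intros L2_continuousD(2)[OF assms]) (use X l in \<open>auto simp: o_def\<close>)
  then have "eventually (%j. 2 * L2_sq (%x. \<nu> ((X \<circ> r) j) x - \<nu> l x) + 2 * L2_sq (\<nu> l) < 2 * L2_sq (\<nu> l) + 1) sequentially"
   by (rule order_tendstoD) simp
  moreover have "eventually (%j. real j > 2 * L2_sq (\<nu> l) + 1) sequentially"
   using filterlim_real_sequentially by (simp add: filterlim_at_top_dense)
  ultimately have "eventually (%j. False) sequentially"
  proof eventually_elim
   case (elim j)
   have "L2_sq (\<nu> (X (r j))) <= 2 * L2_sq (%x. \<nu> (X (r j)) x - \<nu> l x) + 2 * L2_sq (\<nu> l)"
    by (rule square_integrable_diff(2)) (use X(1)[of "r j"] l in \<open>auto intro!: L2_continuousD(1)[OF assms]\<close>)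
   moreover have "real j <= real (r j)" using seq_suble[OF l(2)] by simp
   ultimately show False using elim X(2)[of "r j"] by simp
  qed
  then show False by simp
 qed
 then obtain N :: nat where "\<forall>u\<in>{0..t}. L2_sq (\<nu> u) <= N" by auto
 then show ?thesis by (intro that[of "real N + 1"]) (auto intro: order_trans[where y = "real N"])
qed

lemma pairing_continuous_on:
 fixes \<nu> :: "real => 'a::euclidean_space => complex" and g :: "'a => real"
 assumes L2: "L2_continuous \<nu>"
  and m: "!!u. u \<in> {0..t} ==> \<psi> u \<in> borel_measurable lborel"
  and g: "!!u x. u \<in> {0..t} ==> norm (\<psi> u x) <= g x" "integrable lborel (%x. (g x)^2)" "g \<in> borel_measurable lborel"
  and c: "!!x. continuous_on {0..t} (%u. \<psi> u x)"
 shows "continuous_on {0..t} (%u. pairing (\<nu> u) (\<psi> u))"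
 unfolding continuous_on_sequentially
proof (intro allI ballI impI)
 fix X u assume u: "u \<in> {0..t}" and X: "(\<forall>n. X n \<in> {0..t}) \<and> X \<longlonglongrightarrow> u"
 have "(%j. pairing (\<nu> (X j)) (\<psi> (X j))) \<longlonglongrightarrow> pairing (\<nu> u) (\<psi> u)"
 proof (rule pairing_tendsto[OF L2, where g = g])
  show "(%j. \<psi> (X j) x) \<longlonglongrightarrow> \<psi> u x" for x
   using c[of x] u X unfolding continuous_on_sequentially by (auto simp: o_def)
 qed (use X u m g in auto)
 then show "((%u. pairing (\<nu> u) (\<psi> u)) \<circ> X) \<longlonglongrightarrow> pairing (\<nu> u) (\<psi> u)" by (simp add: o_def)
qed

lemma norm_sq_Basis: "(norm (X::'a::euclidean_space))^2 = (\<Sum>b\<in>Basis. (X \<bullet> b)^2)"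
proof -
 have "(norm X)^2 = (\<Sum>b\<in>Basis. (X \<bullet> b) * (X \<bullet> b))"
  unfolding power2_norm_eq_inner by (rule euclidean_inner)
 then show ?thesis by (simp only: power2_eq_square)
qed

lemma integrable_gaussian_euclidean:
 assumes "c > 0"
 shows "integrable lborel (%X::'a::euclidean_space. exp (- c * (norm X)^2))"
  and "(LINT X::'a|lborel. exp (- c * (norm X)^2)) = sqrt (pi / c) ^ DIM('a)"
proof -
 have eq: "exp (- c * (norm X)^2) = (\<Prod>b\<in>Basis. exp (- c * (X \<bullet> b)^2))" for X :: 'a
  by (simp add: norm_sq_Basis sum_distrib_left flip: exp_sum sum_negf)
 show "integrable lborel (%X::'a. exp (- c * (norm X)^2))"
  unfolding eq by (rule integral_prod_Basis(1)[of "%_ x. exp (- c * x^2)"]) (rule integrable_gaussian(1)[OF assms])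
 show "(LINT X::'a|lborel. exp (- c * (norm X)^2)) = sqrt (pi / c) ^ DIM('a)"
  unfolding eq using integrable_gaussian[OF assms]
  by (subst integral_prod_Basis(2)[of "%_ x. exp (- c * x^2)"]) auto
qed

lemma integrable_gaussian_sq:
 assumes "c > 0"
 shows "integrable lborel (%X::'a::euclidean_space. (B * exp (- c * (norm X)^2))^2)"
proof -
 have "(B * exp (- c * (norm X)^2))^2 = B^2 * exp (- (2 * c) * (norm X)^2)" for X :: 'a
  by (simp add: power_mult_distrib flip: exp_double)
 then show ?thesis using integrable_gaussian_euclidean(1)[of "2 * c", where 'a = 'a] assms by simp
qed

lemma norm_prod_gaussian_le:
 fixes X :: "'a::euclidean_space" and f :: "'a => real => complex"
 assumes "!!b x. b \<in> Basis ==> norm (f b x) <= B * exp (- c * x^2)"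
 shows "norm (\<Prod>b\<in>Basis. f b (X \<bullet> b)) <= B ^ DIM('a) * exp (- c * (norm X)^2)"
proof -
 have "norm (\<Prod>b\<in>Basis. f b (X \<bullet> b)) <= (\<Prod>b\<in>Basis. B * exp (- c * (X \<bullet> b)^2))"
  unfolding prod_norm[symmetric] by (intro prod_mono) (use assms in auto)
 also have "\<dots> = B ^ DIM('a) * exp (- c * (norm X)^2)"
  by (simp add: prod.distrib norm_sq_Basis sum_distrib_left flip: exp_sum sum_negf)
 finally show ?thesis .
qed

lemma norm_prod_gaussian_le':
 fixes X :: "'a::euclidean_space" and f :: "'a => real => complex"
 assumes "!!b x. b \<in> Basis ==> norm (f b x) <= B * exp (- c * x^2)" "b \<in> Basis"
  and "norm z <= B * exp (- c * (X \<bullet> b)^2)"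
 shows "norm (z * (\<Prod>b'\<in>Basis - {b}. f b' (X \<bullet> b'))) <= B ^ DIM('a) * exp (- c * (norm X)^2)"
proof -
 have "norm (z * (\<Prod>b'\<in>Basis - {b}. f b' (X \<bullet> b'))) <=
   (B * exp (- c * (X \<bullet> b)^2)) * (\<Prod>b\<in>Basis - {b}. B * exp (- c * (X \<bullet> b)^2))"
  unfolding norm_mult prod_norm[symmetric]
  by (intro mult_mono prod_mono prod_nonneg) (use assms in \<open>auto intro: order_trans[OF norm_ge_zero]\<close>)
 also have "\<dots> = (\<Prod>b\<in>Basis. B * exp (- c * (X \<bullet> b)^2))"
  using prod.remove[OF finite_Basis assms(2), of "%b. B * exp (- c * (X \<bullet> b)^2)"] by simp
 also have "\<dots> = B ^ DIM('a) * exp (- c * (norm X)^2)"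
  by (simp add: prod.distrib norm_sq_Basis sum_distrib_left flip: exp_sum sum_negf)
 finally show ?thesis .
qed

section \<open>Weak evolutions\<close>

text \<open>A twice differentiable compactly supported factor together with its two derivatives.  Test
 functions that are products of such factors, one for each coordinate, are enough below.\<close>

definition C2_compact :: "(real => complex) => (real => complex) => (real => complex) => bool" where
 "C2_compact f f1 f2 \<longleftrightarrow>
  (\<forall>x. (f has_vector_derivative f1 x) (at x)) \<and> (\<forall>x. (f1 has_vector_derivative f2 x) (at x)) \<and>
  continuous_on UNIV f2 \<and> (\<exists>r. \<forall>x. f x ~= 0 \<longrightarrow> \<bar>x\<bar> <= r)"

lemma DERIV_max_power:
 "((%u::real. (max 0 u) ^ Suc (Suc n)) has_real_derivative real (Suc (Suc n)) * (max 0 u) ^ Suc n) (at u)"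
proof -
 consider "u > 0" | "u < 0" | "u = 0" by linarith
 then show ?thesis
 proof cases
  case 1
  have "((%u::real. u ^ Suc (Suc n)) has_real_derivative real (Suc (Suc n)) * u ^ Suc n) (at u)"
   using DERIV_pow[of "Suc (Suc n)" u] by simp
  then have "((%u::real. (max 0 u) ^ Suc (Suc n)) has_real_derivative real (Suc (Suc n)) * u ^ Suc n) (at u)"
   by (rule has_field_derivative_transform_within_open[of _ _ _ "{0<..}"]) (use 1 in auto)
  with 1 show ?thesis by simp
 next
  case 2
  have "((%u::real. 0) has_real_derivative 0) (at u)" by simp
  then have "((%u::real. (max 0 u) ^ Suc (Suc n)) has_real_derivative 0) (at u)"
   by (rule has_field_derivative_transform_within_open[of _ _ _ "{..<0}"]) (use 2 in auto)
  with 2 show ?thesis by simp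
 next
  case 3
  have "(%h. ((max 0 (0 + h)) ^ Suc (Suc n) - (max 0 0) ^ Suc (Suc n)) / h) \<midarrow>0\<rightarrow> (0::real)"
  proof (rule Lim_null_comparison[where g = "%h. \<bar>h\<bar> ^ Suc n"])
   show "\<forall>\<^sub>F h::real in at 0. norm (((max 0 (0 + h)) ^ Suc (Suc n) - (max 0 0) ^ Suc (Suc n)) / h) <= \<bar>h\<bar> ^ Suc n"
    by (intro always_eventually allI) (auto simp: max_def abs_mult power_abs intro: mult_nonpos_nonneg)
   have "(%h::real. \<bar>h\<bar> ^ Suc n) \<midarrow>0\<rightarrow> \<bar>0\<bar> ^ Suc n" by (intro tendsto_intros)
   then show "(%h::real. \<bar>h\<bar> ^ Suc n) \<midarrow>0\<rightarrow> 0" by simp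
  qed
  then show ?thesis using 3 by (simp add: DERIV_def)
 qed
qed

text \<open>A cutoff that is a polynomial inside the interval; the cube makes it twice continuously
 differentiable at the end points.\<close>

definition bump :: "real => real" where "bump y = (max 0 (1 - y^2)) ^ 3"
definition bump1 :: "real => real" where "bump1 y = - 6 * y * (max 0 (1 - y^2))^2"
definition bump2 :: "real => real" where
 "bump2 y = 24 * y^2 * max 0 (1 - y^2) - 6 * (max 0 (1 - y^2))^2"

lemma bump_derivs:
 "(bump has_real_derivative bump1 y) (at y)" "(bump1 has_real_derivative bump2 y) (at y)"
proof -
 have q: "((%y::real. 1 - y^2) has_real_derivative - 2 * y) (at y)"
  by (auto intro!: derivative_eq_intros)
 have d3: "((%y::real. (max 0 (1 - y^2)) ^ 3) has_real_derivative 3 * (max 0 (1 - y^2))^2 * (- 2 * y)) (at y)"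
  using DERIV_chain2[OF DERIV_max_power[of 1] q] by (simp add: numeral_eq_Suc)
 have d2: "((%y::real. (max 0 (1 - y^2))^2) has_real_derivative 2 * max 0 (1 - y^2) * (- 2 * y)) (at y)"
  using DERIV_chain2[OF DERIV_max_power[of 0] q] by (simp add: numeral_eq_Suc)
 show "(bump has_real_derivative bump1 y) (at y)"
  using d3 by (simp add: bump_def[abs_def] bump1_def mult_ac)
 have "((%y. (- 6 * y) * (max 0 (1 - y^2))^2) has_real_derivative
   - 6 * (max 0 (1 - y^2))^2 + (2 * max 0 (1 - y^2) * (- 2 * y)) * (- 6 * y)) (at y)"
  by (rule DERIV_mult[OF _ d2]) (auto intro!: derivative_eq_intros)
 then show "(bump1 has_real_derivative bump2 y) (at y)"
  by (simp add: bump1_def[abs_def] bump2_def power2_eq_square algebra_simps)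
qed

lemma bump_bounds: "\<bar>bump y\<bar> <= 1" "\<bar>bump1 y\<bar> <= 6" "\<bar>bump2 y\<bar> <= 30"
proof -
 define m where "m = max 0 (1 - y^2)"
 have m: "0 <= m" "m <= 1" by (auto simp: m_def)
 have m2: "0 <= m^2" "m^2 <= 1" using m by (auto simp: power_le_one)
 show "\<bar>bump y\<bar> <= 1" using m by (simp add: bump_def power_le_one flip: m_def)
 show "\<bar>bump1 y\<bar> <= 6"
 proof (cases "\<bar>y\<bar> <= 1")
  case True
  have "\<bar>y\<bar> * m^2 <= 1 * 1" using True m2 by (intro mult_mono) auto
  then show ?thesis by (simp add: bump1_def abs_mult flip: m_def)
 next
  case False
  then have "y^2 \<ge> 1" using abs_square_less_1[of y] by linarith
  then show ?thesis by (simp add: bump1_def)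
 qed
 show "\<bar>bump2 y\<bar> <= 30"
 proof (cases "\<bar>y\<bar> <= 1")
  case True
  then have "y^2 <= 1" by (simp add: abs_square_le_1)
  then have "y^2 * m <= 1 * 1" using m by (intro mult_mono) auto
  moreover have "0 <= y^2 * m" using m by simp
  moreover have "bump2 y = 24 * (y^2 * m) - 6 * m^2" by (simp add: bump2_def m_def)
  ultimately show ?thesis using m2 unfolding abs_le_iff by linarith
 next
  case False
  then have "y^2 \<ge> 1" using abs_square_less_1[of y] by linarith
  then show ?thesis by (simp add: bump2_def)
 qed
qed

lemma bump_0 [simp]: "bump 0 = 1" and bump_eq_0: "1 <= \<bar>y\<bar> ==> bump y = 0"
proof -
 show "bump 0 = 1" by (simp add: bump_def)
 assume "1 <= \<bar>y\<bar>"
 then have "1 <= y^2" by (metis abs_ge_zero one_le_power power2_abs)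
 then show "bump y = 0" by (simp add: bump_def)
qed

lemma continuous_bump [continuous_intros]:
 "continuous_on S f ==> continuous_on S (%x. bump (f x))"
 "continuous_on S f ==> continuous_on S (%x. bump1 (f x))"
 "continuous_on S f ==> continuous_on S (%x. bump2 (f x))"
 unfolding bump_def bump1_def bump2_def by (intro continuous_intros; assumption)+

definition cut :: "real => (real => complex) => real => complex" where
 "cut R f x = of_real (bump (x / R)) * f x"

definition cut2 :: "real => (real => complex) => (real => complex) => (real => complex) => real => complex" where
 "cut2 R f f1 f2 x = of_real (bump2 (x / R) / R^2) * f x + 2 * of_real (bump1 (x / R) / R) * f1 x
   + of_real (bump (x / R)) * f2 x"

lemma C2_compact_cut:
 assumes "R > 0" "!!x. (f has_vector_derivative f1 x) (at x)" "!!x. (f1 has_vector_derivative f2 x) (at x)"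
  and "continuous_on UNIV f2"
 shows "C2_compact (cut R f) (%x. of_real (bump1 (x / R) / R) * f x + of_real (bump (x / R)) * f1 x) (cut2 R f f1 f2)"
proof -
 have b: "((%x. of_real (bump (x / R)) :: complex) has_vector_derivative of_real (bump1 (x / R) / R)) (at x)" for x
  using has_vector_derivative_of_real[OF DERIV_chain2[OF bump_derivs(1) DERIV_cdivide[OF DERIV_ident, of R]], where 'a = complex]
  by (simp add: o_def)
 have b1: "((%x. of_real (bump1 (x / R) / R) :: complex) has_vector_derivative of_real (bump2 (x / R) / R^2)) (at x)" for x
  using has_vector_derivative_of_real[OF DERIV_cdivide[OF DERIV_chain2[OF bump_derivs(2) DERIV_cdivide[OF DERIV_ident, of R]], of R], where 'a = complex]
  by (simp add: o_def power2_eq_square)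
 have f: "continuous_on UNIV f" "continuous_on UNIV f1"
  using assms(2,3) by (meson continuous_at_imp_continuous_on has_vector_derivative_continuous)+
 show ?thesis unfolding C2_compact_def
 proof (intro conjI allI)
  fix x
  show "(cut R f has_vector_derivative of_real (bump1 (x / R) / R) * f x + of_real (bump (x / R)) * f1 x) (at x)"
   unfolding cut_def[abs_def]
   by (rule has_vector_derivative_eq_rhs[OF has_vector_derivative_mult[OF b assms(2)]]) simp
  show "((%x. of_real (bump1 (x / R) / R) * f x + of_real (bump (x / R)) * f1 x) has_vector_derivative cut2 R f f1 f2 x) (at x)"
   unfolding cut2_def
   by (rule has_vector_derivative_eq_rhs[OF has_vector_derivative_add[OF
      has_vector_derivative_mult[OF b1 assms(2)] has_vector_derivative_mult[OF b assms(3)]]])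
    (simp add: algebra_simps)
 next
  show "continuous_on UNIV (cut2 R f f1 f2)"
   unfolding cut2_def[abs_def] by (intro continuous_intros f assms(4)) (use assms(1) in auto)
  show "\<exists>r. \<forall>x. cut R f x ~= 0 \<longrightarrow> \<bar>x\<bar> <= r"
  proof (intro exI[of _ R] allI impI)
   fix x assume "cut R f x ~= 0"
   then have "\<bar>x / R\<bar> < 1" using bump_eq_0[of "x / R"] by (force simp: cut_def not_le)
   then show "\<bar>x\<bar> <= R" using assms(1) by (simp add: abs_div)
  qed
 qed
qed

lemma norm_cut_le:
 assumes "norm (f x) <= B * exp (- c * x^2)"
 shows "norm (cut R f x) <= B * exp (- c * x^2)"
 using mult_mono[OF bump_bounds(1)[of "x / R"] assms] by (simp add: cut_def norm_mult)

lemma norm_cut2_le: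
 assumes "R \<ge> 1" "norm (f x) <= M" "norm (f1 x) <= M" "norm (f2 x) <= M"
 shows "norm (cut2 R f f1 f2 x) <= 43 * M"
proof -
 have "\<bar>bump2 (x / R)\<bar> / R^2 <= 30 / 1"
  using assms(1) bump_bounds(3)[of "x / R"] by (intro frac_le) (auto simp: one_le_power)
 then have 1: "norm (complex_of_real (bump2 (x / R) / R^2) * f x) <= 30 * M"
  unfolding norm_mult norm_of_real using assms by (intro mult_mono) (auto simp: abs_divide)
 have "\<bar>bump1 (x / R)\<bar> / R <= 6 / 1"
  using assms(1) bump_bounds(2)[of "x / R"] by (intro frac_le) auto
 then have 2: "norm (2 * complex_of_real (bump1 (x / R) / R) * f1 x) <= (2 * 6) * M"
  unfolding norm_mult norm_of_real using assms by (intro mult_mono) (auto simp: abs_divide)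
 have 3: "norm (complex_of_real (bump (x / R)) * f2 x) <= 1 * M"
  unfolding norm_mult using assms bump_bounds(1)[of "x / R"] by (intro mult_mono) auto
 show ?thesis unfolding cut2_def
  using norm_triangle_le[OF add_mono[OF norm_triangle_le[OF add_mono[OF 1 2]] 3]] by simp
qed

lemma cut_tendsto:
 "(%j. cut (real (Suc j)) f x) \<longlonglongrightarrow> f x"
 "(%j. cut2 (real (Suc j)) f f1 f2 x) \<longlonglongrightarrow> f2 x"
proof -
 have i: "(%j. 1 / real (Suc j)) \<longlonglongrightarrow> 0" using LIMSEQ_inverse_real_of_nat by (simp add: inverse_eq_divide)
 then have y: "(%j. x / real (Suc j)) \<longlonglongrightarrow> 0"
  using tendsto_mult[OF tendsto_const[of x] i] by simp
 have b: "(%j. bump (x / real (Suc j))) \<longlonglongrightarrow> bump 0" "(%j. bump1 (x / real (Suc j))) \<longlonglongrightarrow> bump1 0"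
   "(%j. bump2 (x / real (Suc j))) \<longlonglongrightarrow> bump2 0"
  using continuous_bump[of UNIV "%x. x"] isCont_tendsto_compose[of 0 bump, OF _ y]
   isCont_tendsto_compose[of 0 bump1, OF _ y] isCont_tendsto_compose[of 0 bump2, OF _ y]
  by (simp_all add: continuous_on_eq_continuous_at del: bump_0 of_nat_Suc)
 have "(%j. cut (real (Suc j)) f x) \<longlonglongrightarrow> of_real (bump 0) * f x"
  unfolding cut_def by (intro tendsto_intros b)
 then show "(%j. cut (real (Suc j)) f x) \<longlonglongrightarrow> f x" by simp
 have "(%j. of_real (bump2 (x / real (Suc j)) * (1 / real (Suc j)) * (1 / real (Suc j))) * f x
   + 2 * of_real (bump1 (x / real (Suc j)) * (1 / real (Suc j))) * f1 x
   + of_real (bump (x / real (Suc j))) * f2 x) \<longlonglongrightarrow>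
   of_real (bump2 0 * 0 * 0) * f x + 2 * of_real (bump1 0 * 0) * f1 x + of_real (bump 0) * f2 x"
  by (intro tendsto_intros b i)
 then show "(%j. cut2 (real (Suc j)) f f1 f2 x) \<longlonglongrightarrow> f2 x"
  by (simp add: cut2_def power2_eq_square)
qed

lemma has_vector_derivative_prod:
 fixes f :: "'i => real => complex"
 assumes "!!i. i \<in> I ==> (f i has_vector_derivative f' i) (at x within S)"
 shows "((%x. \<Prod>i\<in>I. f i x) has_vector_derivative (\<Sum>i\<in>I. f' i * (\<Prod>j\<in>I - {i}. f j x))) (at x within S)"
proof -
 have "((%x. \<Prod>i\<in>I. f i x) has_derivative (%y. \<Sum>i\<in>I. (y *\<^sub>R f' i) * (\<Prod>j\<in>I - {i}. f j x))) (at x within S)"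
  by (rule has_derivative_prod) (use assms in \<open>auto simp: has_vector_derivative_def\<close>)
 then show ?thesis by (simp add: has_vector_derivative_def scaleR_sum_right)
qed

lemma tendsto_set_integral_continuous:
 fixes f :: "nat => real => complex" and g :: "real => complex"
 assumes c: "!!j. continuous_on {0..t} (f j)" "continuous_on {0..t} g"
  and B: "!!j u. u \<in> {0..t} ==> norm (f j u) <= B"
  and lim: "!!u. u \<in> {0..t} ==> (%j. f j u) \<longlonglongrightarrow> g u"
 shows "(%j. LINT u:{0..t}|lborel. f j u) \<longlonglongrightarrow> (LINT u:{0..t}|lborel. g u)"
 unfolding set_lebesgue_integral_def
proof (rule integral_dominated_convergence[where w = "%u. indicator {0..t} u *\<^sub>R B"])
 show "integrable lborel (%u. indicator {0..t} u *\<^sub>R B)"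
  by (rule integrableI_bounded_set_indicator[where B="\<bar>B\<bar>"]) (auto simp: emeasure_lborel_Icc_eq)
 show "AE u in lborel. (%j. indicator {0..t} u *\<^sub>R f j u) \<longlonglongrightarrow> indicator {0..t} u *\<^sub>R g u"
  using lim by (auto intro!: AE_I2 simp: indicator_def)
 show "(%u. indicator {0..t} u *\<^sub>R g u) \<in> borel_measurable lborel"
  using borel_measurable_continuous_on_indicator[OF _ c(2)] by simp
 show "(%u. indicator {0..t} u *\<^sub>R f j u) \<in> borel_measurable lborel" for j
  using borel_measurable_continuous_on_indicator[OF _ c(1)] by simp
qed (use B in \<open>auto simp: indicator_def\<close>)

context kicks
begin

definition potential :: "'a => complex" where
 "potential X = (LINT k|K. s k * cis (A k \<bullet> X))"

lemma norm_potential_le: "norm (potential X) <= rate"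
 unfolding potential_def using norm_scatter_le[of "%k. cis (A k \<bullet> X)" 1] by simp

lemma borel_measurable_potential [measurable]: "potential \<in> borel_measurable borel"
 unfolding potential_def by measurable

end

definition basis_prod :: "('a::euclidean_space => real => complex) => 'a => complex" where
 "basis_prod f X = (\<Prod>b\<in>Basis. f b (X \<bullet> b))"

definition basis_deriv :: "('a::euclidean_space => real => complex) => ('a => real => complex) => 'a => complex" where
 "basis_deriv f d X = (\<Sum>b\<in>Basis. d b (X \<bullet> b) * (\<Prod>b'\<in>Basis - {b}. f b' (X \<bullet> b')))"

lemma borel_measurable_basis_prod:
 assumes "!!b. b \<in> Basis ==> f b \<in> borel_measurable borel"
 shows "basis_prod f \<in> borel_measurable borel"
 unfolding basis_prod_def[abs_def] by (rule borel_measurable_prod_Basis) (rule assms)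

lemma borel_measurable_basis_deriv:
 fixes f d :: "'a::euclidean_space => real => complex"
 assumes "!!b. b \<in> Basis ==> f b \<in> borel_measurable borel" "!!b. b \<in> Basis ==> d b \<in> borel_measurable borel"
 shows "basis_deriv f d \<in> borel_measurable borel"
proof -
 have m: "(%X::'a. h (X \<bullet> b)) \<in> borel_measurable borel" if "h \<in> borel_measurable borel" for h :: "real => complex" and b
  using that by (rule measurable_compose[rotated]) simp
 show ?thesis
  unfolding basis_deriv_def[abs_def]
  by (intro borel_measurable_sum borel_measurable_times borel_measurable_prod m assms) auto
qed

text \<open>The weak form of \<open>d\<nu>/dt = i (\<Sum>b. \<theta> b * d^2\<nu>/db^2) + potential * \<nu>\<close>, in which each coordinate
 direction has its own real dispersion constant.\<close>

locale weak_evolution = kicks K A s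
 for K :: "'k measure" and A :: "'k => 'a::euclidean_space" and s :: "'k => real" +
 fixes \<theta> :: "'a => real" and \<nu> :: "real => 'a => complex"
 assumes L2: "L2_continuous \<nu>"
  and weak: "!!f f1 f2 t. (!!b. b \<in> Basis ==> C2_compact (f b) (f1 b) (f2 b)) ==> 0 <= t ==>
   ((%t. pairing (\<nu> t) (basis_prod f)) has_vector_derivative
    pairing (\<nu> t) (%X. basis_deriv f (%b x. \<i> * \<theta> b * f2 b x) X + potential X * basis_prod f X))
   (at t within {0..})"
begin

text \<open>Testing against a solution of the adjoint free equation leaves only the potential term.  The
 solutions have Gaussian decay but no compact support: they are cut off at radius \<open>R\<close>, and the
 weak equation is integrated before \<open>R\<close> tends to infinity.\<close>

lemma pairing_duhamel:
 fixes g g1 g2 :: "'a => real => real => complex"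
 assumes t: "0 <= t"
  and x1: "!!b u x. b \<in> Basis ==> u \<in> {0..t} ==> (g b u has_vector_derivative g1 b u x) (at x)"
  and x2: "!!b u x. b \<in> Basis ==> u \<in> {0..t} ==> (g1 b u has_vector_derivative g2 b u x) (at x)"
  and c2: "!!b u. b \<in> Basis ==> u \<in> {0..t} ==> continuous_on UNIV (g2 b u)"
  and tm: "!!b u x. b \<in> Basis ==> u \<in> {0..t} ==>
   ((%u. g b u x) has_vector_derivative - \<i> * \<theta> b * g2 b u x) (at u within {0..t})"
  and ct: "!!b x. b \<in> Basis ==> continuous_on {0..t} (%u. g1 b u x)"
    "!!b x. b \<in> Basis ==> continuous_on {0..t} (%u. g2 b u x)"
  and B: "c > 0" "!!b u x. b \<in> Basis ==> u \<in> {0..t} ==> norm (g b u x) <= B * exp (- c * x^2)"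
    "!!b u x. b \<in> Basis ==> u \<in> {0..t} ==> norm (g1 b u x) <= B * exp (- c * x^2)"
    "!!b u x. b \<in> Basis ==> u \<in> {0..t} ==> norm (g2 b u x) <= B * exp (- c * x^2)"
 shows "pairing (\<nu> t) (basis_prod (%b. g b t)) - pairing (\<nu> 0) (basis_prod (%b. g b 0)) =
   (LINT u:{0..t}|lborel. pairing (\<nu> u) (%X. potential X * basis_prod (%b. g b u) X))"
  and "continuous_on {0..t} (%u. pairing (\<nu> u) (%X. potential X * basis_prod (%b. g b u) X))"
proof -
 define R where "R j = real (Suc j)" for j
 have R: "R j \<ge> 1" "R j > 0" "R j ~= 0" for j by (auto simp: R_def)
 define \<Theta> where "\<Theta> = 1 + (\<Sum>b\<in>Basis. \<bar>\<theta> b\<bar>)"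
 have \<Theta>: "\<bar>\<theta> b\<bar> <= \<Theta>" "1 <= \<Theta>" if "b \<in> Basis" for b
 proof -
  have "\<bar>\<theta> b\<bar> <= (\<Sum>b\<in>Basis. \<bar>\<theta> b\<bar>)" by (rule member_le_sum[OF that]) auto
  then show "\<bar>\<theta> b\<bar> <= \<Theta>" "1 <= \<Theta>" by (simp_all add: \<Theta>_def sum_nonneg)
 qed
 have \<Theta>1: "1 <= \<Theta>" by (simp add: \<Theta>_def sum_nonneg)
 have B0: "0 <= B"
 proof -
  have "norm (g (SOME b. b \<in> Basis) 0 0) <= B * exp (- c * 0^2)"
   by (rule B(2)[OF SOME_Basis]) (use t in auto)
  from order_trans[OF norm_ge_zero this] show ?thesis by simp
 qed
 define M where "M = 44 * \<Theta> * B"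
 have M: "B <= M" "0 <= M"
 proof -
  have "1 * B <= (44 * \<Theta>) * B" by (rule mult_right_mono) (use \<Theta>1 B0 in auto)
  then show "B <= M" by (simp only: M_def mult_1)
  show "0 <= M" using \<Theta>1 B0 by (simp add: M_def)
 qed
 define E :: "'a => real" where "E X = M ^ DIM('a) * exp (- c * (norm X)^2)" for X
 have E0: "0 <= E X" for X using M by (simp add: E_def)
 have Em [measurable]: "E \<in> borel_measurable borel" unfolding E_def[abs_def] by measurable
 define D where "D = real (DIM('a))"
 define dom where "dom X = (2 * D + rate) * E X" for X
 have dsq: "integrable lborel (%X. (dom X)^2)"
  using integrable_gaussian_sq[OF B(1), of "(2 * D + rate) * M ^ DIM('a)", where 'a = 'a]
  by (simp add: dom_def E_def mult_ac)
 have dm [measurable]: "dom \<in> borel_measurable borel" unfolding dom_def[abs_def] by measurable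
 have D: "1 <= D" by (simp add: D_def DIM_positive Suc_leI)
 have E_dom: "E X <= dom X" "D * E X <= dom X" "rate * E X <= dom X"
   "D * E X + rate * E X <= dom X" "D * E X + rate * E X + D * E X <= dom X" for X
 proof -
  have "0 <= D * E X" "E X <= D * E X" "0 <= rate * E X"
   using E0[of X] D mult_right_mono[of 1 D "E X"] by auto
  then show "E X <= dom X" "D * E X <= dom X" "rate * E X <= dom X"
   "D * E X + rate * E X <= dom X" "D * E X + rate * E X + D * E X <= dom X"
   using E0[of X] unfolding dom_def distrib_right by linarith+
 qed
 have c0: "continuous_on {0..t} (%u. g b u x)" if "b \<in> Basis" for b x
  using tm[OF that] by (meson continuous_on_eq_continuous_within has_vector_derivative_continuous)
 have gm: "g b u \<in> borel_measurable borel" "g1 b u \<in> borel_measurable borel" "g2 b u \<in> borel_measurable borel"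
  if "b \<in> Basis" "u \<in> {0..t}" for b u
  using x1[OF that] x2[OF that] c2[OF that]
  by (auto intro!: borel_measurable_continuous_onI continuous_at_imp_continuous_on has_vector_derivative_continuous)
 define p where "p j u = basis_prod (%b. cut (R j) (g b u))" for j u
 define d where "d j u = basis_deriv (%b. cut (R j) (g b u)) (%b x. - \<i> * \<theta> b * cut (R j) (g2 b u) x)" for j u
 define h where "h j u = basis_deriv (%b. cut (R j) (g b u))
   (%b x. \<i> * \<theta> b * cut2 (R j) (g b u) (g1 b u) (g2 b u) x)" for j u
 have bm: "(%x. complex_of_real (bump (x / R j))) \<in> borel_measurable borel"
   "(%x. complex_of_real (bump1 (x / R j) / R j)) \<in> borel_measurable borel"
   "(%x. complex_of_real (bump2 (x / R j) / (R j)^2)) \<in> borel_measurable borel" for j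
  using R(2)[of j] by (auto intro!: borel_measurable_continuous_onI continuous_intros)
 have cutm: "cut (R j) f \<in> borel_measurable borel" if "f \<in> borel_measurable borel" for f j
  unfolding cut_def[abs_def] by (intro borel_measurable_times bm that)
 have cut2m: "cut2 (R j) (g b u) (g1 b u) (g2 b u) \<in> borel_measurable borel" if "b \<in> Basis" "u \<in> {0..t}" for b j u
  unfolding cut2_def[abs_def]
  by (intro borel_measurable_times borel_measurable_add borel_measurable_const bm gm that)
 have pm: "p j u \<in> borel_measurable borel" if "u \<in> {0..t}" for j u
  unfolding p_def using that by (intro borel_measurable_basis_prod cutm gm)
 have dmm: "d j u \<in> borel_measurable borel" if "u \<in> {0..t}" for j u
  unfolding d_def using that by (intro borel_measurable_basis_deriv borel_measurable_times borel_measurable_const cutm gm)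
 have hm: "h j u \<in> borel_measurable borel" if "u \<in> {0..t}" for j u
  unfolding h_def using that by (intro borel_measurable_basis_deriv borel_measurable_times borel_measurable_const cutm gm cut2m)
 have BM0: "B * exp (- c * x^2) <= M * exp (- c * x^2)" for x :: real
  by (intro mult_right_mono M) auto
 have ple: "norm (basis_prod f X) <= E X" if "!!b x. b \<in> Basis ==> norm (f b x) <= B * exp (- c * x^2)" for f X
  unfolding basis_prod_def E_def
  by (rule norm_prod_gaussian_le) (rule order_trans[OF that BM0])
 have dle: "norm (basis_deriv f q X) <= D * E X"
  if "!!b x. b \<in> Basis ==> norm (f b x) <= B * exp (- c * x^2)"
   "!!b x. b \<in> Basis ==> norm (q b x) <= M * exp (- c * x^2)" for f q X
 proof -
  have "norm (basis_deriv f q X) <= (\<Sum>b\<in>(Basis::'a set). E X)"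
   unfolding basis_deriv_def E_def
  proof (rule sum_norm_le)
   fix b :: 'a assume b: "b \<in> Basis"
   show "norm (q b (X \<bullet> b) * (\<Prod>b'\<in>Basis - {b}. f b' (X \<bullet> b'))) <= M ^ DIM('a) * exp (- c * (norm X)^2)"
    by (rule norm_prod_gaussian_le'[OF order_trans[OF that(1) BM0] b that(2)[OF b]])
  qed
  then show ?thesis by (simp add: D_def)
 qed
 have cutle: "norm (cut (R j) (g b u) x) <= B * exp (- c * x^2)" if "b \<in> Basis" "u \<in> {0..t}" for b u x j
  using B(2)[OF that] by (rule norm_cut_le)
 have p_le: "norm (p j u X) <= E X" if "u \<in> {0..t}" for j u X
  unfolding p_def using that by (intro ple cutle)
 have BM: "\<bar>\<theta> b\<bar> * (43 * (B * exp (- c * x^2))) <= M * exp (- c * x^2)" if "b \<in> Basis" for b x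
 proof -
  have "\<bar>\<theta> b\<bar> * (43 * (B * exp (- c * x^2))) <= \<Theta> * (44 * (B * exp (- c * x^2)))"
   using \<Theta>[OF that] B0 by (intro mult_mono) auto
  then show ?thesis by (simp add: M_def mult_ac)
 qed
 have d_le: "norm (d j u X) <= D * E X" if u: "u \<in> {0..t}" for j u X
  unfolding d_def
 proof (intro dle cutle u)
  fix b :: 'a and x assume b: "b \<in> Basis"
  have "norm (- \<i> * \<theta> b * cut (R j) (g2 b u) x) <= \<bar>\<theta> b\<bar> * (43 * (B * exp (- c * x^2)))"
  proof -
   have "norm (cut (R j) (g2 b u) x) <= 43 * (B * exp (- c * x^2))"
    using norm_cut_le[of "g2 b u" x B c "R j", OF B(4)[OF b u, of x]]
    by (rule order_trans) (use B0 in simp)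
   from mult_left_mono[OF this, of "\<bar>\<theta> b\<bar>"] show ?thesis by (simp add: norm_mult)
  qed
  then show "norm (- \<i> * \<theta> b * cut (R j) (g2 b u) x) <= M * exp (- c * x^2)"
   using BM[OF b] by (rule order_trans)
 qed
 have h_le: "norm (h j u X) <= D * E X" if u: "u \<in> {0..t}" for j u X
  unfolding h_def
 proof (intro dle cutle u)
  fix b :: 'a and x assume b: "b \<in> Basis"
  have "norm (\<i> * \<theta> b * cut2 (R j) (g b u) (g1 b u) (g2 b u) x) <= \<bar>\<theta> b\<bar> * (43 * (B * exp (- c * x^2)))"
   using mult_left_mono[OF norm_cut2_le[of "R j" "g b u" x "B * exp (- c * x^2)" "g1 b u" "g2 b u",
    OF R(1)[of j] B(2)[OF b u, of x] B(3)[OF b u, of x] B(4)[OF b u, of x]], of "\<bar>\<theta> b\<bar>"]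
   by (simp add: norm_mult)
  then show "norm (\<i> * \<theta> b * cut2 (R j) (g b u) (g1 b u) (g2 b u) x) <= M * exp (- c * x^2)"
   using BM[OF b] by (rule order_trans)
 qed
 have pot: "norm (potential X * z) <= rate * E X" if "norm z <= E X" for z X
  unfolding norm_mult using that norm_potential_le E0 by (intro mult_mono) auto
 have time_deriv: "((%u. p j u X) has_vector_derivative d j u X) (at u within {0..t})" if u: "u \<in> {0..t}" for j u X
  unfolding p_def d_def basis_prod_def basis_deriv_def
 proof (rule has_vector_derivative_prod)
  fix b :: 'a assume b: "b \<in> Basis"
  have "((%u. of_real (bump ((X \<bullet> b) / R j)) * g b u (X \<bullet> b)) has_vector_derivative
    of_real (bump ((X \<bullet> b) / R j)) * (- \<i> * \<theta> b * g2 b u (X \<bullet> b))) (at u within {0..t})"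
   by (intro has_vector_derivative_mult_right tm b u)
  then show "((%u. cut (R j) (g b u) (X \<bullet> b)) has_vector_derivative
    - \<i> * \<theta> b * cut (R j) (g2 b u) (X \<bullet> b)) (at u within {0..t})"
   by (simp add: cut_def mult_ac)
 qed
 define \<Phi> where "\<Phi> j u X = h j u X + potential X * p j u X + d j u X" for j u X
 have \<Phi>m: "\<Phi> j u \<in> borel_measurable borel" if "u \<in> {0..t}" for j u
  unfolding \<Phi>_def[abs_def] using that by (intro borel_measurable_add borel_measurable_times hm pm dmm borel_measurable_potential)
 have \<Phi>_le: "norm (\<Phi> j u X) <= dom X" if "u \<in> {0..t}" for j u X
  unfolding \<Phi>_def
  by (rule order_trans[OF _ E_dom(5)]) (intro norm_triangle_mono h_le pot p_le d_le that)
 have deriv: "((%u. pairing (\<nu> u) (p j u)) has_vector_derivative pairing (\<nu> u) (\<Phi> j u)) (at u within {0..t})"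
  if u: "u \<in> {0..t}" for j u
  unfolding has_vector_derivative_iff_sequentially
 proof (intro allI impI)
  fix X assume X: "(\<forall>i. X i \<in> {0..t} - {u}) \<and> X \<longlonglongrightarrow> u"
  have psq: "square_integrable (p j v)" if "v \<in> {0..t}" for v
   by (rule square_integrable_bound[OF _ dsq]) (use that pm order_trans[OF p_le E_dom(1)] in auto)
  have 1: "(%i. pairing (\<nu> (X i)) (%x. (p j (X i) x - p j u x) /\<^sub>R (X i - u))) \<longlonglongrightarrow> pairing (\<nu> u) (d j u)"
  proof (rule pairing_tendsto[OF L2, where g = dom])
   show "(%i. (p j (X i) x - p j u x) /\<^sub>R (X i - u)) \<longlonglongrightarrow> d j u x" for x
    using time_deriv[OF u, of j x] X unfolding has_vector_derivative_iff_sequentially by auto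
   show "norm ((p j (X i) x - p j u x) /\<^sub>R (X i - u)) <= dom x" for i x
    by (rule order_trans[OF norm_difference_quotient_le[of "{0..t}" "%u. p j u x" "%u. d j u x"] E_dom(2)])
     (use X u time_deriv d_le in auto)
   show "(%x. (p j (X i) x - p j u x) /\<^sub>R (X i - u)) \<in> borel_measurable lborel" for i
    using pm[of "X i" j] pm[OF u] X by auto
  qed (use X u dmm dsq in auto)
  have w: "((%v. pairing (\<nu> v) (p j u)) has_vector_derivative
    pairing (\<nu> u) (%x. h j u x + potential x * p j u x)) (at u within {0..})"
   unfolding h_def p_def
   by (rule weak) (use u in \<open>auto intro!: C2_compact_cut R x1 x2 c2\<close>)
  have 2: "(%i. (pairing (\<nu> (X i)) (p j u) - pairing (\<nu> u) (p j u)) /\<^sub>R (X i - u))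
    \<longlonglongrightarrow> pairing (\<nu> u) (%x. h j u x + potential x * p j u x)"
   by (rule w[unfolded has_vector_derivative_iff_sequentially, rule_format]) (use X in auto)
  have int: "integrable lborel (%x. \<nu> v x * p j w x)" if "v \<in> {0..t}" "w \<in> {0..t}" for v w
   using pairing_bound(1)[OF L2_continuousD(1)[OF L2] psq zero_less_one] that by simp
  have "(pairing (\<nu> (X i)) (p j (X i)) - pairing (\<nu> u) (p j u)) /\<^sub>R (X i - u) =
    pairing (\<nu> (X i)) (%x. (p j (X i) x - p j u x) /\<^sub>R (X i - u)) +
    (pairing (\<nu> (X i)) (p j u) - pairing (\<nu> u) (p j u)) /\<^sub>R (X i - u)" for i
  proof -
   have Xi: "X i \<in> {0..t}" using X by auto
   have "pairing (\<nu> (X i)) (%x. (p j (X i) x - p j u x) /\<^sub>R (X i - u)) =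
     (LINT x|lborel. (\<nu> (X i) x * p j (X i) x - \<nu> (X i) x * p j u x) /\<^sub>R (X i - u))"
    unfolding pairing_def by (simp add: right_diff_distrib)
   also have "\<dots> = (pairing (\<nu> (X i)) (p j (X i)) - pairing (\<nu> (X i)) (p j u)) /\<^sub>R (X i - u)"
    using int[OF Xi Xi] int[OF Xi u] by (simp add: pairing_def)
   finally show ?thesis by (simp add: scaleR_right_diff_distrib)
  qed
  moreover have "pairing (\<nu> u) (\<Phi> j u) = pairing (\<nu> u) (d j u) + pairing (\<nu> u) (%x. h j u x + potential x * p j u x)"
  proof -
   have i1: "integrable lborel (%x. \<nu> u x * d j u x)"
    by (rule pairing_bound(1)[OF L2_continuousD(1)[OF L2] square_integrable_bound[OF _ dsq] zero_less_one])
     (use u dmm order_trans[OF d_le E_dom(2)] in auto)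
   have "norm (h j u x + potential x * p j u x) <= dom x" for x
    by (rule order_trans[OF _ E_dom(4)]) (intro norm_triangle_mono h_le pot p_le u)
   then have i2: "integrable lborel (%x. \<nu> u x * (h j u x + potential x * p j u x))"
    by (intro pairing_bound(1)[OF L2_continuousD(1)[OF L2] square_integrable_bound[OF _ dsq] zero_less_one])
     (use u hm[of u j] pm[of u j] in auto)
   show ?thesis
    unfolding pairing_def \<Phi>_def using Bochner_Integration.integral_add[OF i1 i2]
    by (simp add: algebra_simps)
  qed
  ultimately show "(%i. (pairing (\<nu> (X i)) (p j (X i)) - pairing (\<nu> u) (p j u)) /\<^sub>R (X i - u)) \<longlonglongrightarrow> pairing (\<nu> u) (\<Phi> j u)"
   using tendsto_add[OF 1 2] by simp
 qed
 have prod_cont: "continuous_on {0..t} (%u. basis_prod (%b. f b u) X)"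
  if "!!b x. b \<in> Basis ==> continuous_on {0..t} (%u. f b u x)" for f :: "'a => real => real => complex" and X
  unfolding basis_prod_def using that by (intro continuous_on_prod) auto
 have deriv_cont: "continuous_on {0..t} (%u. basis_deriv (%b. f b u) (%b. q b u) X)"
  if "!!b x. b \<in> Basis ==> continuous_on {0..t} (%u. f b u x)"
   "!!b x. b \<in> Basis ==> continuous_on {0..t} (%u. q b u x)" for f q :: "'a => real => real => complex" and X
  unfolding basis_deriv_def using that by (intro continuous_on_sum continuous_on_mult continuous_on_prod) auto
 have \<Phi>_cont: "continuous_on {0..t} (%u. \<Phi> j u X)" for j X
  unfolding \<Phi>_def h_def p_def d_def
  by (intro continuous_on_add continuous_on_mult continuous_on_const prod_cont deriv_cont)
   (auto simp: cut_def cut2_def R intro!: continuous_intros c0 ct)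
 have int_cont: "continuous_on {0..t} (%u. pairing (\<nu> u) (\<Phi> j u))" for j
  by (rule pairing_continuous_on[OF L2, where g = dom]) (use \<Phi>m \<Phi>_le dsq \<Phi>_cont in auto)
 have FTC: "(LINT u:{0..t}|lborel. pairing (\<nu> u) (\<Phi> j u)) = pairing (\<nu> t) (p j t) - pairing (\<nu> 0) (p j 0)" for j
  unfolding set_lebesgue_integral_def by (rule integral_FTC_Icc) (use t deriv int_cont in auto)
 define P where "P u X = potential X * basis_prod (%b. g b u) X" for u X
 have Pm: "P u \<in> borel_measurable borel" if "u \<in> {0..t}" for u
  unfolding P_def[abs_def] using that by (intro borel_measurable_times borel_measurable_potential borel_measurable_basis_prod gm)
 have P_le: "norm (P u X) <= dom X" if "u \<in> {0..t}" for u X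
  unfolding P_def by (rule order_trans[OF pot[OF ple] E_dom(3)]) (use B that in auto)
 have P_cont: "continuous_on {0..t} (%u. pairing (\<nu> u) (P u))"
  by (rule pairing_continuous_on[OF L2, where g = dom])
   (use Pm P_le dsq in \<open>auto simp: P_def intro!: continuous_intros prod_cont c0\<close>)
 then show "continuous_on {0..t} (%u. pairing (\<nu> u) (%X. potential X * basis_prod (%b. g b u) X))"
  by (simp add: P_def[abs_def])
 have cut_lim: "(%j. cut (R j) f x) \<longlonglongrightarrow> f x" "(%j. cut2 (R j) f f1 f2 x) \<longlonglongrightarrow> f2 x" for f f1 f2 x
  unfolding R_def by (rule cut_tendsto)+
 have p_lim: "(%j. p j u X) \<longlonglongrightarrow> basis_prod (%b. g b u) X" for u X
  unfolding p_def basis_prod_def by (intro tendsto_prod cut_lim)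
 have \<Phi>_lim: "(%j. \<Phi> j u X) \<longlonglongrightarrow> P u X" for u X
 proof -
  have "(%j. \<Phi> j u X) \<longlonglongrightarrow> basis_deriv (%b. g b u) (%b x. \<i> * \<theta> b * g2 b u x) X
    + potential X * basis_prod (%b. g b u) X + basis_deriv (%b. g b u) (%b x. - \<i> * \<theta> b * g2 b u x) X"
   unfolding \<Phi>_def h_def d_def
   by (intro tendsto_add tendsto_mult tendsto_const p_lim)
    (unfold basis_deriv_def, (intro tendsto_sum tendsto_mult tendsto_const tendsto_prod cut_lim)+)
  moreover have "basis_deriv (%b. g b u) (%b x. - \<i> * \<theta> b * g2 b u x) X = - basis_deriv (%b. g b u) (%b x. \<i> * \<theta> b * g2 b u x) X"
   by (simp add: basis_deriv_def sum_negf)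
  ultimately show ?thesis by (simp add: P_def)
 qed
 have pair_lim: "(%j. pairing (\<nu> u) (f j)) \<longlonglongrightarrow> pairing (\<nu> u) f'"
  if "u \<in> {0..t}" "!!j. f j \<in> borel_measurable borel" "f' \<in> borel_measurable borel" "!!j X. norm (f j X) <= dom X"
   "!!X. (%j. f j X) \<longlonglongrightarrow> f' X" for u f f'
  by (rule pairing_tendsto[OF L2, where g = dom]) (use that dsq in auto)
 obtain N where N: "N > 0" "!!u. u \<in> {0..t} ==> L2_sq (\<nu> u) <= N"
  using L2_bounded_on_Icc[OF L2] by blast
 have bound: "norm (pairing (\<nu> u) (\<Phi> j u)) <= (N + (LINT X|lborel. (dom X)^2)) / 2" if u: "u \<in> {0..t}" for j u
 proof -
  have sq: "square_integrable (\<Phi> j u)" by (rule square_integrable_bound[OF _ dsq]) (use u \<Phi>m \<Phi>_le in auto)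
  have "L2_sq (\<Phi> j u) <= (LINT X|lborel. (dom X)^2)"
   using sq dsq \<Phi>_le[OF u] by (intro integral_mono) (auto simp: square_integrable_def intro!: power_mono)
  then show ?thesis
   using pairing_bound(2)[OF L2_continuousD(1)[OF L2] sq zero_less_one, of u] N(2)[OF u] u by simp
 qed
 have "(%j. LINT u:{0..t}|lborel. pairing (\<nu> u) (\<Phi> j u)) \<longlonglongrightarrow> (LINT u:{0..t}|lborel. pairing (\<nu> u) (P u))"
  by (rule tendsto_set_integral_continuous[OF int_cont P_cont bound])
   (use pair_lim \<Phi>m Pm \<Phi>_le \<Phi>_lim in auto)
 moreover have "(%j. pairing (\<nu> u) (p j u)) \<longlonglongrightarrow> pairing (\<nu> u) (basis_prod (%b. g b u))" if "u \<in> {0..t}" for u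
  by (rule pair_lim) (use that pm p_lim order_trans[OF p_le E_dom(1)] gm borel_measurable_basis_prod[of "%b. g b u"] in auto)
 ultimately have "pairing (\<nu> t) (basis_prod (%b. g b t)) - pairing (\<nu> 0) (basis_prod (%b. g b 0)) =
   (LINT u:{0..t}|lborel. pairing (\<nu> u) (P u))"
  using t unfolding FTC by (intro LIMSEQ_unique[OF tendsto_diff]) auto
 then show "pairing (\<nu> t) (basis_prod (%b. g b t)) - pairing (\<nu> 0) (basis_prod (%b. g b 0)) =
   (LINT u:{0..t}|lborel. pairing (\<nu> u) (%X. potential X * basis_prod (%b. g b u) X))"
  by (simp add: P_def[abs_def])
qed

end

section \<open>Wave packets\<close>

lemma cgauss_uniform_bound:
 assumes "\<delta> > 0" "0 <= \<eta>"
 obtains B c where "c > 0"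
  "!!a x. Re a = \<delta> ==> \<bar>Im a\<bar> <= \<eta> ==> norm (cgauss a (of_real x - bt)) <= B * exp (- c * x^2)"
  "!!a x. Re a = \<delta> ==> \<bar>Im a\<bar> <= \<eta> ==> norm (cgauss1 a (of_real x - bt)) <= B * exp (- c * x^2)"
  "!!a x. Re a = \<delta> ==> \<bar>Im a\<bar> <= \<eta> ==> norm (cgauss2 a (of_real x - bt)) <= B * exp (- c * x^2)"
proof -
 define c1 where "c1 = \<delta> / (\<delta> + \<eta>)^2"
 define m0 where "m0 = \<bar>Re bt\<bar> + \<eta> * \<bar>Im bt\<bar> / \<delta>"
 define k where "k = sqrt (2 * pi / \<delta> * exp ((Im bt)^2 / \<delta> + c1 * m0^2))"
 define c2 where "c2 = c1 / 4"
 have c1: "c1 > 0" using assms by (simp add: c1_def)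
 have c2: "c2 > 0" using c1 by (simp add: c2_def)
 have k: "k \<ge> 0" using assms by (simp add: k_def)
 have cg: "norm (cgauss a (of_real x - bt)) <= k * exp (- c2 * x^2)" if a: "Re a = \<delta>" "\<bar>Im a\<bar> <= \<eta>" for a x
 proof (rule power2_le_imp_le)
  define m where "m = Re bt + Im a * Im bt / \<delta>"
  have na: "\<delta> <= norm a" "norm a <= \<delta> + \<eta>"
   using complex_Re_le_cmod[of a] cmod_le[of a] a assms by auto
  have pos: "0 < norm a" "0 < \<delta> + \<eta>" using na assms by linarith+
  have "\<bar>m\<bar> <= m0"
  proof -
   have "\<bar>Im a * Im bt / \<delta>\<bar> <= \<eta> * \<bar>Im bt\<bar> / \<delta>"
    using a assms by (simp add: abs_mult abs_div divide_right_mono mult_right_mono)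
   then show ?thesis unfolding m_def m0_def by linarith
  qed
  then have m: "m^2 <= m0^2" using power_mono[of "\<bar>m\<bar>" m0 2] by simp
  have "x^2 <= 2 * (x - m)^2 + 2 * m^2"
   using zero_le_power2[of "x - 2 * m"] by (simp add: power2_eq_square algebra_simps)
  then have xm: "x^2 / 2 - m0^2 <= (x - m)^2" using m by linarith
  have c1a: "c1 <= \<delta> / (norm a)^2"
   unfolding c1_def using na assms pos by (intro divide_left_mono power_mono mult_pos_pos zero_less_power) auto
  have "c1 * (x^2 / 2 - m0^2) <= c1 * (x - m)^2" using xm c1 by (intro mult_left_mono) auto
  also have "\<dots> <= \<delta> / (norm a)^2 * (x - m)^2" using c1a by (intro mult_right_mono) auto
  finally have e: "- (\<delta> / (norm a)^2) * (x - m)^2 <= c1 * m0^2 - 2 * c2 * x^2"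
   by (simp add: c2_def algebra_simps)
  have "(norm (cgauss a (of_real x - bt)))^2 =
    2 * pi / norm a * exp ((Im bt)^2 / \<delta>) * exp (- (\<delta> / (norm a)^2) * (x - m)^2)"
   unfolding m_def by (rule norm_cgauss[OF a(1) assms(1)])
  also have "\<dots> <= 2 * pi / \<delta> * exp ((Im bt)^2 / \<delta>) * exp (c1 * m0^2 - 2 * c2 * x^2)"
   using e na assms by (intro mult_mono) (auto intro!: divide_left_mono mult_pos_pos)
  also have "\<dots> = (k * exp (- c2 * x^2))^2"
  proof -
   have "k^2 = 2 * pi / \<delta> * exp ((Im bt)^2 / \<delta> + c1 * m0^2)"
    unfolding k_def using assms by (intro real_sqrt_pow2) auto
   moreover have "(exp (- c2 * x^2))^2 = exp (- (2 * c2 * x^2))" by (simp flip: exp_double)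
   ultimately show ?thesis by (simp add: power_mult_distrib exp_add exp_diff exp_minus divide_inverse)
  qed
  finally show "(norm (cgauss a (of_real x - bt)))^2 <= (k * exp (- c2 * x^2))^2" .
 qed (use k in simp)
 obtain B0 where B0: "B0 > 0" "!!x::real. \<bar>x\<bar> ^ 0 * exp (1 * \<bar>x\<bar> - c2 * x^2) <= B0 * exp (- (c2 / 2) * x^2)"
  using power_exp_gaussian_le[OF c2 zero_le_one, of 0] by metis
 define L where "L = (1 + 1 / \<delta>)^2"
 define B where "B = L * 2 * exp (1 + norm bt) * k * B0"
 have poly: "q * norm (cgauss a (of_real x - bt)) <= B * exp (- (c2 / 2) * x^2)"
  if a: "Re a = \<delta>" "\<bar>Im a\<bar> <= \<eta>" and q: "0 <= q" "q <= L * (1 + \<bar>x\<bar> + norm bt)^2" for a x q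
 proof -
  have e2: "(1 + \<bar>x\<bar> + norm bt)^2 <= 2 * exp (1 + \<bar>x\<bar> + norm bt)"
  proof -
   have "y^2 <= 2 * exp y" if "0 <= y" for y :: real
    using exp_lower_Taylor_quadratic[OF that] that by linarith
   then show ?thesis by simp
  qed
  have "q <= L * (2 * exp (1 + \<bar>x\<bar> + norm bt))"
   using q(2) mult_left_mono[OF e2, of L] by (auto simp: L_def)
  then have "q * norm (cgauss a (of_real x - bt)) <= (L * (2 * exp (1 + \<bar>x\<bar> + norm bt))) * (k * exp (- c2 * x^2))"
   using cg[OF a] q(1) by (intro mult_mono) (auto simp: L_def)
  also have "\<dots> = L * 2 * exp (1 + norm bt) * k * exp (\<bar>x\<bar> - c2 * x^2)"
   by (simp add: exp_add exp_diff exp_minus divide_inverse)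
  also have "\<dots> <= L * 2 * exp (1 + norm bt) * k * (B0 * exp (- (c2 / 2) * x^2))"
   using B0(2)[of x] k by (intro mult_left_mono) (auto simp: L_def)
  finally show ?thesis by (simp only: B_def mult.assoc)
 qed
 have id: "1 / \<delta> > 0" using assms by simp
 have bounds: "1 <= L * P^2" "y / \<delta> <= L * P^2" "y^2 / \<delta>\<^sup>2 + 1 / \<delta> <= L * P^2"
  if "P = 1 + y" "0 <= y" for P y
 proof -
  define i where "i = 1 / \<delta>"
  have i: "i > 0" using id by (simp add: i_def)
  have e: "L * P^2 = 1 + 2 * y + y^2 + 2 * i + 4 * i * y + 2 * i * y^2 + i^2 + 2 * i^2 * y + i^2 * y^2"
   unfolding L_def that(1) i_def[symmetric] by (simp add: power2_eq_square algebra_simps)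
  have nn: "0 <= y^2" "0 <= i * y" "0 <= i * y^2" "0 <= i^2" "0 <= i^2 * y" "0 <= i^2 * y^2"
   using i that(2) by auto
  show "1 <= L * P^2" unfolding e using nn i that(2) by linarith
  have "y / \<delta> = i * y" by (simp add: i_def)
  then show "y / \<delta> <= L * P^2" unfolding e using nn i that(2) by linarith
  have "y^2 / \<delta>\<^sup>2 + 1 / \<delta> = i^2 * y^2 + i" by (simp add: i_def power_divide)
  then show "y^2 / \<delta>\<^sup>2 + 1 / \<delta> <= L * P^2" unfolding e using nn i that(2) by linarith
 qed
 have na: "\<delta> <= norm a" if "Re a = \<delta>" for a using complex_Re_le_cmod[of a] that by simp
 have z: "norm (of_real x - bt) <= \<bar>x\<bar> + norm bt" for x
  using norm_triangle_ineq4[of "of_real x" bt] by simp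
 show ?thesis
 proof (rule that[of "c2 / 2" B])
  fix a x assume a: "Re a = \<delta>" "\<bar>Im a\<bar> <= \<eta>"
  let ?y = "\<bar>x\<bar> + norm bt"
  have b: "1 <= L * (1 + \<bar>x\<bar> + norm bt)^2" "?y / \<delta> <= L * (1 + \<bar>x\<bar> + norm bt)^2"
    "?y^2 / \<delta>\<^sup>2 + 1 / \<delta> <= L * (1 + \<bar>x\<bar> + norm bt)^2"
   using bounds[OF _ add_nonneg_nonneg[OF abs_ge_zero norm_ge_zero], of "1 + \<bar>x\<bar> + norm bt" x bt]
   by (simp_all only: add.assoc simp_thms)
  show "norm (cgauss a (of_real x - bt)) <= B * exp (- (c2 / 2) * x^2)"
   using poly[OF a zero_le_one b(1)] by simp
  have za: "norm ((of_real x - bt) / a) <= ?y / \<delta>"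
   unfolding norm_divide using z na[OF a(1)] assms by (intro frac_le) auto
  have "norm (- ((of_real x - bt) / a)) <= L * (1 + \<bar>x\<bar> + norm bt)^2"
   using za b(2) by simp
  from poly[OF a norm_ge_zero this]
  show "norm (cgauss1 a (of_real x - bt)) <= B * exp (- (c2 / 2) * x^2)"
   by (simp only: cgauss1_def norm_mult)
  have "norm ((of_real x - bt)^2 / a^2 - 1 / a) <= (norm ((of_real x - bt) / a))^2 + norm (1 / a)"
   using norm_triangle_ineq4[of "(of_real x - bt)^2 / a^2" "1 / a"] by (simp add: norm_power norm_divide power_divide)
  also have "\<dots> <= (?y / \<delta>)^2 + 1 / \<delta>"
  proof (intro add_mono power_mono za norm_ge_zero)
   show "norm (1 / a) <= 1 / \<delta>" unfolding norm_divide norm_one using na[OF a(1)] assms by (intro frac_le) auto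
  qed
  also have "\<dots> <= L * (1 + \<bar>x\<bar> + norm bt)^2" using b(3) by (simp only: power_divide)
  finally have "norm ((of_real x - bt)^2 / a^2 - 1 / a) <= L * (1 + \<bar>x\<bar> + norm bt)^2" .
  from poly[OF a norm_ge_zero this]
  show "norm (cgauss2 a (of_real x - bt)) <= B * exp (- (c2 / 2) * x^2)"
   by (simp only: cgauss2_def norm_mult)
 qed (use c2 in simp)
qed

text \<open>Packets and their Fourier symbols are parametrised so that both the free flow (acting on
 \<open>a\<close>) and multiplication by a plane wave (acting on \<open>bt\<close>, which becomes complex) map a packet to a
 multiple of a packet.\<close>

definition packet :: "('a::euclidean_space => complex) => ('a => complex) => 'a => complex" where
 "packet a bt = basis_prod (%b x. cgauss (a b) (of_real x - bt b))"

definition symbol :: "('a::euclidean_space => complex) => ('a => complex) => 'a => complex" where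
 "symbol a bt = basis_prod (%b x. exp (- a b * of_real x ^ 2 / 2 + \<i> * of_real x * bt b))"

lemma continuous_cgauss: "Re a > 0 ==> continuous_on UNIV (%x. cgauss a (of_real x - bt))"
 unfolding cgauss_def by (intro continuous_intros) auto

lemma borel_measurable_packet:
 assumes "!!b. b \<in> Basis ==> Re (a b) > 0"
 shows "packet a bt \<in> borel_measurable borel"
 unfolding packet_def using assms
 by (intro borel_measurable_basis_prod borel_measurable_continuous_onI continuous_cgauss)

lemma borel_measurable_symbol: "symbol a bt \<in> borel_measurable borel"
 unfolding symbol_def
 by (intro borel_measurable_basis_prod borel_measurable_continuous_onI continuous_intros) auto

lemma integrable_symbol:
 assumes "!!b. b \<in> Basis ==> Re (a b) > 0"
 shows "integrable lborel (symbol a (bt :: 'a::euclidean_space => complex))"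
 unfolding symbol_def basis_prod_def
proof (rule integral_prod_Basis(1))
 fix b :: 'a assume "b \<in> Basis"
 then show "integrable lborel (%x. exp (- a b * of_real x ^ 2 / 2 + \<i> * of_real x * bt b))"
  using integrable_power_gauss_wave[of "a b" 0 "- bt b"] assms by simp
qed

lemma cis_inner_Basis: "cis (p \<bullet> X) = (\<Prod>b\<in>Basis. exp (\<i> * of_real ((p \<bullet> b) * (X \<bullet> b))))" for p X :: "'a::euclidean_space"
 unfolding cis_conv_exp euclidean_inner[of p X] by (simp add: sum_distrib_left exp_sum)

lemma packet_fourier:
 fixes bt :: "'a::euclidean_space => complex"
 assumes "!!b. b \<in> Basis ==> Re (a b) > 0"
 shows "(LINT p|lborel. symbol a bt p * cis (- (p \<bullet> X))) = packet a bt X"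
proof -
 have eq: "symbol a bt p * cis (- (p \<bullet> X)) = (\<Prod>b\<in>Basis. gauss_wave (a b) (of_real (X \<bullet> b) - bt b) (p \<bullet> b))" for p
 proof -
  have "cis (- (p \<bullet> X)) = (\<Prod>b\<in>Basis. exp (\<i> * of_real ((p \<bullet> b) * ((- X) \<bullet> b))))"
   using cis_inner_Basis[of p "- X"] by simp
  then show ?thesis
   unfolding symbol_def basis_prod_def
   by (simp add: prod.distrib[symmetric] exp_add[symmetric] algebra_simps)
 qed
 have "(LINT p|lborel. symbol a bt p * cis (- (p \<bullet> X))) =
   (\<Prod>b\<in>Basis. LINT x|lborel. gauss_wave (a b) (of_real (X \<bullet> b) - bt b) x)"
  unfolding eq
 proof (rule integral_prod_Basis(2))
  fix b :: 'a assume "b \<in> Basis"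
  then show "integrable lborel (gauss_wave (a b) (of_real (X \<bullet> b) - bt b))"
   using integrable_power_gauss_wave[of "a b" 0] assms by simp
 qed
 also have "\<dots> = packet a bt X"
  unfolding packet_def basis_prod_def by (intro prod.cong refl integral_gauss_wave assms)
 finally show ?thesis .
qed

text \<open>The norm depends on \<open>a\<close> only through \<open>Re a\<close>, hence is conserved by the free flow.\<close>

lemma packet_L2:
 fixes bt :: "'a::euclidean_space => complex"
 assumes "!!b. b \<in> Basis ==> Re (a b) = \<delta>" "\<delta> > 0"
 shows "square_integrable (packet a bt)"
  and "L2_sq (packet a bt) = (\<Prod>b\<in>(Basis::'a set). 2 * pi * sqrt (pi / \<delta>) * exp ((Im (bt b))^2 / \<delta>))"
proof -
 have eq: "(norm (packet a bt X))^2 = (\<Prod>b\<in>Basis. (norm (cgauss (a b) (of_real (X \<bullet> b) - bt b)))^2)" for X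
  unfolding packet_def basis_prod_def prod_norm[symmetric] by (rule prod_power_distrib)
 have i: "integrable lborel (%x. (norm (cgauss (a b) (of_real x - bt b)))^2)" if "b \<in> Basis" for b
  by (rule integral_norm_cgauss(1)[OF assms(1)[OF that] assms(2)])
 show "square_integrable (packet a bt)"
  unfolding square_integrable_def eq
  using borel_measurable_packet[of a bt] assms integral_prod_Basis(1)[of "%b x. (norm (cgauss (a b) (of_real x - bt b)))^2", OF i]
  by auto
 show "L2_sq (packet a bt) = (\<Prod>b\<in>(Basis::'a set). 2 * pi * sqrt (pi / \<delta>) * exp ((Im (bt b))^2 / \<delta>))"
 proof -
  have "L2_sq (packet a bt) = (\<Prod>b\<in>(Basis::'a set). LINT x|lborel. (norm (cgauss (a b) (of_real x - bt b)))^2)"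
   unfolding eq by (rule integral_prod_Basis(2)) (rule i)
  also have "\<dots> = (\<Prod>b\<in>(Basis::'a set). 2 * pi * sqrt (pi / \<delta>) * exp ((Im (bt b))^2 / \<delta>))"
   by (intro prod.cong refl integral_norm_cgauss(2) assms)
  finally show ?thesis .
 qed
qed

definition kick_shift :: "('a::euclidean_space => complex) => ('a => complex) => 'a => 'a => complex" where
 "kick_shift a bt q b = bt b + \<i> * a b * of_real (q \<bullet> b)"

definition kick_factor :: "('a::euclidean_space => complex) => ('a => complex) => 'a => complex" where
 "kick_factor a bt q = symbol a bt q"

lemma symbol_shift: "symbol a bt (p + q) = kick_factor a bt q * symbol a (kick_shift a bt q) p"
proof -
 have "- a b * of_real ((p + q) \<bullet> b) ^ 2 / 2 + \<i> * of_real ((p + q) \<bullet> b) * bt b =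
   (- a b * of_real (q \<bullet> b) ^ 2 / 2 + \<i> * of_real (q \<bullet> b) * bt b) +
   (- a b * of_real (p \<bullet> b) ^ 2 / 2 + \<i> * of_real (p \<bullet> b) * kick_shift a bt q b)" for b
 proof -
  have "\<i> * x * (bt b + \<i> * a b * y) = \<i> * x * bt b - a b * (x * y)" for x y
  proof -
   have "\<i> * x * (bt b + \<i> * a b * y) = \<i> * x * bt b + (\<i> * \<i>) * (a b * (x * y))"
    by (simp only: distrib_left mult.assoc mult.commute mult.left_commute)
   then show ?thesis by simp
  qed
  then have e: "\<i> * x * (bt b + \<i> * a b * y) = \<i> * x * bt b - a b * (x * y)" for x y .
  have sq: "- \<alpha> * (x + y)^2 / 2 = - \<alpha> * y^2 / 2 + - \<alpha> * x^2 / 2 - \<alpha> * (x * y)" for x y \<alpha> :: complex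
   by (simp add: power2_eq_square field_simps)
  show ?thesis
   unfolding kick_shift_def inner_add_left of_real_add sq e by (simp add: algebra_simps)
 qed
 then show ?thesis
  unfolding symbol_def kick_factor_def basis_prod_def
  by (simp only: prod.distrib[symmetric] exp_add[symmetric])
qed

lemma packet_modulate:
 assumes "!!b. b \<in> Basis ==> a b ~= 0"
 shows "cis (q \<bullet> X) * packet a bt X = kick_factor a bt q * packet a (kick_shift a bt q) X"
proof -
 have "exp (\<i> * of_real ((q \<bullet> b) * (X \<bullet> b))) * cgauss (a b) (of_real (X \<bullet> b) - bt b) =
   exp (- a b * of_real (q \<bullet> b) ^ 2 / 2 + \<i> * of_real (q \<bullet> b) * bt b) *
   cgauss (a b) (of_real (X \<bullet> b) - kick_shift a bt q b)" if b: "b \<in> Basis" for b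
 proof -
  define x y where "x = complex_of_real (X \<bullet> b)" and "y = complex_of_real (q \<bullet> b)"
  have a: "a b ~= 0" using assms[OF b] .
  have "(x - (bt b + \<i> * a b * y))^2 = (x - bt b)^2 - 2 * (x - bt b) * \<i> * a b * y - (a b * y)^2"
   by (simp add: power2_eq_square algebra_simps)
  then have "- (x - (bt b + \<i> * a b * y))\<^sup>2 / (2 * a b) =
    (- (x - bt b)\<^sup>2 + 2 * (x - bt b) * \<i> * a b * y + (a b * y)^2) / (2 * a b)" by simp
  also have "\<dots> = - (x - bt b)\<^sup>2 / (2 * a b) + \<i> * y * (x - bt b) + a b * y^2 / 2"
  proof -
   have "2 * (x - bt b) * \<i> * a b * y / (2 * a b) = \<i> * y * (x - bt b)" using a by simp
   moreover have "(a b * y)^2 / (2 * a b) = a b * y^2 / 2" using a by (simp add: power2_eq_square)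
   ultimately show ?thesis by (simp only: add_divide_distrib)
  qed
  finally have e: "\<i> * (y * x) + - (x - bt b)\<^sup>2 / (2 * a b) =
    (- a b * y ^ 2 / 2 + \<i> * y * bt b) + - (x - (bt b + \<i> * a b * y))\<^sup>2 / (2 * a b)"
   by (simp add: algebra_simps)
  have "exp (\<i> * (y * x)) * (z * exp (- (x - bt b)\<^sup>2 / (2 * a b))) =
    exp (- a b * y ^ 2 / 2 + \<i> * y * bt b) * (z * exp (- (x - (bt b + \<i> * a b * y))\<^sup>2 / (2 * a b)))" for z
   using arg_cong[OF e, of exp] by (simp only: exp_add mult.left_commute[of _ z])
  then show ?thesis by (simp only: cgauss_def kick_shift_def x_def y_def of_real_mult)
 qed
 then show ?thesis
  unfolding packet_def kick_factor_def symbol_def basis_prod_def cis_inner_Basis prod.distrib[symmetric]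
  by (intro prod.cong refl)
qed

context kicks
begin

definition quad_freq :: "('a => real) => 'a => real" where
 "quad_freq \<theta> p = (\<Sum>b\<in>Basis. \<theta> b * (p \<bullet> b)^2)"

lemma borel_measurable_quad_freq [measurable]: "quad_freq \<theta> \<in> borel_measurable borel"
 unfolding quad_freq_def by measurable

definition evolve :: "('a => real) => ('a => complex) => real => 'a => complex" where
 "evolve \<theta> a l b = a b + of_real l * (2 * \<i> * of_real (\<theta> b))"

lemma Re_evolve [simp]: "Re (evolve \<theta> a l b) = Re (a b)"
 by (simp add: evolve_def)

lemma symbol_evolve: "cis (- quad_freq \<theta> p * l) * symbol a bt p = symbol (evolve \<theta> a l) bt p"
proof -
 have "cis (- quad_freq \<theta> p * l) = (\<Prod>b\<in>Basis. exp (- (of_real l * (2 * \<i> * of_real (\<theta> b))) * of_real (p \<bullet> b) ^ 2 / 2))"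
  unfolding cis_conv_exp quad_freq_def exp_sum[OF finite_Basis, symmetric]
  by (simp add: sum_distrib_left sum_distrib_right sum_negf mult_ac)
 moreover have "- u * P / 2 + (- v * P / 2 + w) = - (v + u) * P / 2 + w" for u v w P :: complex
  by (simp add: field_simps)
 ultimately show ?thesis
  unfolding symbol_def basis_prod_def evolve_def
  by (simp only: prod.distrib[symmetric] exp_add[symmetric])
qed

text \<open>The part of the expansion with exactly \<open>n\<close> kicks, for initial data with transform \<open>m\<close>.\<close>

definition moment_term :: "('a => complex) => ('a => real) => ('a => complex) => nat => real => complex" where
 "moment_term m Om h n t = (LINT p|lborel. m p * dyson Om h n t p)"

lemma integrable_moment:
 fixes m :: "'a => complex"
 assumes m: "integrable lborel m" and [measurable]: "Om \<in> borel_measurable borel" "h \<in> borel_measurable borel"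
  and H: "!!p. norm (h p) <= H" and "0 <= t"
 shows "integrable lborel (%p. m p * dyson Om h n t p)"
  and "norm (moment_term m Om h n t) <= (LINT p|lborel. norm (m p)) * (H * (rate * t) ^ n / fact n)"
proof -
 have [measurable]: "m \<in> borel_measurable borel" using m by auto
 let ?B = "H * (rate * t) ^ n / fact n"
 have le: "norm (m p * dyson Om h n t p) <= norm (m p) * ?B" for p
  unfolding norm_mult by (intro mult_left_mono norm_dyson_le H \<open>0 <= t\<close>) auto
 have "norm (dyson Om h n t 0) <= ?B" by (rule norm_dyson_le[OF H \<open>0 <= t\<close>])
 then have "0 <= ?B" by (rule order_trans[OF norm_ge_zero])
 have int: "integrable lborel (%p. norm (m p) * ?B)" using m by (intro integrable_mult_left integrable_norm)
 show "integrable lborel (%p. m p * dyson Om h n t p)"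
  using int
 proof (rule Bochner_Integration.integrable_bound)
  show "AE p in lborel. norm (m p * dyson Om h n t p) <= norm (norm (m p) * ?B)"
   by (intro AE_I2 order_trans[OF le]) (simp only: real_norm_def abs_ge_self)
 qed measurable
 have "norm (moment_term m Om h n t) <= (LINT p|lborel. norm (m p) * ?B)"
  unfolding moment_term_def
  by (rule order_trans[OF integral_norm_bound
     integral_mono'[OF int le mult_nonneg_nonneg[OF norm_ge_zero \<open>0 <= ?B\<close>]]])
 then show "norm (moment_term m Om h n t) <= (LINT p|lborel. norm (m p)) * ?B"
  by (simp only: integral_mult_left_zero)
qed

text \<open>Fubini turns the last-kick identity into the recursion that the iterated Volterra equation
 of the weak evolution produces.\<close>

lemma moment_term_last_kick:
 fixes m :: "'a => complex"
 assumes m: "integrable lborel m" and [measurable]: "Om \<in> borel_measurable borel" "h \<in> borel_measurable borel"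
  and H: "!!p. norm (h p) <= H" and "0 <= t"
 shows "moment_term m Om h (Suc n) t =
   (LINT l:{0..t}|lborel. (LINT k|K. s k * moment_term m Om (kicked Om h k l) n (t - l)))"
proof -
 have [measurable]: "m \<in> borel_measurable borel" using m by auto
 let ?L = "(lborel :: real measure) \<Otimes>\<^sub>M K"
 let ?B = "H * (rate * t) ^ n / fact n"
 interpret LL: pair_sigma_finite ?L "lborel :: 'a measure" by unfold_locales
 have H0: "0 <= H" using H[of 0] norm_ge_zero order_trans by blast
 define F where "F x p = indicator {0..t} (fst x) *\<^sub>R (s (snd x) * (m p * dyson Om (kicked Om h (snd x) (fst x)) n (t - fst x) p))" for x p
 have [measurable]: "(%(x, p). F x p) \<in> borel_measurable (?L \<Otimes>\<^sub>M lborel)"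
  unfolding F_def by measurable
 have F_le: "norm (F x p) <= norm (indicator {0..t} (fst x) *\<^sub>R (1::real)) * (norm (m p) * ?B)" for x p
 proof (cases "fst x \<in> {0..t}")
  case True
  then have "norm (m p * dyson Om (kicked Om h (snd x) (fst x)) n (t - fst x) p) <= norm (m p) * ?B"
   unfolding norm_mult by (intro mult_left_mono dyson_bound_uniform) (auto intro: H)
  from norm_s_mult_le[OF this] True show ?thesis by (simp add: F_def)
 qed (simp add: F_def)
 have int: "integrable (?L \<Otimes>\<^sub>M lborel) (%(x, p). F x p)"
 proof (rule LL.Fubini_integrable)
  have i: "integrable ?L (%x. indicator ({0..t} \<times> space K) x :: real)"
   by (rule integrable_real_indicator)
    (simp_all add: emeasure_pair_measure_Times emeasure_lborel_Icc_eq ennreal_mult_eq_top_iff less_top[symmetric])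
  then have "integrable ?L (%x. indicator ({0..t} \<times> space K) x * (LINT p|lborel. norm (m p) * ?B))"
   by (rule integrable_mult_left)
  then show "integrable ?L (%x. LINT p|lborel. norm (case (x, p) of (x, p) => F x p))"
  proof (rule Bochner_Integration.integrable_bound)
   show "AE x in ?L. norm (LINT p|lborel. norm (case (x, p) of (x, p) => F x p)) <=
     norm (indicator ({0..t} \<times> space K) x * (LINT p|lborel. norm (m p) * ?B))"
   proof (intro AE_I2)
    fix x assume x: "x \<in> space ?L"
    have "(LINT p|lborel. norm (F x p)) <= (LINT p|lborel. indicator {0..t} (fst x) * (norm (m p) * ?B))"
     using m F_le[of x] \<open>0 <= t\<close> H0
     by (intro integral_mono' integrable_mult_right integrable_mult_left integrable_norm) auto
    also have "\<dots> = indicator ({0..t} \<times> space K) x * (LINT p|lborel. norm (m p) * ?B)"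
     using x by (auto simp: indicator_def space_pair_measure)
    finally have le: "(LINT p|lborel. norm (F x p)) <= indicator ({0..t} \<times> space K) x * (LINT p|lborel. norm (m p) * ?B)" .
    have nn: "0 <= (LINT p|lborel. norm (F x p))" by simp
    show "norm (LINT p|lborel. norm (case (x, p) of (x, p) => F x p)) <=
     norm (indicator ({0..t} \<times> space K) x * (LINT p|lborel. norm (m p) * ?B))"
     unfolding split_conv real_norm_def abs_of_nonneg[OF nn] by (rule order_trans[OF le abs_ge_self])
   qed
  qed measurable
  show "AE x in ?L. integrable lborel (%p. case (x, p) of (x, p) => F x p)"
  proof (intro AE_I2)
   fix x assume x: "x \<in> space ?L"
   have "integrable lborel (%p. norm (indicator {0..t} (fst x) *\<^sub>R (1::real)) * (norm (m p) * ?B))"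
    using m by (intro integrable_mult_right integrable_mult_left integrable_norm)
   then have "integrable lborel (F x)"
   proof (rule Bochner_Integration.integrable_bound)
    have "(%p. (x, p)) \<in> borel \<rightarrow>\<^sub>M ?L \<Otimes>\<^sub>M lborel" using x by simp
    from measurable_compose[OF this, of "%(x, p). F x p" borel]
    show "F x \<in> borel_measurable lborel" by simp
    show "AE p in lborel. norm (F x p) <= norm (norm (indicator {0..t} (fst x) *\<^sub>R (1::real)) * (norm (m p) * ?B))"
     by (intro AE_I2 order_trans[OF F_le]) (simp only: real_norm_def abs_ge_self)
   qed
   then show "integrable lborel (%p. case (x, p) of (x, p) => F x p)" by simp
  qed
 qed measurable
 have "moment_term m Om h (Suc n) t = (LINT p|lborel. (LINT x|?L. F x p))"
  unfolding moment_term_def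
 proof (intro integral_cong_fun)
  fix p
  have "dyson Om h (Suc n) t p = (LINT x|?L. indicator {0..t} (fst x) *\<^sub>R
    (s (snd x) * dyson Om (kicked Om h (snd x) (fst x)) n (t - fst x) p))"
   unfolding dyson_last_kick[OF assms(2,3) H \<open>0 <= t\<close>]
   by (rule slab_Fubini(1)[where B = ?B]) (auto intro!: norm_s_mult_le dyson_bound_uniform H)
  then have "m p * dyson Om h (Suc n) t p = (LINT x|?L. m p * (indicator {0..t} (fst x) *\<^sub>R
    (s (snd x) * dyson Om (kicked Om h (snd x) (fst x)) n (t - fst x) p)))"
   by (simp only: integral_mult_right_zero)
  also have "\<dots> = (LINT x|?L. F x p)"
   by (intro integral_cong_fun) (simp add: F_def mult_ac)
  finally show "m p * dyson Om h (Suc n) t p = (LINT x|?L. F x p)" .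
 qed
 also have "\<dots> = (LINT x|?L. (LINT p|lborel. F x p))"
  by (rule LL.Fubini_integral[OF int])
 also have "\<dots> = (LINT x|?L. indicator {0..t} (fst x) *\<^sub>R (s (snd x) * moment_term m Om (kicked Om h (snd x) (fst x)) n (t - fst x)))"
  by (simp add: F_def moment_term_def)
 also have "\<dots> = (LINT l:{0..t}|lborel. (LINT k|K. s k * moment_term m Om (kicked Om h k l) n (t - l)))"
 proof (rule slab_Fubini(1)[where B = "(LINT p|lborel. norm (m p)) * ?B", symmetric])
  show "(%(u, k). s k * moment_term m Om (kicked Om h k u) n (t - u)) \<in> borel_measurable ?L"
   unfolding moment_term_def by measurable
  fix u k assume u: "u \<in> {0..t}"
  have [measurable]: "kicked Om h k u \<in> borel_measurable borel" unfolding kicked_def by measurable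
  have "norm (moment_term m Om (kicked Om h k u) n (t - u)) <=
    (LINT p|lborel. norm (m p)) * (H * (rate * (t - u)) ^ n / fact n)"
   by (rule integrable_moment(2)[OF m]) (use u H in auto)
  also have "\<dots> <= (LINT p|lborel. norm (m p)) * ?B"
   using u H0 by (intro mult_left_mono divide_right_mono power_mono) auto
  finally show "norm (s k * moment_term m Om (kicked Om h k u) n (t - u)) <= (LINT p|lborel. norm (m p)) * ?B"
   by (rule norm_s_mult_le)
 qed
 finally show ?thesis .
qed

end

lemma symbol_bounded:
 fixes bt :: "'a::euclidean_space => complex"
 assumes "!!b. b \<in> Basis ==> Re (a b) > 0"
 obtains H where "!!p. norm (symbol a bt p) <= H"
proof -
 have "\<exists>H. \<forall>x. norm (gauss_wave (a b) (- bt b) x) <= H" if b: "b \<in> Basis" for b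
 proof -
  obtain B where B: "B > 0" "!!x::real. \<bar>x\<bar> ^ 0 * exp (\<bar>Im (bt b)\<bar> * \<bar>x\<bar> - (Re (a b) / 2) * x^2) <= B * exp (- (Re (a b) / 2 / 2) * x^2)"
   using power_exp_gaussian_le[of "Re (a b) / 2" "\<bar>Im (bt b)\<bar>" 0] assms[OF b] by auto
  have "norm (gauss_wave (a b) (- bt b) x) <= B" for x
  proof -
   have "norm (gauss_wave (a b) (- bt b) x) <= exp (\<bar>Im (bt b)\<bar> * \<bar>x\<bar> - Re (a b) / 2 * x^2)"
    by (rule norm_gauss_wave_le) auto
   also have "\<dots> <= B * exp (- (Re (a b) / 2 / 2) * x^2)" using B(2)[of x] by simp
   also have "\<dots> <= B * 1" using assms[OF b] B(1) by (intro mult_left_mono) auto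
   finally show ?thesis by simp
  qed
  then show ?thesis by blast
 qed
 then obtain Hf where Hf: "!!b x. b \<in> Basis ==> norm (gauss_wave (a b) (- bt b) x) <= Hf b" by metis
 have "norm (symbol a bt p) <= (\<Prod>b\<in>Basis. Hf b)" for p
  unfolding symbol_def basis_prod_def prod_norm[symmetric]
  by (intro prod_mono) (use Hf in simp)
 then show ?thesis by (rule that)
qed

lemma norm_set_integral_reflect_power_le:
 fixes f :: "real => complex"
 assumes "0 <= t" "!!l. l \<in> {0..t} ==> norm (f l) <= c * (t - l) ^ n"
 shows "norm (LINT l:{0..t}|lborel. f l) <= c * t ^ Suc n / Suc n"
proof -
 have "norm (LINT l:{0..t}|lborel. f (t - l)) <= (LINT l:{0..t}|lborel. c * l ^ n)"
 proof (rule norm_set_integral_le)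
  fix l assume "l \<in> {0..t}"
  then show "norm (f (t - l)) <= c * l ^ n" using assms(2)[of "t - l"] by simp
 qed (rule set_integral_power(2)[OF assms(1)])
 then show ?thesis unfolding set_integral_reflect set_integral_power(1)[OF assms(1)] .
qed

lemma set_integrable_continuous_Icc:
 fixes f :: "real => complex"
 shows "continuous_on {0..t} f ==> set_integrable lborel {0..t} f"
 unfolding set_integrable_def by (rule borel_integrable_compact) auto

context weak_evolution
begin

abbreviation freq :: "'a => real" where "freq \<equiv> quad_freq \<theta>"

text \<open>Duhamel's formula for packets: after the last kick the packet is again a packet, carried
 back by the free flow.\<close>

lemma packet_volterra:
 fixes bt :: "'a => complex"
 assumes \<delta>: "\<delta> > 0" and a: "!!b. b \<in> Basis ==> Re (a b) = \<delta>" and t: "0 <= t"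
 shows "pairing (\<nu> t) (packet a bt) = pairing (\<nu> 0) (packet (evolve \<theta> a t) bt) +
   (LINT u:{0..t}|lborel. pairing (\<nu> u) (%X. potential X * packet (evolve \<theta> a (t - u)) bt X))"
  and "continuous_on {0..t} (%u. pairing (\<nu> u) (%X. potential X * packet (evolve \<theta> a (t - u)) bt X))"
proof -
 define \<eta> where "\<eta> = (\<Sum>b\<in>Basis. \<bar>Im (a b)\<bar> + 2 * \<bar>\<theta> b\<bar> * t)"
 have \<eta>0: "0 <= \<eta>" unfolding \<eta>_def using t by (intro sum_nonneg) auto
 have \<eta>: "\<bar>Im (evolve \<theta> a (t - u) b)\<bar> <= \<eta>" if "b \<in> Basis" "u \<in> {0..t}" for b u
 proof -
  have "\<bar>Im (evolve \<theta> a (t - u) b)\<bar> <= \<bar>Im (a b)\<bar> + \<bar>(t - u) * (2 * \<theta> b)\<bar>"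
   unfolding evolve_def by simp
  also have "\<bar>(t - u) * (2 * \<theta> b)\<bar> <= 2 * \<bar>\<theta> b\<bar> * t"
   using that(2) mult_right_mono[of "t - u" t "2 * \<bar>\<theta> b\<bar>"] by (simp add: abs_mult mult_ac)
  also have "\<bar>Im (a b)\<bar> + 2 * \<bar>\<theta> b\<bar> * t <= \<eta>"
   unfolding \<eta>_def using t that(1) by (intro member_le_sum) auto
  finally show ?thesis by simp
 qed
 have ex: "\<exists>B c. c > 0 \<and> (\<forall>a x. Re a = \<delta> \<longrightarrow> \<bar>Im a\<bar> <= \<eta> \<longrightarrow> norm (cgauss a (of_real x - bt b)) <= B * exp (- c * x^2)
   \<and> norm (cgauss1 a (of_real x - bt b)) <= B * exp (- c * x^2) \<and> norm (cgauss2 a (of_real x - bt b)) <= B * exp (- c * x^2))" for b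
  by (rule cgauss_uniform_bound[OF \<delta> \<eta>0, of "bt b"]) blast
 then obtain Bf cf where cf: "!!b. cf b > 0" and Bf: "!!b a x. Re a = \<delta> ==> \<bar>Im a\<bar> <= \<eta> ==>
   norm (cgauss a (of_real x - bt b)) <= Bf b * exp (- cf b * x^2) \<and>
   norm (cgauss1 a (of_real x - bt b)) <= Bf b * exp (- cf b * x^2) \<and>
   norm (cgauss2 a (of_real x - bt b)) <= Bf b * exp (- cf b * x^2)"
  by metis
 define c where "c = Min (cf ` Basis)"
 define B where "B = (\<Sum>b\<in>Basis. \<bar>Bf b\<bar>)"
 have c: "c > 0" using cf by (auto simp: c_def)
 have mono: "Bf b * exp (- cf b * x^2) <= B * exp (- c * x^2)" if b: "b \<in> Basis" for b x
 proof -
  have "Bf b <= B"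
   using member_le_sum[OF b, of "%b. \<bar>Bf b\<bar>"] by (auto simp: B_def)
  moreover have "c <= cf b" using b by (simp add: c_def)
  then have "c * x^2 <= cf b * x^2" by (intro mult_right_mono) auto
  moreover have "0 <= B" by (simp add: B_def sum_nonneg)
  ultimately show ?thesis by (intro mult_mono) auto
 qed
 define g where "g b u x = cgauss (evolve \<theta> a (t - u) b) (of_real x - bt b)" for b u x
 define g1 where "g1 b u x = cgauss1 (evolve \<theta> a (t - u) b) (of_real x - bt b)" for b u x
 define g2 where "g2 b u x = cgauss2 (evolve \<theta> a (t - u) b) (of_real x - bt b)" for b u x
 have pg: "basis_prod (%b. g b u) = packet (evolve \<theta> a (t - u)) bt" for u
  by (simp add: g_def[abs_def] packet_def)
 have Re: "Re (evolve \<theta> a (t - u) b) = \<delta>" "Re (evolve \<theta> a (t - u) b) > 0" if "b \<in> Basis" for b u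
  using a[OF that] \<delta> by auto
 have nz: "evolve \<theta> a (t - u) b ~= 0" "evolve \<theta> a (t - u) b \<notin> \<real>\<^sub>\<le>\<^sub>0" if "b \<in> Basis" for b u
 proof -
  have p: "Re (evolve \<theta> a (t - u) b) > 0" by (rule Re(2)[OF that])
  show "evolve \<theta> a (t - u) b ~= 0" using p by (metis less_irrefl zero_complex.sel(1))
  show "evolve \<theta> a (t - u) b \<notin> \<real>\<^sub>\<le>\<^sub>0" using p unfolding complex_nonpos_Reals_iff by linarith
 qed
 have ec: "continuous_on S (%u. evolve \<theta> a (t - u) b)" for b S
  unfolding evolve_def by (intro continuous_intros)
 have ct: "continuous_on {0..t} (%u. g b u x)" if b: "b \<in> Basis" for b x
  unfolding g_def cgauss_def
 proof -
  have "continuous_on {0..t} (%u. csqrt (evolve \<theta> a (t - u) b))"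
   by (rule continuous_on_compose2[OF continuous_on_csqrt ec]) (use nz[OF b] in auto)
  then show "continuous_on {0..t} (%u. of_real (sqrt (2 * pi)) / csqrt (evolve \<theta> a (t - u) b) *
    exp (- (of_real x - bt b)\<^sup>2 / (2 * evolve \<theta> a (t - u) b)))"
   by (intro continuous_intros ec) (use nz[OF b] in auto)
 qed
 note duhamel = pairing_duhamel[OF t, where g = g and ?g1.0 = g1 and ?g2.0 = g2 and c = c and B = B]
 have gder: "(g b u has_vector_derivative g1 b u x) (at x)" "(g1 b u has_vector_derivative g2 b u x) (at x)"
   if b: "b \<in> Basis" and u: "u \<in> {0..t}" for b u x
  unfolding g_def[abs_def] g1_def[abs_def] g2_def by (intro cgauss_derivs Re b)+
 have g2c: "continuous_on UNIV (g2 b u)" if b: "b \<in> Basis" and u: "u \<in> {0..t}" for b u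
  unfolding g2_def[abs_def] cgauss2_def using nz[OF b]
  by (intro continuous_intros continuous_cgauss Re b) auto
 have gtime: "((%v. g b v x) has_vector_derivative - \<i> * \<theta> b * g2 b u x) (at u within {0..t})"
  if b: "b \<in> Basis" and u: "u \<in> {0..t}" for b u x
 proof -
  have eq: "evolve \<theta> a (t - v) b = (a b + of_real t * (2 * \<i> * \<theta> b)) + of_real v * (- (2 * \<i> * \<theta> b))" for v
   by (simp add: evolve_def algebra_simps)
  have "((%v. g b v x) has_vector_derivative - (2 * \<i> * \<theta> b) / 2 * g2 b u x) (at u)"
   unfolding g_def g2_def eq by (rule cgauss_heat) (use a[OF b] \<delta> in auto)
  then show ?thesis by (simp add: has_vector_derivative_at_within)
 qed
 have g12c: "continuous_on {0..t} (%u. g1 b u x)" "continuous_on {0..t} (%u. g2 b u x)"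
  if b: "b \<in> Basis" for b x
  unfolding g1_def g2_def cgauss1_def cgauss2_def g_def[symmetric]
  by (intro continuous_intros ec ct b; use nz[OF b] in auto)+
 have gB: "norm (g b u x) <= B * exp (- c * x^2)" "norm (g1 b u x) <= B * exp (- c * x^2)" "norm (g2 b u x) <= B * exp (- c * x^2)"
  if b: "b \<in> Basis" and u: "u \<in> {0..t}" for b u x
  using Bf[OF Re(1)[OF b] \<eta>[OF b u], of x b] mono[OF b, of x]
  unfolding g_def g1_def g2_def by (auto intro: order_trans)
 note duhamel = duhamel[OF gder g2c gtime g12c c gB]
 have "pairing (\<nu> t) (basis_prod (%b. g b t)) - pairing (\<nu> 0) (basis_prod (%b. g b 0)) =
   (LINT u:{0..t}|lborel. pairing (\<nu> u) (%X. potential X * basis_prod (%b. g b u) X)) \<and>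
   continuous_on {0..t} (%u. pairing (\<nu> u) (%X. potential X * basis_prod (%b. g b u) X))"
  by (rule conjI; rule duhamel)
 moreover have "packet (evolve \<theta> a 0) bt = packet a bt" by (simp add: evolve_def[abs_def])
 ultimately show "pairing (\<nu> t) (packet a bt) = pairing (\<nu> 0) (packet (evolve \<theta> a t) bt) +
   (LINT u:{0..t}|lborel. pairing (\<nu> u) (%X. potential X * packet (evolve \<theta> a (t - u)) bt X))"
  "continuous_on {0..t} (%u. pairing (\<nu> u) (%X. potential X * packet (evolve \<theta> a (t - u)) bt X))"
  unfolding pg by (auto simp: algebra_simps)
qed

lemma pairing_potential:
 assumes sq: "square_integrable f" "square_integrable \<phi>"
 shows "pairing f (%X. potential X * \<phi> X) = (LINT k|K. s k * pairing f (%X. cis (A k \<bullet> X) * \<phi> X))"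
  and "(%k. pairing f (%X. cis (A k \<bullet> X) * \<phi> X)) \<in> borel_measurable K"
proof -
 have [measurable]: "f \<in> borel_measurable borel" "\<phi> \<in> borel_measurable borel"
  using sq by (auto simp: square_integrable_def)
 interpret KL: pair_sigma_finite K "lborel :: 'a measure" by unfold_locales
 have int: "integrable lborel (%X. norm (f X * \<phi> X))"
  by (rule integrable_norm[OF pairing_bound(1)[OF sq zero_less_one]])
 have le: "norm (s k * (f X * (cis (A k \<bullet> X) * \<phi> X))) <= norm (f X * \<phi> X)" for k X
  by (rule norm_s_mult_le) (simp add: norm_mult)
 have int2: "integrable lborel (%X. s k * (f X * (cis (A k \<bullet> X) * \<phi> X)))" for k
  using int by (rule Bochner_Integration.integrable_bound)
   (measurable, intro AE_I2, use le in \<open>simp only: real_norm_def abs_norm_cancel\<close>)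
 have "integrable (K \<Otimes>\<^sub>M lborel) (%(k, X). s k * (f X * (cis (A k \<bullet> X) * \<phi> X)))"
 proof (rule KL.Fubini_integrable)
  show "integrable K (%k. LINT X|lborel. norm (case (k, X) of (k, X) => s k * (f X * (cis (A k \<bullet> X) * \<phi> X))))"
  proof (rule integrable_const_bound[where B = "LINT X|lborel. norm (f X * \<phi> X)"])
   show "AE k in K. norm (LINT X|lborel. norm (case (k, X) of (k, X) => s k * (f X * (cis (A k \<bullet> X) * \<phi> X))))
     <= (LINT X|lborel. norm (f X * \<phi> X))"
   proof (intro AE_I2)
    fix k
    have "(LINT X|lborel. norm (s k * (f X * (cis (A k \<bullet> X) * \<phi> X)))) <= (LINT X|lborel. norm (f X * \<phi> X))"
     by (intro integral_mono int integrable_norm int2 le)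
    then show "norm (LINT X|lborel. norm (case (k, X) of (k, X) => s k * (f X * (cis (A k \<bullet> X) * \<phi> X))))
      <= (LINT X|lborel. norm (f X * \<phi> X))" by simp
   qed
  qed measurable
  show "AE k in K. integrable lborel (%X. case (k, X) of (k, X) => s k * (f X * (cis (A k \<bullet> X) * \<phi> X)))"
   using int2 by (intro AE_I2) simp
 qed measurable
 from KL.Fubini_integral[OF this]
 have "(LINT X|lborel. (LINT k|K. s k * (f X * (cis (A k \<bullet> X) * \<phi> X)))) =
   (LINT k|K. (LINT X|lborel. s k * (f X * (cis (A k \<bullet> X) * \<phi> X))))" by simp
 moreover have "(LINT k|K. s k * (f X * (cis (A k \<bullet> X) * \<phi> X))) = f X * (potential X * \<phi> X)" for X
 proof -
  have "(LINT k|K. s k * (f X * (cis (A k \<bullet> X) * \<phi> X))) = (LINT k|K. (f X * \<phi> X) * (s k * cis (A k \<bullet> X)))"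
   by (intro integral_cong_fun) (simp add: mult_ac)
  then show ?thesis by (simp add: potential_def)
 qed
 ultimately show "pairing f (%X. potential X * \<phi> X) = (LINT k|K. s k * pairing f (%X. cis (A k \<bullet> X) * \<phi> X))"
  by (simp add: pairing_def)
 show "(%k. pairing f (%X. cis (A k \<bullet> X) * \<phi> X)) \<in> borel_measurable K"
  unfolding pairing_def by measurable
qed

lemma kicked_symbol:
 "kicked freq (%p. \<gamma> * symbol a bt p) k l =
  (%p. (\<gamma> * kick_factor (evolve \<theta> a l) bt (A k)) * symbol (evolve \<theta> a l) (kick_shift (evolve \<theta> a l) bt (A k)) p)"
proof
 fix p
 have "kicked freq (%p. \<gamma> * symbol a bt p) k l p = \<gamma> * (cis (- freq (p + A k) * l) * symbol a bt (p + A k))"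
  by (simp add: kicked_def)
 also have "\<dots> = \<gamma> * symbol (evolve \<theta> a l) bt (p + A k)" by (simp only: symbol_evolve)
 also have "\<dots> = (\<gamma> * kick_factor (evolve \<theta> a l) bt (A k)) * symbol (evolve \<theta> a l) (kick_shift (evolve \<theta> a l) bt (A k)) p"
  by (simp only: symbol_shift mult.assoc)
 finally show "kicked freq (%p. \<gamma> * symbol a bt p) k l p =
  (\<gamma> * kick_factor (evolve \<theta> a l) bt (A k)) * symbol (evolve \<theta> a l) (kick_shift (evolve \<theta> a l) bt (A k)) p" .
qed

end

section \<open>Point values from packets\<close>

lemma lborel_integral_affine:
 fixes f :: "'a::euclidean_space => complex" and X0 :: 'a
 assumes "c > 0" and [measurable]: "f \<in> borel_measurable borel"
 shows "(LINT X|lborel. f X) = c ^ DIM('a) *\<^sub>R (LINT Y|lborel. f (X0 + c *\<^sub>R Y))"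
proof -
 have "(LINT X|lborel. f X) = (LINT X|density (distr lborel borel (%x. X0 + c *\<^sub>R x)) (%_. \<bar>c\<bar>^DIM('a)). f X)"
  using lborel_affine[of c X0] assms(1) by simp
 also have "\<dots> = (LINT X|distr lborel borel (%x. X0 + c *\<^sub>R x). \<bar>c\<bar>^DIM('a) *\<^sub>R f X)"
  by (rule integral_density) auto
 also have "\<dots> = (LINT Y|lborel. \<bar>c\<bar>^DIM('a) *\<^sub>R f (X0 + c *\<^sub>R Y))"
  by (rule integral_distr) auto
 finally show ?thesis using assms(1) by simp
qed

lemma packet_real:
 fixes X0 :: "'a::euclidean_space"
 assumes "\<delta> > 0"
 shows "packet (%_. of_real \<delta>) (%b. of_real (X0 \<bullet> b)) X =
  of_real (sqrt (2 * pi / \<delta>) ^ DIM('a) * exp (- (norm (X - X0))\<^sup>2 / (2 * \<delta>)))"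
proof -
 have "cgauss (of_real \<delta>) (of_real (X \<bullet> b) - of_real (X0 \<bullet> b)) =
   of_real (sqrt (2 * pi / \<delta>) * exp (- ((X - X0) \<bullet> b)\<^sup>2 / (2 * \<delta>)))" for b
  using assms by (simp add: cgauss_def real_sqrt_divide inner_diff_left exp_of_real[symmetric])
 then show ?thesis
  unfolding packet_def basis_prod_def
  by (simp add: prod.distrib norm_sq_Basis sum_negf sum_divide_distrib exp_sum[symmetric]
    flip: of_real_prod)
qed

text \<open>Narrow packets form an approximate identity.  The function is merely square integrable away
 from the point, so the tail is handled by comparison with one fixed Gaussian.\<close>

lemma pairing_approximate_identity:
 fixes f :: "'a::euclidean_space => complex"
 assumes sq: "square_integrable f" and cont: "isCont f X0"
 shows "(%j. pairing f (packet (%_. of_real (1 / real (Suc j))) (%b. of_real (X0 \<bullet> b))))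
  \<longlonglongrightarrow> (2 * pi) ^ DIM('a) * f X0"
proof -
 have [measurable]: "f \<in> borel_measurable borel" using sq by (simp add: square_integrable_def)
 define d where "d j = 1 / real (Suc j)" for j
 have d: "d j > 0" "d j <= 1" for j by (auto simp: d_def)
 have d0: "d \<longlonglongrightarrow> 0" unfolding d_def[abs_def] using LIMSEQ_inverse_real_of_nat by (simp add: inverse_eq_divide)
 define \<phi> where "\<phi> j X = sqrt (2 * pi / d j) ^ DIM('a) * exp (- (norm (X - X0))\<^sup>2 / (2 * d j))" for j X
 have [measurable]: "\<phi> j \<in> borel_measurable borel" for j unfolding \<phi>_def[abs_def] by measurable
 have packet: "packet (%_. of_real (1 / real (Suc j))) (%b. of_real (X0 \<bullet> b)) = (%X. of_real (\<phi> j X))" for j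
  using packet_real[OF d(1), of j X0] by (simp add: \<phi>_def d_def fun_eq_iff)
 obtain r where r: "r > 0" "!!X. dist X X0 < r ==> dist (f X) (f X0) < 1"
  using cont unfolding continuous_at_eps_delta by (metis zero_less_one)
 define M where "M = norm (f X0) + 1"
 have M: "norm (f X) <= M" if "X \<in> ball X0 r" for X
  using r(2)[of X] that norm_triangle_ineq2[of "f X" "f X0"] by (auto simp: M_def dist_norm norm_minus_commute[of X0])
 define near where "near j = (LINT X|lborel. indicator (ball X0 r) X *\<^sub>R (f X * of_real (\<phi> j X)))" for j
 define far where "far j = (LINT X|lborel. indicator (- ball X0 r) X *\<^sub>R (f X * of_real (\<phi> j X)))" for j
 have g1: "integrable lborel (%X::'a. exp (- (1/4) * (norm (X - X0))^2))"
  and g2: "integrable lborel (%X::'a. (exp (- (1/4) * (norm (X - X0))^2))^2)"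
 proof -
  have tr: "integrable lborel (%X::'a. h (X - X0))" if "integrable lborel (h :: 'a => real)" for h
  proof -
   have "integrable (distr lborel borel ((+) (- X0))) h"
    using that lborel_distr_plus[of "- X0"] by simp
   then show ?thesis using that by (subst (asm) integrable_distr_eq) auto
  qed
  show "integrable lborel (%X::'a. exp (- (1/4) * (norm (X - X0))^2))"
   by (rule tr) (rule integrable_gaussian_euclidean(1), simp)
  show "integrable lborel (%X::'a. (exp (- (1/4) * (norm (X - X0))^2))^2)"
   using tr[OF integrable_gaussian_sq[of "1/4" 1]] by simp
 qed
 have int4: "integrable lborel (%X. norm (f X * of_real (exp (- (1/4) * (norm (X - X0))^2))))"
  using g2 by (intro integrable_norm pairing_bound(1)[OF sq _ zero_less_one]) (simp add: square_integrable_def)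
 define q where "q j = sqrt (2 * pi / d j) ^ DIM('a) * exp (- r\<^sup>2 / (4 * d j))" for j
 have q0: "q j \<ge> 0" for j using d[of j] by (simp add: q_def)
 have \<phi>0: "\<phi> j X \<ge> 0" for j X using d[of j] by (simp add: \<phi>_def)
 have far_le: "norm (indicator (- ball X0 r) X *\<^sub>R (f X * of_real (\<phi> j X))) <=
   q j * norm (f X * of_real (exp (- (1/4) * (norm (X - X0))^2)))" for j X
 proof (cases "X \<in> ball X0 r")
  case False
  then have "r <= norm (X - X0)" by (simp add: dist_norm norm_minus_commute)
  then have 1: "r^2 <= (norm (X - X0))^2" using r(1) by (intro power_mono) auto
  have "exp (- (norm (X - X0))\<^sup>2 / (2 * d j)) = exp (- (norm (X - X0))\<^sup>2 / (4 * d j)) * exp (- (norm (X - X0))\<^sup>2 / (4 * d j))"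
   by (simp flip: exp_add)
  also have "\<dots> <= exp (- r\<^sup>2 / (4 * d j)) * exp (- (1/4) * (norm (X - X0))^2)"
  proof (intro mult_mono)
   show "exp (- (norm (X - X0))\<^sup>2 / (4 * d j)) <= exp (- r\<^sup>2 / (4 * d j))"
    using 1 d[of j] by (simp add: divide_right_mono)
   have "(norm (X - X0))^2 / 4 <= (norm (X - X0))^2 / (4 * d j)"
    using d[of j] by (intro divide_left_mono) auto
   then show "exp (- (norm (X - X0))\<^sup>2 / (4 * d j)) <= exp (- (1/4) * (norm (X - X0))^2)" by simp
  qed auto
  finally have "\<phi> j X <= sqrt (2 * pi / d j) ^ DIM('a) * (exp (- r\<^sup>2 / (4 * d j)) * exp (- (1/4) * (norm (X - X0))^2))"
   unfolding \<phi>_def using d[of j] by (intro mult_left_mono) auto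
  then have "norm (f X) * \<phi> j X <= norm (f X) * (q j * exp (- (1/4) * (norm (X - X0))^2))"
   by (intro mult_left_mono) (auto simp: q_def mult.assoc)
  then show ?thesis using False \<phi>0[of j X] by (simp add: norm_mult mult_ac)
 qed (use q0 in simp)
 have far_int: "integrable lborel (%X. indicator (- ball X0 r) X *\<^sub>R (f X * of_real (\<phi> j X)))" for j
  by (rule Bochner_Integration.integrable_bound[OF integrable_mult_right[OF int4, of "q j"]])
   (measurable, intro AE_I2 order_trans[OF far_le], simp only: real_norm_def abs_ge_self)
 have near_int: "integrable lborel (%X. indicator (ball X0 r) X *\<^sub>R (f X * of_real (\<phi> j X)))" for j
 proof (rule integrableI_bounded_set_indicator)
  show "emeasure lborel (ball X0 r) < \<infinity>" using emeasure_bounded_finite[of "ball X0 r"] by simp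
  show "AE X in lborel. X \<in> ball X0 r \<longrightarrow> norm (f X * of_real (\<phi> j X)) <= M * sqrt (2 * pi / d j) ^ DIM('a)"
  proof (intro AE_I2 impI)
   fix X assume X: "X \<in> ball X0 r"
   have "\<phi> j X <= sqrt (2 * pi / d j) ^ DIM('a) * 1" unfolding \<phi>_def using d[of j] by (intro mult_left_mono) auto
   then show "norm (f X * of_real (\<phi> j X)) <= M * sqrt (2 * pi / d j) ^ DIM('a)"
    unfolding norm_mult norm_of_real using M[OF X] \<phi>0[of j X] by (intro mult_mono) (auto intro: order_trans[OF norm_ge_zero])
  qed
 qed auto
 have split: "pairing f (packet (%_. of_real (1 / real (Suc j))) (%b. of_real (X0 \<bullet> b))) = near j + far j" for j
 proof -
  have "near j + far j = (LINT X|lborel. indicator (ball X0 r) X *\<^sub>R (f X * of_real (\<phi> j X)) +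
    indicator (- ball X0 r) X *\<^sub>R (f X * of_real (\<phi> j X)))"
   unfolding near_def far_def using near_int far_int by (rule Bochner_Integration.integral_add[symmetric])
  also have "\<dots> = (LINT X|lborel. f X * of_real (\<phi> j X))"
   by (intro integral_cong_fun) (auto simp: indicator_def)
  finally show ?thesis unfolding pairing_def packet ..
 qed
 have "far \<longlonglongrightarrow> 0"
 proof (rule Lim_null_comparison[where g = "%j. q j * (LINT X|lborel. norm (f X * of_real (exp (- (1/4) * (norm (X - X0))^2))))"])
  show "\<forall>\<^sub>F j in sequentially. norm (far j) <= q j * (LINT X|lborel. norm (f X * of_real (exp (- (1/4) * (norm (X - X0))^2))))"
  proof (intro always_eventually allI)
   fix j
   have "norm (far j) <= (LINT X|lborel. q j * norm (f X * of_real (exp (- (1/4) * (norm (X - X0))^2))))"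
    unfolding far_def
    by (rule order_trans[OF integral_norm_bound integral_mono'[OF integrable_mult_right[OF int4] far_le]])
     (use q0 in simp)
   then show "norm (far j) <= q j * (LINT X|lborel. norm (f X * of_real (exp (- (1/4) * (norm (X - X0))^2))))"
    by (simp only: integral_mult_right_zero)
  qed
  have "q \<longlonglongrightarrow> 0"
  proof -
   define c where "c = r^2 / 4"
   have c: "c > 0" using r(1) by (simp add: c_def)
   have top: "filterlim (%j. c * real (Suc j)) at_top sequentially"
    by (rule filterlim_tendsto_pos_mult_at_top[OF tendsto_const c])
     (rule filterlim_compose[OF filterlim_real_sequentially filterlim_Suc])
   have lim: "(%j. (2 * pi / c) ^ DIM('a) * ((c * real (Suc j)) ^ DIM('a) / exp (c * real (Suc j)))) \<longlonglongrightarrow> (2 * pi / c) ^ DIM('a) * 0"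
    by (intro tendsto_mult tendsto_const filterlim_compose[OF tendsto_power_div_exp_0 top])
   have le: "q j <= (2 * pi / c) ^ DIM('a) * ((c * real (Suc j)) ^ DIM('a) / exp (c * real (Suc j)))" for j
   proof -
    have ge1: "1 <= 2 * pi * real (Suc j)" using pi_ge_two mult_mono[of 1 "2 * pi" 1 "real (Suc j)"] by simp
    have "sqrt (2 * pi / d j) <= 2 * pi * real (Suc j)"
    proof (rule real_le_lsqrt[THEN order_trans[OF _ order_refl]])
     show "0 <= 2 * pi * real (Suc j)" using ge1 by linarith
     have "2 * pi / d j = 2 * pi * real (Suc j)" by (simp add: d_def)
     also have "\<dots> <= (2 * pi * real (Suc j))^2" using self_le_power[OF ge1, of 2] by simp
     finally show "2 * pi / d j <= (2 * pi * real (Suc j))^2" .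
    qed
    then have "sqrt (2 * pi / d j) ^ DIM('a) <= (2 * pi * real (Suc j)) ^ DIM('a)"
     using d[of j] by (intro power_mono) auto
    moreover have "exp (- r\<^sup>2 / (4 * d j)) = inverse (exp (c * real (Suc j)))"
     by (simp add: c_def d_def exp_minus[symmetric])
    ultimately have "q j <= (2 * pi * real (Suc j)) ^ DIM('a) * inverse (exp (c * real (Suc j)))"
     unfolding q_def by (intro mult_mono) auto
    also have "\<dots> = (2 * pi / c) ^ DIM('a) * ((c * real (Suc j)) ^ DIM('a) / exp (c * real (Suc j)))"
    proof -
     have "2 * pi * real (Suc j) = (2 * pi / c) * (c * real (Suc j))" using c by simp
     then have "(2 * pi * real (Suc j)) ^ DIM('a) = (2 * pi / c) ^ DIM('a) * (c * real (Suc j)) ^ DIM('a)"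
      by (simp only: power_mult_distrib)
     then show ?thesis by (simp only: divide_inverse[of "(c * _) ^ _"] mult.assoc)
    qed
    finally show ?thesis .
   qed
   show ?thesis
    by (rule tendsto_sandwich[OF _ _ tendsto_const lim[unfolded mult_zero_right]])
     (use q0 le in \<open>auto intro!: always_eventually simp del: of_nat_Suc\<close>)
  qed
  from tendsto_mult[OF this tendsto_const]
  show "(%j. q j * (LINT X|lborel. norm (f X * of_real (exp (- (1/4) * (norm (X - X0))^2))))) \<longlonglongrightarrow> 0"
   by (simp only: mult_zero_left)
 qed
 moreover have "near \<longlonglongrightarrow> (2 * pi) ^ DIM('a) * f X0"
 proof -
  define G where "G j Y = indicator (ball X0 r) (X0 + sqrt (d j) *\<^sub>R Y) *\<^sub>R
   (f (X0 + sqrt (d j) *\<^sub>R Y) * of_real (sqrt (2 * pi) ^ DIM('a) * exp (- (1/2) * (norm Y)^2)))" for j Y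
  have near: "near j = (LINT Y|lborel. G j Y)" for j
  proof -
   have s: "sqrt (d j) > 0" using d[of j] by simp
   have "near j = sqrt (d j) ^ DIM('a) *\<^sub>R (LINT Y|lborel. indicator (ball X0 r) (X0 + sqrt (d j) *\<^sub>R Y) *\<^sub>R
     (f (X0 + sqrt (d j) *\<^sub>R Y) * of_real (\<phi> j (X0 + sqrt (d j) *\<^sub>R Y))))"
    unfolding near_def by (rule lborel_integral_affine[OF s])
      (intro borel_measurable_scaleR borel_measurable_indicator borel_measurable_times borel_measurable_of_real; simp)
   also have "\<dots> = (LINT Y|lborel. sqrt (d j) ^ DIM('a) *\<^sub>R (indicator (ball X0 r) (X0 + sqrt (d j) *\<^sub>R Y) *\<^sub>R
     (f (X0 + sqrt (d j) *\<^sub>R Y) * of_real (\<phi> j (X0 + sqrt (d j) *\<^sub>R Y)))))"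
    unfolding scaleR_conv_of_real integral_mult_right_zero ..
   also have "\<dots> = (LINT Y|lborel. G j Y)"
   proof (intro integral_cong_fun)
    fix Y
    have "sqrt (d j) ^ DIM('a) * \<phi> j (X0 + sqrt (d j) *\<^sub>R Y) = sqrt (2 * pi) ^ DIM('a) * exp (- (1/2) * (norm Y)^2)"
     using d[of j] s by (simp add: \<phi>_def power_mult_distrib real_sqrt_divide power_divide)
    then have E: "complex_of_real (sqrt (d j) ^ DIM('a)) * of_real (\<phi> j (X0 + sqrt (d j) *\<^sub>R Y)) =
      of_real (sqrt (2 * pi) ^ DIM('a) * exp (- (1/2) * (norm Y)^2))"
     by (simp only: of_real_mult[symmetric])
    have swap: "x * (i * (g * y)) = i * (g * (x * y))" for x i g y :: complex
     by (simp add: mult_ac)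
    show "sqrt (d j) ^ DIM('a) *\<^sub>R (indicator (ball X0 r) (X0 + sqrt (d j) *\<^sub>R Y) *\<^sub>R
     (f (X0 + sqrt (d j) *\<^sub>R Y) * of_real (\<phi> j (X0 + sqrt (d j) *\<^sub>R Y)))) = G j Y"
     unfolding G_def scaleR_conv_of_real by (subst E[symmetric]) (rule swap)
   qed
   finally show ?thesis .
  qed
  have L: "(%j. LINT Y|lborel. G j Y) \<longlonglongrightarrow>
    (LINT Y|lborel. f X0 * of_real (sqrt (2 * pi) ^ DIM('a) * exp (- (1/2) * (norm (Y::'a))^2)))"
  proof (rule integral_dominated_convergence[where w = "%Y. M * (sqrt (2 * pi) ^ DIM('a) * exp (- (1/2) * (norm Y)^2))"])
   show "integrable lborel (%Y::'a. M * (sqrt (2 * pi) ^ DIM('a) * exp (- (1/2) * (norm Y)^2)))"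
    by (intro integrable_mult_right integrable_gaussian_euclidean) simp
   show "AE Y in lborel. norm (G j Y) <= M * (sqrt (2 * pi) ^ DIM('a) * exp (- (1/2) * (norm Y)^2))" for j
   proof (intro AE_I2)
    fix Y
    have "0 <= M" by (simp add: M_def)
    then show "norm (G j Y) <= M * (sqrt (2 * pi) ^ DIM('a) * exp (- (1/2) * (norm Y)^2))"
     using M[of "X0 + sqrt (d j) *\<^sub>R Y"]
     by (cases "X0 + sqrt (d j) *\<^sub>R Y \<in> ball X0 r")
      (auto simp: G_def norm_mult norm_power intro!: mult_right_mono)
   qed
   show "AE Y in lborel. (%j. G j Y) \<longlonglongrightarrow> f X0 * of_real (sqrt (2 * pi) ^ DIM('a) * exp (- (1/2) * (norm Y)^2))"
   proof (intro AE_I2)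
    fix Y :: 'a
    have "(%j. X0 + sqrt (d j) *\<^sub>R Y) \<longlonglongrightarrow> X0 + sqrt 0 *\<^sub>R Y" by (intro tendsto_intros d0)
    then have x: "(%j. X0 + sqrt (d j) *\<^sub>R Y) \<longlonglongrightarrow> X0" by simp
    then have "eventually (%j. X0 + sqrt (d j) *\<^sub>R Y \<in> ball X0 r) sequentially"
     by (rule topological_tendstoD) (use r in auto)
    then have ev: "eventually (%j. f (X0 + sqrt (d j) *\<^sub>R Y) * of_real (sqrt (2 * pi) ^ DIM('a) * exp (- (1/2) * (norm Y)^2)) = G j Y) sequentially"
     by eventually_elim (simp add: G_def)
    have "(%j. f (X0 + sqrt (d j) *\<^sub>R Y) * of_real (sqrt (2 * pi) ^ DIM('a) * exp (- (1/2) * (norm Y)^2)))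
      \<longlonglongrightarrow> f X0 * of_real (sqrt (2 * pi) ^ DIM('a) * exp (- (1/2) * (norm Y)^2))"
     by (intro tendsto_mult tendsto_const isCont_tendsto_compose[OF cont x])
    then show "(%j. G j Y) \<longlonglongrightarrow> f X0 * of_real (sqrt (2 * pi) ^ DIM('a) * exp (- (1/2) * (norm Y)^2))"
     using ev by (rule Lim_transform_eventually)
   qed
   have hm: "(%X. indicator (ball X0 r) X *\<^sub>R f X) \<in> borel_measurable borel"
    by (intro borel_measurable_scaleR borel_measurable_indicator; simp)
   show "G j \<in> borel_measurable lborel" for j
   proof -
    have "(%Y. (indicator (ball X0 r) (X0 + sqrt (d j) *\<^sub>R Y) *\<^sub>R f (X0 + sqrt (d j) *\<^sub>R Y)) *
      of_real (sqrt (2 * pi) ^ DIM('a) * exp (- (1/2) * (norm Y)^2))) \<in> borel_measurable lborel"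
     by (intro borel_measurable_times measurable_compose[OF _ hm]) measurable
    then show ?thesis by (simp add: G_def[abs_def])
   qed
  qed measurable
  have Q: "(LINT Y|lborel. f X0 * of_real (sqrt (2 * pi) ^ DIM('a) * exp (- (1/2) * (norm (Y::'a))^2))) =
    (2 * pi) ^ DIM('a) * f X0"
  proof -
   have "(LINT Y|lborel. sqrt (2 * pi) ^ DIM('a) * exp (- (1/2) * (norm (Y::'a))^2)) =
     sqrt (2 * pi) ^ DIM('a) * sqrt (pi / (1/2)) ^ DIM('a)"
    using integrable_gaussian_euclidean(2)[of "1/2", where 'a = 'a] by simp
   also have "\<dots> = (2 * pi) ^ DIM('a)"
   proof -
    have "sqrt (2 * pi) * sqrt (pi / (1/2)) = 2 * pi" by (simp add: mult.commute[of pi 2])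
    then show ?thesis by (simp only: power_mult_distrib[symmetric])
   qed
   finally have "(LINT Y|lborel. complex_of_real (sqrt (2 * pi) ^ DIM('a) * exp (- (1/2) * (norm (Y::'a))^2))) =
     of_real ((2 * pi) ^ DIM('a))"
    by (simp only: integral_complex_of_real)
   then have "(LINT Y|lborel. f X0 * of_real (sqrt (2 * pi) ^ DIM('a) * exp (- (1/2) * (norm (Y::'a))^2))) =
     f X0 * of_real ((2 * pi) ^ DIM('a))"
    by (simp only: integral_mult_right_zero)
   then show ?thesis by (simp add: mult.commute[of "f X0"])
  qed
  show ?thesis using L unfolding Q near[abs_def, symmetric] near[symmetric] .
 qed
 ultimately have "(%j. near j + far j) \<longlonglongrightarrow> (2 * pi) ^ DIM('a) * f X0 + 0"
  by (intro tendsto_add)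
 then show ?thesis unfolding split by simp
qed

section \<open>The expansion of a weak evolution\<close>

lemma symbol_isotropic:
 fixes X0 :: "'a::euclidean_space"
 shows "symbol (%_. of_real (1 / real (Suc j))) (%b. of_real (X0 \<bullet> b)) p =
  of_real (exp (- (norm p)\<^sup>2 / (2 * real (Suc j)))) * cis (p \<bullet> X0)"
proof -
 have "of_real (exp (- (norm p)\<^sup>2 / (2 * real (Suc j)))) =
   (\<Prod>b\<in>Basis. exp (complex_of_real (- (p \<bullet> b)\<^sup>2 / (2 * real (Suc j)))))"
  by (simp add: norm_sq_Basis exp_of_real[symmetric] exp_sum[symmetric] sum_negf sum_divide_distrib)
 then show ?thesis
  unfolding symbol_def basis_prod_def cis_inner_Basis
  by (simp add: prod.distrib[symmetric] exp_add[symmetric] mult_ac)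
qed

lemma tendsto_gaussian_cutoff: "(%j. exp (- y / (2 * real (Suc j)))) \<longlonglongrightarrow> 1"
proof -
 have "(%j. exp (- (y / 2) * inverse (real (Suc j)))) \<longlonglongrightarrow> exp (- (y / 2) * 0)"
  by (intro tendsto_intros LIMSEQ_inverse_real_of_nat)
 moreover have "- y / (2 * x) = - (y / 2) * inverse x" for x :: real
  by (simp add: inverse_eq_divide)
 ultimately show ?thesis by (simp only: mult_zero_right exp_zero)
qed

context weak_evolution
begin

definition initial_transform :: "'a => complex" where
 "initial_transform p = (LINT X|lborel. \<nu> 0 X * cis (- (p \<bullet> X)))"

lemma pairing_initial_packet:
 fixes bt :: "'a => complex"
 assumes \<nu>0: "integrable lborel (\<nu> 0)" and a: "!!b. b \<in> Basis ==> Re (a b) > 0"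
 shows "pairing (\<nu> 0) (packet a bt) = (LINT p|lborel. initial_transform p * symbol a bt p)"
proof -
 have [measurable]: "\<nu> 0 \<in> borel_measurable borel" "symbol a bt \<in> borel_measurable borel"
  using \<nu>0 borel_measurable_symbol by auto
 note s = integrable_symbol[of a bt, OF a]
 have i1: "integrable lborel (%p. \<nu> 0 X * symbol a bt p * cis (- (p \<bullet> X)))" for X
  by (rule Bochner_Integration.integrable_bound[OF integrable_mult_right[OF s, of "\<nu> 0 X"]])
   (measurable, auto simp: norm_mult)
 have "integrable (lborel \<Otimes>\<^sub>M lborel) (%(X, p). \<nu> 0 X * symbol a bt p * cis (- (p \<bullet> X)))"
 proof (rule lborel_pair.Fubini_integrable)
  have "integrable lborel (%X. norm (\<nu> 0 X) * (LINT p|lborel. norm (symbol a bt p)))"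
   using \<nu>0 by (intro integrable_mult_left integrable_norm)
  then show "integrable lborel (%X. LINT p|lborel. norm (case (X, p) of (X, p) => \<nu> 0 X * symbol a bt p * cis (- (p \<bullet> X))))"
   by (simp add: norm_mult)
 qed (use i1 in auto)
 from lborel_pair.Fubini_integral[OF this]
 have "(LINT p|lborel. (LINT X|lborel. \<nu> 0 X * symbol a bt p * cis (- (p \<bullet> X)))) =
   (LINT X|lborel. (LINT p|lborel. \<nu> 0 X * symbol a bt p * cis (- (p \<bullet> X))))" by simp
 also have "\<dots> = pairing (\<nu> 0) (packet a bt)"
 proof -
  have pf: "packet a bt X = (LINT p|lborel. symbol a bt p * cis (- (p \<bullet> X)))" for X
   by (rule packet_fourier[symmetric]) (rule a)
  show ?thesis unfolding pairing_def pf mult.assoc integral_mult_right_zero ..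
 qed
 also have "(LINT p|lborel. (LINT X|lborel. \<nu> 0 X * symbol a bt p * cis (- (p \<bullet> X)))) =
   (LINT p|lborel. initial_transform p * symbol a bt p)"
 proof (intro integral_cong_fun)
  fix p
  have "(LINT X|lborel. \<nu> 0 X * symbol a bt p * cis (- (p \<bullet> X))) =
    (LINT X|lborel. (\<nu> 0 X * cis (- (p \<bullet> X))) * symbol a bt p)"
   by (intro integral_cong_fun) (simp only: mult.assoc mult.commute mult.left_commute)
  then show "(LINT X|lborel. \<nu> 0 X * symbol a bt p * cis (- (p \<bullet> X))) = initial_transform p * symbol a bt p"
   unfolding initial_transform_def integral_mult_left_zero .
 qed
 finally show ?thesis ..
qed

lemma packet_L2_kick:
 fixes bt :: "'a => complex"
 assumes a: "!!b. b \<in> Basis ==> Re (a b) = \<delta>" and \<delta>: "\<delta> > 0"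
 shows "(norm (\<gamma> * kick_factor (evolve \<theta> a l) bt q))^2 * L2_sq (packet (evolve \<theta> a l) (kick_shift (evolve \<theta> a l) bt q)) =
  (norm \<gamma>)^2 * L2_sq (packet a bt)"
proof -
 have nz: "evolve \<theta> a l b ~= 0" if "b \<in> Basis" for b
  using a[OF that] \<delta> Re_evolve[of \<theta> a l b] by (metis less_irrefl zero_complex.sel(1))
 have "norm (kick_factor (evolve \<theta> a l) bt q * packet (evolve \<theta> a l) (kick_shift (evolve \<theta> a l) bt q) X) =
   norm (packet (evolve \<theta> a l) bt X)" for X
 proof -
  have "kick_factor (evolve \<theta> a l) bt q * packet (evolve \<theta> a l) (kick_shift (evolve \<theta> a l) bt q) X =
    cis (q \<bullet> X) * packet (evolve \<theta> a l) bt X"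
   by (rule packet_modulate[symmetric]) (rule nz)
  then show ?thesis by (simp add: norm_mult del: mult_cancel_left mult_cancel_right)
 qed
 then have "(norm (kick_factor (evolve \<theta> a l) bt q))^2 * L2_sq (packet (evolve \<theta> a l) (kick_shift (evolve \<theta> a l) bt q)) =
   L2_sq (packet (evolve \<theta> a l) bt)"
  unfolding integral_mult_right_zero[symmetric] power_mult_distrib[symmetric] norm_mult[symmetric] by simp
 also have "\<dots> = L2_sq (packet a bt)"
  using packet_L2(2)[of "evolve \<theta> a l" \<delta> bt] packet_L2(2)[of a \<delta> bt] a \<delta> by simp
 finally show ?thesis by (simp add: norm_mult power_mult_distrib mult.assoc)
qed

text \<open>Iterating the Volterra equation \<open>N\<close> times leaves a pairing with a packet that has been kicked
 \<open>N\<close> times.  Kicks and free flow conserve its norm, so the remainder is controlled by the volume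
 \<open>(rate * t)^N / N!\<close> of the time simplex alone.  The factor \<open>\<gamma>\<close> must be general, because a kick
 changes the amplitude of the packet.\<close>

lemma expansion_remainder:
 fixes bt :: "'a => complex"
 assumes \<delta>: "\<delta> > 0" and \<nu>0: "integrable lborel (\<nu> 0)" and m: "integrable lborel initial_transform"
  and B: "!!u. u \<in> {0..T} ==> L2_sq (\<nu> u) <= B"
  and t: "t \<in> {0..T}" and a: "!!b. b \<in> Basis ==> Re (a b) = \<delta>"
 shows "norm (\<gamma> * pairing (\<nu> t) (packet a bt) -
   (\<Sum>n<N. moment_term initial_transform freq (%p. \<gamma> * symbol a bt p) n t))
  <= (B + (norm \<gamma>)^2 * L2_sq (packet a bt)) / 2 * (rate * t) ^ N / fact N"
 using t a
proof (induction N arbitrary: t a bt \<gamma>)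
 case 0
 have sq: "square_integrable (packet a bt)" by (rule packet_L2(1)[OF 0(2) \<delta>])
 then have sq': "square_integrable (%X. \<gamma> * packet a bt X)"
  by (auto simp: square_integrable_def norm_mult power_mult_distrib)
 have "\<gamma> * pairing (\<nu> t) (packet a bt) = pairing (\<nu> t) (%X. \<gamma> * packet a bt X)"
  unfolding pairing_def by (simp add: mult.left_commute flip: integral_mult_right_zero)
 moreover have "norm (pairing (\<nu> t) (%X. \<gamma> * packet a bt X)) <= (1 * L2_sq (\<nu> t) + L2_sq (%X. \<gamma> * packet a bt X) / 1) / 2"
  by (rule pairing_bound(2)[OF L2_continuousD(1)[OF L2] sq' zero_less_one]) (use 0 in auto)
 moreover have "L2_sq (%X. \<gamma> * packet a bt X) = (norm \<gamma>)^2 * L2_sq (packet a bt)"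
  by (simp add: norm_mult power_mult_distrib)
 ultimately show ?case using B[OF 0(1)] by simp
next
 case (Suc N)
 have t0: "0 <= t" using Suc.prems by simp
 have Rea: "Re (a b) > 0" if "b \<in> Basis" for b using Suc.prems(2)[OF that] \<delta> by simp
 define C where "C = (B + (norm \<gamma>)^2 * L2_sq (packet a bt)) / 2"
 define a' where "a' = evolve \<theta> a"
 define bt' where "bt' l k = kick_shift (a' l) bt (A k)" for l k
 define \<gamma>' where "\<gamma>' l k = \<gamma> * kick_factor (a' l) bt (A k)" for l k
 define h where "h p = \<gamma> * symbol a bt p" for p
 define G where "G l k = \<gamma>' l k * pairing (\<nu> (t - l)) (packet (a' l) (bt' l k))" for l k
 define M where "M n l k = moment_term initial_transform freq (kicked freq h k l) n (t - l)" for n l k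
 have a': "Re (a' l b) = \<delta>" "Re (a' l b) > 0" "a' l b ~= 0" if "b \<in> Basis" for l b
 proof -
  show 1: "Re (a' l b) = \<delta>" "Re (a' l b) > 0" using Suc.prems(2)[OF that] \<delta> by (auto simp: a'_def)
  then show "a' l b ~= 0" using \<delta> by (metis less_irrefl zero_complex.sel(1))
 qed
 have kicked: "kicked freq h k l = (%p. \<gamma>' l k * symbol (a' l) (bt' l k) p)" for k l
  unfolding h_def[abs_def] kicked_symbol a'_def bt'_def \<gamma>'_def ..
 have step: "norm (G l k - (\<Sum>n<N. M n l k)) <= C * (rate * (t - l)) ^ N / fact N" if l: "l \<in> {0..t}" for l k
 proof -
  have "norm (\<gamma>' l k * pairing (\<nu> (t - l)) (packet (a' l) (bt' l k)) -
   (\<Sum>n<N. moment_term initial_transform freq (%p. \<gamma>' l k * symbol (a' l) (bt' l k) p) n (t - l)))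
  <= (B + (norm (\<gamma>' l k))^2 * L2_sq (packet (a' l) (bt' l k))) / 2 * (rate * (t - l)) ^ N / fact N"
   by (rule Suc.IH) (use l Suc.prems a' in auto)
  moreover have "(norm (\<gamma>' l k))^2 * L2_sq (packet (a' l) (bt' l k)) = (norm \<gamma>)^2 * L2_sq (packet a bt)"
   unfolding \<gamma>'_def bt'_def a'_def by (rule packet_L2_kick[OF Suc.prems(2) \<delta>])
  ultimately show ?thesis unfolding G_def M_def kicked C_def by simp
 qed
 have G: "G l k = \<gamma> * pairing (\<nu> (t - l)) (%X. cis (A k \<bullet> X) * packet (a' l) bt X)" for l k
 proof -
  have pm: "cis (A k \<bullet> X) * packet (a' l) bt X = kick_factor (a' l) bt (A k) * packet (a' l) (bt' l k) X" for X
   unfolding bt'_def by (rule packet_modulate) (rule a'(3))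
  show ?thesis
   unfolding G_def \<gamma>'_def pairing_def pm
   by (simp add: mult.left_commute[of "\<nu> _ _"] mult.assoc)
 qed
 have sqa: "square_integrable (packet (a' l) bt)" for l by (rule packet_L2(1)[OF a'(1) \<delta>])
 have "\<exists>H. \<forall>p. norm (symbol a bt p) <= H"
  by (rule symbol_bounded[of a bt]) (blast intro: Rea)+
 then obtain H0 where H0: "!!p. norm (symbol a bt p) <= H0" by blast
 have H: "norm (h p) <= norm \<gamma> * H0" for p unfolding h_def norm_mult by (intro mult_left_mono H0) auto
 have hm [measurable]: "h \<in> borel_measurable borel" unfolding h_def[abs_def] using borel_measurable_symbol by measurable
 define U where "U l = (LINT k|K. s k * G l k)" for l
 have U: "U l = \<gamma> * pairing (\<nu> (t - l)) (%X. potential X * packet (a' l) bt X)" if l: "l \<in> {0..t}" for l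
 proof -
  have "square_integrable (\<nu> (t - l))" by (rule L2_continuousD(1)[OF L2]) (use l in auto)
  from pairing_potential(1)[OF this sqa, of l]
  have "\<gamma> * pairing (\<nu> (t - l)) (%X. potential X * packet (a' l) bt X) =
   \<gamma> * (LINT k|K. s k * pairing (\<nu> (t - l)) (%X. cis (A k \<bullet> X) * packet (a' l) bt X))" by (simp only:)
  also have "\<dots> = (LINT k|K. \<gamma> * (s k * pairing (\<nu> (t - l)) (%X. cis (A k \<bullet> X) * packet (a' l) bt X)))"
   by (simp only: integral_mult_right_zero)
  also have "\<dots> = U l"
   unfolding U_def G by (intro integral_cong_fun) (rule mult.left_commute)
  finally show ?thesis ..
 qed
 have Uc: "continuous_on {0..t} U"
 proof -
  have "continuous_on {0..t} (%u. pairing (\<nu> u) (%X. potential X * packet (evolve \<theta> a (t - u)) bt X))"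
   by (rule packet_volterra(2)[OF \<delta> Suc.prems(2) t0])
  then have "continuous_on {0..t} (%l. \<gamma> * pairing (\<nu> (t - l)) (%X. potential X * packet (evolve \<theta> a (t - (t - l))) bt X))"
   by (intro continuous_on_mult continuous_on_const)
    (rule continuous_on_compose2[of "{0..t}" _ "{0..t}" "%l. t - l"], auto intro!: continuous_intros)
  then show ?thesis by (rule continuous_on_eq) (simp add: U a'_def)
 qed
 have vol: "\<gamma> * pairing (\<nu> t) (packet a bt) = \<gamma> * pairing (\<nu> 0) (packet (a' t) bt) + (LINT l:{0..t}|lborel. U l)"
 proof -
  let ?f = "%u. \<gamma> * pairing (\<nu> u) (%X. potential X * packet (a' (t - u)) bt X)"
  have "(LINT l:{0..t}|lborel. U l) = (LINT l:{0..t}|lborel. ?f (t - l))"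
   by (rule set_lebesgue_integral_cong) (auto simp: U)
  also have "\<dots> = (LINT u:{0..t}|lborel. ?f u)" by (rule set_integral_reflect)
  also have "\<dots> = \<gamma> * (LINT u:{0..t}|lborel. pairing (\<nu> u) (%X. potential X * packet (a' (t - u)) bt X))"
   by (rule set_integral_mult_right)
  finally show ?thesis
   using packet_volterra(1)[OF \<delta> Suc.prems(2) t0, where bt = bt] by (simp add: a'_def distrib_left)
 qed
 have first: "moment_term initial_transform freq h 0 t = \<gamma> * pairing (\<nu> 0) (packet (a' t) bt)"
 proof -
  have "moment_term initial_transform freq h 0 t =
    (LINT p|lborel. \<gamma> * (initial_transform p * (cis (- freq p * t) * symbol a bt p)))"
   unfolding moment_term_def h_def by (simp add: mult_ac)
  also have "\<dots> = \<gamma> * (LINT p|lborel. initial_transform p * symbol (a' t) bt p)"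
   unfolding symbol_evolve a'_def by simp
  finally show ?thesis using pairing_initial_packet[OF \<nu>0 a'(2)[where l = t], where bt = bt] by simp
 qed
 define W where "W n l = (LINT k|K. s k * M n l k)" for n l
 define Q where "Q n = (LINT p|lborel. norm (initial_transform p)) * (norm \<gamma> * H0 * (rate * t) ^ n / fact n)" for n
 have mm [measurable]: "initial_transform \<in> borel_measurable borel" using m by auto
 have M_meas: "(%(l, k). M n l k) \<in> borel_measurable (lborel \<Otimes>\<^sub>M K)" for n
  unfolding M_def moment_term_def by measurable
 have M_le: "norm (M n l k) <= Q n" if l: "l \<in> {0..t}" for n l k
 proof -
  have km: "kicked freq h k l \<in> borel_measurable borel" unfolding kicked_def by measurable
  have "norm (M n l k) <= (LINT p|lborel. norm (initial_transform p)) * (norm \<gamma> * H0 * (rate * (t - l)) ^ n / fact n)"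
   unfolding M_def by (rule integrable_moment(2)[OF m _ km]) (use l H in auto)
  also have "\<dots> <= Q n"
   unfolding Q_def using l H[of 0] by (intro mult_left_mono divide_right_mono power_mono)
    (auto intro: order_trans[OF norm_ge_zero])
  finally show ?thesis .
 qed
 have W_int: "set_integrable lborel {0..t} (W n)" for n
 proof (rule set_integrable_bounded_Icc)
  show "W n \<in> borel_measurable borel"
   unfolding W_def[abs_def] using M_meas[of n] by measurable
  show "norm (W n l) <= rate * Q n" if "l \<in> {0..t}" for l
   unfolding W_def using M_le[OF that] by (rule norm_scatter_le)
 qed
 have M_k: "(%k. M n l k) \<in> borel_measurable K" for n l
  unfolding M_def moment_term_def by measurable
 have sM_int: "integrable K (%k. s k * M n l k)" if "l \<in> {0..t}" for n l
  by (rule integrable_const_bound[where B = "Q n"]) (use M_k M_le[OF that] in \<open>auto intro!: AE_I2 norm_s_mult_le\<close>)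
 have G_meas: "(%k. G l k) \<in> borel_measurable K" if l: "l \<in> {0..t}" for l
 proof -
  have "square_integrable (\<nu> (t - l))" by (rule L2_continuousD(1)[OF L2]) (use l in auto)
  from pairing_potential(2)[OF this sqa, of l] show ?thesis unfolding G by measurable
 qed
 have sG_int: "integrable K (%k. s k * G l k)" if l: "l \<in> {0..t}" for l
 proof (rule integrable_const_bound[where B = "C * (rate * (t - l)) ^ N / fact N + (\<Sum>n<N. Q n)"])
  show "AE k in K. norm (s k * G l k) <= C * (rate * (t - l)) ^ N / fact N + (\<Sum>n<N. Q n)"
  proof (intro AE_I2 norm_s_mult_le)
   fix k
   have "norm (G l k) <= norm (G l k - (\<Sum>n<N. M n l k)) + norm (\<Sum>n<N. M n l k)"
    using norm_triangle_ineq[of "G l k - (\<Sum>n<N. M n l k)" "\<Sum>n<N. M n l k"] by simp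
   also have "\<dots> <= C * (rate * (t - l)) ^ N / fact N + (\<Sum>n<N. Q n)"
    by (intro add_mono step l sum_norm_le M_le)
   finally show "norm (G l k) <= C * (rate * (t - l)) ^ N / fact N + (\<Sum>n<N. Q n)" .
  qed
 qed (use G_meas[OF l] in measurable)
 have shift: "moment_term initial_transform freq h (Suc n) t = (LINT l:{0..t}|lborel. W n l)" for n
  unfolding W_def M_def by (rule moment_term_last_kick[OF m _ hm H t0]) measurable
 have sumW: "(\<Sum>n<N. (LINT l:{0..t}|lborel. W n l)) = (LINT l:{0..t}|lborel. (\<Sum>n<N. W n l))"
  using W_int unfolding set_lebesgue_integral_def set_integrable_def
  by (simp add: scaleR_sum_right flip: Bochner_Integration.integral_sum)
 have "(\<Sum>n<Suc N. moment_term initial_transform freq h n t) =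
   \<gamma> * pairing (\<nu> 0) (packet (a' t) bt) + (LINT l:{0..t}|lborel. (\<Sum>n<N. W n l))"
  unfolding sum.lessThan_Suc_shift first shift sumW ..
 then have "\<gamma> * pairing (\<nu> t) (packet a bt) - (\<Sum>n<Suc N. moment_term initial_transform freq h n t) =
   (LINT l:{0..t}|lborel. U l) - (LINT l:{0..t}|lborel. (\<Sum>n<N. W n l))"
  unfolding vol by simp
 also have "\<dots> = (LINT l:{0..t}|lborel. U l - (\<Sum>n<N. W n l))"
 proof (rule set_integral_diff(2)[symmetric])
  show "set_integrable lborel {0..t} U" by (rule set_integrable_continuous_Icc[OF Uc])
  show "set_integrable lborel {0..t} (%l. \<Sum>n<N. W n l)"
   unfolding set_integrable_def scaleR_sum_right
   by (rule Bochner_Integration.integrable_sum) (rule W_int[unfolded set_integrable_def])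
 qed
 finally have diff: "\<gamma> * pairing (\<nu> t) (packet a bt) - (\<Sum>n<Suc N. moment_term initial_transform freq h n t) =
   (LINT l:{0..t}|lborel. U l - (\<Sum>n<N. W n l))" .
 have le: "norm (U l - (\<Sum>n<N. W n l)) <= (C * rate ^ Suc N / fact N) * (t - l) ^ N" if l: "l \<in> {0..t}" for l
 proof -
  have "U l - (\<Sum>n<N. W n l) = (LINT k|K. s k * (G l k - (\<Sum>n<N. M n l k)))"
   unfolding U_def W_def using sG_int[OF l] sM_int[OF l]
   by (simp add: right_diff_distrib sum_distrib_left)
  also have "norm \<dots> <= rate * (C * (rate * (t - l)) ^ N / fact N)"
   by (rule norm_scatter_le) (rule step[OF l])
  finally show ?thesis by (simp add: power_mult_distrib mult_ac)
 qed
 have "norm (LINT l:{0..t}|lborel. U l - (\<Sum>n<N. W n l)) <= C * rate ^ Suc N / fact N * t ^ Suc N / real (Suc N)"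
  by (rule norm_set_integral_reflect_power_le[OF t0 le])
 also have "\<dots> = C * (rate * t) ^ Suc N / fact (Suc N)"
  using dyson_coefficient_rearrange[of 1 rate C N t] by (simp add: power_mult_distrib mult_ac)
 finally show ?case unfolding diff[unfolded h_def[abs_def], symmetric] C_def .
qed

lemma packet_expansion:
 fixes bt :: "'a => complex"
 assumes \<delta>: "\<delta> > 0" and \<nu>0: "integrable lborel (\<nu> 0)" and m: "integrable lborel initial_transform"
  and t: "0 <= t" and a: "!!b. b \<in> Basis ==> Re (a b) = \<delta>"
 shows "(%n. moment_term initial_transform freq (symbol a bt) n t) sums pairing (\<nu> t) (packet a bt)"
proof -
 obtain B where B: "!!u. u \<in> {0..t} ==> L2_sq (\<nu> u) <= B" using L2_bounded_on_Icc[OF L2] by metis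
 define C where "C = (B + L2_sq (packet a bt)) / 2"
 have "(%N. pairing (\<nu> t) (packet a bt) - (\<Sum>n<N. moment_term initial_transform freq (symbol a bt) n t)) \<longlonglongrightarrow> 0"
 proof (rule Lim_null_comparison[where g = "%N. C * ((rate * t) ^ N /\<^sub>R fact N)"])
  show "\<forall>\<^sub>F N in sequentially. norm (pairing (\<nu> t) (packet a bt) -
    (\<Sum>n<N. moment_term initial_transform freq (symbol a bt) n t)) <= C * ((rate * t) ^ N /\<^sub>R fact N)"
  proof (intro always_eventually allI)
   fix N
   have e: "norm (1 * pairing (\<nu> t) (packet a bt) - (\<Sum>n<N. moment_term initial_transform freq (%p. 1 * symbol a bt p) n t))
     <= (B + (norm (1::complex))^2 * L2_sq (packet a bt)) / 2 * (rate * t) ^ N / fact N"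
    by (rule expansion_remainder[OF \<delta> \<nu>0 m B _ a]) (use t in auto)
   have eq: "C * ((rate * t) ^ N /\<^sub>R fact N) = C * (rate * t) ^ N / fact N"
    by (simp only: real_scaleR_def divide_inverse_commute mult.left_commute)
   show "norm (pairing (\<nu> t) (packet a bt) - (\<Sum>n<N. moment_term initial_transform freq (symbol a bt) n t))
     <= C * ((rate * t) ^ N /\<^sub>R fact N)"
    unfolding eq using e by (simp only: mult_1 norm_one power_one C_def)
  qed
  have "(%N. C * ((rate * t) ^ N /\<^sub>R fact N)) \<longlonglongrightarrow> C * 0"
   by (intro tendsto_mult tendsto_const summable_LIMSEQ_zero[OF summable_exp_generic])
  then show "(%N. C * ((rate * t) ^ N /\<^sub>R fact N)) \<longlonglongrightarrow> 0" by simp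
 qed
 then have "(%N. pairing (\<nu> t) (packet a bt) - (pairing (\<nu> t) (packet a bt) -
   (\<Sum>n<N. moment_term initial_transform freq (symbol a bt) n t))) \<longlonglongrightarrow> pairing (\<nu> t) (packet a bt) - 0"
  by (intro tendsto_diff tendsto_const)
 then show ?thesis unfolding sums_def by simp
qed

text \<open>The expansion for packets is uniform in their width, so the width can be sent to zero term
 by term; continuity at the point identifies the limit of the left-hand side.\<close>

theorem pointwise_expansion:
 assumes \<nu>0: "integrable lborel (\<nu> 0)" and m: "integrable lborel initial_transform"
  and t: "0 <= t" and cont: "isCont (\<nu> t) X0"
 shows "(%n. moment_term initial_transform freq (%p. cis (p \<bullet> X0)) n t) sums ((2 * pi) ^ DIM('a) * \<nu> t X0)"
proof -
 define a where "a j = (%_::'a. complex_of_real (1 / real (Suc j)))" for j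
 define bt where "bt b = complex_of_real (X0 \<bullet> b)" for b
 define I where "I = (LINT p|lborel. norm (initial_transform p))"
 have [measurable]: "initial_transform \<in> borel_measurable borel" using m by auto
 have sy: "symbol (a j) bt p = of_real (exp (- (norm p)\<^sup>2 / (2 * real (Suc j)))) * cis (p \<bullet> X0)" for j p
  unfolding a_def bt_def by (rule symbol_isotropic)
 have sy_le: "norm (symbol (a j) bt p) <= 1" for j p
  unfolding sy by (simp add: norm_mult)
 have sy_lim: "(%j. symbol (a j) bt p) \<longlonglongrightarrow> cis (p \<bullet> X0)" for p
 proof -
  have "(%j. of_real (exp (- (norm p)\<^sup>2 / (2 * real (Suc j)))) * cis (p \<bullet> X0)) \<longlonglongrightarrow> of_real 1 * cis (p \<bullet> X0)"
   by (intro tendsto_mult tendsto_const tendsto_of_real tendsto_gaussian_cutoff)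
  then show ?thesis unfolding sy by (simp only: of_real_1 mult_1)
 qed
 have [measurable]: "symbol (a j) bt \<in> borel_measurable borel" for j by (rule borel_measurable_symbol)
 have cm: "(%p. cis (p \<bullet> X0)) \<in> borel_measurable borel" by measurable
 have terms: "(%j. moment_term initial_transform freq (symbol (a j) bt) n t) \<longlonglongrightarrow>
   moment_term initial_transform freq (%p. cis (p \<bullet> X0)) n t" for n
  unfolding moment_term_def
 proof (rule integral_dominated_convergence[where w = "%p. norm (initial_transform p) * (1 * (rate * t) ^ n / fact n)"])
  show "integrable lborel (%p. norm (initial_transform p) * (1 * (rate * t) ^ n / fact n))"
   using m by (intro integrable_mult_left integrable_norm)
  show "AE p in lborel. (%j. initial_transform p * dyson freq (symbol (a j) bt) n t p) \<longlonglongrightarrow>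
    initial_transform p * dyson freq (%p. cis (p \<bullet> X0)) n t p"
   by (intro AE_I2 tendsto_mult tendsto_const tendsto_dyson[where H = 1] sy_le sy_lim t cm) measurable
  show "AE p in lborel. norm (initial_transform p * dyson freq (symbol (a j) bt) n t p) <=
    norm (initial_transform p) * (1 * (rate * t) ^ n / fact n)" for j
   unfolding norm_mult by (intro AE_I2 mult_left_mono norm_dyson_le sy_le t) auto
  show "(%p. initial_transform p * dyson freq (%p. cis (p \<bullet> X0)) n t p) \<in> borel_measurable lborel"
   using cm by measurable
 qed measurable
 define Mb where "Mb n = I * ((rate * t) ^ n /\<^sub>R fact n)" for n
 have sumMb: "summable Mb" unfolding Mb_def by (intro summable_mult summable_exp_generic)
 have bound: "norm (moment_term initial_transform freq (symbol (a j) bt) n t) <= Mb n" for n j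
 proof -
  have eq: "Mb n = I * (1 * (rate * t) ^ n / fact n)"
   by (simp only: Mb_def real_scaleR_def mult_1 divide_inverse_commute)
  show ?thesis unfolding eq I_def
   by (rule integrable_moment(2)[OF m borel_measurable_quad_freq borel_measurable_symbol sy_le t])
 qed
 have tan: "eventually (%j. summable (%n. norm (moment_term initial_transform freq (symbol (a j) bt) n t))) sequentially \<and>
   summable (%n. norm (moment_term initial_transform freq (%p. cis (p \<bullet> X0)) n t)) \<and>
   (%j. \<Sum>n. moment_term initial_transform freq (symbol (a j) bt) n t) \<longlonglongrightarrow>
    (\<Sum>n. moment_term initial_transform freq (%p. cis (p \<bullet> X0)) n t)"
  by (rule tannerys_theorem[OF terms _ sumMb]) (use bound in \<open>auto intro!: always_eventually\<close>)
 have "(%n. moment_term initial_transform freq (symbol (a j) bt) n t) sums pairing (\<nu> t) (packet (a j) bt)" for j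
  by (rule packet_expansion[OF _ \<nu>0 m t, of "1 / real (Suc j)"]) (auto simp: a_def)
 then have "(\<Sum>n. moment_term initial_transform freq (symbol (a j) bt) n t) = pairing (\<nu> t) (packet (a j) bt)" for j
  by (rule sums_unique[symmetric])
 moreover have "(%j. pairing (\<nu> t) (packet (a j) bt)) \<longlonglongrightarrow> (2 * pi) ^ DIM('a) * \<nu> t X0"
  unfolding a_def bt_def by (rule pairing_approximate_identity[OF L2_continuousD(1)[OF L2 t] cont])
 ultimately have "(%j. \<Sum>n. moment_term initial_transform freq (symbol (a j) bt) n t) \<longlonglongrightarrow>
   (2 * pi) ^ DIM('a) * \<nu> t X0" by (simp only:)
 then have "(\<Sum>n. moment_term initial_transform freq (%p. cis (p \<bullet> X0)) n t) = (2 * pi) ^ DIM('a) * \<nu> t X0"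
  by (rule LIMSEQ_unique[OF conjunct2[OF conjunct2[OF tan]]])
 moreover have "summable (%n. moment_term initial_transform freq (%p. cis (p \<bullet> X0)) n t)"
  by (rule summable_norm_cancel[OF conjunct1[OF conjunct2[OF tan]]])
 ultimately show ?thesis by (simp only: sums_iff simp_thms)
qed

end

section \<open>The spectral density of a covariance function\<close>

lemma (in product_prob_space) distr_PiM_pair:
 assumes "i \<in> I" "j \<in> I" "i ~= j"
 shows "distr (Pi\<^sub>M I M) (M i \<Otimes>\<^sub>M M j) (%\<omega>. (\<omega> i, \<omega> j)) = M i \<Otimes>\<^sub>M M j"
proof (rule pair_measure_eqI[symmetric])
 have [measurable]: "(%\<omega>. (\<omega> i, \<omega> j)) \<in> Pi\<^sub>M I M \<rightarrow>\<^sub>M M i \<Otimes>\<^sub>M M j"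
  using assms by measurable
 fix A B assume AB: "A \<in> sets (M i)" "B \<in> sets (M j)"
 have "emeasure (distr (Pi\<^sub>M I M) (M i \<Otimes>\<^sub>M M j) (%\<omega>. (\<omega> i, \<omega> j))) (A \<times> B) =
   emeasure (Pi\<^sub>M I M) ((%\<omega>. (\<omega> i, \<omega> j)) -` (A \<times> B) \<inter> space (Pi\<^sub>M I M))"
  using AB by (intro emeasure_distr) auto
 also have "(%\<omega>. (\<omega> i, \<omega> j)) -` (A \<times> B) \<inter> space (Pi\<^sub>M I M) =
   {\<omega> \<in> space (Pi\<^sub>M I M). \<forall>l\<in>{i, j}. \<omega> l \<in> (if l = i then A else B)}"
  using assms(3) by auto
 also have "emeasure (Pi\<^sub>M I M) \<dots> = (\<Prod>l\<in>{i, j}. emeasure (M l) (if l = i then A else B))"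
  using assms AB by (intro emeasure_PiM_Collect) auto
 finally show "emeasure (M i) A * emeasure (M j) B =
   emeasure (distr (Pi\<^sub>M I M) (M i \<Otimes>\<^sub>M M j) (%\<omega>. (\<omega> i, \<omega> j))) (A \<times> B)"
  using assms(3) by simp
qed (auto intro: prob_space_imp_sigma_finite prob_space)

lemma covariance_bounded:
 assumes "covariance_function C"
 shows "\<bar>C x\<bar> <= C 0"
proof -
 have q: "0 <= (\<Sum>i<2. \<Sum>j<2. a i * a j * C (y i - y j))" for a :: "nat => real" and y
  using assms unfolding covariance_function_def by blast
 have even: "C (- x) = C x" using assms by (auto simp: covariance_function_def)
 from q[of "%i. 1" "%i. if i = 0 then x else 0"] q[of "%i. if i = 0 then 1 else -1" "%i. if i = 0 then x else 0"]
 show ?thesis using even by (simp add: numeral_2_eq_2)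
qed

text \<open>Averaging the positive definiteness inequality over \<open>n\<close> independent points with law \<open>\<mu>\<close> gives
 \<open>n\<close> bounded diagonal terms and \<open>n (n - 1)\<close> copies of the double integral, which therefore
 cannot be negative.\<close>

lemma covariance_double_integral_nonneg:
 assumes C: "covariance_function C" and "prob_space \<mu>" and [measurable_cong]: "sets \<mu> = sets borel"
  and [measurable]: "a \<in> borel_measurable borel" and a: "!!x. \<bar>a x\<bar> <= 1"
 shows "0 <= (LINT z|(\<mu> \<Otimes>\<^sub>M \<mu>). a (fst z) * a (snd z) * C (fst z - snd z))"
proof (rule ccontr)
 interpret prob_space \<mu> by fact
 interpret P: product_prob_space "%_::nat. \<mu>" UNIV by unfold_locales
 interpret PP: pair_prob_space \<mu> \<mu> ..
 have [measurable]: "C \<in> borel_measurable borel"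
  using C by (auto simp: covariance_function_def intro: borel_measurable_continuous_onI)
 have Cb: "\<bar>C x\<bar> <= C 0" for x by (rule covariance_bounded[OF C])
 have C0: "0 <= C 0" using Cb[of 0] by linarith
 have pd0: "0 <= (\<Sum>i<n. \<Sum>j<n. b i * b j * C (y i - y j))" for n :: nat and b y
  using C unfolding covariance_function_def by blast
 have pd: "0 <= (\<Sum>i<n. \<Sum>j<n. a (y i) * a (y j) * C (y i - y j))" for n :: nat and y
  by (rule pd0)
 define J where "J = (LINT z|(\<mu> \<Otimes>\<^sub>M \<mu>). a (fst z) * a (snd z) * C (fst z - snd z))"
 have le: "\<bar>a x * a y * C z\<bar> <= C 0" for x y z
  unfolding abs_mult using mult_mono[OF mult_mono[OF a[of x] a[of y]] Cb[of z]] by simp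
 define T where "T i j \<omega> = a (\<omega> i) * a (\<omega> j) * C (\<omega> i - \<omega> j)" for i j :: nat and \<omega>
 have [measurable]: "T i j \<in> borel_measurable (Pi\<^sub>M UNIV (%_. \<mu>))" for i j
  unfolding T_def[abs_def] by measurable
 have int: "integrable (Pi\<^sub>M UNIV (%_. \<mu>)) (T i j)" for i j
  by (rule P.P.integrable_const_bound[where B = "C 0"]) (auto simp: T_def le)
 have off: "(LINT \<omega>|Pi\<^sub>M UNIV (%_. \<mu>). T i j \<omega>) = J" if "i ~= j" for i j
 proof -
  have "J = (LINT z|distr (Pi\<^sub>M UNIV (%_. \<mu>)) (\<mu> \<Otimes>\<^sub>M \<mu>) (%\<omega>. (\<omega> i, \<omega> j)). a (fst z) * a (snd z) * C (fst z - snd z))"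
   unfolding J_def using P.distr_PiM_pair[of i j] that by simp
  also have "\<dots> = (LINT \<omega>|Pi\<^sub>M UNIV (%_. \<mu>). T i j \<omega>)"
   by (subst integral_distr) (auto simp: T_def[abs_def])
  finally show ?thesis ..
 qed
 have diag: "(LINT \<omega>|Pi\<^sub>M UNIV (%_. \<mu>). T i i \<omega>) <= C 0" for i
 proof (rule P.P.integral_le_const[OF int])
  show "AE \<omega> in Pi\<^sub>M UNIV (%_. \<mu>). T i i \<omega> <= C 0"
   unfolding T_def by (intro AE_I2 abs_le_D1[OF le])
 qed
 assume "\<not> 0 <= (LINT z|(\<mu> \<Otimes>\<^sub>M \<mu>). a (fst z) * a (snd z) * C (fst z - snd z))"
 then have J: "J < 0" by (simp add: J_def)
 obtain n :: nat where n: "real n > C 0 / (- J)" using reals_Archimedean2 by blast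
 then have n2: "C 0 + real n * J < 0" using J by (simp add: field_simps)
 have "0 <= (LINT \<omega>|Pi\<^sub>M UNIV (%_. \<mu>). (\<Sum>i<Suc n. \<Sum>j<Suc n. T i j \<omega>))"
  unfolding T_def by (intro Bochner_Integration.integral_nonneg) (rule pd)
 also have "\<dots> = (\<Sum>i<Suc n. \<Sum>j<Suc n. (LINT \<omega>|Pi\<^sub>M UNIV (%_. \<mu>). T i j \<omega>))"
  using int by simp
 also have "\<dots> <= (\<Sum>i<Suc n. C 0 + real n * J)"
 proof (rule sum_mono)
  fix i assume i: "i \<in> {..<Suc n}"
  have "(\<Sum>j<Suc n. (LINT \<omega>|Pi\<^sub>M UNIV (%_. \<mu>). T i j \<omega>)) =
    (LINT \<omega>|Pi\<^sub>M UNIV (%_. \<mu>). T i i \<omega>) + (\<Sum>j\<in>{..<Suc n} - {i}. J)"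
   using i off by (subst sum.remove[of _ i]) (auto intro!: sum.cong)
  also have "(\<Sum>j\<in>{..<Suc n} - {i}. J) = real n * J" using i by simp
  finally show "(\<Sum>j<Suc n. (LINT \<omega>|Pi\<^sub>M UNIV (%_. \<mu>). T i j \<omega>)) <= C 0 + real n * J" using diag[of i] by simp
 qed
 also have "\<dots> = real (Suc n) * (C 0 + real n * J)" by simp
 also have "\<dots> < 0" using n2 by (simp add: mult_pos_neg)
 finally show False by simp
qed

lemma integral_translate:
 fixes f :: "'a::euclidean_space => 'b::{banach, second_countable_topology}"
 assumes [measurable]: "f \<in> borel_measurable borel"
 shows "(LINT x|lborel. f (x + y)) = (LINT x|lborel. f x)"
proof -
 have "(LINT x|distr lborel borel ((+) y). f x) = (LINT x|lborel. f (x + y))"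
  by (subst integral_distr) (auto simp: add.commute)
 then show ?thesis unfolding lborel_distr_plus by simp
qed

lemma integrable_translate:
 fixes f :: "'a::euclidean_space => 'b::{banach, second_countable_topology}"
 assumes "integrable lborel f"
 shows "integrable lborel (%x. f (x + y))"
proof -
 have [measurable]: "f \<in> borel_measurable borel" using assms by auto
 have "integrable (distr lborel borel ((+) y)) f" unfolding lborel_distr_plus by fact
 then show ?thesis by (subst (asm) integrable_distr_eq) (auto simp: add.commute)
qed

lemma integral_reflect:
 fixes f :: "'a::euclidean_space => 'b::{banach, second_countable_topology}"
 assumes [measurable]: "f \<in> borel_measurable borel"
 shows "(LINT x|lborel. f (- x)) = (LINT x|lborel. f x)"
proof -
 have "(LINT x|lborel. f x) = (LINT x|density (distr lborel borel (%x::'a. 0 + (-1) *\<^sub>R x)) (%_. \<bar>-1::real\<bar>^DIM('a)). f x)"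
  using lborel_affine[of "-1" "0::'a"] by simp
 also have "\<dots> = (LINT x|distr lborel borel (%x::'a. 0 + (-1) *\<^sub>R x). \<bar>-1::real\<bar>^DIM('a) *\<^sub>R f x)"
  by (rule integral_density) auto
 also have "\<dots> = (LINT x|lborel. f (- x))" by (subst integral_distr) auto
 finally show ?thesis ..
qed

lemma gaussian_autocorrelation:
 fixes v :: "'a::euclidean_space"
 assumes "c > 0"
 shows "integrable lborel (%y. exp (- c * (norm (y + v))^2) * exp (- c * (norm y)^2))"
  and "(LINT y|lborel. exp (- c * (norm (y + v))^2) * exp (- c * (norm y)^2)) =
   sqrt (pi / (2 * c)) ^ DIM('a) * exp (- (c / 2) * (norm v)^2)"
proof -
 have eq: "exp (- c * (norm (y + v))^2) * exp (- c * (norm y)^2) =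
   exp (- (2 * c) * (norm (y + v /\<^sub>R 2))^2) * exp (- (c / 2) * (norm v)^2)" for y
 proof -
  have "(norm (y + v))^2 + (norm y)^2 = 2 * (norm (y + v /\<^sub>R 2))^2 + (norm v)^2 / 2"
   unfolding power2_norm_eq_inner by (simp add: inner_add_left inner_add_right inner_commute)
  from arg_cong[OF this, of "%w. exp (- c * w)"] show ?thesis
   by (simp add: distrib_left mult_ac flip: exp_add)
 qed
 have i: "integrable lborel (%y::'a. exp (- (2 * c) * (norm y)^2))"
  by (rule integrable_gaussian_euclidean(1)) (use assms in simp)
 show "integrable lborel (%y. exp (- c * (norm (y + v))^2) * exp (- c * (norm y)^2))"
  unfolding eq by (rule integrable_mult_left[OF integrable_translate[OF i]])
 have "(LINT y|lborel. exp (- (2 * c) * (norm (y + v /\<^sub>R 2))^2)) = sqrt (pi / (2 * c)) ^ DIM('a)"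
 proof -
  have "(LINT y|lborel. exp (- (2 * c) * (norm (y + v /\<^sub>R 2))^2)) = (LINT y::'a|lborel. exp (- (2 * c) * (norm y)^2))"
   by (rule integral_translate[where f = "%y::'a. exp (- (2 * c) * (norm y)^2)"]) measurable
  then show ?thesis using integrable_gaussian_euclidean(2)[of "2 * c", where 'a = 'a] assms by simp
 qed
 then show "(LINT y|lborel. exp (- c * (norm (y + v))^2) * exp (- c * (norm y)^2)) =
   sqrt (pi / (2 * c)) ^ DIM('a) * exp (- (c / 2) * (norm v)^2)"
  unfolding eq integral_mult_left_zero by simp
qed

text \<open>Convolving two equal Gaussians: the double integral of a function of the difference is a
 single Gaussian integral with twice the variance.\<close>

lemma integral_difference_gaussian:
 fixes F :: "'a::euclidean_space => 'b::{real_normed_field, banach, second_countable_topology}"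
 assumes [measurable]: "F \<in> borel_measurable borel" and c: "c > 0"
  and F: "integrable lborel (%v. F v * of_real (exp (- (c / 2) * (norm v)^2)))"
 shows "(LINT y|lborel. (LINT x|lborel. F (x - y) * of_real (exp (- c * (norm x)^2) * exp (- c * (norm y)^2)))) =
   of_real (sqrt (pi / (2 * c)) ^ DIM('a)) * (LINT v|lborel. F v * of_real (exp (- (c / 2) * (norm v)^2)))"
proof -
 let ?g = "%x::'a. exp (- c * (norm x)^2)"
 have shift: "(LINT x|lborel. F (x - y) * of_real (?g x * ?g y)) = (LINT v|lborel. F v * of_real (?g (v + y) * ?g y))" for y
 proof -
  have "(%x. F (x - y) * of_real (?g x * ?g y)) \<in> borel_measurable borel" by measurable
  from integral_translate[OF this, of y] show ?thesis by simp
 qed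
 have i3: "integrable (lborel \<Otimes>\<^sub>M lborel) (%(v, y). F v * of_real (?g (v + y) * ?g y))"
 proof (rule lborel_pair.Fubini_integrable)
  have a: "integrable lborel (%y. ?g (v + y) * ?g y)" "(LINT y|lborel. ?g (v + y) * ?g y) = sqrt (pi / (2 * c)) ^ DIM('a) * exp (- (c / 2) * (norm v)^2)" for v
   using gaussian_autocorrelation[OF c, of v] by (simp_all add: add.commute)
  show "AE v in lborel. integrable lborel (%y. case (v, y) of (v, y) => F v * of_real (?g (v + y) * ?g y))"
   using a(1) by (auto intro!: AE_I2 simp del: of_real_mult)
  have "integrable lborel (%v. norm (F v) * (sqrt (pi / (2 * c)) ^ DIM('a) * exp (- (c / 2) * (norm v)^2)))"
   using integrable_mult_right[OF integrable_norm[OF F], of "sqrt (pi / (2 * c)) ^ DIM('a)"]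
   by (simp only: norm_mult norm_of_real abs_exp_cancel mult.left_commute)
  moreover have "(LINT y|lborel. norm (case (v, y) of (v, y) => F v * of_real (?g (v + y) * ?g y))) =
    norm (F v) * (sqrt (pi / (2 * c)) ^ DIM('a) * exp (- (c / 2) * (norm v)^2))" for v
   by (simp only: prod.case norm_mult norm_of_real abs_mult abs_exp_cancel integral_mult_right_zero a(2))
  ultimately show "integrable lborel (%v. LINT y|lborel. norm (case (v, y) of (v, y) => F v * of_real (?g (v + y) * ?g y)))"
   by (simp only:)
 qed measurable
 have "(LINT y|lborel. (LINT x|lborel. F (x - y) * of_real (?g x * ?g y))) = (LINT y|lborel. (LINT v|lborel. F v * of_real (?g (v + y) * ?g y)))"
  unfolding shift ..
 also have "\<dots> = (LINT v|lborel. (LINT y|lborel. F v * of_real (?g (v + y) * ?g y)))"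
  using lborel_pair.Fubini_integral[OF i3] by simp
 also have "\<dots> = (LINT v|lborel. F v * of_real (sqrt (pi / (2 * c)) ^ DIM('a) * exp (- (c / 2) * (norm v)^2)))"
 proof (intro integral_cong_fun)
  fix v
  have "(LINT y|lborel. of_real (?g (v + y) * ?g y) :: 'b) = of_real (LINT y|lborel. ?g (v + y) * ?g y)"
   by (rule integral_of_real) (use gaussian_autocorrelation(1)[OF c, of v] in \<open>simp add: add.commute\<close>)
  then show "(LINT y|lborel. F v * of_real (?g (v + y) * ?g y)) = F v * of_real (sqrt (pi / (2 * c)) ^ DIM('a) * exp (- (c / 2) * (norm v)^2))"
   using gaussian_autocorrelation(2)[OF c, of v] by (simp add: add.commute del: of_real_mult)
 qed
 also have "\<dots> = of_real (sqrt (pi / (2 * c)) ^ DIM('a)) * (LINT v|lborel. F v * of_real (exp (- (c / 2) * (norm v)^2)))"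
  by (simp add: mult_ac flip: integral_mult_right_zero)
 finally show "(LINT y|lborel. (LINT x|lborel. F (x - y) * of_real (?g x * ?g y))) =
   of_real (sqrt (pi / (2 * c)) ^ DIM('a)) * (LINT v|lborel. F v * of_real (exp (- (c / 2) * (norm v)^2)))" .
qed

definition spectral_density :: "(plane => real) => plane => real" where
 "spectral_density C k = (LINT v|lborel. C v * cos (k \<bullet> v)) / (2 * pi)^2"

text \<open>Bochner's theorem for integrable covariances: with a wide Gaussian law and the weights
 \<open>cos (k \<bullet> x)\<close> and \<open>sin (k \<bullet> x)\<close>, the sum of the two double integrals is a multiple of the
 regularised cosine transform.\<close>

lemma cosine_transform_nonneg:
 assumes C: "covariance_function C" "integrable lborel C"
 shows "0 <= (LINT v|lborel. C v * cos (k \<bullet> v))"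
proof -
 have [measurable]: "C \<in> borel_measurable borel" using C by auto
 define F where "F v = C v * cos (k \<bullet> v)" for v
 have [measurable]: "F \<in> borel_measurable borel" unfolding F_def[abs_def] by measurable
 have F: "integrable lborel F"
  by (rule Bochner_Integration.integrable_bound[OF C(2)]) (auto simp: F_def abs_mult mult_left_le intro!: AE_I2)
 have pos: "0 <= (LINT v|lborel. F v * exp (- (c / 2) * (norm v)^2))" if c: "c > 0" for c
 proof -
  define Z where "Z = sqrt (pi / c) ^ DIM(plane)"
  have Z: "Z > 0" using c by (simp add: Z_def)
  define g where "g x = exp (- c * (norm (x::plane))^2) / Z" for x
  define \<mu> where "\<mu> = density lborel (%x. ennreal (g x))"
  have g0: "0 <= g x" for x using Z by (simp add: g_def)
  have [measurable]: "g \<in> borel_measurable borel" unfolding g_def[abs_def] by measurable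
  have gi: "integrable lborel g" "(LINT x|lborel. g x) = 1"
   using integrable_gaussian_euclidean[OF c, where 'a = plane] Z unfolding g_def[abs_def] Z_def[symmetric] by simp_all
  have prob: "prob_space \<mu>"
  proof
   have "emeasure \<mu> (space \<mu>) = (\<integral>\<^sup>+ x. ennreal (g x) \<partial>lborel)"
    unfolding \<mu>_def by (subst emeasure_density) auto
   also have "\<dots> = 1" using nn_integral_eq_integral[OF gi(1)] g0 gi(2) by simp
   finally show "emeasure \<mu> (space \<mu>) = 1" .
  qed
  have sets[measurable_cong]: "sets \<mu> = sets borel" by (simp add: \<mu>_def)
  interpret prob_space \<mu> by (rule prob)
  interpret PP: pair_prob_space \<mu> \<mu> ..
  have Cb: "\<bar>C x\<bar> <= C 0" for x by (rule covariance_bounded[OF C(1)])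
  have int: "integrable (\<mu> \<Otimes>\<^sub>M \<mu>) (%z. a (fst z) * a (snd z) * C (fst z - snd z))"
   if [measurable]: "a \<in> borel_measurable borel" and a: "!!x. \<bar>a x\<bar> <= 1" for a
  proof (rule PP.integrable_const_bound[where B = "C 0"])
   show "AE z in \<mu> \<Otimes>\<^sub>M \<mu>. norm (a (fst z) * a (snd z) * C (fst z - snd z)) <= C 0"
    using mult_mono[OF mult_mono[OF a a] Cb] by (intro AE_I2) (simp add: abs_mult)
  qed measurable
  have cs: "(%x. cos (k \<bullet> x)) \<in> borel_measurable borel" "(%x. sin (k \<bullet> x)) \<in> borel_measurable borel"
   by measurable
  have "0 <= (LINT z|(\<mu> \<Otimes>\<^sub>M \<mu>). cos (k \<bullet> fst z) * cos (k \<bullet> snd z) * C (fst z - snd z)) +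
    (LINT z|(\<mu> \<Otimes>\<^sub>M \<mu>). sin (k \<bullet> fst z) * sin (k \<bullet> snd z) * C (fst z - snd z))"
   by (intro add_nonneg_nonneg covariance_double_integral_nonneg[OF C(1) prob sets] cs) auto
  also have "\<dots> = (LINT z|(\<mu> \<Otimes>\<^sub>M \<mu>). cos (k \<bullet> fst z) * cos (k \<bullet> snd z) * C (fst z - snd z) +
    sin (k \<bullet> fst z) * sin (k \<bullet> snd z) * C (fst z - snd z))"
   by (rule Bochner_Integration.integral_add[symmetric]; rule int[OF cs(1)] int[OF cs(2)]) auto
  also have "\<dots> = (LINT z|(\<mu> \<Otimes>\<^sub>M \<mu>). (case z of (x, y) => F (x - y)))"
   by (intro integral_cong_fun) (simp add: F_def inner_diff_right cos_diff case_prod_beta' algebra_simps)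
  also have "\<dots> = (LINT y|\<mu>. (LINT x|\<mu>. F (x - y)))"
  proof (rule PP.integral_snd[symmetric], rule PP.integrable_const_bound[where B = "C 0"])
   have "\<bar>F v\<bar> <= C 0" for v unfolding F_def abs_mult using mult_mono[OF Cb[of v] abs_cos_le_one[of "k \<bullet> v"]] Cb[of 0] by simp
   then show "AE z in \<mu> \<Otimes>\<^sub>M \<mu>. norm (case z of (x, y) => F (x - y)) <= C 0"
    by (intro AE_I2) (simp add: case_prod_beta')
  qed measurable
  also have "\<dots> = (LINT y|lborel. g y * (LINT x|lborel. g x * F (x - y)))"
  proof -
   have "(LINT x|\<mu>. f x) = (LINT x|lborel. g x * f x)" if "f \<in> borel_measurable borel" for f :: "plane => real"
    unfolding \<mu>_def using that g0 by (subst integral_density) auto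
   moreover have "(%x. F (x - y)) \<in> borel_measurable borel" for y by measurable
   moreover have "(%y. (LINT x|lborel. g x * F (x - y))) \<in> borel_measurable borel" by measurable
   ultimately show ?thesis by simp
  qed
  also have "\<dots> = inverse Z * inverse Z * (LINT y|lborel. (LINT x|lborel. F (x - y) * of_real (exp (- c * (norm x)^2) * exp (- c * (norm y)^2))))"
   unfolding g_def divide_inverse integral_mult_right_zero[symmetric] of_real_eq_id id_apply
   by (simp only: mult_ac)
  also have "\<dots> = inverse Z * inverse Z * (sqrt (pi / (2 * c)) ^ DIM(plane) * (LINT v|lborel. F v * exp (- (c / 2) * (norm v)^2)))"
  proof -
   have "integrable lborel (%v. F v * exp (- (c / 2) * (norm v)^2))"
    by (rule Bochner_Integration.integrable_bound[OF F]) (use c in \<open>auto simp: abs_mult mult_left_le intro!: AE_I2\<close>)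
   then show ?thesis
    using integral_difference_gaussian[of F c] c by simp
  qed
  finally have "0 <= (inverse Z * inverse Z * sqrt (pi / (2 * c)) ^ DIM(plane)) * (LINT v|lborel. F v * exp (- (c / 2) * (norm v)^2))"
   by (simp only: mult.assoc)
  moreover have "0 < inverse Z * inverse Z * sqrt (pi / (2 * c)) ^ DIM(plane)" using Z c by simp
  ultimately show ?thesis by (meson not_le mult_pos_neg)
 qed
 have lim: "(%j. LINT v|lborel. F v * exp (- (norm v)\<^sup>2 / (2 * real (Suc j)))) \<longlonglongrightarrow> (LINT v|lborel. F v)"
 proof (rule integral_dominated_convergence[where w = "%v. norm (F v)"])
  show "AE v in lborel. (%j. F v * exp (- (norm v)\<^sup>2 / (2 * real (Suc j)))) \<longlonglongrightarrow> F v"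
   using tendsto_mult[OF tendsto_const tendsto_gaussian_cutoff] by (intro AE_I2) (simp only: mult_1_right)
 qed (use F in \<open>auto simp: abs_mult mult_left_le intro!: AE_I2 integrable_abs\<close>)
 have nn: "0 <= (LINT v|lborel. F v * exp (- (norm v)\<^sup>2 / (2 * real (Suc j))))" for j
  using pos[of "1 / real (Suc j)"] by (simp add: mult.commute)
 have "0 <= (LINT v|lborel. F v)" by (rule LIMSEQ_le_const[OF lim]) (use nn in blast)
 then show ?thesis by (simp add: F_def)
qed

lemma complex_spectral_density:
 assumes C: "covariance_function C" "integrable lborel C"
 shows "(LINT v|lborel. of_real (C v) * cis (- (k \<bullet> v))) = complex_of_real ((2 * pi)^2 * spectral_density C k)"
  and "integrable lborel (%v. of_real (C v) * cis (- (k \<bullet> v)))"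
proof -
 have [measurable]: "C \<in> borel_measurable borel" using C by auto
 show i: "integrable lborel (%v. of_real (C v) * cis (- (k \<bullet> v)))"
  by (rule Bochner_Integration.integrable_bound[OF C(2)]) (auto simp: norm_mult intro!: AE_I2)
 have "(LINT v|lborel. C v * sin (k \<bullet> v)) = (LINT v|lborel. C (- v) * sin (k \<bullet> (- v)))"
  by (rule integral_reflect[symmetric]) measurable
 also have "\<dots> = - (LINT v|lborel. C v * sin (k \<bullet> v))"
  using C(1) by (simp add: covariance_function_def)
 finally have "(LINT v|lborel. C v * sin (k \<bullet> v)) = 0" by simp
 then show "(LINT v|lborel. of_real (C v) * cis (- (k \<bullet> v))) = complex_of_real ((2 * pi)^2 * spectral_density C k)"
  using integral_Re[OF i] integral_Im[OF i] by (intro complex_eqI) (simp_all add: spectral_density_def)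
qed

text \<open>With a Gaussian regularisation inversion holds by the approximate identity.  At the origin
 the regularised integrals increase to \<open>C 0\<close>, so monotone convergence shows that the density is
 integrable; then the regularisation can be removed everywhere.\<close>

theorem spectral_representation:
 assumes C: "covariance_function C" "integrable lborel C"
 shows "0 <= spectral_density C k" "integrable lborel (spectral_density C)"
  and "(LINT k|lborel. of_real (spectral_density C k) * cis (k \<bullet> x)) = complex_of_real (C x)"
proof -
 define \<rho> where "\<rho> = spectral_density C"
 have [measurable]: "C \<in> borel_measurable borel" using C by auto
 have [measurable]: "\<rho> \<in> borel_measurable borel" unfolding \<rho>_def spectral_density_def[abs_def] by measurable
 have \<rho>0: "0 <= \<rho> k" for k unfolding \<rho>_def spectral_density_def using cosine_transform_nonneg[OF C] by simp
 then show "0 <= spectral_density C k" by (simp add: \<rho>_def)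
 define G where "G j k = exp (- (norm (k::plane))\<^sup>2 / (2 * real (Suc j)))" for j k
 have [measurable]: "G j \<in> borel_measurable borel" for j unfolding G_def[abs_def] by measurable
 have Glim: "(%j. G j k) \<longlonglongrightarrow> 1" for k unfolding G_def by (rule tendsto_gaussian_cutoff)
 have G: "0 <= G j k" "G j k <= 1" for j k by (simp_all add: G_def)
 have Cb: "\<bar>C x\<bar> <= C 0" for x by (rule covariance_bounded[OF C(1)])
 have Cb2: "C x * C x <= C 0 * \<bar>C x\<bar>" for x
  using mult_right_mono[OF Cb[of x], of "\<bar>C x\<bar>"] by simp
 have sq: "square_integrable (%v. complex_of_real (C v))"
  unfolding square_integrable_def
 proof
  show "integrable lborel (%x. (norm (complex_of_real (C x)))^2)"
  proof (rule Bochner_Integration.integrable_bound[OF integrable_mult_right[OF C(2), of "C 0"]])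
   show "AE x in lborel. norm ((norm (complex_of_real (C x)))^2) <= norm (C 0 * C x)"
    using Cb2 Cb[of 0] by (intro AE_I2) (simp add: power2_eq_square abs_mult)
  qed measurable
 qed measurable
 have cont: "isCont (%v. complex_of_real (C v)) x" for x
 proof -
  have "isCont C x" using C(1) by (simp add: covariance_function_def continuous_on_eq_continuous_at)
  then show ?thesis by (intro continuous_intros)
 qed
 have regular: "integrable lborel (%k. of_real (\<rho> k * G j k) * cis (k \<bullet> x))"
  "(%j. LINT k|lborel. of_real (\<rho> k * G j k) * cis (k \<bullet> x)) \<longlonglongrightarrow> complex_of_real (C x)" for x j
 proof -
  define a where "a j = (%_::plane. complex_of_real (1 / real (Suc j)))" for j
  define bt where "bt b = complex_of_real (x \<bullet> b)" for b
  have a: "b \<in> Basis ==> Re (a j b) > 0" for b j by (simp add: a_def)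
  have S: "symbol (a j) bt k = of_real (G j k) * cis (k \<bullet> x)" for j k
   unfolding a_def bt_def G_def by (rule symbol_isotropic)
  have Sm [measurable]: "symbol (a j) bt \<in> borel_measurable borel" for j by (rule borel_measurable_symbol)
  have iS: "integrable lborel (symbol (a j) bt)" for j by (rule integrable_symbol) (rule a)
  have F: "integrable (lborel \<Otimes>\<^sub>M lborel) (%(v, k). of_real (C v) * cis (- (k \<bullet> v)) * symbol (a j) bt k)" for j
  proof (rule lborel_pair.Fubini_integrable)
   show "integrable lborel (%v. LINT k|lborel. norm (case (v, k) of (v, k) => of_real (C v) * cis (- (k \<bullet> v)) * symbol (a j) bt k))"
    using C(2) by (simp add: norm_mult)
   have "integrable lborel (%k. of_real (C v) * cis (- (k \<bullet> v)) * symbol (a j) bt k)" for v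
    by (rule Bochner_Integration.integrable_bound[OF integrable_mult_right[OF integrable_norm[OF iS[of j]], of "C v"]])
     (measurable, simp add: norm_mult abs_mult)
   then show "AE v in lborel. integrable lborel (%k. case (v, k) of (v, k) => of_real (C v) * cis (- (k \<bullet> v)) * symbol (a j) bt k)"
    by (simp only: prod.case AE_I2)
  qed measurable
  have eq: "(LINT v|lborel. of_real (C v) * cis (- (k \<bullet> v)) * symbol (a j) bt k) = of_real ((2 * pi)^2) * (of_real (\<rho> k * G j k) * cis (k \<bullet> x))" for k j
   unfolding integral_mult_left_zero complex_spectral_density(1)[OF C] S \<rho>_def by simp
  have c0: "inverse (complex_of_real ((2 * pi)^2)) * (of_real ((2 * pi)^2) * y) = y" for y by simp
  have "integrable lborel (%k. of_real ((2 * pi)^2) * (of_real (\<rho> k * G j k) * cis (k \<bullet> x)))"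
   unfolding eq[symmetric] using lborel_pair.integrable_snd[OF F[of j]] .
  from integrable_mult_right[OF this, of "inverse (complex_of_real ((2 * pi)^2))"]
  show "integrable lborel (%k. of_real (\<rho> k * G j k) * cis (k \<bullet> x))" unfolding c0 .
  have pe: "pairing (%v. of_real (C v)) (packet (a j) bt) = of_real ((2 * pi)^2) * (LINT k|lborel. of_real (\<rho> k * G j k) * cis (k \<bullet> x))" for j
  proof -
   have pk: "packet (a j) bt v = (LINT k|lborel. symbol (a j) bt k * cis (- (k \<bullet> v)))" for v
    by (rule packet_fourier[symmetric]) (rule a)
   have "pairing (%v. of_real (C v)) (packet (a j) bt) =
     (LINT v|lborel. (LINT k|lborel. of_real (C v) * cis (- (k \<bullet> v)) * symbol (a j) bt k))"
    unfolding pairing_def pk integral_mult_right_zero[symmetric]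
    by (simp only: mult_ac)
   also have "\<dots> = (LINT k|lborel. (LINT v|lborel. of_real (C v) * cis (- (k \<bullet> v)) * symbol (a j) bt k))"
    by (rule lborel_pair.Fubini_integral[OF F, symmetric])
   finally show ?thesis unfolding eq by simp
  qed
  have "(%j. pairing (%v. of_real (C v)) (packet (a j) bt)) \<longlonglongrightarrow> of_real ((2 * pi)^2) * complex_of_real (C x)"
   using pairing_approximate_identity[OF sq cont, of x] by (simp add: a_def bt_def[abs_def])
  then have "(%j. of_real ((2 * pi)^2) * (LINT k|lborel. of_real (\<rho> k * G j k) * cis (k \<bullet> x))) \<longlonglongrightarrow> of_real ((2 * pi)^2) * complex_of_real (C x)"
   unfolding pe .
  from tendsto_mult[OF tendsto_const this, of "inverse (complex_of_real ((2 * pi)^2))"]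
  show "(%j. LINT k|lborel. of_real (\<rho> k * G j k) * cis (k \<bullet> x)) \<longlonglongrightarrow> complex_of_real (C x)"
   unfolding c0 .
 qed
 have iG: "integrable lborel (%k. \<rho> k * G j k)" for j
  using integrable_Re[OF regular(1)[of j 0]] by simp
 have "(%j. complex_of_real (LINT k|lborel. \<rho> k * G j k)) \<longlonglongrightarrow> of_real (C 0)"
  using regular(2)[of 0] by (simp del: of_real_mult)
 then have l0: "(%j. LINT k|lborel. \<rho> k * G j k) \<longlonglongrightarrow> C 0" by (rule tendsto_of_real_iff[THEN iffD1])
 have int: "integrable lborel \<rho>"
 proof (rule integrable_monotone_convergence[OF iG _ _ l0])
  have "mono (%j. \<rho> k * G j k)" for k
   unfolding G_def using \<rho>0[of k] by (intro monoI mult_left_mono) (auto intro!: divide_left_mono)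
  then show "AE k in lborel. mono (%j. \<rho> k * G j k)" by (rule AE_I2)
  show "AE k in lborel. (%j. \<rho> k * G j k) \<longlonglongrightarrow> \<rho> k"
   using tendsto_mult[OF tendsto_const Glim] by (intro AE_I2) (simp only: mult_1_right)
 qed measurable
 then show "integrable lborel (spectral_density C)" by (simp add: \<rho>_def)
 have "(%j. LINT k|lborel. of_real (\<rho> k * G j k) * cis (k \<bullet> x)) \<longlonglongrightarrow> (LINT k|lborel. of_real (\<rho> k) * cis (k \<bullet> x))"
 proof (rule integral_dominated_convergence[where w = "%k. norm (\<rho> k)"])
  have "(%j. of_real (\<rho> k * G j k) * cis (k \<bullet> x)) \<longlonglongrightarrow> of_real (\<rho> k * 1) * cis (k \<bullet> x)" for k
   by (intro tendsto_intros Glim)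
  then show "AE k in lborel. (%j. of_real (\<rho> k * G j k) * cis (k \<bullet> x)) \<longlonglongrightarrow> of_real (\<rho> k) * cis (k \<bullet> x)"
   by (intro AE_I2) (simp only: mult_1_right)
  show "AE k in lborel. norm (complex_of_real (\<rho> k * G j k) * cis (k \<bullet> x)) <= norm (\<rho> k)" for j
   using G by (intro AE_I2) (simp add: norm_mult mult_left_le)
 qed (use int in \<open>auto intro: integrable_abs\<close>)
 then show "(LINT k|lborel. of_real (spectral_density C k) * cis (k \<bullet> x)) = complex_of_real (C x)"
  unfolding \<rho>_def[symmetric] using regular(2)[of x] LIMSEQ_unique by blast
qed

section \<open>Test functions of product form\<close>

text \<open>For maps into arbitrary normed spaces, so that it can be applied to derivatives.\<close>

definition C1 :: "('a::real_normed_vector => 'b::real_normed_vector) => bool" where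
 "C1 f \<longleftrightarrow> (\<exists>f'. (\<forall>x. (f has_derivative blinfun_apply (f' x)) (at x)) \<and> continuous_on UNIV f')"

lemma C1_imp_continuous: "C1 f ==> continuous_on UNIV f"
proof -
 assume "C1 f"
 then obtain f' where f': "!!x. (f has_derivative blinfun_apply (f' x)) (at x)" unfolding C1_def by blast
 show ?thesis by (intro continuous_at_imp_continuous_on ballI has_derivative_continuous[OF f'])
qed

lemma C1_const: "C1 (%_. c)"
 unfolding C1_def by (intro exI[of _ "%_. 0"]) (auto intro!: derivative_eq_intros)

text \<open>Covers both products of functions and compositions of linear maps, and thereby the second
 derivative of a product.\<close>

lemma C1_bilinear:
 assumes B: "bounded_bilinear B" and f: "C1 f" and g: "C1 g"
 shows "C1 (%x. B (f x) (g x))"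
proof -
 interpret bounded_bilinear B by fact
 obtain f' g' where f': "!!x. (f has_derivative blinfun_apply (f' x)) (at x)" "continuous_on UNIV f'"
  and g': "!!x. (g has_derivative blinfun_apply (g' x)) (at x)" "continuous_on UNIV g'"
  using f g unfolding C1_def by blast
 have c: "continuous_on UNIV f" "continuous_on UNIV g" using f g by (auto intro: C1_imp_continuous)
 define D where "D x = (prod_right (f x) o\<^sub>L g' x) + (prod_left (g x) o\<^sub>L f' x)" for x
 have "((%x. B (f x) (g x)) has_derivative blinfun_apply (D x)) (at x)" for x
 proof -
  have "blinfun_apply (D x) = (%h. B (f x) (g' x h) + B (f' x h) (g x))"
   by (rule ext) (simp add: D_def blinfun.add_left)
  then show ?thesis using FDERIV[OF f'(1)[of x] g'(1)[of x]] by simp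
 qed
 moreover have "continuous_on UNIV D"
  unfolding D_def[abs_def]
  by (intro continuous_on_add bounded_bilinear.continuous_on[OF bounded_bilinear_blinfun_compose]
    bounded_linear.continuous_on[OF bounded_linear_prod_right] bounded_linear.continuous_on[OF bounded_linear_prod_left] c f' g')
 ultimately show ?thesis unfolding C1_def by blast
qed

lemma C1_add: "C1 f ==> C1 g ==> C1 (%x. f x + g x)"
proof -
 assume "C1 f" "C1 g"
 then obtain f' g' where f': "!!x. (f has_derivative blinfun_apply (f' x)) (at x)" "continuous_on UNIV f'"
  and g': "!!x. (g has_derivative blinfun_apply (g' x)) (at x)" "continuous_on UNIV g'"
  unfolding C1_def by blast
 have "((%x. f x + g x) has_derivative blinfun_apply (f' x + g' x)) (at x)" for x
  using has_derivative_add[OF f'(1)[of x] g'(1)[of x]] by (simp add: plus_blinfun.rep_eq)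
 moreover have "continuous_on UNIV (%x. f' x + g' x)" by (intro continuous_on_add f' g')
 ultimately show ?thesis unfolding C1_def by (intro exI[of _ "%x. f' x + g' x"]) simp
qed

lemma C1_linear:
 assumes L: "bounded_linear L" and f: "C1 f"
 shows "C1 (%x. L (f x))"
proof -
 obtain f' where f': "!!x. (f has_derivative blinfun_apply (f' x)) (at x)" "continuous_on UNIV f'"
  using f unfolding C1_def by blast
 have "((%x. L (f x)) has_derivative blinfun_apply (Blinfun L o\<^sub>L f' x)) (at x)" for x
 proof -
  have "blinfun_apply (Blinfun L o\<^sub>L f' x) = (%h. L (f' x h))"
   by (rule ext) (simp add: bounded_linear_Blinfun_apply[OF L])
  then show ?thesis using bounded_linear.has_derivative[OF L f'(1)[of x]] by simp
 qed
 moreover have "continuous_on UNIV (%x. Blinfun L o\<^sub>L f' x)"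
  by (intro bounded_bilinear.continuous_on[OF bounded_bilinear_blinfun_compose] continuous_on_const f')
 ultimately show ?thesis unfolding C1_def by (intro exI[of _ "%x. Blinfun L o\<^sub>L f' x"]) simp
qed

definition C2 :: "('a::euclidean_space => complex) => bool" where
 "C2 f \<longleftrightarrow> (\<exists>f'. (\<forall>x. (f has_derivative blinfun_apply (f' x)) (at x)) \<and> C1 f')"

lemma C2_imp_C1: "C2 f ==> C1 f"
 unfolding C2_def C1_def[of f] using C1_imp_continuous by blast

lemma C2_const: "C2 (%_. c)"
 unfolding C2_def by (intro exI[of _ "%_. 0"]) (auto intro!: derivative_eq_intros C1_const)

lemma bounded_bilinear_scale_functional:
 "bounded_bilinear (%(c::complex) (T :: 'a::euclidean_space \<Rightarrow>\<^sub>L complex). blinfun_mult_right c o\<^sub>L T)"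
 using bounded_bilinear.comp1[OF bounded_bilinear_blinfun_compose bounded_linear_blinfun_mult_right] .

lemma C2_mult:
 assumes "C2 f" "C2 g"
 shows "C2 (%x. f x * g x)"
proof -
 obtain f' g' where f': "!!x. (f has_derivative blinfun_apply (f' x)) (at x)" "C1 f'"
  and g': "!!x. (g has_derivative blinfun_apply (g' x)) (at x)" "C1 g'"
  using assms unfolding C2_def by blast
 define D where "D x = (blinfun_mult_right (f x) o\<^sub>L g' x) + (blinfun_mult_right (g x) o\<^sub>L f' x)" for x
 have "((%x. f x * g x) has_derivative blinfun_apply (D x)) (at x)" for x
  by (rule has_derivative_eq_rhs[OF has_derivative_mult[OF f'(1) g'(1)]])
   (simp add: D_def blinfun.add_left fun_eq_iff mult.commute)
 moreover have "C1 D" unfolding D_def[abs_def]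
  by (intro C1_add C1_bilinear[OF bounded_bilinear_scale_functional] f' g' C2_imp_C1 assms)
 ultimately show ?thesis unfolding C2_def by blast
qed

lemma C2_prod:
 assumes "!!i. i \<in> I ==> C2 (f i)"
 shows "C2 (%x. \<Prod>i\<in>I. f i x)"
 using assms by (induction I rule: infinite_finite_induct) (auto intro!: C2_const C2_mult)

lemma C2_coordinate:
 fixes b :: "'a::euclidean_space"
 assumes f: "!!x. (f has_vector_derivative f1 x) (at x)" "!!x. (f1 has_vector_derivative f2 x) (at x)" "continuous_on UNIV f2"
 shows "C2 (%X. f (X \<bullet> b))"
proof -
 define D :: "complex => 'a \<Rightarrow>\<^sub>L complex" where "D c = blinfun_scaleR_left c o\<^sub>L blinfun_inner_left b" for c
 have D: "bounded_linear D" unfolding D_def[abs_def]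
  by (rule bounded_linear_compose[OF bounded_bilinear.bounded_linear_left[OF bounded_bilinear_blinfun_compose] bounded_linear_blinfun_scaleR_left])
 have d: "((%X. h (X \<bullet> b)) has_derivative blinfun_apply (D (h' (X \<bullet> b)))) (at X)"
  if "!!x. (h has_vector_derivative h' x) (at x)" for h h' and X :: 'a
 proof -
  have i: "((%X::'a. X \<bullet> b) has_derivative (%Y. Y \<bullet> b)) (at X)" by (auto intro!: derivative_eq_intros)
  have "(h has_derivative (%x. x *\<^sub>R h' (X \<bullet> b))) (at (X \<bullet> b))"
   using that by (simp add: has_vector_derivative_def)
  from has_derivative_compose[OF i this] show ?thesis
   by (rule has_derivative_eq_rhs) (simp add: D_def fun_eq_iff)
 qed
 have "C1 (%X. D (f1 (X \<bullet> b)))"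
 proof (rule C1_linear[OF D])
  have "continuous_on UNIV (%X. D (f2 (X \<bullet> b)))"
   by (intro bounded_linear.continuous_on[OF D] continuous_on_compose2[OF f(3)] continuous_intros) auto
  then show "C1 (%X. f1 (X \<bullet> b))" unfolding C1_def using d[OF f(2)]
   by (intro exI[of _ "%X. D (f2 (X \<bullet> b))"]) simp
 qed
 then show ?thesis unfolding C2_def using d[OF f(1)] by (intro exI[of _ "%X. D (f1 (X \<bullet> b))"]) simp
qed

lemma test_function_iff: "test_function \<phi> \<longleftrightarrow> bounded {x. \<phi> x ~= 0} \<and> C2 \<phi>"
 unfolding test_function_def C2_def C1_def by blast

lemma C2_compactD:
 assumes "C2_compact f f1 f2"
 obtains r where "!!x. \<bar>x\<bar> > r ==> f x = 0 \<and> f1 x = 0 \<and> f2 x = 0"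
proof -
 obtain r where r: "!!x. f x ~= 0 ==> \<bar>x\<bar> <= r" using assms unfolding C2_compact_def by blast
 have o: "open {x::real. \<bar>x\<bar> > r}" by (intro open_Collect_less continuous_intros)
 have z: "h' x = 0" if h: "!!x. (h has_vector_derivative h' x) (at x)" "!!x. \<bar>x\<bar> > r ==> h x = (0::complex)" and x: "\<bar>x\<bar> > r" for h h' x
 proof -
  have "((%_. 0::complex) has_vector_derivative h' x) (at x)"
   by (rule has_vector_derivative_transform_within_open[OF h(1) o]) (use h(2) x in auto)
  from vector_derivative_unique_at[OF this has_vector_derivative_const] show ?thesis .
 qed
 have f: "f x = 0" if "\<bar>x\<bar> > r" for x using r[of x] that by fastforce
 have f1: "f1 x = 0" if "\<bar>x\<bar> > r" for x
  by (rule z[of f]) (use assms f that in \<open>auto simp: C2_compact_def\<close>)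
 have f2: "f2 x = 0" if "\<bar>x\<bar> > r" for x
  by (rule z[of f1]) (use assms f1 that in \<open>auto simp: C2_compact_def\<close>)
 show ?thesis by (rule that) (use f f1 f2 in blast)
qed

lemma C2_compact_continuous:
 assumes "C2_compact f f1 f2"
 shows "continuous_on UNIV f" "continuous_on UNIV f1" "continuous_on UNIV f2"
 using assms unfolding C2_compact_def
 by (auto intro!: continuous_at_imp_continuous_on has_vector_derivative_continuous)

lemma compact_support_gaussian_bound:
 fixes f :: "real => complex"
 assumes c: "continuous_on UNIV f" and z: "!!x. \<bar>x\<bar> > r ==> f x = 0"
 shows "\<exists>B. \<forall>x. norm (f x) <= B * exp (- 1 * x^2)"
proof -
 have "compact ((%x. norm (f x) * exp (x^2)) ` {-r..r})"
  by (intro compact_continuous_image continuous_intros continuous_on_subset[OF c]) auto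
 then have "bounded ((%x. norm (f x) * exp (x^2)) ` {-r..r})" by (rule compact_imp_bounded)
 then obtain B where "\<forall>y\<in>(%x. norm (f x) * exp (x^2)) ` {-r..r}. norm y <= B" unfolding bounded_iff by blast
 then have B: "norm (f x) * exp (x^2) <= B" if "x \<in> {-r..r}" for x using that by (fastforce simp: abs_mult)
 have "norm (f x) <= max 0 B * exp (- 1 * x^2)" for x
 proof (cases "\<bar>x\<bar> > r")
  case False
  then have "x \<in> {-r..r}" by auto
  then have "norm (f x) * exp (x^2) <= max 0 B" using B[of x] by simp
  then have "norm (f x) * exp (x^2) * exp (- x\<^sup>2) <= max 0 B * exp (- x\<^sup>2)" by (rule mult_right_mono) simp
  then show ?thesis by (simp add: mult.assoc flip: exp_add)
 qed (simp add: z)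
 then show ?thesis by blast
qed

text \<open>Gaussian bounds for the factors multiply to a Gaussian bound in the norm of the whole
 vector.\<close>

lemma C2_compact_gaussian_bound:
 fixes f f1 f2 :: "'a::euclidean_space => real => complex"
 assumes f: "!!b. b \<in> Basis ==> C2_compact (f b) (f1 b) (f2 b)"
 obtains B where "0 <= B" "!!b x. b \<in> Basis ==> norm (f b x) <= B * exp (- 1 * x^2)"
  "!!b x. b \<in> Basis ==> norm (f2 b x) <= B * exp (- 1 * x^2)"
proof -
 have "\<exists>B. \<forall>x. norm (f b x) <= B * exp (- 1 * x^2) \<and> norm (f2 b x) <= B * exp (- 1 * x^2)" if b: "b \<in> Basis" for b
 proof -
  obtain r where r: "!!x. \<bar>x\<bar> > r ==> f b x = 0 \<and> f1 b x = 0 \<and> f2 b x = 0" using C2_compactD[OF f[OF b]] by blast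
  obtain B1 where "!!x. norm (f b x) <= B1 * exp (- 1 * x^2)"
   using compact_support_gaussian_bound[OF C2_compact_continuous(1)[OF f[OF b]], of r] r by blast
  moreover obtain B2 where "!!x. norm (f2 b x) <= B2 * exp (- 1 * x^2)"
   using compact_support_gaussian_bound[OF C2_compact_continuous(3)[OF f[OF b]], of r] r by blast
  moreover have "B1 * exp (- 1 * x^2) <= max B1 B2 * exp (- 1 * x^2)" "B2 * exp (- 1 * x^2) <= max B1 B2 * exp (- 1 * x^2)" for x :: real
   by (rule mult_right_mono; simp)+
  ultimately show ?thesis by (intro exI[of _ "max B1 B2"]) (meson order_trans)
 qed
 then obtain B where B: "!!b x. b \<in> Basis ==> norm (f b x) <= B b * exp (- 1 * x^2) \<and> norm (f2 b x) <= B b * exp (- 1 * x^2)"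
  by metis
 define M where "M = (\<Sum>b\<in>Basis. \<bar>B b\<bar>)"
 have "B b * exp (- 1 * x^2) <= M * exp (- 1 * x^2)" if "b \<in> Basis" for b and x :: real
  using member_le_sum[OF that, of "%b. \<bar>B b\<bar>"] by (intro mult_right_mono) (auto simp: M_def)
 note le = this
 show ?thesis
 proof (rule that[of M])
  show "0 <= M" by (simp add: M_def sum_nonneg)
  fix b :: 'a and x :: real assume b: "b \<in> Basis"
  show "norm (f b x) <= M * exp (- 1 * x^2)" by (rule order_trans[OF conjunct1[OF B[OF b]] le[OF b]])
  show "norm (f2 b x) <= M * exp (- 1 * x^2)" by (rule order_trans[OF conjunct2[OF B[OF b]] le[OF b]])
 qed
qed

lemma test_function_basis_prod:
 fixes f f1 f2 :: "'a::euclidean_space => real => complex"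
 assumes f: "!!b. b \<in> Basis ==> C2_compact (f b) (f1 b) (f2 b)"
 shows "test_function (basis_prod f)"
 unfolding test_function_iff
proof
 have "C2 (%X. \<Prod>b\<in>Basis. f b (X \<bullet> b))"
  by (rule C2_prod, rule C2_coordinate) (use f in \<open>auto simp: C2_compact_def\<close>)
 then show "C2 (basis_prod f)" by (simp add: basis_prod_def[abs_def])
 have "\<exists>r. \<forall>x. f b x ~= 0 \<longrightarrow> \<bar>x\<bar> <= r" if "b \<in> Basis" for b using f[OF that] by (simp add: C2_compact_def)
 then obtain r where r: "!!b x. b \<in> Basis ==> f b x ~= 0 ==> \<bar>x\<bar> <= r b" by metis
 show "bounded {X. basis_prod f X ~= 0}"
  unfolding bounded_iff
 proof (intro exI ballI)
  fix X assume "X \<in> {X. basis_prod f X ~= 0}"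
  then have "!!b. b \<in> Basis ==> f b (X \<bullet> b) ~= 0" by (auto simp: basis_prod_def)
  then have "(\<Sum>b\<in>Basis. \<bar>X \<bullet> b\<bar>) <= (\<Sum>b\<in>Basis. r b)" using r by (intro sum_mono) auto
  then show "norm X <= (\<Sum>b\<in>Basis. r b)" using norm_le_l1[of X] by linarith
 qed
qed

lemma second_derivative_basis_prod:
 fixes X :: "'a::euclidean_space"
 assumes f: "!!b. b \<in> Basis ==> C2_compact (f b) (f1 b) (f2 b)" and b: "b \<in> Basis"
 shows "vector_derivative (%s. vector_derivative (%t. basis_prod f (X + t *\<^sub>R b)) (at s)) (at 0) =
  f2 b (X \<bullet> b) * (\<Prod>b'\<in>Basis - {b}. f b' (X \<bullet> b'))"
proof -
 let ?R = "\<Prod>b'\<in>Basis - {b}. f b' (X \<bullet> b')"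
 have F: "basis_prod f (X + t *\<^sub>R b) = f b (X \<bullet> b + t) * ?R" for t
 proof -
  have "basis_prod f (X + t *\<^sub>R b) = f b ((X + t *\<^sub>R b) \<bullet> b) * (\<Prod>b'\<in>Basis - {b}. f b' ((X + t *\<^sub>R b) \<bullet> b'))"
   unfolding basis_prod_def using b by (simp add: prod.remove)
  also have "(\<Prod>b'\<in>Basis - {b}. f b' ((X + t *\<^sub>R b) \<bullet> b')) = ?R"
   using b by (intro prod.cong refl) (auto simp: inner_add_left inner_not_same_Basis)
  finally show ?thesis using b by (simp add: inner_add_left inner_Basis)
 qed
 have sh: "((%t. h (X \<bullet> b + t) * ?R) has_vector_derivative h' (X \<bullet> b + s) * ?R) (at s)"
  if h: "!!x. (h has_vector_derivative h' x) (at x)" for h h' s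
 proof (intro has_vector_derivative_mult_left)
  have "((%t. X \<bullet> b + t) has_vector_derivative 1) (at s)" by (auto intro!: derivative_eq_intros)
  from vector_diff_chain_at[OF this h] show "((%t. h (X \<bullet> b + t)) has_vector_derivative h' (X \<bullet> b + s)) (at s)"
   by (simp add: o_def)
 qed
 have "vector_derivative (%t. basis_prod f (X + t *\<^sub>R b)) (at s) = f1 b (X \<bullet> b + s) * ?R" for s
  unfolding F by (rule vector_derivative_at[OF sh]) (use f[OF b] in \<open>simp add: C2_compact_def\<close>)
 moreover have "vector_derivative (%s. f1 b (X \<bullet> b + s) * ?R) (at 0) = f2 b (X \<bullet> b + 0) * ?R"
  by (rule vector_derivative_at[OF sh]) (use f[OF b] in \<open>simp add: C2_compact_def\<close>)
 ultimately show ?thesis by simp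
qed

section \<open>From moment equations to weak evolutions\<close>

lemma L2_continuous_rescaled:
 assumes m: "L2_continuous m" and eps: "eps > 0"
 shows "L2_continuous (%t X. of_real (exp (c * t)) * m (t / eps) X)"
 unfolding L2_continuous_def
proof (intro conjI allI impI)
 fix t :: real assume t: "0 <= t"
 have sq: "square_integrable (%X. of_real w * m u X)" and L: "L2_sq (%X. of_real w * m u X) = w^2 * L2_sq (m u)"
  if "0 <= u" for u w
  using L2_continuousD(1)[OF m that] by (auto simp: square_integrable_def norm_mult power_mult_distrib)
 show "square_integrable (%X. of_real (exp (c * t)) * m (t / eps) X)" by (rule sq) (use t eps in simp)
 define g where "g u = 2 * ((exp (c * u))^2 * L2_sq (%X. m (u / eps) X - m (t / eps) X)) + 2 * ((exp (c * u) - exp (c * t))^2 * L2_sq (m (t / eps)))" for u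
 have le: "L2_sq (%X. of_real (exp (c * u)) * m (u / eps) X - of_real (exp (c * t)) * m (t / eps) X) <= g u" if u: "0 <= u" for u
 proof -
  let ?F = "%X. of_real (exp (c * u)) * m (u / eps) X - of_real (exp (c * t)) * m (t / eps) X"
  let ?G = "%X. of_real (exp (c * u)) * (m (u / eps) X - m (t / eps) X)"
  have p: "0 <= u / eps" "0 <= t / eps" using u t eps by auto
  have F: "square_integrable ?F" by (rule square_integrable_diff(1)[OF sq[OF p(1)] sq[OF p(2)]])
  have d: "square_integrable (%X. m (u / eps) X - m (t / eps) X)"
   using square_integrable_diff(1)[OF L2_continuousD(1)[OF m p(1)] L2_continuousD(1)[OF m p(2)]] .
  then have G: "square_integrable ?G" and LG: "L2_sq ?G = (exp (c * u))^2 * L2_sq (%X. m (u / eps) X - m (t / eps) X)"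
   by (auto simp: square_integrable_def norm_mult power_mult_distrib)
  have eq: "?F X - ?G X = of_real (exp (c * u) - exp (c * t)) * m (t / eps) X" for X
   by (simp add: algebra_simps)
  from square_integrable_diff(2)[OF F G] show ?thesis
   unfolding eq LG L[OF p(2)] g_def by linarith
 qed
 have "((%u. L2_sq (%X. m u X - m (t / eps) X)) \<longlongrightarrow> 0) (at (t / eps) within {0..})"
  using m t eps by (auto simp: L2_continuous_def)
 then have "continuous (at (t / eps) within {0..}) (%u. L2_sq (%X. m u X - m (t / eps) X))"
  by (simp add: continuous_within)
 moreover have "continuous (at t within {0..}) (%u. u / eps)" using eps by (intro continuous_intros) auto
 moreover have "(%u. u / eps) ` {0..} \<subseteq> {0..}" using eps by auto
 ultimately have "continuous (at t within {0..}) (%u. L2_sq (%X. m (u / eps) X - m (t / eps) X))"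
  using continuous_within_compose2[of t "{0..}" "%u. u / eps" "%u. L2_sq (%X. m u X - m (t / eps) X)"]
   continuous_within_subset by blast
 then have "((%u. L2_sq (%X. m (u / eps) X - m (t / eps) X)) \<longlongrightarrow> 0) (at t within {0..})"
  by (simp add: continuous_within)
 moreover have "((%u. exp (c * u)) \<longlongrightarrow> exp (c * t)) (at t within {0..})" by (intro tendsto_intros)
 ultimately have "(g \<longlongrightarrow> 2 * ((exp (c * t))^2 * 0) + 2 * ((exp (c * t) - exp (c * t))^2 * L2_sq (m (t / eps)))) (at t within {0..})"
  unfolding g_def by (intro tendsto_intros)
 then have g0: "(g \<longlongrightarrow> 0) (at t within {0..})" by simp
 show "((%u. L2_sq (%X. of_real (exp (c * u)) * m (u / eps) X - of_real (exp (c * t)) * m (t / eps) X)) \<longlongrightarrow> 0) (at t within {0..})"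
 proof (rule tendsto_sandwich[OF _ _ tendsto_const g0])
  show "\<forall>\<^sub>F u in at t within {0..}. L2_sq (%X. of_real (exp (c * u)) * m (u / eps) X - of_real (exp (c * t)) * m (t / eps) X) <= g u"
   using le by (auto simp: eventually_at_filter)
 qed (auto intro!: always_eventually)
qed

text \<open>Slowing down time by \<open>eps\<close> removes the factor \<open>eps\<close> from the potential, and the exponential
 factor removes its constant part; what is left are the kicks.\<close>

lemma weak_evolution_rescaled:
 fixes m :: "real => 'a::euclidean_space => complex"
 assumes "kicks K A s" and sol: "solves_in_L2 G m0 m" and eps: "eps > 0"
  and G: "!!f f1 f2 X. (!!b. b \<in> Basis ==> C2_compact (f b) (f1 b) (f2 b)) ==>
   G (basis_prod f) X = of_real eps * (basis_deriv f (%b x. \<i> * \<theta> b * f2 b x) X +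
    (kicks.potential K A s X - of_real c) * basis_prod f X)"
 shows "weak_evolution K A s \<theta> (%t X. of_real (exp (c * t)) * m (t / eps) X)"
proof -
 interpret kicks K A s by fact
 have m: "L2_continuous m" using sol by (simp add: solves_in_L2_def)
 show ?thesis
 proof (unfold_locales, rule L2_continuous_rescaled[OF m eps])
  fix f f1 f2 :: "'a => real => complex" and t :: real
  assume f: "!!b. b \<in> Basis ==> C2_compact (f b) (f1 b) (f2 b)" and t: "0 <= t"
  define \<Phi> where "\<Phi> = basis_prod f"
  define H where "H X = basis_deriv f (%b x. \<i> * \<theta> b * f2 b x) X + potential X * basis_prod f X" for X
  obtain B where B: "0 <= B" "!!b x. b \<in> Basis ==> norm (f b x) <= B * exp (- 1 * x^2)"
   "!!b x. b \<in> Basis ==> norm (f2 b x) <= B * exp (- 1 * x^2)" by (rule C2_compact_gaussian_bound[of f f1 f2, OF _ that]) (rule f)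
  define T where "T = 1 + (\<Sum>b\<in>Basis. \<bar>\<theta> b\<bar>)"
  have T: "1 <= T" by (simp add: T_def sum_nonneg)
  have \<theta>T: "\<bar>\<theta> b\<bar> <= T" if "b \<in> Basis" for b
   using member_le_sum[OF that, of "%b. \<bar>\<theta> b\<bar>"] by (simp add: T_def)
  define B' where "B' = T * B"
  have BB: "B <= B'" using mult_right_mono[OF T B(1)] by (simp add: B'_def)
  have f_le: "norm (f b x) <= B' * exp (- 1 * x^2)" if "b \<in> Basis" for b x
   by (rule order_trans[OF B(2)[OF that] mult_right_mono[OF BB]]) simp
  have d_le: "norm (\<i> * \<theta> b * f2 b x) <= B' * exp (- 1 * x^2)" if "b \<in> Basis" for b x
   using mult_mono[OF \<theta>T[OF that] B(3)[OF that, of x]] T by (simp add: norm_mult B'_def mult.assoc)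
  let ?E = "%X::'a. B' ^ DIM('a) * exp (- 1 * (norm X)^2)"
  have E0: "0 <= ?E X" for X using B(1) BB by simp
  have \<Phi>_le: "norm (\<Phi> X) <= ?E X" for X
   unfolding \<Phi>_def basis_prod_def by (rule norm_prod_gaussian_le) (rule f_le)
  have D_le: "norm (basis_deriv f (%b x. \<i> * \<theta> b * f2 b x) X) <= real DIM('a) * ?E X" for X
  proof -
   have each: "norm (\<i> * \<theta> b * f2 b (X \<bullet> b) * (\<Prod>b'\<in>Basis - {b}. f b' (X \<bullet> b'))) <= ?E X" if "b \<in> Basis" for b
    by (rule norm_prod_gaussian_le'[OF _ that d_le[OF that]]) (rule f_le)
   show ?thesis unfolding basis_deriv_def
    by (rule order_trans[OF norm_sum sum_bounded_above]) (rule each)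
  qed
  have H_le: "norm (H X) <= ((real DIM('a) + rate) * B' ^ DIM('a)) * exp (- 1 * (norm X)^2)" for X
  proof -
   have "norm (potential X * basis_prod f X) <= rate * ?E X"
    unfolding norm_mult using norm_potential_le \<Phi>_le[of X] by (intro mult_mono) (auto simp: \<Phi>_def)
   then have "norm (H X) <= real DIM('a) * ?E X + rate * ?E X"
    unfolding H_def by (rule order_trans[OF norm_triangle_ineq add_mono[OF D_le]])
   then show ?thesis by (simp only: distrib_right mult.assoc)
  qed
  have cf: "f b \<in> borel_measurable borel" "f2 b \<in> borel_measurable borel" if "b \<in> Basis" for b
   using C2_compact_continuous[OF f[OF that]] by (auto intro: borel_measurable_continuous_onI)
  have \<Phi>m [measurable]: "\<Phi> \<in> borel_measurable borel" "basis_prod f \<in> borel_measurable borel"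
   unfolding \<Phi>_def by (intro borel_measurable_basis_prod cf; simp)+
  have [measurable]: "basis_deriv f (%b x. \<i> * \<theta> b * f2 b x) \<in> borel_measurable borel"
   by (intro borel_measurable_basis_deriv borel_measurable_times cf borel_measurable_const)
  have Hm [measurable]: "H \<in> borel_measurable borel" unfolding H_def[abs_def] by measurable
  have sq\<Phi>: "square_integrable \<Phi>"
   by (rule square_integrable_bound[OF _ integrable_gaussian_sq[OF zero_less_one] \<Phi>_le]) measurable
  have sqH: "square_integrable H"
   by (rule square_integrable_bound[OF _ integrable_gaussian_sq[OF zero_less_one] H_le]) measurable
  have pG: "pairing (m u) (G \<Phi>) = of_real eps * (pairing (m u) H - of_real c * pairing (m u) \<Phi>)" if "0 <= u" for u
  proof -
   have i: "integrable lborel (%X. m u X * H X)" "integrable lborel (%X. m u X * \<Phi> X)"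
    by (rule pairing_bound(1)[OF L2_continuousD(1)[OF m that] _ zero_less_one], rule sqH sq\<Phi>)+
   have GX: "G (basis_prod f) X = of_real eps * (basis_deriv f (%b x. \<i> * \<theta> b * f2 b x) X +
     (potential X - of_real c) * basis_prod f X)" for X
    by (rule G) (rule f)
   have eq: "m u X * G \<Phi> X = of_real eps * (m u X * H X - of_real c * (m u X * \<Phi> X))" for X
    unfolding \<Phi>_def GX H_def by (simp add: algebra_simps)
   show ?thesis unfolding pairing_def eq using i by simp
  qed
  have "((%z. pairing (m z) \<Phi>) has_vector_derivative pairing (m (t / eps)) (G \<Phi>)) (at (t / eps) within {0..})"
  proof -
   have "test_function (basis_prod f)" by (rule test_function_basis_prod) (rule f)
   then show ?thesis using sol t eps unfolding solves_in_L2_def \<Phi>_def by auto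
  qed
  then have d1: "((%z. pairing (m z) \<Phi>) has_vector_derivative pairing (m (t / eps)) (G \<Phi>)) (at (t / eps) within (%u. u / eps) ` {0..})"
   by (rule has_vector_derivative_within_subset) (use eps in auto)
  have d2: "((%u. u / eps) has_vector_derivative 1 / eps) (at t within {0..})"
   using eps by (auto intro!: derivative_eq_intros simp: has_real_derivative_iff_has_vector_derivative[symmetric])
  have d3: "((%u. pairing (m (u / eps)) \<Phi>) has_vector_derivative (1 / eps) *\<^sub>R pairing (m (t / eps)) (G \<Phi>)) (at t within {0..})"
   using vector_diff_chain_within[OF d2 d1] by (simp add: o_def)
  have d4: "((%u. complex_of_real (exp (c * u))) has_vector_derivative of_real (c * exp (c * t))) (at t within {0..})"
   by (rule has_vector_derivative_of_real)
    (auto intro!: derivative_eq_intros simp: has_real_derivative_iff_has_vector_derivative[symmetric])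
  have p: "pairing (%X. of_real w * m u X) F = of_real w * pairing (m u) F" for w u F
   unfolding pairing_def by (simp add: mult.assoc)
  have tgt: "of_real (exp (c * t)) * ((1 / eps) *\<^sub>R pairing (m (t / eps)) (G \<Phi>)) + of_real (c * exp (c * t)) * pairing (m (t / eps)) \<Phi> =
    of_real (exp (c * t)) * pairing (m (t / eps)) H"
   unfolding pG[OF divide_nonneg_pos[OF t eps]] using eps by (simp add: scaleR_conv_of_real algebra_simps)
  from has_vector_derivative_mult[OF d4 d3]
  show "((%t. pairing (%X. of_real (exp (c * t)) * m (t / eps) X) (basis_prod f)) has_vector_derivative
    pairing (%X. of_real (exp (c * t)) * m (t / eps) X)
     (%X. basis_deriv f (%b x. \<i> * complex_of_real (\<theta> b) * f2 b x) X + potential X * basis_prod f X))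
    (at t within {0..})"
   unfolding p tgt unfolding H_def[abs_def] \<Phi>_def .
 qed
qed

text \<open>Finitely many types of kicks, each with a wave vector distributed with density \<open>g\<close>.\<close>

definition kick_measure :: "nat => (plane => real) => (nat \<times> plane) measure" where
 "kick_measure N g = count_space {..<N} \<Otimes>\<^sub>M density lborel (%k. ennreal (g k))"

context
 fixes N :: nat and g :: "plane => real"
 assumes g: "integrable lborel g" and g0: "!!k. 0 <= g k"
begin

lemma finite_measure_density: "finite_measure (density lborel (%k. ennreal (g k)))"
proof
 have "emeasure (density lborel (%k. ennreal (g k))) (space (density lborel (%k. ennreal (g k)))) = ennreal (LINT k|lborel. g k)"
  using g g0 by (subst emeasure_density) (auto simp: nn_integral_eq_integral)
 then show "emeasure (density lborel (%k. ennreal (g k))) (space (density lborel (%k. ennreal (g k)))) ~= \<infinity>" by simp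
qed

lemma finite_measure_kick: "finite_measure (kick_measure N g)"
proof -
 interpret D: finite_measure "density lborel (%k. ennreal (g k))" by (rule finite_measure_density)
 interpret I: finite_measure "count_space {..<N}" by (rule finite_measure_count_space) simp
 interpret P: pair_sigma_finite "count_space {..<N}" "density lborel (%k. ennreal (g k))" ..
 show ?thesis unfolding kick_measure_def
  by (rule finite_measure_pair_measure) unfold_locales
qed

lemma integral_kick_measure:
 fixes F :: "nat \<times> plane => complex"
 assumes F [measurable]: "F \<in> borel_measurable (kick_measure N g)" and B: "!!x. norm (F x) <= B"
 shows "(LINT x|kick_measure N g. F x) = (\<Sum>i<N. LINT k|lborel. of_real (g k) * F (i, k))"
proof -
 let ?D = "density lborel (%k. ennreal (g k))"
 interpret D: finite_measure ?D by (rule finite_measure_density)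
 interpret I: finite_measure "count_space {..<N}" by (rule finite_measure_count_space) simp
 interpret K: finite_measure "kick_measure N g" by (rule finite_measure_kick)
 interpret P: pair_sigma_finite "count_space {..<N}" ?D ..
 have int: "integrable (count_space {..<N} \<Otimes>\<^sub>M ?D) F"
  using K.integrable_const_bound[of F B] B unfolding kick_measure_def by (auto simp: kick_measure_def[symmetric])
 have "(LINT x|kick_measure N g. F x) = (LINT i|count_space {..<N}. (LINT k|?D. F (i, k)))"
  unfolding kick_measure_def by (rule P.integral_fst'[OF int, symmetric])
 also have "\<dots> = (\<Sum>i<N. LINT k|?D. F (i, k))" by (simp add: lebesgue_integral_count_space_finite)
 also have "\<dots> = (\<Sum>i<N. LINT k|lborel. of_real (g k) * F (i, k))"
 proof (rule sum.cong[OF refl])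
  fix i assume i: "i \<in> {..<N}"
  have "(%k. F (i, k)) \<in> borel_measurable ?D"
   by (rule measurable_compose[OF measurable_Pair1' F[unfolded kick_measure_def]]) (use i in simp)
  then show "(LINT k|?D. F (i, k)) = (LINT k|lborel. of_real (g k) * F (i, k))"
   using g g0 by (subst integral_density) (auto simp: scaleR_conv_of_real)
 qed
 finally show ?thesis .
qed

lemma AE_kick_measure:
 assumes "!!i. i < N ==> AE k in lborel. P (i, k)"
 shows "AE x in kick_measure N g. P x"
proof -
 let ?D = "density lborel (%k. ennreal (g k))"
 interpret D: finite_measure ?D by (rule finite_measure_density)
 have "\<forall>i\<in>{..<N}. \<exists>S\<in>null_sets lborel. {k. \<not> P (i, k)} \<subseteq> S"
  using assms unfolding eventually_ae_filter by auto
 then obtain S where S: "!!i. i < N ==> S i \<in> null_sets lborel" "!!i. i < N ==> {k. \<not> P (i, k)} \<subseteq> S i"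
  by (metis lessThan_iff)
 define U where "U = (\<Union>i\<in>{..<N}. {i} \<times> S i)"
 have Sm: "S i \<in> sets lborel" "emeasure ?D (S i) = 0" if "i < N" for i
 proof -
  show "S i \<in> sets lborel" using S(1)[OF that] by auto
  have "S i \<in> null_sets ?D"
   using S(1)[OF that] g by (subst null_sets_density_iff) (auto dest: AE_not_in)
  then show "emeasure ?D (S i) = 0" by auto
 qed
 have "U \<in> null_sets (kick_measure N g)"
  unfolding U_def
 proof (rule null_sets_UN')
  fix i assume i: "i \<in> {..<N}"
  have "emeasure (count_space {..<N} \<Otimes>\<^sub>M ?D) ({i} \<times> S i) = emeasure (count_space {..<N}) {i} * emeasure ?D (S i)"
   using i Sm by (intro D.emeasure_pair_measure_Times) auto
  then show "{i} \<times> S i \<in> null_sets (kick_measure N g)"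
   unfolding kick_measure_def using i Sm by (intro null_setsI) auto
 qed simp
 moreover have "{x \<in> space (kick_measure N g). \<not> P x} \<subseteq> U"
  using S(2) by (auto simp: U_def kick_measure_def space_pair_measure)
 ultimately show ?thesis by (auto simp: eventually_ae_filter)
qed

end

section \<open>Resonant channels\<close>

lemma set_integrable_const_Icc: "set_integrable lborel {a..b} (%_::real. c::real)"
 unfolding set_integrable_def
 by (intro integrable_scaleR_left integrable_real_indicator) (auto simp: emeasure_lborel_Icc_eq)

context kicks
begin

text \<open>The integrated resonance is a primitive of the averaged phase, which is why the iterated
 time integrals produce an exponential series.\<close>

lemma resonant_integral:
 fixes \<omega> :: "'k => real"
 assumes [measurable]: "\<omega> \<in> borel_measurable K" "J \<in> sets K" and t: "0 <= t"
 defines "\<phi> \<equiv> %u. LINT k|K. indicator J k *\<^sub>R cis (- \<omega> k * u)"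
 defines "\<Phi> \<equiv> %t. LINT u:{0..t}|lborel. \<phi> u"
 shows "continuous_on UNIV \<phi>" and "norm (\<phi> u) <= rate"
  and "(LINT u:{0..t}|lborel. \<phi> u * \<Phi> u ^ n) = \<Phi> t ^ Suc n / of_nat (Suc n)"
  and "norm (\<Phi> t) <= rate * t"
  and "continuous_on {0..t} \<Phi>"
proof -
 have b: "norm (indicator J k *\<^sub>R cis (- \<omega> k * u)) <= 1" for k u by (simp add: indicator_def)
 show c: "continuous_on UNIV \<phi>"
  unfolding continuous_on_sequentially \<phi>_def o_def
 proof (intro allI ballI impI)
  fix X :: "nat => real" and a assume "(\<forall>n. X n \<in> UNIV) \<and> X \<longlonglongrightarrow> a"
  then have X: "X \<longlonglongrightarrow> a" by simp
  show "(%n. LINT k|K. indicator J k *\<^sub>R cis (- \<omega> k * X n)) \<longlonglongrightarrow> (LINT k|K. indicator J k *\<^sub>R cis (- \<omega> k * a))"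
  proof (rule integral_dominated_convergence[where w = "%_. 1"])
   show "AE k in K. (%n. indicator J k *\<^sub>R cis (- \<omega> k * X n)) \<longlonglongrightarrow> indicator J k *\<^sub>R cis (- \<omega> k * a)"
    unfolding cis_conv_exp by (intro AE_I2 tendsto_intros X)
  qed (use b in \<open>auto intro!: AE_I2\<close>)
 qed
 have i: "integrable K (%k. indicator J k *\<^sub>R cis (- \<omega> k * u))" for u
  by (rule integrable_const_bound[where B = 1]) (use b in \<open>auto intro!: AE_I2\<close>)
 show \<phi>_le: "norm (\<phi> u) <= rate" for u
 proof -
  have "norm (\<phi> u) <= (LINT k|K. norm (indicator J k *\<^sub>R cis (- \<omega> k * u)))"
   unfolding \<phi>_def by (rule integral_norm_bound)
  also have "\<dots> <= (LINT k|K. 1)" by (rule integral_mono[OF integrable_norm[OF i]]) (use b in auto)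
  finally show ?thesis by simp
 qed
 have \<Phi>I: "\<Phi> u = integral {0..u} \<phi>" if "0 <= u" for u
  unfolding \<Phi>_def by (rule set_borel_integral_eq_integral(2)) (rule set_integrable_continuous_Icc[OF continuous_on_subset[OF c]], simp)
 have d: "(\<Phi> has_vector_derivative \<phi> u) (at u within {0..t})" if "u \<in> {0..t}" for u
 proof -
  have "((%u. integral {0..u} \<phi>) has_vector_derivative \<phi> u) (at u within {0..t})"
   by (rule integral_has_vector_derivative[OF continuous_on_subset[OF c] that]) simp
  then show ?thesis by (rule has_vector_derivative_transform[OF that, rotated]) (use \<Phi>I in simp)
 qed
 show c\<Phi>: "continuous_on {0..t} \<Phi>"
  unfolding continuous_on_eq_continuous_within by (intro ballI has_vector_derivative_continuous[OF d])
 have dn: "((%u. \<Phi> u ^ Suc n / of_nat (Suc n)) has_vector_derivative \<phi> u * \<Phi> u ^ n) (at u within {0..t})" if "u \<in> {0..t}" for u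
 proof -
  have p: "((%z::complex. z ^ Suc n / of_nat (Suc n)) has_field_derivative \<Phi> u ^ n) (at (\<Phi> u) within S)" for S
   by (rule derivative_eq_intros refl | simp add: field_simps del: of_nat_Suc)+
  from field_vector_diff_chain_within[OF d[OF that] p] show ?thesis by (simp add: o_def mult.commute)
 qed
 have "((%u. \<phi> u * \<Phi> u ^ n) has_integral (\<Phi> t ^ Suc n / of_nat (Suc n) - \<Phi> 0 ^ Suc n / of_nat (Suc n))) {0..t}"
  by (rule fundamental_theorem_of_calculus[OF t dn])
 moreover have "\<Phi> 0 = 0" using \<Phi>I[of 0] by simp
 moreover have "(LINT u:{0..t}|lborel. \<phi> u * \<Phi> u ^ n) = integral {0..t} (%u. \<phi> u * \<Phi> u ^ n)"
  by (rule set_borel_integral_eq_integral(2), rule set_integrable_continuous_Icc)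
   (intro continuous_intros continuous_on_subset[OF c] c\<Phi>; simp)
 ultimately show "(LINT u:{0..t}|lborel. \<phi> u * \<Phi> u ^ n) = \<Phi> t ^ Suc n / of_nat (Suc n)"
  by (simp add: integral_unique)
 have "norm (\<Phi> t) <= (LINT u:{0..t}|lborel. rate)"
  unfolding \<Phi>_def by (rule norm_set_integral_le[OF \<phi>_le set_integrable_const_Icc])
 then show "norm (\<Phi> t) <= rate * t" using t by (simp add: set_lebesgue_integral_def mult.commute)
qed

text \<open>Average of \<open>cis (- \<omega> k * u)\<close> over the kicks in \<open>J\<close>, integrated over the time \<open>u\<close>.\<close>

definition resonance :: "('k => real) => 'k set => real => complex" where
 "resonance \<omega> J t = (LINT u:{0..t}|lborel. (LINT k|K. indicator J k *\<^sub>R cis (- \<omega> k * u)))"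

lemma resonance_step:
 assumes \<omega> [measurable]: "\<omega> \<in> borel_measurable K" and J [measurable]: "J \<in> sets K" and t: "0 <= t"
 shows "(LINT k|K. indicator J k *\<^sub>R (LINT u:{0..t}|lborel. cis (- w * u) * (H * cis (- (w + \<omega> k) * (t - u)) * resonance \<omega> J (t - u) ^ n / fact n))) =
  H * cis (- w * t) * resonance \<omega> J t ^ Suc n / fact (Suc n)"
proof -
 let ?\<Phi> = "resonance \<omega> J"
 let ?\<phi> = "%u. LINT k|K. indicator J k *\<^sub>R cis (- \<omega> k * u)"
 note R = resonant_integral[OF \<omega> J, folded resonance_def]
 define P where "P u = indicator {0..t} u *\<^sub>R (H * cis (- w * t) * ?\<Phi> u ^ n / fact n)" for u
 have c: "continuous_on {0..t} (%u. H * cis (- w * t) * ?\<Phi> u ^ n / fact n)"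
  by (intro continuous_intros R(5)[OF t]) simp_all
 have Pm [measurable]: "P \<in> borel_measurable borel"
  unfolding P_def[abs_def] by (rule borel_measurable_continuous_on_indicator[OF _ c]) simp
 have Pb: "norm (P u) <= norm H * (rate * t) ^ n / fact n" for u
 proof (cases "u \<in> {0..t}")
  case True
  then have "norm (?\<Phi> u) <= rate * t" using R(4)[of u] mult_left_mono[of u t rate] by (simp add: order_trans)
  then have "norm (?\<Phi> u) ^ n <= (rate * t) ^ n" by (rule power_mono) simp
  then show ?thesis using True by (simp add: P_def norm_mult norm_divide norm_power mult_left_mono divide_right_mono)
 qed (use t in \<open>simp add: P_def\<close>)
 have LK: "pair_sigma_finite (lborel :: real measure) K" by unfold_locales
 have int: "integrable (lborel \<Otimes>\<^sub>M K) (%(u, k). P u * (indicator J k *\<^sub>R cis (- \<omega> k * u)))"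
 proof (rule pair_sigma_finite.Fubini_integrable[OF LK])
  have iP: "integrable lborel P" unfolding P_def
   using set_integrable_continuous_Icc[OF c] by (simp add: set_integrable_def)
  have ik: "integrable K (%k. P u * (indicator J k *\<^sub>R cis (- \<omega> k * u)))" for u
   by (rule integrable_const_bound[where B = "norm (P u)"]) (auto simp: norm_mult indicator_def intro!: AE_I2)
  show "AE u in lborel. integrable K (%k. case (u, k) of (u, k) => P u * (indicator J k *\<^sub>R cis (- \<omega> k * u)))"
   using ik by simp
  show "integrable lborel (%u. LINT k|K. norm (case (u, k) of (u, k) => P u * (indicator J k *\<^sub>R cis (- \<omega> k * u))))"
   using iP by (simp add: norm_mult)
 qed measurable
 have "(LINT k|K. indicator J k *\<^sub>R (LINT u:{0..t}|lborel. cis (- w * u) * (H * cis (- (w + \<omega> k) * (t - u)) * ?\<Phi> (t - u) ^ n / fact n))) =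
   (LINT k|K. (LINT u|lborel. P u * (indicator J k *\<^sub>R cis (- \<omega> k * u))))"
 proof (rule integral_cong_fun)
  fix k
  have e: "cis (- w * u) * (H * cis (- (w + \<omega> k) * (t - u)) * ?\<Phi> (t - u) ^ n / fact n) =
    (%v. H * cis (- w * t) * ?\<Phi> v ^ n / fact n * cis (- \<omega> k * v)) (t - u)" for u
  proof -
   have "cis (- w * u) * cis (- (w + \<omega> k) * (t - u)) = cis (- w * t) * cis (- \<omega> k * (t - u))"
    unfolding cis_mult by (rule arg_cong[of _ _ cis]) (simp add: algebra_simps)
   then have "(cis (- w * u) * cis (- (w + \<omega> k) * (t - u))) * (H * ?\<Phi> (t - u) ^ n / fact n) =
     (cis (- w * t) * cis (- \<omega> k * (t - u))) * (H * ?\<Phi> (t - u) ^ n / fact n)" by simp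
   then show ?thesis by (simp add: mult_ac)
  qed
  have "(LINT u:{0..t}|lborel. cis (- w * u) * (H * cis (- (w + \<omega> k) * (t - u)) * ?\<Phi> (t - u) ^ n / fact n)) =
   (LINT v:{0..t}|lborel. H * cis (- w * t) * ?\<Phi> v ^ n / fact n * cis (- \<omega> k * v))"
   unfolding e by (rule set_integral_reflect)
  also have "\<dots> = (LINT v|lborel. P v * cis (- \<omega> k * v))"
   unfolding set_lebesgue_integral_def P_def by (simp only: mult_scaleR_left)
  finally show "indicator J k *\<^sub>R (LINT u:{0..t}|lborel. cis (- w * u) * (H * cis (- (w + \<omega> k) * (t - u)) * ?\<Phi> (t - u) ^ n / fact n)) =
    (LINT u|lborel. P u * (indicator J k *\<^sub>R cis (- \<omega> k * u)))"
   by simp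
 qed
 also have "\<dots> = (LINT u|lborel. (LINT k|K. P u * (indicator J k *\<^sub>R cis (- \<omega> k * u))))"
  using pair_sigma_finite.Fubini_integral[OF LK int] by (simp only: prod.case)
 also have "\<dots> = (LINT u|lborel. P u * ?\<phi> u)" by (simp only: integral_mult_right_zero)
 also have "\<dots> = (LINT u:{0..t}|lborel. H * cis (- w * t) / fact n * (?\<phi> u * ?\<Phi> u ^ n))"
 proof -
  have "(a * b * F / f) * y = a * b / f * (y * F)" for a b F f y :: complex
   by (simp add: mult.commute mult.left_commute)
  then show ?thesis unfolding set_lebesgue_integral_def P_def by (simp only: mult_scaleR_left)
 qed
 also have "\<dots> = H * cis (- w * t) / fact n * (LINT u:{0..t}|lborel. ?\<phi> u * ?\<Phi> u ^ n)"
  by (simp only: set_lebesgue_integral_def mult_scaleR_right[symmetric] integral_mult_right_zero)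
 also have "\<dots> = H * cis (- w * t) / fact n * (?\<Phi> t ^ Suc n / of_nat (Suc n))" unfolding R(3)[OF t] ..
 also have "\<dots> = H * cis (- w * t) * ?\<Phi> t ^ Suc n / fact (Suc n)"
  by (simp add: fact_Suc mult_ac del: of_nat_Suc)
 finally show ?thesis .
qed

text \<open>\<open>R\<close> is a set of resonant states that is left invariant by almost every kick in \<open>J\<close>, while
 almost every other kick is detuned.  On \<open>R\<close> the limiting frequency is additive along kicks, so
 the contributions of successive kicks factorise.\<close>

lemma dyson_resonant_limit:
 fixes Om :: "nat => 'a => real" and q :: "nat => 'a" and h :: "nat => 'a => complex" and w :: "'a => real"
 assumes m [measurable]: "!!j. Om j \<in> borel_measurable borel" "!!j. h j \<in> borel_measurable borel" "w \<in> borel_measurable borel"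
   "J \<in> sets K"
  and h1: "!!j p. norm (h j p) <= 1"
  and good: "!!P. P \<in> R ==> (%j. Om j (q j + P)) \<longlonglongrightarrow> w P" "!!P. P \<in> R ==> (%j. h j (q j + P)) \<longlonglongrightarrow> H"
  and sJ: "!!k. k \<in> J ==> s k = 1"
  and w_add: "!!P k. k \<in> J ==> w (P + A k) = w P + w (A k)"
  and kick: "!!P. P \<in> R ==> AE k in K. (k \<in> J \<and> P + A k \<in> R) \<or>
    (k \<notin> J \<and> filterlim (%j. Om j (q j + P) - Om j (q j + (P + A k))) at_infinity sequentially)"
  and P: "P \<in> R" and t: "0 <= t"
 shows "(%j. dyson (Om j) (h j) n t (q j + P)) \<longlonglongrightarrow> H * cis (- w P * t) * resonance (%k. w (A k)) J t ^ n / fact n"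
 using P t
proof (induction n arbitrary: P t)
 case 0
 have "(%j. cis (- Om j (q j + P) * t) * h j (q j + P)) \<longlonglongrightarrow> cis (- w P * t) * H"
  unfolding cis_conv_exp by (intro tendsto_intros good 0)
 then show ?case by (simp add: mult.commute)
next
 case (Suc n)
 let ?\<Phi> = "resonance (%k. w (A k)) J"
 define L where "L u k = indicator J k *\<^sub>R (H * cis (- (w P + w (A k)) * u) * ?\<Phi> u ^ n / fact n)" for u k
 have [measurable]: "?\<Phi> \<in> borel_measurable borel"
  unfolding resonance_def set_lebesgue_integral_def by measurable
 have Lm: "(%(u, k). L u k) \<in> borel_measurable (lborel \<Otimes>\<^sub>M K)" unfolding L_def by measurable
 have "(%j. dyson (Om j) (h j) (Suc n) t (q j + P)) \<longlonglongrightarrow>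
   (LINT k|K. s k * (LINT u:{0..t}|lborel. cis (- w P * u) * L (t - u) k))"
 proof (rule dyson_step_limit[OF m(1) m(2) Lm h1 Suc.prems(2) good(1)[OF Suc.prems(1)]])
  show "AE k in K.
   (\<forall>u\<in>{0..t}. (%j. dyson (Om j) (h j) n u (q j + P + A k)) \<longlonglongrightarrow> L u k) \<or>
   ((\<forall>u\<in>{0..t}. L u k = 0) \<and> filterlim (%j. Om j (q j + P) - Om j (q j + P + A k)) at_infinity sequentially)"
   using kick[OF Suc.prems(1)]
  proof eventually_elim
   case (elim k)
   show ?case
   proof (cases "k \<in> J")
    case True
    then have "P + A k \<in> R" using elim by blast
    then have "(%j. dyson (Om j) (h j) n u (q j + P + A k)) \<longlonglongrightarrow> L u k" if "u \<in> {0..t}" for u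
     using Suc.IH[of "P + A k" u] that True w_add[OF True] by (simp add: L_def add.assoc)
    then show ?thesis by blast
   next
    case False
    then show ?thesis using elim by (auto simp: L_def add.assoc)
   qed
  qed
 qed
 also have "(LINT k|K. s k * (LINT u:{0..t}|lborel. cis (- w P * u) * L (t - u) k)) =
   (LINT k|K. indicator J k *\<^sub>R (LINT u:{0..t}|lborel. cis (- w P * u) * (H * cis (- (w P + w (A k)) * (t - u)) * ?\<Phi> (t - u) ^ n / fact n)))"
 proof (rule integral_cong_fun)
  fix k show "s k * (LINT u:{0..t}|lborel. cis (- w P * u) * L (t - u) k) =
   indicator J k *\<^sub>R (LINT u:{0..t}|lborel. cis (- w P * u) * (H * cis (- (w P + w (A k)) * (t - u)) * ?\<Phi> (t - u) ^ n / fact n))"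
   by (cases "k \<in> J") (simp_all add: sJ L_def)
 qed
 also have "\<dots> = H * cis (- w P * t) * ?\<Phi> t ^ Suc n / fact (Suc n)"
  by (rule resonance_step[OF _ m(4) Suc.prems(2)]) measurable
 finally show ?case .
qed

text \<open>The unkicked state lies at the intersection of two channels.  The first kick decides which
 one is entered, and it is never left afterwards.\<close>

lemma dyson_two_channel_limit:
 fixes Om :: "nat => 'a => real" and q :: "nat => 'a" and h :: "nat => 'a => complex" and w :: "'a => real"
 assumes m [measurable]: "!!j. Om j \<in> borel_measurable borel" "!!j. h j \<in> borel_measurable borel" "w \<in> borel_measurable borel"
   "J1 \<in> sets K" "J2 \<in> sets K" and dis: "J1 \<inter> J2 = {}"
  and h1: "!!j p. norm (h j p) <= 1"
  and start: "(%j. Om j (q j)) \<longlonglongrightarrow> w 0" "w 0 = 0"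
  and sJ: "!!k. k \<in> J1 \<union> J2 ==> s k = 1"
  and kick: "AE k in K. (k \<in> J1 \<and> (\<forall>u\<ge>0. (%j. dyson (Om j) (h j) n u (q j + A k)) \<longlonglongrightarrow>
     H * cis (- w (A k) * u) * resonance (%k. w (A k)) J1 u ^ n / fact n)) \<or>
    (k \<in> J2 \<and> (\<forall>u\<ge>0. (%j. dyson (Om j) (h j) n u (q j + A k)) \<longlonglongrightarrow>
     H * cis (- w (A k) * u) * resonance (%k. w (A k)) J2 u ^ n / fact n)) \<or>
    (k \<notin> J1 \<union> J2 \<and> filterlim (%j. Om j (q j) - Om j (q j + A k)) at_infinity sequentially)"
  and t: "0 <= t"
 shows "(%j. dyson (Om j) (h j) (Suc n) t (q j)) \<longlonglongrightarrow>
  H * resonance (%k. w (A k)) J1 t ^ Suc n / fact (Suc n) + H * resonance (%k. w (A k)) J2 t ^ Suc n / fact (Suc n)"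
proof -
 define Z where "Z J u k = H * cis (- (0 + w (A k)) * u) * resonance (%k. w (A k)) J u ^ n / fact n" for J u k
 define L where "L u k = indicator J1 k *\<^sub>R Z J1 u k + indicator J2 k *\<^sub>R Z J2 u k" for u k
 have rm: "resonance (%k. w (A k)) J \<in> borel_measurable borel" if [measurable]: "J \<in> sets K" for J
  unfolding resonance_def set_lebesgue_integral_def by measurable
 note [measurable] = rm[OF m(4)] rm[OF m(5)]
 have Lm: "(%(u, k). L u k) \<in> borel_measurable (lborel \<Otimes>\<^sub>M K)" unfolding L_def Z_def by measurable
 have "(%j. dyson (Om j) (h j) (Suc n) t (q j)) \<longlonglongrightarrow>
   (LINT k|K. s k * (LINT u:{0..t}|lborel. cis (- w 0 * u) * L (t - u) k))"
 proof (rule dyson_step_limit[OF m(1) m(2) Lm h1 t start(1)])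
  show "AE k in K. (\<forall>u\<in>{0..t}. (%j. dyson (Om j) (h j) n u (q j + A k)) \<longlonglongrightarrow> L u k) \<or>
   ((\<forall>u\<in>{0..t}. L u k = 0) \<and> filterlim (%j. Om j (q j) - Om j (q j + A k)) at_infinity sequentially)"
   using kick
  proof eventually_elim
   case (elim k)
   consider "k \<in> J1" "k \<notin> J2" | "k \<in> J2" "k \<notin> J1" | "k \<notin> J1 \<union> J2" using dis by blast
   then show ?case using elim by cases (auto simp: L_def Z_def)
  qed
 qed
 also have "(LINT k|K. s k * (LINT u:{0..t}|lborel. cis (- w 0 * u) * L (t - u) k)) =
   (LINT k|K. indicator J1 k *\<^sub>R (LINT u:{0..t}|lborel. cis (- 0 * u) * Z J1 (t - u) k) +
    indicator J2 k *\<^sub>R (LINT u:{0..t}|lborel. cis (- 0 * u) * Z J2 (t - u) k))"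
 proof (rule integral_cong_fun)
  fix k
  consider "k \<in> J1" "k \<notin> J2" | "k \<in> J2" "k \<notin> J1" | "k \<notin> J1 \<union> J2" using dis by blast
  then show "s k * (LINT u:{0..t}|lborel. cis (- w 0 * u) * L (t - u) k) =
   indicator J1 k *\<^sub>R (LINT u:{0..t}|lborel. cis (- 0 * u) * Z J1 (t - u) k) +
    indicator J2 k *\<^sub>R (LINT u:{0..t}|lborel. cis (- 0 * u) * Z J2 (t - u) k)"
   by cases (simp_all add: sJ L_def start(2))
 qed
 also have "\<dots> = (LINT k|K. indicator J1 k *\<^sub>R (LINT u:{0..t}|lborel. cis (- 0 * u) * Z J1 (t - u) k)) +
    (LINT k|K. indicator J2 k *\<^sub>R (LINT u:{0..t}|lborel. cis (- 0 * u) * Z J2 (t - u) k))"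
 proof (rule Bochner_Integration.integral_add)
  have Zi: "integrable K (%k. indicator J k *\<^sub>R (LINT u:{0..t}|lborel. cis (- 0 * u) * Z J (t - u) k))"
   if [measurable]: "J \<in> sets K" for J
  proof (rule integrable_const_bound)
   note [measurable] = rm[OF that]
   have zb: "norm (cis (- 0 * u) * Z J (t - u) k) <= norm H * (rate * t) ^ n / fact n" if u: "u \<in> {0..t}" for u k
   proof -
    have "norm (resonance (%k. w (A k)) J (t - u)) <= rate * (t - u)"
     unfolding resonance_def by (rule resonant_integral(4)) (use u in auto)
    also have "\<dots> <= rate * t" using u by (intro mult_left_mono) auto
    finally have "norm (resonance (%k. w (A k)) J (t - u)) ^ n <= (rate * t) ^ n" by (rule power_mono) simp
    then show ?thesis by (simp add: Z_def norm_mult norm_divide norm_power mult_left_mono divide_right_mono)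
   qed
   have "norm (LINT u:{0..t}|lborel. cis (- 0 * u) * Z J (t - u) k) <= (LINT u:{0..t}|lborel. norm H * (rate * t) ^ n / fact n)" for k
    by (rule norm_set_integral_le[OF zb set_integrable_const_Icc])
   note le = this
   have "norm (indicator J k *\<^sub>R (LINT u:{0..t}|lborel. cis (- 0 * u) * Z J (t - u) k)) <= (LINT u:{0..t}|lborel. norm H * (rate * t) ^ n / fact n)" for k
   proof -
    have "norm (indicator J k *\<^sub>R y) <= norm y" for y :: complex by (simp add: indicator_def)
    from order_trans[OF this le] show ?thesis .
   qed
   then show "AE k in K. norm (indicator J k *\<^sub>R (LINT u:{0..t}|lborel. cis (- 0 * u) * Z J (t - u) k)) <= (LINT u:{0..t}|lborel. norm H * (rate * t) ^ n / fact n)"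
    by (rule AE_I2)
   show "(%k. indicator J k *\<^sub>R (LINT u:{0..t}|lborel. cis (- 0 * u) * Z J (t - u) k)) \<in> borel_measurable K"
    unfolding Z_def set_lebesgue_integral_def by measurable
  qed
  show "integrable K (%k. indicator J1 k *\<^sub>R (LINT u:{0..t}|lborel. cis (- 0 * u) * Z J1 (t - u) k))"
   by (rule Zi[OF m(4)])
  show "integrable K (%k. indicator J2 k *\<^sub>R (LINT u:{0..t}|lborel. cis (- 0 * u) * Z J2 (t - u) k))"
   by (rule Zi[OF m(5)])
 qed
 also have "\<dots> = H * cis (- 0 * t) * resonance (%k. w (A k)) J1 t ^ Suc n / fact (Suc n) +
   H * cis (- 0 * t) * resonance (%k. w (A k)) J2 t ^ Suc n / fact (Suc n)"
  unfolding Z_def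
  by (intro arg_cong2[of _ _ _ _ "(+)"] resonance_step[OF _ m(4) t] resonance_step[OF _ m(5) t]) measurable
 finally show ?thesis by simp
qed

end

section \<open>Gaussian initial data\<close>

text \<open>The density of the normal law with variance \<open>1 / r0^2\<close> in each coordinate: the transform of
 the initial data in the frequency scale \<open>eps\<close>, normalised by \<open>(2 \<pi>)^d\<close>.\<close>

definition gauss :: "real => 'a::euclidean_space => real" where
 "gauss r0 xi = (r0 / sqrt (2 * pi)) ^ DIM('a) * exp (- (r0^2 / 2) * (norm xi)^2)"

lemma borel_measurable_gauss [measurable]: "gauss r0 \<in> borel_measurable borel"
 unfolding gauss_def[abs_def] by measurable

lemma gauss_nonneg: "r0 > 0 ==> 0 <= gauss r0 xi"
 by (simp add: gauss_def)

lemma integrable_gauss: "r0 > 0 ==> integrable lborel (gauss r0 :: 'a::euclidean_space => real)"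
 unfolding gauss_def[abs_def] by (intro integrable_mult_right integrable_gaussian_euclidean(1)) simp

lemma gaussian_fourier:
 fixes p :: "'a::euclidean_space"
 assumes r0: "r0 > 0" and eps: "eps > 0"
 shows "integrable lborel (%X::'a. complex_of_real (exp (- (eps^2 * (norm X)^2 / (2 * r0^2)))))" (is ?A)
  and "(LINT X|lborel. of_real (exp (- (eps^2 * (norm X)^2 / (2 * r0^2)))) * cis (- (p \<bullet> X))) =
   complex_of_real ((sqrt (2 * pi) * r0 / eps) ^ DIM('a) * exp (- (r0^2 * (norm p)^2 / (2 * eps^2))))" (is ?B)
proof -
 define \<delta> where "\<delta> = eps^2 / r0^2"
 have \<delta>: "\<delta> > 0" using assms by (simp add: \<delta>_def)
 have "symbol (%_. of_real \<delta>) (%b. of_real ((0::'a) \<bullet> b)) X = of_real (exp (- (\<delta> * (norm X)^2 / 2)))" for X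
  unfolding symbol_def basis_prod_def
  by (simp add: norm_sq_Basis exp_of_real[symmetric] exp_sum[symmetric] sum_negf sum_divide_distrib sum_distrib_left)
 then have S: "symbol (%_. of_real \<delta>) (%b. of_real ((0::'a) \<bullet> b)) X = of_real (exp (- (eps^2 * (norm X)^2 / (2 * r0^2))))" for X
  by (simp add: \<delta>_def mult.commute)
 show ?A unfolding S[symmetric] by (rule integrable_symbol) (use \<delta> in simp)
 have "sqrt (2 * pi / \<delta>) = sqrt (2 * pi) * r0 / eps"
  using assms by (simp add: \<delta>_def real_sqrt_divide real_sqrt_mult)
 moreover have "- (norm (p - 0))\<^sup>2 / (2 * \<delta>) = - (r0^2 * (norm p)^2 / (2 * eps^2))"
  by (simp add: \<delta>_def)
 moreover have "(LINT X|lborel. symbol (%_. of_real \<delta>) (%b. of_real ((0::'a) \<bullet> b)) X * cis (- (X \<bullet> p))) =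
   packet (%_. of_real \<delta>) (%b. of_real ((0::'a) \<bullet> b)) p"
  by (rule packet_fourier) (use \<delta> in simp)
 ultimately show ?B unfolding S packet_real[OF \<delta>] by (simp only: inner_commute[of p])
qed

context weak_evolution
begin

text \<open>The substitution \<open>p = eps * xi\<close> makes the weight independent of \<open>eps\<close>.\<close>

lemma gaussian_expansion:
 assumes r0: "r0 > 0" and eps: "eps > 0" and \<nu>0: "\<nu> 0 = (%X. of_real (exp (- (eps^2 * (norm X)^2 / (2 * r0^2)))))"
  and t: "0 <= t" and cont: "isCont (\<nu> t) X0"
 shows "(%n. LINT xi|lborel. of_real (gauss r0 xi) * dyson freq (%p. cis (p \<bullet> X0)) n t (eps *\<^sub>R xi)) sums \<nu> t X0"
proof -
 define c where "c = complex_of_real ((2 * pi) ^ DIM('a))"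
 have c0: "c ~= 0" by (simp add: c_def)
 have it: "initial_transform = (%p. complex_of_real ((sqrt (2 * pi) * r0 / eps) ^ DIM('a) * exp (- (r0^2 * (norm p)^2 / (2 * eps^2)))))"
  unfolding initial_transform_def[abs_def] \<nu>0 gaussian_fourier(2)[OF r0 eps] ..
 have "integrable lborel (%p::'a. exp (- (r0^2 / (2 * eps^2)) * (norm p)^2))"
  by (rule integrable_gaussian_euclidean(1)) (use r0 eps in simp)
 then have m: "integrable lborel initial_transform" unfolding it by simp
 have i0: "integrable lborel (\<nu> 0)" unfolding \<nu>0 by (rule gaussian_fourier(1)[OF r0 eps])
 have [measurable]: "initial_transform \<in> borel_measurable borel" using m by auto
 have cm [measurable]: "(%p. cis (p \<bullet> X0)) \<in> borel_measurable borel" by measurable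
 have mterm: "moment_term initial_transform freq (%p. cis (p \<bullet> X0)) n t =
   c * (LINT xi|lborel. of_real (gauss r0 xi) * dyson freq (%p. cis (p \<bullet> X0)) n t (eps *\<^sub>R xi))" for n
 proof -
  let ?D = "%p. dyson freq (%p. cis (p \<bullet> X0)) n t p"
  have "moment_term initial_transform freq (%p. cis (p \<bullet> X0)) n t =
    eps ^ DIM('a) *\<^sub>R (LINT xi|lborel. initial_transform (0 + eps *\<^sub>R xi) * ?D (0 + eps *\<^sub>R xi))"
   unfolding moment_term_def by (rule lborel_integral_affine[OF eps]) measurable
  also have "\<dots> = (LINT xi|lborel. of_real (eps ^ DIM('a)) * (initial_transform (eps *\<^sub>R xi) * ?D (eps *\<^sub>R xi)))"
   by (simp add: scaleR_conv_of_real)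
  also have "\<dots> = (LINT xi|lborel. c * (of_real (gauss r0 xi) * ?D (eps *\<^sub>R xi)))"
  proof (rule integral_cong_fun)
   fix xi :: 'a
   have "eps * (sqrt (2 * pi) * r0 / eps) = (2 * pi) * (r0 / sqrt (2 * pi))"
    using eps by (simp add: field_simps)
   then have p: "eps ^ DIM('a) * (sqrt (2 * pi) * r0 / eps) ^ DIM('a) = (2 * pi) ^ DIM('a) * (r0 / sqrt (2 * pi)) ^ DIM('a)"
    by (simp only: power_mult_distrib[symmetric])
   have e: "exp (- (r0^2 * (norm (eps *\<^sub>R xi))^2 / (2 * eps^2))) = exp (- (r0^2 / 2) * (norm xi)^2)"
    using eps by (simp add: power_mult_distrib)
   have "of_real (eps ^ DIM('a)) * initial_transform (eps *\<^sub>R xi) = c * of_real (gauss r0 xi)"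
    unfolding it c_def gauss_def e of_real_mult[symmetric] by (simp only: mult.assoc[symmetric] p)
   then show "of_real (eps ^ DIM('a)) * (initial_transform (eps *\<^sub>R xi) * ?D (eps *\<^sub>R xi)) = c * (of_real (gauss r0 xi) * ?D (eps *\<^sub>R xi))"
    by (simp only: mult.assoc[symmetric])
  qed
  finally show ?thesis by (simp only: integral_mult_right_zero)
 qed
 have "(%n. moment_term initial_transform freq (%p. cis (p \<bullet> X0)) n t) sums (c * \<nu> t X0)"
  using pointwise_expansion[OF i0 m t cont] by (simp add: c_def)
 then have "(%n. inverse c * moment_term initial_transform freq (%p. cis (p \<bullet> X0)) n t) sums (inverse c * (c * \<nu> t X0))"
  by (rule sums_mult)
 then show ?thesis unfolding mterm using c0 by (simp add: mult.assoc[symmetric])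
qed

end

text \<open>The number of kicks is dominated by a Poisson weight, uniformly in \<open>j\<close>: this permits passing
 to the limit under the sum and under the integral over \<open>xi\<close>.\<close>

lemma (in kicks) gaussian_limit:
 fixes \<nu> :: "nat => real => 'a => complex"
 assumes we: "!!j. weak_evolution K A s (\<theta> j) (\<nu> j)" and r0: "r0 > 0" and eps: "!!j. eps j > 0"
  and \<nu>0: "!!j. \<nu> j 0 = (%X. of_real (exp (- ((eps j)^2 * (norm X)^2 / (2 * r0^2)))))"
  and t: "0 <= t" and cont: "!!j. isCont (\<nu> j t) (X0 j)"
  and lim: "!!n xi. (%j. dyson (quad_freq (\<theta> j)) (%p. cis (p \<bullet> X0 j)) n t (eps j *\<^sub>R xi)) \<longlonglongrightarrow> \<Lambda> n xi"
  and S: "!!xi. (%n. \<Lambda> n xi) sums S xi"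
 shows "(%j. \<nu> j t (X0 j)) \<longlonglongrightarrow> (LINT xi|lborel. of_real (gauss r0 xi) * S xi)"
proof -
 let ?D = "%j n xi. dyson (quad_freq (\<theta> j)) (%p. cis (p \<bullet> X0 j)) n t (eps j *\<^sub>R xi)"
 let ?T = "%j n. LINT xi|lborel. of_real (gauss r0 xi) * ?D j n xi"
 define I where "I = (LINT xi::'a|lborel. gauss r0 xi)"
 have cm [measurable]: "(%p. cis (p \<bullet> X0 j)) \<in> borel_measurable borel" for j by measurable
 have Dm [measurable]: "?D j n \<in> borel_measurable borel" for j n by measurable
 have Lm [measurable]: "\<Lambda> n \<in> borel_measurable borel" for n
  by (rule borel_measurable_LIMSEQ_metric[OF Dm lim])
 define b where "b n = (rate * t) ^ n /\<^sub>R fact n" for n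
 have b: "b n = 1 * (rate * t) ^ n / fact n" for n
  by (simp only: b_def real_scaleR_def mult_1 divide_inverse_commute)
 have D_le: "norm (?D j n xi) <= b n" for j n xi
  unfolding b by (rule norm_dyson_le) (use t in auto)
 have L_le: "norm (\<Lambda> n xi) <= b n" for n xi
  by (rule LIMSEQ_le_const2[OF tendsto_norm[OF lim]]) (use D_le in auto)
 have gi: "integrable lborel (%xi::'a. gauss r0 xi * b n)" for n
  by (intro integrable_mult_left integrable_gauss r0)
 have g0: "0 <= gauss r0 xi" for xi :: 'a by (rule gauss_nonneg[OF r0])
 have sb: "summable b" unfolding b_def by (rule summable_exp_generic)
 have T_lim: "(%j. ?T j n) \<longlonglongrightarrow> (LINT xi|lborel. of_real (gauss r0 xi) * \<Lambda> n xi)" for n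
 proof (rule integral_dominated_convergence[OF _ _ gi])
  show "AE xi in lborel. (%j. of_real (gauss r0 xi) * ?D j n xi) \<longlonglongrightarrow> of_real (gauss r0 xi) * \<Lambda> n xi"
   by (intro AE_I2 tendsto_mult tendsto_const lim)
  show "AE xi in lborel. norm (of_real (gauss r0 xi) * ?D j n xi) <= gauss r0 xi * b n" for j
   using D_le g0 by (intro AE_I2) (simp add: norm_mult mult_left_mono)
 qed measurable
 have T_le: "norm (?T j n) <= I * b n" for j n
 proof -
  have "norm (?T j n) <= (LINT xi::'a|lborel. gauss r0 xi * b n)"
   by (rule order_trans[OF integral_norm_bound integral_mono'[OF gi]])
    (use D_le g0 in \<open>auto simp: norm_mult mult_left_mono intro!: mult_nonneg_nonneg order_trans[OF norm_ge_zero D_le]\<close>)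
  then show ?thesis by (simp add: I_def)
 qed
 have tan: "eventually (%j. summable (%n. norm (?T j n))) sequentially \<and>
   summable (%n. norm (LINT xi|lborel. of_real (gauss r0 xi) * \<Lambda> n xi)) \<and>
   (%j. \<Sum>n. ?T j n) \<longlonglongrightarrow> (\<Sum>n. LINT xi|lborel. of_real (gauss r0 xi) * \<Lambda> n xi)"
  by (rule tannerys_theorem[OF T_lim _ summable_mult[OF sb]]) (use T_le in \<open>auto intro!: always_eventually\<close>)
 have "(\<Sum>n. ?T j n) = \<nu> j t (X0 j)" for j
  using weak_evolution.gaussian_expansion[OF we r0 eps \<nu>0 t cont] by (rule sums_unique[symmetric])
 moreover have "(\<Sum>n. LINT xi|lborel. of_real (gauss r0 xi) * \<Lambda> n xi) = (LINT xi|lborel. (\<Sum>n. of_real (gauss r0 xi) * \<Lambda> n xi))"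
 proof (rule integral_suminf[symmetric])
  have le: "norm (of_real (gauss r0 xi) * \<Lambda> n xi) <= gauss r0 xi * b n" for n xi
   using L_le g0 by (simp add: norm_mult mult_left_mono)
  show i: "integrable lborel (%xi. of_real (gauss r0 xi) * \<Lambda> n xi)" for n
   by (rule Bochner_Integration.integrable_bound[OF gi[of n]]) (measurable, use le in \<open>auto intro!: AE_I2 order_trans[OF le abs_ge_self]\<close>)
  show "AE xi in lborel. summable (%n. norm (of_real (gauss r0 xi) * \<Lambda> n xi))"
   using le by (intro AE_I2 summable_comparison_test'[OF summable_mult[OF sb]]) auto
  have "(LINT xi|lborel. norm (of_real (gauss r0 xi) * \<Lambda> n xi)) <= (LINT xi::'a|lborel. gauss r0 xi * b n)" for n
   by (intro integral_mono integrable_norm i gi le)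
  then have "norm (LINT xi|lborel. norm (of_real (gauss r0 xi) * \<Lambda> n xi)) <= I * b n" for n
   by (simp add: I_def)
  then show "summable (%n. LINT xi|lborel. norm (of_real (gauss r0 xi) * \<Lambda> n xi))"
   by (intro summable_comparison_test'[OF summable_mult[OF sb, of I], of 0]) auto
 qed
 moreover have "(\<Sum>n. of_real (gauss r0 xi) * \<Lambda> n xi) = of_real (gauss r0 xi) * S xi" for xi
  by (rule sums_unique[symmetric], rule sums_mult, rule S)
 ultimately show ?thesis using conjunct2[OF conjunct2[OF tan]] by (simp only:)
qed

lemma filterlim_detuned:
 fixes c :: "nat => real"
 assumes "d ~= 0" "!!j. eps j > 0" "eps \<longlonglongrightarrow> 0" "c \<longlonglongrightarrow> c0"
 shows "filterlim (%j. c j + d * inverse (eps j)) at_infinity sequentially"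
proof -
 have "filterlim eps (at 0) sequentially"
  using assms(2,3) by (auto simp: filterlim_at less_le intro!: always_eventually)
 then have "filterlim (%j. inverse (eps j)) at_infinity sequentially"
  by (rule filterlim_compose[OF filterlim_inverse_at_infinity])
 then have "filterlim (%j. d * inverse (eps j)) at_infinity sequentially"
  by (rule tendsto_mult_filterlim_at_infinity[OF tendsto_const assms(1)])
 then show ?thesis by (rule tendsto_add_filterlim_at_infinity[OF assms(4)])
qed

lemma AE_not_negligible:
 fixes S :: "plane set"
 assumes "negligible S"
 shows "AE k in lborel. k \<notin> S"
proof -
 have "AE k in lebesgue. k \<notin> S" using assms by (intro AE_not_in) (simp add: negligible_iff_null_sets)
 then show ?thesis by (simp only: AE_completion_iff)
qed

lemma AE_inner_nonzero: "v ~= 0 ==> AE k in lborel. k \<bullet> (v::plane) ~= 0"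
 using AE_not_negligible[OF negligible_hyperplane[of v 0]] by (simp add: inner_commute)

text \<open>The exceptional vectors form a sphere through the origin.\<close>

lemma AE_sphere: "AE k in lborel. (norm k)^2 + k \<bullet> (v::plane) ~= 0"
proof -
 have "k \<in> sphere (- v /\<^sub>R 2) (norm v / 2)" if "(norm k)^2 + k \<bullet> v = 0" for k
 proof -
  have "(norm (k + v /\<^sub>R 2))^2 = (norm v / 2)^2"
   using that unfolding power_divide power2_norm_eq_inner
   by (simp add: inner_add_left inner_add_right inner_commute)
  then have "norm (k + v /\<^sub>R 2) = norm v / 2" by (rule power2_eq_imp_eq) simp_all
  then show ?thesis by (simp add: dist_norm norm_minus_commute add.commute)
 qed
 then show ?thesis using AE_not_negligible[OF negligible_sphere[of "- v /\<^sub>R 2" "norm v / 2"]]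
  by (auto elim!: eventually_mono)
qed

lemma AE_neq: "AE k in lborel. k ~= (v::plane)"
 using AE_not_negligible[OF negligible_sing[of v]] by simp

section \<open>Two and four particles\<close>

lemma norm_sq_shift: "(norm (eps *\<^sub>R a + p))^2 = eps^2 * (norm a)^2 + 2 * eps * (a \<bullet> p) + (norm p)^2"
 unfolding power2_norm_eq_inner by (simp add: inner_add_left inner_add_right inner_commute power2_eq_square algebra_simps)

text \<open>The particles of \<open>u\<close> and of its conjugate have opposite dispersion.\<close>

definition sign2 :: "plane \<times> plane => real" where
 "sign2 b = (if snd b = 0 then 1 else -1)"

definition Q2 :: "plane \<times> plane => real" where
 "Q2 = (%(p, q). (norm p)^2 - (norm q)^2)"

definition kick2 :: "nat \<times> plane => plane \<times> plane" where
 "kick2 = (%(i, k). (k, - k))"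

definition sign4 :: "plane \<times> plane \<times> plane \<times> plane => real" where
 "sign4 b = (if snd (snd b) = 0 then 1 else -1)"

definition Q4 :: "plane \<times> plane \<times> plane \<times> plane => real" where
 "Q4 = (%(p1, p2, q1, q2). (norm p1)^2 + (norm p2)^2 - (norm q1)^2 - (norm q2)^2)"

text \<open>Types 0 and 1 couple \<open>(x1, y1)\<close> and \<open>(x2, y2)\<close>, types 2 and 3 couple \<open>(x1, y2)\<close> and \<open>(x2, y1)\<close>;
 types 4 and 5 couple two particles of the same kind and enter with a negative sign.\<close>

definition kick4 :: "nat \<times> plane => plane \<times> plane \<times> plane \<times> plane" where
 "kick4 = (%(i, k). if i = 0 then (k, 0, - k, 0) else if i = 1 then (0, k, 0, - k)
  else if i = 2 then (k, 0, 0, - k) else if i = 3 then (0, k, - k, 0)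
  else if i = 4 then (k, - k, 0, 0) else (0, 0, k, - k))"

definition kick_sign4 :: "nat \<times> plane => real" where
 "kick_sign4 x = (if fst x < 4 then 1 else -1)"

lemma Basis_pair_iff: "(u, v) \<in> Basis \<longleftrightarrow> (u \<in> Basis \<and> v = 0) \<or> (u = 0 \<and> v \<in> Basis)"
 by (auto simp: Basis_prod_def)

lemma sum_Basis_pair:
 fixes f :: "'a::euclidean_space \<times> 'b::euclidean_space => 'c::comm_monoid_add"
 shows "(\<Sum>b\<in>Basis. f b) = (\<Sum>b\<in>Basis. f (b, 0)) + (\<Sum>b\<in>Basis. f (0, b))"
proof -
 have "(\<Sum>b\<in>Basis. f b) = (\<Sum>b\<in>(%u. (u, 0)) ` Basis. f b) + (\<Sum>b\<in>(%v. (0, v)) ` Basis. f b)"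
  unfolding Basis_prod_def by (rule sum.union_disjoint) (auto dest: nonzero_Basis)
 also have "(\<Sum>b\<in>(%u. (u, 0)) ` Basis. f b) = (\<Sum>b\<in>Basis. f (b, 0))"
  by (subst sum.reindex) (auto intro: inj_onI)
 also have "(\<Sum>b\<in>(%v. (0, v)) ` Basis. f b) = (\<Sum>b\<in>Basis. f (0, b))"
  by (subst sum.reindex) (auto intro: inj_onI)
 finally show ?thesis .
qed

lemma sum_Basis_sign2:
 fixes f :: "plane \<times> plane => 'c::real_algebra_1"
 shows "(\<Sum>b\<in>Basis. of_real (sign2 b) * f b) = (\<Sum>b\<in>Basis. f (b, 0)) - (\<Sum>b\<in>Basis. f (0, b))"
 unfolding sum_Basis_pair by (simp add: sign2_def sum_negf nonzero_Basis cong: sum.cong)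

lemma sum_Basis_sign4:
 fixes f :: "plane \<times> plane \<times> plane \<times> plane => 'c::real_algebra_1"
 shows "(\<Sum>b\<in>Basis. of_real (sign4 b) * f b) = (\<Sum>b\<in>Basis. f (b, 0, 0, 0)) + (\<Sum>b\<in>Basis. f (0, b, 0, 0))
  - (\<Sum>b\<in>Basis. f (0, 0, b, 0)) - (\<Sum>b\<in>Basis. f (0, 0, 0, b))"
 unfolding sum_Basis_pair by (simp add: sign4_def sum_negf nonzero_Basis zero_prod_def cong: sum.cong)

lemma generator2_basis_prod:
 assumes f: "!!b. b \<in> Basis ==> C2_compact (f b) (f1 b) (f2 b)" and "eps > 0"
 shows "generator2 k0 C eps (basis_prod f) X = of_real eps *
  (basis_deriv f (%b x. \<i> * of_real (1 / (2 * k0 * eps) * sign2 b) * f2 b x) X +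
   (of_real (k0^2 / 4 * C (fst X - snd X)) - of_real (k0^2 / 4 * C 0)) * basis_prod f X)"
proof -
 obtain x y where X: "X = (x, y)" by (cases X)
 define d where "d b = f2 b (X \<bullet> b) * (\<Prod>b'\<in>Basis - {b}. f b' (X \<bullet> b'))" for b
 have D: "vector_derivative (%s. vector_derivative (%t. basis_prod f (X + t *\<^sub>R b)) (at s)) (at 0) = d b" if "b \<in> Basis" for b
  unfolding d_def by (rule second_derivative_basis_prod[OF f that])
 have l1: "laplacian (%xi. basis_prod f (xi, y)) x = (\<Sum>b\<in>Basis. d (b, 0))"
  unfolding laplacian_def using D[of "(b, 0)" for b] by (intro sum.cong refl) (simp add: X Basis_pair_iff)
 have l2: "laplacian (%xi. basis_prod f (x, xi)) y = (\<Sum>b\<in>Basis. d (0, b))"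
  unfolding laplacian_def using D[of "(0, b)" for b] by (intro sum.cong refl) (simp add: X Basis_pair_iff)
 have "of_real eps * basis_deriv f (%b x. \<i> * of_real (1 / (2 * k0 * eps) * sign2 b) * f2 b x) X =
   (\<i> / (2 * of_real k0)) * (\<Sum>b\<in>Basis. of_real (sign2 b) * d b)"
  unfolding basis_deriv_def d_def sum_distrib_left using \<open>eps > 0\<close> by (intro sum.cong refl) simp
 also have "(\<Sum>b\<in>Basis. of_real (sign2 b) * d b) = (\<Sum>b\<in>Basis. d (b, 0)) - (\<Sum>b\<in>Basis. d (0, b))"
  by (rule sum_Basis_sign2)
 finally have e: "of_real eps * basis_deriv f (%b x. \<i> * of_real (1 / (2 * k0 * eps) * sign2 b) * f2 b x) X =
   (\<i> / (2 * of_real k0)) * ((\<Sum>b\<in>Basis. d (b, 0)) - (\<Sum>b\<in>Basis. d (0, b)))" .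
 have g: "generator2 k0 C eps (basis_prod f) X = (\<i> / (2 * of_real k0)) * ((\<Sum>b\<in>Basis. d (b, 0)) - (\<Sum>b\<in>Basis. d (0, b))) +
   of_real (k0^2 * eps / 4 * (C (x - y) - C 0)) * basis_prod f X"
  unfolding generator2_def X by (simp only: prod.case l1[unfolded X] l2[unfolded X] d_def X)
 have r: "of_real (k0^2 * eps / 4 * (C (x - y) - C 0)) = complex_of_real eps * (of_real (k0^2 / 4 * C (x - y)) - of_real (k0^2 / 4 * C 0))"
  unfolding of_real_mult[symmetric] of_real_diff[symmetric] by (rule arg_cong[where f = complex_of_real]) (simp add: field_simps)
 show ?thesis unfolding g r distrib_left[of "complex_of_real eps"] e by (simp only: X fst_conv snd_conv mult.assoc)
qed

text \<open>Each partial Laplacian is the sum of the second derivatives in the basis directions of one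
 of the four planes.\<close>

lemma generator4_basis_prod:
 assumes f: "!!b. b \<in> Basis ==> C2_compact (f b) (f1 b) (f2 b)" and "eps > 0"
 shows "generator4 k0 C eps (basis_prod f) X = of_real eps *
  (basis_deriv f (%b x. \<i> * of_real (1 / (2 * k0 * eps) * sign4 b) * f2 b x) X +
   (of_real (k0^2 / 4 * (case X of (x1, x2, y1, y2) => C (x1 - y1) + C (x1 - y2) + C (x2 - y1) + C (x2 - y2)
    - C (x1 - x2) - C (y1 - y2))) - of_real (2 * (k0^2 / 4 * C 0))) * basis_prod f X)"
proof -
 obtain x1 x2 y1 y2 where X: "X = (x1, x2, y1, y2)" by (cases X)
 define d where "d b = f2 b (X \<bullet> b) * (\<Prod>b'\<in>Basis - {b}. f b' (X \<bullet> b'))" for b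
 have D: "vector_derivative (%s. vector_derivative (%t. basis_prod f (X + t *\<^sub>R b)) (at s)) (at 0) = d b" if "b \<in> Basis" for b
  unfolding d_def by (rule second_derivative_basis_prod[OF f that])
 have l1: "laplacian (%xi. basis_prod f (xi, x2, y1, y2)) x1 = (\<Sum>b\<in>Basis. d (b, 0, 0, 0))"
  unfolding laplacian_def using D[of "(b, 0, 0, 0)" for b] by (intro sum.cong refl) (simp add: X Basis_pair_iff zero_prod_def)
 have l2: "laplacian (%xi. basis_prod f (x1, xi, y1, y2)) x2 = (\<Sum>b\<in>Basis. d (0, b, 0, 0))"
  unfolding laplacian_def using D[of "(0, b, 0, 0)" for b] by (intro sum.cong refl) (simp add: X Basis_pair_iff zero_prod_def)
 have l3: "laplacian (%xi. basis_prod f (x1, x2, xi, y2)) y1 = (\<Sum>b\<in>Basis. d (0, 0, b, 0))"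
  unfolding laplacian_def using D[of "(0, 0, b, 0)" for b] by (intro sum.cong refl) (simp add: X Basis_pair_iff zero_prod_def)
 have l4: "laplacian (%xi. basis_prod f (x1, x2, y1, xi)) y2 = (\<Sum>b\<in>Basis. d (0, 0, 0, b))"
  unfolding laplacian_def using D[of "(0, 0, 0, b)" for b] by (intro sum.cong refl) (simp add: X Basis_pair_iff zero_prod_def)
 let ?S = "(\<Sum>b\<in>Basis. d (b, 0, 0, 0)) + (\<Sum>b\<in>Basis. d (0, b, 0, 0)) - (\<Sum>b\<in>Basis. d (0, 0, b, 0)) - (\<Sum>b\<in>Basis. d (0, 0, 0, b))"
 have "of_real eps * basis_deriv f (%b x. \<i> * of_real (1 / (2 * k0 * eps) * sign4 b) * f2 b x) X =
   (\<i> / (2 * of_real k0)) * (\<Sum>b\<in>Basis. of_real (sign4 b) * d b)"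
  unfolding basis_deriv_def d_def sum_distrib_left using \<open>eps > 0\<close> by (intro sum.cong refl) simp
 also have "(\<Sum>b\<in>Basis. of_real (sign4 b) * d b) = ?S"
  by (rule sum_Basis_sign4)
 finally have e: "of_real eps * basis_deriv f (%b x. \<i> * of_real (1 / (2 * k0 * eps) * sign4 b) * f2 b x) X =
   (\<i> / (2 * of_real k0)) * ?S" .
 let ?c = "C (x1 - y1) + C (x1 - y2) + C (x2 - y1) + C (x2 - y2) - C (x1 - x2) - C (y1 - y2)"
 have g: "generator4 k0 C eps (basis_prod f) X = (\<i> / (2 * of_real k0)) * ?S +
   of_real (k0^2 * eps / 4 * (?c - 2 * C 0)) * basis_prod f X"
  unfolding generator4_def X by (simp only: prod.case l1[unfolded X] l2[unfolded X] l3[unfolded X] l4[unfolded X] d_def X)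
 have r: "of_real (k0^2 * eps / 4 * (c - 2 * C 0)) = complex_of_real eps * (of_real (k0^2 / 4 * c) - of_real (2 * (k0^2 / 4 * C 0)))" for c
  unfolding of_real_mult[symmetric] of_real_diff[symmetric] by (rule arg_cong[where f = complex_of_real]) (simp add: field_simps)
 show ?thesis unfolding g r distrib_left[of "complex_of_real eps"] e by (simp only: X prod.case mult.assoc)
qed

locale kick_setting =
 fixes k0 r0 :: real and C :: "plane => real"
 assumes k0: "k0 > 0" and r0: "r0 > 0" and C: "covariance_function C" "integrable lborel C"
begin

definition g :: "plane => real" where "g k = k0^2 / 4 * spectral_density C k"

lemma g: "integrable lborel g" "0 <= g k"
proof -
 show "integrable lborel g" unfolding g_def[abs_def] by (intro integrable_mult_right spectral_representation(2)[OF C])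
 show "0 <= g k" unfolding g_def by (intro mult_nonneg_nonneg spectral_representation(1)[OF C]) simp
qed

lemma g_measurable [measurable]: "g \<in> borel_measurable borel" using g(1) by auto

lemma C_minus: "C (- x) = C x" using C by (simp add: covariance_function_def)

lemma g_fourier: "(LINT k|lborel. of_real (g k) * cis (k \<bullet> x)) = of_real (k0^2 / 4 * C x)"
proof -
 have "(LINT k|lborel. of_real (g k) * cis (k \<bullet> x)) = (LINT k|lborel. of_real (k0^2 / 4) * (of_real (spectral_density C k) * cis (k \<bullet> x)))"
  by (simp add: g_def mult.assoc)
 also have "\<dots> = of_real (k0^2 / 4) * of_real (C x)"
  unfolding integral_mult_right_zero spectral_representation(3)[OF C] ..
 finally show ?thesis by simp
qed

abbreviation "K2 \<equiv> kick_measure 1 g"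
abbreviation "K4 \<equiv> kick_measure 6 g"

lemma kick_measurable:
 "snd \<in> borel_measurable (kick_measure N g)" "fst \<in> kick_measure N g \<rightarrow>\<^sub>M count_space UNIV"
proof -
 show "snd \<in> borel_measurable (kick_measure N g)" unfolding kick_measure_def by measurable
 have "fst \<in> kick_measure N g \<rightarrow>\<^sub>M count_space {..<N}" unfolding kick_measure_def by measurable
 then show "fst \<in> kick_measure N g \<rightarrow>\<^sub>M count_space UNIV"
  by (rule measurable_compose) simp
qed

lemma kick4_alt: "kick4 x = (if fst x = 0 then (snd x, 0, - snd x, 0) else if fst x = 1 then (0, snd x, 0, - snd x)
  else if fst x = 2 then (snd x, 0, 0, - snd x) else if fst x = 3 then (0, snd x, - snd x, 0)
  else if fst x = 4 then (snd x, - snd x, 0, 0) else (0, 0, snd x, - snd x))"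
 by (cases x) (simp add: kick4_def)

lemma kicks2: "kicks K2 kick2 (%_. 1)"
proof -
 interpret finite_measure K2 by (rule finite_measure_kick[OF g])
 note [measurable] = kick_measurable[of 1]
 show ?thesis
 proof unfold_locales
  have e: "kick2 = (%x. (snd x, - snd x))" by (simp add: kick2_def fun_eq_iff split: prod.split)
  show "kick2 \<in> borel_measurable K2" unfolding e by measurable
 qed simp_all
qed

lemma kicks4: "kicks K4 kick4 kick_sign4"
proof -
 interpret finite_measure K4 by (rule finite_measure_kick[OF g])
 note [measurable] = kick_measurable[of 6]
 show ?thesis
 proof unfold_locales
  show "kick4 \<in> borel_measurable K4" unfolding kick4_alt[abs_def] by measurable
  show "kick_sign4 \<in> borel_measurable K4" unfolding kick_sign4_def[abs_def] by measurable
 qed (simp add: kick_sign4_def)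
qed

sublocale M2: kicks K2 kick2 "%_. 1" by (rule kicks2)
sublocale M4: kicks K4 kick4 kick_sign4 by (rule kicks4)

lemma quad_freq_sign2: "M2.quad_freq (%b. c * sign2 b) P = c * Q2 P"
proof -
 have "M2.quad_freq (%b. c * sign2 b) P = c * (\<Sum>b\<in>Basis. sign2 b * (P \<bullet> b)^2)"
  by (simp add: M2.quad_freq_def sum_distrib_left mult.assoc)
 also have "(\<Sum>b\<in>Basis. sign2 b * (P \<bullet> b)^2) = Q2 P"
  unfolding sum_Basis_sign2[where 'c = real, unfolded of_real_eq_id id_apply] by (cases P) (simp add: Q2_def norm_sq_Basis)
 finally show ?thesis .
qed

lemma quad_freq_sign4: "M4.quad_freq (%b. c * sign4 b) P = c * Q4 P"
proof -
 have "M4.quad_freq (%b. c * sign4 b) P = c * (\<Sum>b\<in>Basis. sign4 b * (P \<bullet> b)^2)"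
  by (simp add: M4.quad_freq_def sum_distrib_left mult.assoc)
 also have "(\<Sum>b\<in>Basis. sign4 b * (P \<bullet> b)^2) = Q4 P"
  unfolding sum_Basis_sign4[where 'c = real, unfolded of_real_eq_id id_apply] by (cases P) (simp add: Q4_def norm_sq_Basis)
 finally show ?thesis .
qed

lemma potential2: "M2.potential X = of_real (k0^2 / 4 * C (fst X - snd X))"
proof -
 have m: "(%x. cis (kick2 x \<bullet> X)) \<in> borel_measurable K2" by measurable
 have "M2.potential X = (LINT x|K2. cis (kick2 x \<bullet> X))" unfolding M2.potential_def of_real_1 mult_1 ..
 also have "\<dots> = (\<Sum>i<1. LINT k|lborel. of_real (g k) * cis (kick2 (i, k) \<bullet> X))"
  by (rule integral_kick_measure[OF g m, where B = 1]) simp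
 also have "\<dots> = (LINT k|lborel. of_real (g k) * cis (k \<bullet> (fst X - snd X)))"
  by (cases X) (simp add: kick2_def inner_diff_right)
 finally show ?thesis unfolding g_fourier .
qed

lemma potential4: "M4.potential X = of_real (k0^2 / 4 * (case X of (x1, x2, y1, y2) =>
 C (x1 - y1) + C (x1 - y2) + C (x2 - y1) + C (x2 - y2) - C (x1 - x2) - C (y1 - y2)))"
proof -
 obtain x1 x2 y1 y2 where X: "X = (x1, x2, y1, y2)" by (cases X)
 have G: "(LINT k|lborel. of_real (g k) * cis (k \<bullet> a - k \<bullet> b)) = of_real (k0^2 / 4 * C (a - b))" for a b
  using g_fourier[of "a - b"] by (simp add: inner_diff_right)
 have s6: "(\<Sum>i<6. f i) = f 0 + f 1 + f 2 + f 3 + f 4 + f 5" for f :: "nat => complex"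
  by (simp add: eval_nat_numeral)
 have m: "(%x. of_real (kick_sign4 x) * cis (kick4 x \<bullet> X)) \<in> borel_measurable K4" by measurable
 have "M4.potential X = (\<Sum>i<6. LINT k|lborel. of_real (g k) * (of_real (kick_sign4 (i, k)) * cis (kick4 (i, k) \<bullet> X)))"
  unfolding M4.potential_def
  by (rule integral_kick_measure[OF g m, where B = 1]) (simp add: norm_mult kick_sign4_def)
 also have "\<dots> = (LINT k|lborel. of_real (g k) * cis (k \<bullet> x1 - k \<bullet> y1)) + (LINT k|lborel. of_real (g k) * cis (k \<bullet> x2 - k \<bullet> y2))
   + (LINT k|lborel. of_real (g k) * cis (k \<bullet> x1 - k \<bullet> y2)) + (LINT k|lborel. of_real (g k) * cis (k \<bullet> x2 - k \<bullet> y1))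
   - (LINT k|lborel. of_real (g k) * cis (k \<bullet> x1 - k \<bullet> x2)) - (LINT k|lborel. of_real (g k) * cis (k \<bullet> y1 - k \<bullet> y2))"
  unfolding X s6 by (simp add: kick4_def kick_sign4_def)
 also have "\<dots> = of_real (k0^2 / 4 * (C (x1 - y1) + C (x1 - y2) + C (x2 - y1) + C (x2 - y2) - C (x1 - x2) - C (y1 - y2)))"
  unfolding G by (simp add: algebra_simps add_divide_distrib)
 finally show ?thesis unfolding X prod.case .
qed

lemma weak_evolution2:
 assumes "solves_in_L2 (generator2 k0 C eps) m0 m" "eps > 0"
 shows "weak_evolution K2 kick2 (%_. 1) (%b. 1 / (2 * k0 * eps) * sign2 b)
  (%t X. of_real (exp (k0^2 / 4 * C 0 * t)) * m (t / eps) X)"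
proof (rule weak_evolution_rescaled[OF kicks2 assms])
 fix f f1 f2 :: "plane \<times> plane => real => complex" and X
 assume f: "!!b. b \<in> Basis ==> C2_compact (f b) (f1 b) (f2 b)"
 show "generator2 k0 C eps (basis_prod f) X = of_real eps * (basis_deriv f (%b x. \<i> * of_real (1 / (2 * k0 * eps) * sign2 b) * f2 b x) X +
    (M2.potential X - of_real (k0^2 / 4 * C 0)) * basis_prod f X)"
  unfolding potential2 by (rule generator2_basis_prod[OF f assms(2)])
qed

lemma weak_evolution4:
 assumes "solves_in_L2 (generator4 k0 C eps) m0 m" "eps > 0"
 shows "weak_evolution K4 kick4 kick_sign4 (%b. 1 / (2 * k0 * eps) * sign4 b)
  (%t X. of_real (exp (2 * (k0^2 / 4 * C 0) * t)) * m (t / eps) X)"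
proof (rule weak_evolution_rescaled[OF kicks4 assms])
 fix f f1 f2 :: "plane \<times> plane \<times> plane \<times> plane => real => complex" and X
 assume f: "!!b. b \<in> Basis ==> C2_compact (f b) (f1 b) (f2 b)"
 show "generator4 k0 C eps (basis_prod f) X = of_real eps * (basis_deriv f (%b x. \<i> * of_real (1 / (2 * k0 * eps) * sign4 b) * f2 b x) X +
    (M4.potential X - of_real (2 * (k0^2 / 4 * C 0))) * basis_prod f X)"
  unfolding potential4 by (rule generator4_basis_prod[OF f assms(2)])
qed

text \<open>The exponent gained by a pair of particles whose scaled frequencies add up to \<open>v\<close>.\<close>

definition \<Psi> :: "real => plane => real" where
 "\<Psi> t v = k0^2 / 4 * (LINT u:{0..t}|lborel. C ((u / k0) *\<^sub>R v))"

lemma \<Psi>_integrand: "set_integrable lborel {0..t} (%u. C ((u / k0) *\<^sub>R v))"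
proof -
 have "continuous_on UNIV C" using C by (simp add: covariance_function_def)
 then have "continuous_on {0..t} (%u. C ((u / k0) *\<^sub>R v))"
  by (rule continuous_on_compose2) (auto intro!: continuous_intros simp: k0[THEN less_imp_neq, symmetric])
 then show ?thesis unfolding set_integrable_def by (intro borel_integrable_compact) auto
qed

lemma kick_fourier: "(LINT k|lborel. of_real (g k) * cis (- (v \<bullet> k / k0) * u)) = of_real (k0^2 / 4 * C ((u / k0) *\<^sub>R v))"
proof -
 have "- (v \<bullet> k / k0) * u = k \<bullet> (- ((u / k0) *\<^sub>R v))" for k by (simp add: inner_commute)
 then show ?thesis using g_fourier[of "- ((u / k0) *\<^sub>R v)"] by (simp only: C_minus)
qed

end

section \<open>The limit of vanishing noise\<close>

lemma sums_exp_divide: "(%n. x ^ n / fact n) sums exp (x::complex)"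
 using exp_converges[of x] by (simp add: scaleR_conv_of_real divide_inverse mult.commute)

context kick_setting
begin

lemma space_kick: "space (kick_measure N g) = {..<N} \<times> UNIV"
 by (simp add: kick_measure_def space_pair_measure)

lemma sets_kick: "I \<subseteq> {..<N} ==> I \<times> UNIV \<in> sets (kick_measure N g)"
 unfolding kick_measure_def by (intro pair_measureI) auto

text \<open>The term of order one in the frequency at \<open>eps * xi + P\<close>: the bilinear form of the
 quadratic form evaluated at \<open>xi\<close> and \<open>P\<close>.\<close>

definition w2 :: "plane \<times> plane => plane \<times> plane => real" where
 "w2 xi P = (fst xi \<bullet> fst P - snd xi \<bullet> snd P) / k0"

definition w4 :: "plane \<times> plane \<times> plane \<times> plane => plane \<times> plane \<times> plane \<times> plane => real" where
 "w4 xi P = (case xi of (a1, a2, b1, b2) => case P of (p1, p2, q1, q2) =>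
  (a1 \<bullet> p1 + a2 \<bullet> p2 - b1 \<bullet> q1 - b2 \<bullet> q2) / k0)"

lemma w2_add: "w2 xi (P + P') = w2 xi P + w2 xi P'"
 by (simp add: w2_def inner_add_right add_divide_distrib[symmetric] algebra_simps)

lemma w4_add: "w4 xi (P + P') = w4 xi P + w4 xi P'"
 by (cases xi; cases P; cases P') (simp add: w4_def inner_add_right add_divide_distrib[symmetric] algebra_simps)

lemma w_measurable: "w2 \<zeta> \<in> borel_measurable borel" "w4 xi \<in> borel_measurable borel"
proof -
 show "w2 \<zeta> \<in> borel_measurable borel" unfolding w2_def[abs_def]
  by (intro borel_measurable_continuous_onI continuous_intros) (use k0 in auto)
 have "w4 xi = (%P. (fst xi \<bullet> fst P + fst (snd xi) \<bullet> fst (snd P) - fst (snd (snd xi)) \<bullet> fst (snd (snd P)) - snd (snd (snd xi)) \<bullet> snd (snd (snd P))) / k0)"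
  by (simp add: w4_def fun_eq_iff split: prod.split)
 then show "w4 xi \<in> borel_measurable borel"
  by (auto intro!: borel_measurable_continuous_onI continuous_intros simp: k0[THEN less_imp_neq, symmetric])
qed

lemma scaled_square:
 assumes "eps > 0"
 shows "1 / (2 * k0 * eps) * (eps^2 * x + 2 * eps * y + z) = eps * (x / (2 * k0)) + y / k0 + z / (2 * k0) * inverse eps"
 using assms k0 by (simp add: field_simps power2_eq_square)

lemma freq2:
 assumes "eps > 0"
 shows "M2.quad_freq (%b. 1 / (2 * k0 * eps) * sign2 b) (eps *\<^sub>R xi + P) =
  eps * (Q2 xi / (2 * k0)) + w2 xi P + Q2 P / (2 * k0) * inverse eps"
proof -
 have "Q2 (eps *\<^sub>R xi + P) = eps^2 * Q2 xi + 2 * eps * (fst xi \<bullet> fst P - snd xi \<bullet> snd P) + Q2 P"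
  by (cases xi; cases P) (simp add: Q2_def norm_sq_shift, simp add: algebra_simps)
 then show ?thesis unfolding quad_freq_sign2 w2_def by (simp only: scaled_square[OF assms])
qed

lemma freq4:
 assumes "eps > 0"
 shows "M4.quad_freq (%b. 1 / (2 * k0 * eps) * sign4 b) (eps *\<^sub>R xi + P) =
  eps * (Q4 xi / (2 * k0)) + w4 xi P + Q4 P / (2 * k0) * inverse eps"
proof -
 obtain a1 a2 b1 b2 where xi: "xi = (a1, a2, b1, b2)" by (cases xi)
 obtain p1 p2 q1 q2 where P: "P = (p1, p2, q1, q2)" by (cases P)
 have "Q4 (eps *\<^sub>R xi + P) = eps^2 * Q4 xi + 2 * eps * (a1 \<bullet> p1 + a2 \<bullet> p2 - b1 \<bullet> q1 - b2 \<bullet> q2) + Q4 P"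
  by (simp add: xi P Q4_def norm_sq_shift, simp add: algebra_simps)
 then show ?thesis unfolding quad_freq_sign4 by (simp only: scaled_square[OF assms] w4_def xi P prod.case)
qed

lemma kick_integral_fourier:
 assumes J: "J = I \<times> UNIV" "I \<subseteq> {..<N}" and \<omega>: "\<omega> \<in> borel_measurable (kick_measure N g)"
  and v: "!!i k. i \<in> I ==> \<omega> (i, k) = v i \<bullet> k / k0"
 shows "(LINT x|kick_measure N g. indicator J x *\<^sub>R cis (- \<omega> x * u)) = of_real (\<Sum>i\<in>I. k0^2 / 4 * C ((u / k0) *\<^sub>R v i))"
proof -
 have [measurable]: "J \<in> sets (kick_measure N g)" using J sets_kick by simp
 note [measurable] = \<omega>
 have "(LINT x|kick_measure N g. indicator J x *\<^sub>R cis (- \<omega> x * u)) =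
   (\<Sum>i<N. LINT k|lborel. of_real (g k) * (indicator J (i, k) *\<^sub>R cis (- \<omega> (i, k) * u)))"
 proof (rule integral_kick_measure[OF g, where B = 1])
  show "(%x. indicator J x *\<^sub>R cis (- \<omega> x * u)) \<in> borel_measurable (kick_measure N g)"
   by (intro borel_measurable_scaleR borel_measurable_indicator borel_measurable_cis borel_measurable_times
     borel_measurable_uminus borel_measurable_const \<omega>) fact
 qed (simp add: indicator_def)
 also have "\<dots> = (\<Sum>i<N. if i \<in> I then of_real (k0^2 / 4 * C ((u / k0) *\<^sub>R v i)) else 0)"
 proof (rule sum.cong[OF refl])
  fix i show "(LINT k|lborel. of_real (g k) * (indicator J (i, k) *\<^sub>R cis (- \<omega> (i, k) * u))) =
    (if i \<in> I then of_real (k0^2 / 4 * C ((u / k0) *\<^sub>R v i)) else 0)"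
  proof (cases "i \<in> I")
   case True
   then have "(LINT k|lborel. of_real (g k) * (indicator J (i, k) *\<^sub>R cis (- \<omega> (i, k) * u))) =
     (LINT k|lborel. of_real (g k) * cis (- (v i \<bullet> k / k0) * u))" by (simp add: J v)
   then show ?thesis unfolding kick_fourier using True by simp
  qed (simp add: J)
 qed
 also have "\<dots> = (\<Sum>i\<in>I. of_real (k0^2 / 4 * C ((u / k0) *\<^sub>R v i)))"
  using J(2) by (subst sum.inter_restrict[symmetric]) (auto simp: Int_absorb1)
 finally show ?thesis by simp
qed

lemma integral_sum_\<Psi>:
 assumes "finite I"
 shows "(LINT u:{0..t}|lborel. complex_of_real (\<Sum>i\<in>I. k0^2 / 4 * C ((u / k0) *\<^sub>R v i))) = of_real (\<Sum>i\<in>I. \<Psi> t (v i))"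
proof -
 have "(LINT u:{0..t}|lborel. (\<Sum>i\<in>I. k0^2 / 4 * C ((u / k0) *\<^sub>R v i))) = (\<Sum>i\<in>I. \<Psi> t (v i))"
  unfolding \<Psi>_def set_lebesgue_integral_def scaleR_sum_right
 proof (subst Bochner_Integration.integral_sum)
  fix i show "integrable lborel (%u. indicator {0..t} u *\<^sub>R (k0^2 / 4 * C ((u / k0) *\<^sub>R v i)))"
   using integrable_mult_right[OF \<Psi>_integrand[unfolded set_integrable_def], of "k0^2 / 4"]
   by (simp only: real_scaleR_def mult.left_commute)
 qed (simp only: real_scaleR_def mult.left_commute[of "indicator _ _"] integral_mult_right_zero)
 then show ?thesis by (simp only: set_integral_complex_of_real)
qed

lemma resonance2: "M2.resonance (%x. w2 xi (kick2 x)) ({..<1} \<times> UNIV) t = of_real (\<Psi> t (fst xi + snd xi))"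
proof -
 note [measurable] = w_measurable(1)[of xi]
 have m: "(%x. w2 xi (kick2 x)) \<in> borel_measurable K2" by measurable
 have "w2 xi (kick2 (i, k)) = (fst xi + snd xi) \<bullet> k / k0" for i k
  by (simp add: w2_def kick2_def inner_add_left)
 then have k: "(LINT x|K2. indicator ({..<1} \<times> UNIV) x *\<^sub>R cis (- w2 xi (kick2 x) * u)) =
   of_real (\<Sum>i\<in>{..<1::nat}. k0^2 / 4 * C ((u / k0) *\<^sub>R (fst xi + snd xi)))" for u
  by (rule kick_integral_fourier[OF refl subset_refl m])
 show ?thesis unfolding M2.resonance_def k integral_sum_\<Psi>[OF finite_lessThan] by simp
qed

lemma resonance4:
 assumes I: "I \<subseteq> {..<4}"
 shows "M4.resonance (%x. w4 (a1, a2, b1, b2) (kick4 x)) (I \<times> UNIV) t =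
  of_real (\<Sum>i\<in>I. \<Psi> t (if i = 0 then a1 + b1 else if i = 1 then a2 + b2 else if i = 2 then a1 + b2 else a2 + b1))"
proof -
 let ?v = "%i::nat. if i = 0 then a1 + b1 else if i = 1 then a2 + b2 else if i = 2 then a1 + b2 else a2 + b1"
 note [measurable] = w_measurable(2)[of "(a1, a2, b1, b2)"]
 have m: "(%x. w4 (a1, a2, b1, b2) (kick4 x)) \<in> borel_measurable K4" by measurable
 have v: "w4 (a1, a2, b1, b2) (kick4 (i, k)) = ?v i \<bullet> k / k0" if "i \<in> I" for i k
 proof -
  have "i < 4" using that I by auto
  then have "i = 0 \<or> i = 1 \<or> i = 2 \<or> i = 3" by linarith
  then show ?thesis by (auto simp: w4_def kick4_def inner_add_left)
 qed
 have "I \<subseteq> {..<6}" "finite I" using I by (auto dest: finite_subset intro: finite_subset[OF I])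
 with kick_integral_fourier[OF refl _ m v, of I] show ?thesis
  unfolding M4.resonance_def by (simp only: integral_sum_\<Psi>)
qed

end

locale vanishing_noise = kick_setting +
 fixes eps :: "nat => real" and r :: plane
 assumes eps: "!!j. eps j > 0" and eps0: "eps \<longlonglongrightarrow> 0"
begin

lemma inner_X0_2: "(eps j *\<^sub>R xi + P) \<bullet> (r /\<^sub>R eps j, r /\<^sub>R eps j) = (fst xi + snd xi) \<bullet> r + (fst P + snd P) \<bullet> r * inverse (eps j)"
proof -
 have e: "eps j * (inverse (eps j) * x) = x" for x using eps[of j] by simp
 show ?thesis by (cases xi; cases P) (simp add: inner_add_left algebra_simps e)
qed

lemma inner_X0_4: "(eps j *\<^sub>R (a1, a2, b1, b2) + (p1, p2, q1, q2)) \<bullet> (r /\<^sub>R eps j, r /\<^sub>R eps j, r /\<^sub>R eps j, r /\<^sub>R eps j) =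
  (a1 + a2 + b1 + b2) \<bullet> r + (p1 + p2 + q1 + q2) \<bullet> r * inverse (eps j)"
proof -
 have e: "eps j * (inverse (eps j) * x) = x" for x using eps[of j] by simp
 show ?thesis by (simp add: inner_add_left algebra_simps e)
qed

lemma freq_tendsto: "(%j. eps j * c + w + 0 / d * inverse (eps j)) \<longlonglongrightarrow> w"
 using tendsto_add[OF tendsto_mult[OF eps0 tendsto_const] tendsto_const, of c w] by simp

theorem second_moment_limit:
 fixes \<nu> :: "nat => real => plane \<times> plane => complex"
 assumes we: "!!j. weak_evolution K2 kick2 (%_. 1) (%b. 1 / (2 * k0 * eps j) * sign2 b) (\<nu> j)"
  and \<nu>0: "!!j. \<nu> j 0 = (%X. of_real (exp (- ((eps j)^2 * (norm X)^2 / (2 * r0^2)))))"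
  and t: "0 <= t" and cont: "!!j. isCont (\<nu> j t) (r /\<^sub>R eps j, r /\<^sub>R eps j)"
 shows "(%j. \<nu> j t (r /\<^sub>R eps j, r /\<^sub>R eps j)) \<longlonglongrightarrow>
  (LINT xi|lborel. of_real (gauss r0 xi) * (cis ((fst xi + snd xi) \<bullet> r) * exp (of_real (\<Psi> t (fst xi + snd xi)))))"
proof (rule M2.gaussian_limit[OF we r0 eps \<nu>0 t cont])
 let ?H = "%xi. cis ((fst xi + snd xi) \<bullet> r)"
 fix xi :: "plane \<times> plane"
 show "(%n. ?H xi * (of_real (\<Psi> t (fst xi + snd xi)) ^ n / fact n)) sums (?H xi * exp (of_real (\<Psi> t (fst xi + snd xi))))"
  by (intro sums_mult sums_exp_divide)
 fix n
 let ?R = "{P::plane \<times> plane. snd P = - fst P}"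
 have Q: "Q2 P = 0" "fst P + snd P = 0" if "P \<in> ?R" for P using that by (auto simp: Q2_def case_prod_beta')
 have "(%j. M2.dyson (M2.quad_freq (%b. 1 / (2 * k0 * eps j) * sign2 b)) (%p. cis (p \<bullet> (r /\<^sub>R eps j, r /\<^sub>R eps j))) n t (eps j *\<^sub>R xi + 0)) \<longlonglongrightarrow>
   ?H xi * cis (- w2 xi 0 * t) * M2.resonance (%x. w2 xi (kick2 x)) ({..<1} \<times> UNIV) t ^ n / fact n"
 proof (rule M2.dyson_resonant_limit[where R = ?R and w = "w2 xi"])
  show "w2 xi \<in> borel_measurable borel" by (rule w_measurable)
  show "{..<1} \<times> UNIV \<in> sets K2" by (rule sets_kick) simp
  show "(%p. cis (p \<bullet> (r /\<^sub>R eps j, r /\<^sub>R eps j))) \<in> borel_measurable borel" for j by measurable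
  show "(%j. M2.quad_freq (%b. 1 / (2 * k0 * eps j) * sign2 b) (eps j *\<^sub>R xi + P)) \<longlonglongrightarrow> w2 xi P" if "P \<in> ?R" for P
   unfolding freq2[OF eps] Q(1)[OF that] by (rule freq_tendsto)
  show "(%j. cis ((eps j *\<^sub>R xi + P) \<bullet> (r /\<^sub>R eps j, r /\<^sub>R eps j))) \<longlonglongrightarrow> ?H xi" if "P \<in> ?R" for P
   unfolding inner_X0_2 Q(2)[OF that] by simp
  show "AE x in K2. (x \<in> {..<1} \<times> UNIV \<and> P + kick2 x \<in> ?R) \<or>
    (x \<notin> {..<1} \<times> UNIV \<and> filterlim (%j. M2.quad_freq (%b. 1 / (2 * k0 * eps j) * sign2 b) (eps j *\<^sub>R xi + P) -
     M2.quad_freq (%b. 1 / (2 * k0 * eps j) * sign2 b) (eps j *\<^sub>R xi + (P + kick2 x))) at_infinity sequentially)"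
   if "P \<in> ?R" for P
   using that by (intro AE_I2) (auto simp: space_kick kick2_def)
 qed (use t in \<open>auto simp: w2_add intro: M2.borel_measurable_quad_freq\<close>)
 then show "(%j. M2.dyson (M2.quad_freq (%b. 1 / (2 * k0 * eps j) * sign2 b)) (%p. cis (p \<bullet> (r /\<^sub>R eps j, r /\<^sub>R eps j))) n t (eps j *\<^sub>R xi)) \<longlonglongrightarrow>
   ?H xi * (of_real (\<Psi> t (fst xi + snd xi)) ^ n / fact n)"
  unfolding resonance2 by (simp add: w2_def)
qed

lemma detuned4:
 assumes "Q4 P = 0" "Q4 P' ~= 0"
 shows "filterlim (%j. M4.quad_freq (%b. 1 / (2 * k0 * eps j) * sign4 b) (eps j *\<^sub>R xi + P) -
  M4.quad_freq (%b. 1 / (2 * k0 * eps j) * sign4 b) (eps j *\<^sub>R xi + P')) at_infinity sequentially"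
proof -
 have "M4.quad_freq (%b. 1 / (2 * k0 * eps j) * sign4 b) (eps j *\<^sub>R xi + P) -
  M4.quad_freq (%b. 1 / (2 * k0 * eps j) * sign4 b) (eps j *\<^sub>R xi + P') =
  (w4 xi P - w4 xi P') + (- (Q4 P' / (2 * k0))) * inverse (eps j)" for j
  unfolding freq4[OF eps] assms(1) by simp
 moreover have "filterlim (%j. (w4 xi P - w4 xi P') + (- (Q4 P' / (2 * k0))) * inverse (eps j)) at_infinity sequentially"
  by (rule filterlim_detuned[OF _ eps eps0 tendsto_const]) (use assms(2) k0 in auto)
 ultimately show ?thesis by (simp only:)
qed

abbreviation "Om4 j \<equiv> M4.quad_freq (%b. 1 / (2 * k0 * eps j) * sign4 b)"
abbreviation "h4 j \<equiv> (%p. cis (p \<bullet> (r /\<^sub>R eps j, r /\<^sub>R eps j, r /\<^sub>R eps j, r /\<^sub>R eps j)))"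
abbreviation "J1 \<equiv> {0, 1::nat} \<times> (UNIV :: plane set)"
abbreviation "J2 \<equiv> {2, 3::nat} \<times> (UNIV :: plane set)"

text \<open>The states that arise from kicks within one pairing.  The diagonal is excluded: there the two
 pairings cannot be told apart, and kicks of the other pairing would be resonant too.\<close>

definition R1 :: "(plane \<times> plane \<times> plane \<times> plane) set" where
 "R1 = {(p1, p2, - p1, - p2) | p1 p2. p1 ~= p2}"
definition R2 :: "(plane \<times> plane \<times> plane \<times> plane) set" where
 "R2 = {(p1, p2, - p2, - p1) | p1 p2. p1 ~= p2}"

lemma nonresonant_state:
 assumes "P \<in> R1 \<union> R2"
 shows "Q4 P = 0" "(%j. h4 j (eps j *\<^sub>R (a1, a2, b1, b2) + P)) \<longlonglongrightarrow> cis ((a1 + a2 + b1 + b2) \<bullet> r)"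
proof -
 show "Q4 P = 0" using assms by (auto simp: R1_def R2_def Q4_def)
 obtain p1 p2 q1 q2 where P: "P = (p1, p2, q1, q2)" by (cases P)
 have "p1 + p2 + q1 + q2 = 0" using assms by (auto simp: R1_def R2_def P)
 then show "(%j. h4 j (eps j *\<^sub>R (a1, a2, b1, b2) + P)) \<longlonglongrightarrow> cis ((a1 + a2 + b1 + b2) \<bullet> r)"
  unfolding P inner_X0_4 by simp
qed

lemma shift_square: "(norm (p + k))^2 = (norm p)^2 + 2 * (k \<bullet> p) + (norm k)^2"
 unfolding power2_norm_eq_inner by (simp add: inner_add_left inner_add_right inner_commute)

text \<open>The detuning of a kick is a linear form in \<open>k\<close>, or a quadratic form for kicks between
 particles of the same kind; its zero set is a hyperplane or a sphere unless it vanishes.\<close>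

lemma Q4_kick:
 assumes P: "P = (p1, p2, - q1, - q2)" and q: "(norm q1)^2 + (norm q2)^2 = (norm p1)^2 + (norm p2)^2"
 shows "Q4 (P + kick4 (0, k)) = 2 * (k \<bullet> (p1 - q1))" "Q4 (P + kick4 (1, k)) = 2 * (k \<bullet> (p2 - q2))"
  "Q4 (P + kick4 (2, k)) = 2 * (k \<bullet> (p1 - q2))" "Q4 (P + kick4 (3, k)) = 2 * (k \<bullet> (p2 - q1))"
  "Q4 (P + kick4 (4, k)) = 2 * ((norm k)^2 + k \<bullet> (p1 - p2))"
  "Q4 (P + kick4 (5, k)) = - 2 * ((norm k)^2 + k \<bullet> (q2 - q1))"
proof -
 have m: "(norm (- q + k))^2 = (norm q)^2 - 2 * (k \<bullet> q) + (norm k)^2" "(norm (- q - k))^2 = (norm q)^2 + 2 * (k \<bullet> q) + (norm k)^2"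
  "(norm (q - k))^2 = (norm q)^2 - 2 * (k \<bullet> q) + (norm k)^2" "(norm (k - q))^2 = (norm q)^2 - 2 * (k \<bullet> q) + (norm k)^2" for q
  unfolding power2_norm_eq_inner by (simp_all add: inner_add_left inner_add_right inner_diff_left inner_diff_right inner_commute)
 note S = P kick4_def Q4_def shift_square m inner_diff_right
 show "Q4 (P + kick4 (0, k)) = 2 * (k \<bullet> (p1 - q1))" using q by (simp add: S)
 show "Q4 (P + kick4 (1, k)) = 2 * (k \<bullet> (p2 - q2))" using q by (simp add: S)
 show "Q4 (P + kick4 (2, k)) = 2 * (k \<bullet> (p1 - q2))" using q by (simp add: S)
 show "Q4 (P + kick4 (3, k)) = 2 * (k \<bullet> (p2 - q1))" using q by (simp add: S)
 show "Q4 (P + kick4 (4, k)) = 2 * ((norm k)^2 + k \<bullet> (p1 - p2))" using q by (simp add: S)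
 show "Q4 (P + kick4 (5, k)) = - 2 * ((norm k)^2 + k \<bullet> (q2 - q1))" using q by (simp add: S)
qed

lemma less_6_cases: "i < 6 \<longleftrightarrow> i = 0 \<or> i = 1 \<or> i = 2 \<or> i = 3 \<or> i = 4 \<or> i = (5::nat)"
 by auto

lemma kick_R1:
 assumes "P \<in> R1"
 shows "AE x in K4. (x \<in> J1 \<and> P + kick4 x \<in> R1) \<or> (x \<notin> J1 \<and> Q4 (P + kick4 x) ~= 0)"
proof (rule AE_kick_measure[OF g])
 fix i :: nat assume i: "i < 6"
 obtain p1 p2 where P: "P = (p1, p2, - p1, - p2)" and ne: "p1 ~= p2" using assms by (auto simp: R1_def)
 note Q = Q4_kick[OF P refl]
 have d: "p1 - p2 ~= 0" "p2 - p1 ~= 0" using ne by auto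
 have R: "P + kick4 (0, k) \<in> R1" if "k ~= p2 - p1" for k
  using that unfolding R1_def P by (auto simp: kick4_def intro!: exI[of _ "p1 + k"] exI[of _ p2])
 have R': "P + kick4 (1, k) \<in> R1" if "k ~= p1 - p2" for k
  using that unfolding R1_def P by (auto simp: kick4_def intro!: exI[of _ "p2 + k"] exI[of _ p1])
 have key: "AE k in lborel. k ~= p2 - p1 \<and> k ~= p1 - p2 \<and> k \<bullet> (p1 - p2) ~= 0 \<and> k \<bullet> (p2 - p1) ~= 0 \<and>
   (norm k)^2 + k \<bullet> (p1 - p2) ~= 0 \<and> (norm k)\<^sup>2 + k \<bullet> (p2 - p1) ~= 0"
  using AE_neq[of "p2 - p1"] AE_neq[of "p1 - p2"] AE_inner_nonzero[OF d(1)] AE_inner_nonzero[OF d(2)] AE_sphere[of "p1 - p2"] AE_sphere[of "p2 - p1"]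
  by eventually_elim blast
 show "AE k in lborel. ((i, k) \<in> J1 \<and> P + kick4 (i, k) \<in> R1) \<or> ((i, k) \<notin> J1 \<and> Q4 (P + kick4 (i, k)) ~= 0)"
  using key
 proof eventually_elim
  case (elim k)
  from i consider "i = 0" | "i = 1" | "i = 2" | "i = 3" | "i = 4" | "i = 5" unfolding less_6_cases by blast
  then show ?case
  proof cases
   case 1
   then show ?thesis using R elim by simp
  next
   case 2
   then show ?thesis using R' elim by simp
  next
   case 3
   have "Q4 (P + kick4 (2, k)) ~= 0" unfolding Q(3) by (rule no_zero_divisors) (use elim in blast | simp)+
   then show ?thesis using 3 by simp
  next
   case 4
   have "Q4 (P + kick4 (3, k)) ~= 0" unfolding Q(4) by (rule no_zero_divisors) (use elim in blast | simp)+
   then show ?thesis using 4 by simp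
  next
   case 5
   have "Q4 (P + kick4 (4, k)) ~= 0" unfolding Q(5) by (rule no_zero_divisors) (use elim in blast | simp)+
   then show ?thesis using 5 by simp
  next
   case 6
   have "Q4 (P + kick4 (5, k)) ~= 0" unfolding Q(6) by (rule no_zero_divisors) (use elim in blast | simp)+
   then show ?thesis using 6 by simp
  qed
 qed
qed

lemma kick_R2:
 assumes "P \<in> R2"
 shows "AE x in K4. (x \<in> J2 \<and> P + kick4 x \<in> R2) \<or> (x \<notin> J2 \<and> Q4 (P + kick4 x) ~= 0)"
proof (rule AE_kick_measure[OF g])
 fix i :: nat assume i: "i < 6"
 obtain p1 p2 where P: "P = (p1, p2, - p2, - p1)" and ne: "p1 ~= p2" using assms by (auto simp: R2_def)
 note Q = Q4_kick[OF P add.commute]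
 have d: "p1 - p2 ~= 0" "p2 - p1 ~= 0" using ne by auto
 have R: "P + kick4 (2, k) \<in> R2" if "k ~= p2 - p1" for k
  using that unfolding R2_def P by (auto simp: kick4_def intro!: exI[of _ "p1 + k"] exI[of _ p2])
 have R': "P + kick4 (3, k) \<in> R2" if "k ~= p1 - p2" for k
  using that unfolding R2_def P by (auto simp: kick4_def intro!: exI[of _ "p2 + k"] exI[of _ p1])
 have key: "AE k in lborel. k ~= p2 - p1 \<and> k ~= p1 - p2 \<and> k \<bullet> (p1 - p2) ~= 0 \<and> k \<bullet> (p2 - p1) ~= 0 \<and>
   (norm k)^2 + k \<bullet> (p1 - p2) ~= 0 \<and> (norm k)\<^sup>2 + k \<bullet> (p2 - p1) ~= 0"
  using AE_neq[of "p2 - p1"] AE_neq[of "p1 - p2"] AE_inner_nonzero[OF d(1)] AE_inner_nonzero[OF d(2)] AE_sphere[of "p1 - p2"] AE_sphere[of "p2 - p1"]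
  by eventually_elim blast
 show "AE k in lborel. ((i, k) \<in> J2 \<and> P + kick4 (i, k) \<in> R2) \<or> ((i, k) \<notin> J2 \<and> Q4 (P + kick4 (i, k)) ~= 0)"
  using key
 proof eventually_elim
  case (elim k)
  from i consider "i = 0" | "i = 1" | "i = 2" | "i = 3" | "i = 4" | "i = 5" unfolding less_6_cases by blast
  then show ?case
  proof cases
   case 1
   have "Q4 (P + kick4 (0, k)) ~= 0" unfolding Q(1) by (rule no_zero_divisors) (use elim in blast | simp)+
   then show ?thesis using 1 by simp
  next
   case 2
   have "Q4 (P + kick4 (1, k)) ~= 0" unfolding Q(2) by (rule no_zero_divisors) (use elim in blast | simp)+
   then show ?thesis using 2 by simp
  next
   case 3
   then show ?thesis using R elim by simp
  next
   case 4
   then show ?thesis using R' elim by simp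
  next
   case 5
   have "Q4 (P + kick4 (4, k)) ~= 0" unfolding Q(5) by (rule no_zero_divisors) (use elim in blast | simp)+
   then show ?thesis using 5 by simp
  next
   case 6
   have "Q4 (P + kick4 (5, k)) ~= 0" unfolding Q(6) by (rule no_zero_divisors) (use elim in blast | simp)+
   then show ?thesis using 6 by simp
  qed
 qed
qed

lemma channel_limit:
 assumes J: "J = I \<times> UNIV" "I \<subseteq> {..<4}" and R: "R \<subseteq> R1 \<union> R2"
  and kick: "!!P. P \<in> R ==> AE x in K4. (x \<in> J \<and> P + kick4 x \<in> R) \<or> (x \<notin> J \<and> Q4 (P + kick4 x) ~= 0)"
  and P: "P \<in> R" and t: "0 <= t"
 shows "(%j. M4.dyson (Om4 j) (h4 j) n t (eps j *\<^sub>R (a1, a2, b1, b2) + P)) \<longlonglongrightarrow>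
  cis ((a1 + a2 + b1 + b2) \<bullet> r) * cis (- w4 (a1, a2, b1, b2) P * t) * M4.resonance (%x. w4 (a1, a2, b1, b2) (kick4 x)) J t ^ n / fact n"
proof (rule M4.dyson_resonant_limit[where R = R and w = "w4 (a1, a2, b1, b2)"])
 show "w4 (a1, a2, b1, b2) \<in> borel_measurable borel" by (rule w_measurable)
 show "J \<in> sets K4" unfolding J by (rule sets_kick) (use J(2) in auto)
 show "h4 j \<in> borel_measurable borel" for j by measurable
 show "(%j. Om4 j (eps j *\<^sub>R (a1, a2, b1, b2) + P)) \<longlonglongrightarrow> w4 (a1, a2, b1, b2) P" if "P \<in> R" for P
 proof -
  have "Q4 P = 0" using nonresonant_state(1) that R by blast
  then show ?thesis unfolding freq4[OF eps] by (simp only: freq_tendsto)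
 qed
 show "(%j. h4 j (eps j *\<^sub>R (a1, a2, b1, b2) + P)) \<longlonglongrightarrow> cis ((a1 + a2 + b1 + b2) \<bullet> r)" if "P \<in> R" for P
  by (rule nonresonant_state(2)) (use that R in blast)
 show "kick_sign4 x = 1" if "x \<in> J" for x using that J by (auto simp: kick_sign4_def)
 show "AE x in K4. (x \<in> J \<and> P + kick4 x \<in> R) \<or>
   (x \<notin> J \<and> filterlim (%j. Om4 j (eps j *\<^sub>R (a1, a2, b1, b2) + P) - Om4 j (eps j *\<^sub>R (a1, a2, b1, b2) + (P + kick4 x))) at_infinity sequentially)"
  if "P \<in> R" for P
  using kick[OF that]
 proof eventually_elim
  case (elim x)
  have "Q4 P = 0" using nonresonant_state(1) that R by blast
  with elim show ?case using detuned4 by blast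
 qed
qed (use P t in \<open>auto simp: w4_add intro: M4.borel_measurable_quad_freq\<close>)

text \<open>The history without kicks belongs to both pairings and is counted once, whence the \<open>- 1\<close>.\<close>

theorem fourth_moment_limit:
 fixes \<nu> :: "nat => real => plane \<times> plane \<times> plane \<times> plane => complex"
 assumes we: "!!j. weak_evolution K4 kick4 kick_sign4 (%b. 1 / (2 * k0 * eps j) * sign4 b) (\<nu> j)"
  and \<nu>0: "!!j. \<nu> j 0 = (%X. of_real (exp (- ((eps j)^2 * (norm X)^2 / (2 * r0^2)))))"
  and t: "0 <= t" and cont: "!!j. isCont (\<nu> j t) (r /\<^sub>R eps j, r /\<^sub>R eps j, r /\<^sub>R eps j, r /\<^sub>R eps j)"
 shows "(%j. \<nu> j t (r /\<^sub>R eps j, r /\<^sub>R eps j, r /\<^sub>R eps j, r /\<^sub>R eps j)) \<longlonglongrightarrow>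
  (LINT xi|lborel. of_real (gauss r0 xi) * (case xi of (a1, a2, b1, b2) => cis ((a1 + a2 + b1 + b2) \<bullet> r) *
   (exp (of_real (\<Psi> t (a1 + b1) + \<Psi> t (a2 + b2))) + exp (of_real (\<Psi> t (a1 + b2) + \<Psi> t (a2 + b1))) - 1)))"
proof (rule M4.gaussian_limit[OF we r0 eps \<nu>0 t cont])
 fix xi :: "plane \<times> plane \<times> plane \<times> plane"
 obtain a1 a2 b1 b2 where xi: "xi = (a1, a2, b1, b2)" by (cases xi)
 let ?H = "cis ((a1 + a2 + b1 + b2) \<bullet> r)"
 let ?x = "complex_of_real (\<Psi> t (a1 + b1) + \<Psi> t (a2 + b2))" and ?y = "complex_of_real (\<Psi> t (a1 + b2) + \<Psi> t (a2 + b1))"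
 let ?\<Lambda> = "%n. ?H * (?x ^ n / fact n + ?y ^ n / fact n - (if n = 0 then 1 else 0))"
 have e: "(case xi of (a1, a2, b1, b2) => cis ((a1 + a2 + b1 + b2) \<bullet> r) *
   (complex_of_real (\<Psi> t (a1 + b1) + \<Psi> t (a2 + b2)) ^ n / fact n + complex_of_real (\<Psi> t (a1 + b2) + \<Psi> t (a2 + b1)) ^ n / fact n - (if n = 0 then 1 else 0))) = ?\<Lambda> n" for n
  by (simp only: xi prod.case)
 have "?\<Lambda> sums (?H * (exp ?x + exp ?y - 1))"
  by (intro sums_mult sums_diff sums_add sums_exp_divide) (rule sums_single[of 0 "%_. 1"])
 then show "(%n. case xi of (a1, a2, b1, b2) => cis ((a1 + a2 + b1 + b2) \<bullet> r) *
   (complex_of_real (\<Psi> t (a1 + b1) + \<Psi> t (a2 + b2)) ^ n / fact n + complex_of_real (\<Psi> t (a1 + b2) + \<Psi> t (a2 + b1)) ^ n / fact n - (if n = 0 then 1 else 0)))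
  sums (case xi of (a1, a2, b1, b2) => cis ((a1 + a2 + b1 + b2) \<bullet> r) *
   (exp (of_real (\<Psi> t (a1 + b1) + \<Psi> t (a2 + b2))) + exp (of_real (\<Psi> t (a1 + b2) + \<Psi> t (a2 + b1))) - 1))"
  unfolding e by (simp only: xi prod.case)
 fix n
 have w0: "w4 xi 0 = 0" by (simp add: xi w4_def zero_prod_def)
 have Q40: "Q4 0 = 0" by (simp add: Q4_def zero_prod_def)
 have start: "(%j. Om4 j (eps j *\<^sub>R xi)) \<longlonglongrightarrow> w4 xi 0"
 proof -
  have "Om4 j (eps j *\<^sub>R xi) = eps j * (Q4 xi / (2 * k0)) + w4 xi 0 + 0 / (2 * k0) * inverse (eps j)" for j
   using freq4[OF eps[of j], of xi 0] by (simp only: add_0_right Q40)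
  then show ?thesis by (simp only: freq_tendsto)
 qed
 have h0: "h4 j (eps j *\<^sub>R xi) = ?H" for j using inner_X0_4[of j a1 a2 b1 b2 0 0 0 0] by (simp add: xi zero_prod_def[symmetric])
 have r1: "M4.resonance (%x. w4 xi (kick4 x)) J1 t = ?x" unfolding xi by (subst resonance4) auto
 have r2: "M4.resonance (%x. w4 xi (kick4 x)) J2 t = ?y" unfolding xi by (subst resonance4) auto
 have "(%j. M4.dyson (Om4 j) (h4 j) n t (eps j *\<^sub>R xi)) \<longlonglongrightarrow> ?\<Lambda> n"
 proof (cases n)
  case 0
  have "(%j. cis (- Om4 j (eps j *\<^sub>R xi) * t) * ?H) \<longlonglongrightarrow> cis (- w4 xi 0 * t) * ?H"
   unfolding cis_conv_exp by (intro tendsto_intros start)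
  moreover have "M4.dyson (Om4 j) (h4 j) 0 t (eps j *\<^sub>R xi) = cis (- Om4 j (eps j *\<^sub>R xi) * t) * ?H" for j
   by (simp only: M4.dyson.simps h0)
  ultimately have "(%j. M4.dyson (Om4 j) (h4 j) 0 t (eps j *\<^sub>R xi)) \<longlonglongrightarrow> cis (- w4 xi 0 * t) * ?H"
   by (simp only:)
  then show ?thesis unfolding 0 by (simp add: w0)
 next
  case (Suc m)
  have "(%j. M4.dyson (Om4 j) (h4 j) (Suc m) t (eps j *\<^sub>R xi)) \<longlonglongrightarrow>
    ?H * M4.resonance (%x. w4 xi (kick4 x)) J1 t ^ Suc m / fact (Suc m) + ?H * M4.resonance (%x. w4 xi (kick4 x)) J2 t ^ Suc m / fact (Suc m)"
  proof (rule M4.dyson_two_channel_limit[where w = "w4 xi" and Om = "%j. Om4 j" and q = "%j. eps j *\<^sub>R xi", OF _ _ _ _ _ _ _ start w0 _ _ t])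
   show "h4 j \<in> borel_measurable borel" for j by measurable
   show "w4 xi \<in> borel_measurable borel" by (rule w_measurable)
   show "J1 \<in> sets K4" "J2 \<in> sets K4" by (rule sets_kick, simp)+
   show "kick_sign4 x = 1" if "x \<in> J1 \<union> J2" for x using that by (auto simp: kick_sign4_def)
   have c1: "(%j. M4.dyson (Om4 j) (h4 j) m u (eps j *\<^sub>R xi + P)) \<longlonglongrightarrow>
     ?H * cis (- w4 xi P * u) * M4.resonance (%x. w4 xi (kick4 x)) J1 u ^ m / fact m" if "P \<in> R1" "0 <= u" for P u
    unfolding xi by (rule channel_limit[OF refl _ _ kick_R1 that]) auto
   have c2: "(%j. M4.dyson (Om4 j) (h4 j) m u (eps j *\<^sub>R xi + P)) \<longlonglongrightarrow>
     ?H * cis (- w4 xi P * u) * M4.resonance (%x. w4 xi (kick4 x)) J2 u ^ m / fact m" if "P \<in> R2" "0 <= u" for P u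
    unfolding xi by (rule channel_limit[OF refl _ _ kick_R2 that]) auto
   have det: "filterlim (%j. Om4 j (eps j *\<^sub>R xi) - Om4 j (eps j *\<^sub>R xi + P')) at_infinity sequentially" if "Q4 P' ~= 0" for P'
    using detuned4[OF Q40 that, of xi] by (simp only: add_0_right)
   have "AE x in K4. (x \<in> J1 \<and> kick4 x \<in> R1) \<or> (x \<in> J2 \<and> kick4 x \<in> R2) \<or> (x \<notin> J1 \<union> J2 \<and> Q4 (kick4 x) ~= 0)"
   proof (rule AE_kick_measure[OF g])
    fix i :: nat assume i: "i < 6"
    have "((i, k) \<in> J1 \<and> kick4 (i, k) \<in> R1) \<or> ((i, k) \<in> J2 \<and> kick4 (i, k) \<in> R2) \<or> ((i, k) \<notin> J1 \<union> J2 \<and> Q4 (kick4 (i, k)) ~= 0)" if "k ~= 0" for k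
     using i that unfolding less_6_cases by (elim disjE) (auto simp: kick4_def R1_def R2_def Q4_def)
    then show "AE k in lborel. ((i, k) \<in> J1 \<and> kick4 (i, k) \<in> R1) \<or> ((i, k) \<in> J2 \<and> kick4 (i, k) \<in> R2) \<or> ((i, k) \<notin> J1 \<union> J2 \<and> Q4 (kick4 (i, k)) ~= 0)"
     using AE_neq[of 0] by (auto elim!: eventually_mono)
   qed
   then show "AE k in K4. (k \<in> J1 \<and> (\<forall>u\<ge>0. (%j. M4.dyson (Om4 j) (h4 j) m u (eps j *\<^sub>R xi + kick4 k)) \<longlonglongrightarrow>
     ?H * cis (- w4 xi (kick4 k) * u) * M4.resonance (%k. w4 xi (kick4 k)) J1 u ^ m / fact m)) \<or>
    (k \<in> J2 \<and> (\<forall>u\<ge>0. (%j. M4.dyson (Om4 j) (h4 j) m u (eps j *\<^sub>R xi + kick4 k)) \<longlonglongrightarrow>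
     ?H * cis (- w4 xi (kick4 k) * u) * M4.resonance (%k. w4 xi (kick4 k)) J2 u ^ m / fact m)) \<or>
    (k \<notin> J1 \<union> J2 \<and> filterlim (%j. Om4 j (eps j *\<^sub>R xi) - Om4 j (eps j *\<^sub>R xi + kick4 k)) at_infinity sequentially)"
   proof eventually_elim
    case (elim k)
    then show ?case using c1 c2 det by blast
   qed
  qed (auto intro: M4.borel_measurable_quad_freq)
  then show ?thesis unfolding r1 r2 Suc by (simp add: distrib_left)
 qed
 then show "(%j. M4.dyson (Om4 j) (h4 j) n t (eps j *\<^sub>R xi)) \<longlonglongrightarrow> (case xi of (a1, a2, b1, b2) => cis ((a1 + a2 + b1 + b2) \<bullet> r) *
   (complex_of_real (\<Psi> t (a1 + b1) + \<Psi> t (a2 + b2)) ^ n / fact n + complex_of_real (\<Psi> t (a1 + b2) + \<Psi> t (a2 + b1)) ^ n / fact n - (if n = 0 then 1 else 0)))"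
  unfolding e .
qed

end

section \<open>Evaluation of the limits\<close>

lemma gauss_pair: "gauss r0 (a, b) = gauss r0 a * gauss r0 (b :: 'b::euclidean_space)" for a :: "'a::euclidean_space"
 by (simp add: gauss_def norm_Pair power_add distrib_left flip: exp_add)

lemma borel_measurable_continuous_arg:
 fixes c :: "'a::topological_space => 'b::topological_space" and F :: "'b => complex"
 assumes "F \<in> borel_measurable borel" "continuous_on UNIV c"
 shows "(%x. F (c x)) \<in> borel_measurable borel"
 by (rule measurable_compose[OF borel_measurable_continuous_onI assms(1)]) (rule assms(2))

lemma integrable_gauss_mult:
 fixes F :: "'a::euclidean_space => complex"
 assumes [measurable]: "F \<in> borel_measurable borel" and B: "!!x. norm (F x) <= B" and r0: "r0 > 0"
 shows "integrable lborel (%xi. of_real (gauss r0 xi) * F xi)"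
proof (rule Bochner_Integration.integrable_bound)
 show "integrable lborel (%xi::'a. gauss r0 xi * B)" by (intro integrable_mult_left integrable_gauss r0)
 show "AE xi in lborel. norm (of_real (gauss r0 xi) * F xi) <= norm (gauss r0 xi * B)"
  using B gauss_nonneg[OF r0] by (intro AE_I2) (auto simp: norm_mult abs_mult intro!: mult_left_mono order_trans[OF B abs_ge_self])
qed measurable

lemma integral_gauss_pair:
 fixes F :: "'a::euclidean_space \<times> 'b::euclidean_space => complex"
 assumes F: "F \<in> borel_measurable borel" "!!x. norm (F x) <= B" and r0: "r0 > 0"
 shows "(LINT xi|lborel. of_real (gauss r0 xi) * F xi) =
  (LINT a|lborel. of_real (gauss r0 a) * (LINT b|lborel. of_real (gauss r0 b) * F (a, b)))"
proof -
 have i: "integrable (lborel \<Otimes>\<^sub>M lborel) (%xi. of_real (gauss r0 xi) * F xi)"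
  unfolding lborel_prod by (rule integrable_gauss_mult[OF F r0])
 have "(LINT xi|lborel. of_real (gauss r0 xi) * F xi) = (LINT a|lborel. (LINT b|lborel. of_real (gauss r0 (a, b)) * F (a, b)))"
  using lborel_pair.integral_fst'[OF i] unfolding lborel_prod by simp
 also have "\<dots> = (LINT a|lborel. of_real (gauss r0 a) * (LINT b|lborel. of_real (gauss r0 b) * F (a, b)))"
  by (simp only: gauss_pair of_real_mult mult.assoc integral_mult_right_zero)
 finally show ?thesis .
qed

lemma integral_gauss_cis:
 fixes R :: "'a::euclidean_space"
 assumes r0: "r0 > 0"
 shows "(LINT xi|lborel. of_real (gauss r0 xi) * cis (xi \<bullet> R)) = complex_of_real (exp (- ((norm R)^2 / (2 * r0^2))))"
proof -
 have q: "1 / r0 > 0" using r0 by simp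
 have c: "(r0 / sqrt (2 * pi)) ^ DIM('a) * (sqrt (2 * pi) * (1 / r0) / 1) ^ DIM('a) = 1"
  unfolding power_mult_distrib[symmetric] using r0 by simp
 have g: "gauss r0 xi = (r0 / sqrt (2 * pi)) ^ DIM('a) * exp (- (1^2 * (norm xi)^2 / (2 * (1 / r0)^2)))" for xi :: 'a
  using r0 by (simp add: gauss_def power_divide)
 have "(LINT xi|lborel. of_real (gauss r0 xi) * cis (xi \<bullet> R)) = of_real ((r0 / sqrt (2 * pi)) ^ DIM('a)) *
   (LINT X|lborel. of_real (exp (- (1^2 * (norm X)^2 / (2 * (1 / r0)^2)))) * cis (- ((- R) \<bullet> X)))"
  unfolding g of_real_mult mult.assoc integral_mult_right_zero by (simp add: inner_commute)
 also have "\<dots> = of_real (((r0 / sqrt (2 * pi)) ^ DIM('a) * (sqrt (2 * pi) * (1 / r0) / 1) ^ DIM('a)) * exp (- ((1 / r0)^2 * (norm (- R))^2 / (2 * 1^2))))"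
  unfolding gaussian_fourier(2)[OF q zero_less_one] by (simp only: of_real_mult mult.assoc)
 finally show ?thesis unfolding c using r0 by (simp add: power_divide)
qed

text \<open>For each pairing the four-fold Gaussian integral factorises into two equal double integrals,
 although the pairs are interleaved in the order of the variables.\<close>

lemma integral_gauss_crossing:
 fixes F :: "plane => complex"
 assumes Fm [measurable]: "F \<in> borel_measurable borel" and B: "!!x. norm (F x) <= B" and r0: "r0 > 0"
 defines "D \<equiv> LINT xi|lborel. of_real (gauss r0 xi) * F (fst xi + snd xi)"
 shows "(LINT xi|lborel. of_real (gauss r0 xi) * (case xi of (a1, a2, b1, b2) => F (a1 + b1) * F (a2 + b2))) = D * D" (is ?A)
  and "(LINT xi|lborel. of_real (gauss r0 xi) * (case xi of (a1, a2, b1, b2) => F (a1 + b2) * F (a2 + b1))) = D * D" (is ?B)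
proof -
 have B0: "0 <= B" using B[of 0] norm_ge_zero order_trans by blast
 have BB: "norm (F x * F y) <= B * B" for x y unfolding norm_mult by (rule mult_mono[OF B B B0]) simp
 define G where "G a = (LINT b|lborel. of_real (gauss r0 b) * F (a + b))" for a
 have D: "D = (LINT a|lborel. of_real (gauss r0 a) * G a)"
  unfolding D_def G_def by (subst integral_gauss_pair[OF _ B r0]) (auto intro!: borel_measurable_continuous_arg[OF Fm] continuous_intros)
 note I = integral_gauss_pair[OF _ BB r0]
 have "(LINT xi|lborel. of_real (gauss r0 xi) * (case xi of (a1, a2, b1, b2) => F (a1 + b1) * F (a2 + b2))) =
   (LINT xi|lborel. of_real (gauss r0 xi) * (F (fst xi + fst (snd (snd xi))) * F (fst (snd xi) + snd (snd (snd xi)))))"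
  by (simp only: case_prod_beta')
 also have "\<dots> = (LINT a1|lborel. of_real (gauss r0 a1) * (LINT xi|lborel. of_real (gauss r0 xi) * (F (a1 + fst (snd xi)) * F (fst xi + snd (snd xi)))))"
  by (subst I) (auto intro!: borel_measurable_times borel_measurable_continuous_arg[OF Fm] continuous_intros)
 also have "\<dots> = (LINT a1|lborel. of_real (gauss r0 a1) * (LINT a2|lborel. of_real (gauss r0 a2) * (LINT xi|lborel. of_real (gauss r0 xi) * (F (a1 + fst xi) * F (a2 + snd xi)))))"
  by (subst I) (auto intro!: borel_measurable_times borel_measurable_continuous_arg[OF Fm] continuous_intros)
 also have "\<dots> = (LINT a1|lborel. of_real (gauss r0 a1) * (LINT a2|lborel. of_real (gauss r0 a2) * (LINT b1|lborel. of_real (gauss r0 b1) * (LINT b2|lborel. of_real (gauss r0 b2) * (F (a1 + b1) * F (a2 + b2))))))"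
  by (subst I) (auto intro!: borel_measurable_times borel_measurable_continuous_arg[OF Fm] continuous_intros)
 also have "\<dots> = (LINT a1|lborel. of_real (gauss r0 a1) * (LINT a2|lborel. of_real (gauss r0 a2) * (G a1 * G a2)))"
 proof -
  have "(LINT b1|lborel. of_real (gauss r0 b1) * (LINT b2|lborel. of_real (gauss r0 b2) * (F (a1 + b1) * F (a2 + b2)))) = G a1 * G a2" for a1 a2
  proof -
   have "(LINT b2|lborel. of_real (gauss r0 b2) * (F (a1 + b1) * F (a2 + b2))) = F (a1 + b1) * G a2" for b1
    unfolding G_def integral_mult_right_zero[symmetric] by (simp only: mult.left_commute)
   then show ?thesis unfolding G_def[of a1] by (simp only: mult.assoc[symmetric] integral_mult_left_zero)
  qed
  then show ?thesis by (simp only:)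
 qed
 also have "\<dots> = D * D"
 proof -
  have "(LINT a2|lborel. of_real (gauss r0 a2) * (G a1 * G a2)) = G a1 * D" for a1
   unfolding D integral_mult_right_zero[symmetric] by (simp only: mult.left_commute)
  then show ?thesis by (simp only: mult.assoc[symmetric] integral_mult_left_zero D[symmetric])
 qed
 finally show ?A .
 have "(LINT xi|lborel. of_real (gauss r0 xi) * (case xi of (a1, a2, b1, b2) => F (a1 + b2) * F (a2 + b1))) =
   (LINT xi|lborel. of_real (gauss r0 xi) * (F (fst xi + snd (snd (snd xi))) * F (fst (snd xi) + fst (snd (snd xi)))))"
  by (simp only: case_prod_beta')
 also have "\<dots> = (LINT a1|lborel. of_real (gauss r0 a1) * (LINT xi|lborel. of_real (gauss r0 xi) * (F (a1 + snd (snd xi)) * F (fst xi + fst (snd xi)))))"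
  by (subst I) (auto intro!: borel_measurable_times borel_measurable_continuous_arg[OF Fm] continuous_intros)
 also have "\<dots> = (LINT a1|lborel. of_real (gauss r0 a1) * (LINT a2|lborel. of_real (gauss r0 a2) * (LINT xi|lborel. of_real (gauss r0 xi) * (F (a1 + snd xi) * F (a2 + fst xi)))))"
  by (subst I) (auto intro!: borel_measurable_times borel_measurable_continuous_arg[OF Fm] continuous_intros)
 also have "\<dots> = (LINT a1|lborel. of_real (gauss r0 a1) * (LINT a2|lborel. of_real (gauss r0 a2) * (LINT b1|lborel. of_real (gauss r0 b1) * (LINT b2|lborel. of_real (gauss r0 b2) * (F (a1 + b2) * F (a2 + b1))))))"
  by (subst I) (auto intro!: borel_measurable_times borel_measurable_continuous_arg[OF Fm] continuous_intros)
 also have "\<dots> = (LINT a1|lborel. of_real (gauss r0 a1) * (LINT a2|lborel. of_real (gauss r0 a2) * (G a1 * G a2)))"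
 proof -
  have "(LINT b1|lborel. of_real (gauss r0 b1) * (LINT b2|lborel. of_real (gauss r0 b2) * (F (a1 + b2) * F (a2 + b1)))) = G a1 * G a2" for a1 a2
  proof -
   have "(LINT b2|lborel. of_real (gauss r0 b2) * (F (a1 + b2) * F (a2 + b1))) = G a1 * F (a2 + b1)" for b1
    unfolding G_def integral_mult_left_zero[symmetric] by (simp only: mult.assoc)
   moreover have "(LINT b1|lborel. of_real (gauss r0 b1) * (G a1 * F (a2 + b1))) = (LINT b1|lborel. G a1 * (of_real (gauss r0 b1) * F (a2 + b1)))"
    by (simp only: mult.left_commute)
   moreover have "\<dots> = G a1 * G a2" unfolding G_def[of a2] by (rule integral_mult_right_zero)
   ultimately show ?thesis by (simp only:)
  qed
  then show ?thesis by (simp only:)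
 qed
 also have "\<dots> = D * D"
 proof -
  have "(LINT a2|lborel. of_real (gauss r0 a2) * (G a1 * G a2)) = G a1 * D" for a1
   unfolding D integral_mult_right_zero[symmetric] by (simp only: mult.left_commute)
  then show ?thesis by (simp only: mult.assoc[symmetric] integral_mult_left_zero D[symmetric])
 qed
 finally show ?B .
qed

lemma integral_gauss_sum:
 fixes F :: "plane => complex"
 assumes Fm [measurable]: "F \<in> borel_measurable borel" and B: "!!x. norm (F x) <= B" and r0: "r0 > 0"
 shows "(LINT xi|lborel. of_real (gauss r0 xi) * F (fst xi + snd xi)) =
  1 / (4 * of_real pi) * (LINT w|lborel. F ((1 / r0) *\<^sub>R w) * of_real (exp (- ((norm w)^2 / 4))))"
proof -
 let ?e = "%x::plane. exp (- (r0^2 / 2) * (norm x)^2)"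
 define \<kappa> where "\<kappa> = (r0 / sqrt (2 * pi)) ^ DIM(plane)"
 have c: "r0^2 / 2 > 0" using r0 by simp
 have gs: "gauss r0 x = \<kappa> * ?e x" for x :: plane by (simp add: gauss_def \<kappa>_def)
 have "(LINT xi|lborel. of_real (gauss r0 xi) * F (fst xi + snd xi)) =
   (LINT y|lborel. of_real (gauss r0 y) * (LINT x|lborel. of_real (gauss r0 x) * F (y + x)))"
  by (subst integral_gauss_pair[OF _ B r0]) (auto intro!: borel_measurable_continuous_arg[OF Fm] continuous_intros)
 also have "\<dots> = (LINT y|lborel. of_real (gauss r0 (- y)) * (LINT x|lborel. of_real (gauss r0 x) * F (- y + x)))"
  by (rule integral_reflect[symmetric]) measurable
 also have "\<dots> = (LINT y|lborel. (LINT x|lborel. of_real (\<kappa> * \<kappa>) * (F (x - y) * of_real (?e x * ?e y))))"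
 proof (intro integral_cong_fun)
  fix y
  have "of_real (gauss r0 (- y)) * (LINT x|lborel. of_real (gauss r0 x) * F (- y + x)) =
   (LINT x|lborel. of_real (gauss r0 (- y)) * (of_real (gauss r0 x) * F (- y + x)))" by simp
  also have "\<dots> = (LINT x|lborel. of_real (\<kappa> * \<kappa>) * (F (x - y) * of_real (?e x * ?e y)))"
  proof (intro integral_cong_fun)
   fix x
   have a: "- y + x = x - y" by simp
   show "of_real (gauss r0 (- y)) * (of_real (gauss r0 x) * F (- y + x)) = of_real (\<kappa> * \<kappa>) * (F (x - y) * of_real (?e x * ?e y))"
    unfolding gs norm_minus_cancel a of_real_mult by (simp only: mult.assoc mult.commute mult.left_commute)
  qed
  finally show "of_real (gauss r0 (- y)) * (LINT x|lborel. of_real (gauss r0 x) * F (- y + x)) =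
   (LINT x|lborel. of_real (\<kappa> * \<kappa>) * (F (x - y) * of_real (?e x * ?e y)))" .
 qed
 also have "\<dots> = of_real (\<kappa> * \<kappa>) * (LINT y|lborel. (LINT x|lborel. F (x - y) * of_real (?e x * ?e y)))"
  by (simp only: integral_mult_right_zero)
 also have "(LINT y|lborel. (LINT x|lborel. F (x - y) * of_real (?e x * ?e y))) =
   of_real (sqrt (pi / (2 * (r0^2 / 2))) ^ DIM(plane)) * (LINT v|lborel. F v * of_real (exp (- ((r0^2 / 2) / 2) * (norm v)^2)))"
 proof (rule integral_difference_gaussian[OF _ c])
  have "integrable lborel (%v::plane. B * exp (- ((r0^2 / 2) / 2) * (norm v)^2))"
   by (intro integrable_mult_right integrable_gaussian_euclidean(1)) (use r0 in simp)
  then show "integrable lborel (%v. F v * of_real (exp (- ((r0^2 / 2) / 2) * (norm v)^2)))"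
  proof (rule Bochner_Integration.integrable_bound)
   show "AE v in lborel. norm (F v * of_real (exp (- ((r0^2 / 2) / 2) * (norm v)^2))) <= norm (B * exp (- ((r0^2 / 2) / 2) * (norm v)^2))"
    using order_trans[OF B abs_ge_self] by (intro AE_I2) (simp add: norm_mult abs_mult)
  qed measurable
 qed measurable
 also have "(LINT v|lborel. F v * of_real (exp (- ((r0^2 / 2) / 2) * (norm v)^2))) =
   (1 / r0) ^ DIM(plane) *\<^sub>R (LINT w|lborel. F (0 + (1 / r0) *\<^sub>R w) * of_real (exp (- ((r0^2 / 2) / 2) * (norm (0 + (1 / r0) *\<^sub>R w))^2)))"
  by (rule lborel_integral_affine) (use r0 in \<open>simp, measurable\<close>)
 also have "(LINT w|lborel. F (0 + (1 / r0) *\<^sub>R w) * of_real (exp (- ((r0^2 / 2) / 2) * (norm (0 + (1 / r0) *\<^sub>R w))^2))) =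
   (LINT w|lborel. F ((1 / r0) *\<^sub>R w) * of_real (exp (- ((norm w)^2 / 4))))"
 proof -
  have "- ((r0^2 / 2) / 2) * (norm (0 + (1 / r0) *\<^sub>R w))^2 = - ((norm w)^2 / 4)" for w :: plane
   using r0 by (simp add: power_divide)
  then show ?thesis by (simp only: add_0)
 qed
 finally have "(LINT xi|lborel. of_real (gauss r0 xi) * F (fst xi + snd xi)) =
   of_real (\<kappa> * \<kappa> * sqrt (pi / (2 * (r0^2 / 2))) ^ DIM(plane) * (1 / r0) ^ DIM(plane)) *
    (LINT w|lborel. F ((1 / r0) *\<^sub>R w) * of_real (exp (- ((norm w)^2 / 4))))"
  by (simp only: scaleR_conv_of_real of_real_mult mult.assoc)
 also have "\<kappa> * \<kappa> * sqrt (pi / (2 * (r0^2 / 2))) ^ DIM(plane) * (1 / r0) ^ DIM(plane) = 1 / (4 * pi)"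
  using r0 by (simp add: \<kappa>_def power_divide field_simps power2_eq_square)
 finally show ?thesis by simp
qed

text \<open>By Fubini one factor \<open>P\<close> of the integrand can be traded for an average of translations of \<open>R\<close>;
 for \<open>n = 0\<close> the integral is a Gaussian.\<close>

lemma positive_definite_power:
 fixes Y :: "'k => 'a::euclidean_space" and \<eta> :: "'k => real"
 assumes "sigma_finite_measure N" and Y [measurable]: "Y \<in> borel_measurable N" and \<eta>: "integrable N \<eta>" "!!x. 0 <= \<eta> x" and r0: "r0 > 0"
 defines "P \<equiv> %xi. LINT x|N. of_real (\<eta> x) * cis (xi \<bullet> Y x)"
 shows "\<exists>c\<ge>0. (LINT xi|lborel. of_real (gauss r0 xi) * (cis (xi \<bullet> R) * P xi ^ n)) = complex_of_real c"
  and "norm (P xi) <= (LINT x|N. \<eta> x)" and "P \<in> borel_measurable borel"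
proof -
 interpret N: sigma_finite_measure N by fact
 interpret LN: pair_sigma_finite "lborel :: 'a measure" N by unfold_locales
 have [measurable]: "\<eta> \<in> borel_measurable N" using \<eta>(1) by auto
 show Pm [measurable]: "P \<in> borel_measurable borel" unfolding P_def by measurable
 let ?B = "LINT x|N. \<eta> x"
 show PB: "norm (P xi) <= ?B" for xi
  unfolding P_def using \<eta>(2) by (intro order_trans[OF integral_norm_bound]) (simp add: norm_mult)
 have B0: "0 <= ?B" using \<eta>(2) by simp
 define I where "I n R = (LINT xi|lborel. of_real (gauss r0 xi) * (cis (xi \<bullet> R) * P xi ^ n))" for n R
 have Pn: "norm (cis (xi \<bullet> R) * P xi ^ n) <= ?B ^ n" for xi R n
  by (simp add: norm_mult norm_power power_mono PB)
 have int: "integrable lborel (%xi. of_real (gauss r0 xi) * (cis (xi \<bullet> R) * P xi ^ n))" for R n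
  by (rule integrable_gauss_mult[OF _ Pn r0]) measurable
 have step: "I (Suc n) R = (LINT x|N. of_real (\<eta> x) * I n (R + Y x))" for n R
 proof -
  let ?f = "%xi x. of_real (gauss r0 xi) * (cis (xi \<bullet> R) * P xi ^ n) * (of_real (\<eta> x) * cis (xi \<bullet> Y x))"
  have f: "integrable (lborel \<Otimes>\<^sub>M N) (%(xi, x). ?f xi x)"
  proof (rule LN.Fubini_integrable)
   have "integrable N (%x. of_real (\<eta> x) * cis (xi \<bullet> Y x))" for xi
    by (rule Bochner_Integration.integrable_bound[OF \<eta>(1)]) (auto simp: norm_mult)
   then show "AE xi in lborel. integrable N (%x. case (xi, x) of (xi, x) => ?f xi x)"
    by (intro AE_I2) (simp only: prod.case, rule integrable_mult_right)
   have "(LINT x|N. norm (case (xi, x) of (xi, x) => ?f xi x)) = norm (of_real (gauss r0 xi) * (cis (xi \<bullet> R) * P xi ^ n)) * ?B" for xi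
    using \<eta>(2) by (simp add: norm_mult)
   then show "integrable lborel (%xi. LINT x|N. norm (case (xi, x) of (xi, x) => ?f xi x))"
    using integrable_mult_left[OF integrable_norm[OF int[of R n]], of ?B] by (simp only:)
  qed measurable
  have "I (Suc n) R = (LINT xi|lborel. (LINT x|N. ?f xi x))"
  proof -
   have "of_real (gauss r0 xi) * (cis (xi \<bullet> R) * P xi ^ Suc n) = (LINT x|N. ?f xi x)" for xi
    unfolding integral_mult_right_zero P_def[symmetric] power_Suc2 by (simp only: mult.assoc P_def)
   then show ?thesis unfolding I_def by (simp only:)
  qed
  also have "\<dots> = (LINT x|N. (LINT xi|lborel. ?f xi x))" using LN.Fubini_integral[OF f] by (simp only: prod.case)
  also have "\<dots> = (LINT x|N. of_real (\<eta> x) * I n (R + Y x))"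
  proof (intro integral_cong_fun)
   fix x
   have "?f xi x = of_real (\<eta> x) * (of_real (gauss r0 xi) * (cis (xi \<bullet> (R + Y x)) * P xi ^ n))" for xi
    by (simp add: inner_add_right cis_mult[symmetric])
   then show "(LINT xi|lborel. ?f xi x) = of_real (\<eta> x) * I n (R + Y x)"
    unfolding I_def by (simp only: integral_mult_right_zero)
  qed
  finally show ?thesis .
 qed
 have "\<exists>c\<ge>0. I n R = complex_of_real c" for n R
 proof (induction n arbitrary: R)
  case 0
  have "I 0 R = complex_of_real (exp (- ((norm R)^2 / (2 * r0^2))))"
   using integral_gauss_cis[OF r0, of R] by (simp add: I_def)
  then show ?case by (intro exI[of _ "exp (- ((norm R)^2 / (2 * r0^2)))"]) simp
 next
  case (Suc n)
  then obtain c where c: "!!R. 0 <= c R" "!!R. I n R = complex_of_real (c R)" by metis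
  have "I (Suc n) R = (LINT x|N. complex_of_real (\<eta> x * c (R + Y x)))"
   unfolding step c(2) by simp
  also have "\<dots> = complex_of_real (LINT x|N. \<eta> x * c (R + Y x))" by (rule integral_complex_of_real)
  finally show ?case using c(1) \<eta>(2) by (intro exI[of _ "LINT x|N. \<eta> x * c (R + Y x)"]) simp
 qed
 then show "\<exists>c\<ge>0. (LINT xi|lborel. of_real (gauss r0 xi) * (cis (xi \<bullet> R) * P xi ^ n)) = complex_of_real c"
  by (simp add: I_def)
qed

text \<open>All terms of the exponential series are nonnegative and the first one is positive.\<close>

lemma positive_definite_exp:
 fixes Y :: "'k => 'a::euclidean_space" and \<eta> :: "'k => real"
 assumes N: "sigma_finite_measure N" and Y: "Y \<in> borel_measurable N" and \<eta>: "integrable N \<eta>" "!!x. 0 <= \<eta> x" and r0: "r0 > 0"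
 defines "P \<equiv> %xi. LINT x|N. of_real (\<eta> x) * cis (xi \<bullet> Y x)"
 shows "\<exists>d>0. (LINT xi|lborel. of_real (gauss r0 xi) * (cis (xi \<bullet> R) * exp (P xi))) = complex_of_real d"
proof -
 have PX: "(LINT x|N. of_real (\<eta> x) * cis (xi \<bullet> Y x)) = P xi" for xi by (simp add: P_def)
 note P = positive_definite_power[OF N Y \<eta> r0, unfolded PX]
 note [measurable] = P(3)
 let ?B = "LINT x|N. \<eta> x"
 define b where "b n = ?B ^ n /\<^sub>R fact n" for n
 have b: "b n = ?B ^ n / fact n" for n by (simp only: b_def real_scaleR_def divide_inverse_commute)
 have sb: "summable b" unfolding b_def by (rule summable_exp_generic)
 let ?f = "%n xi. of_real (gauss r0 xi) * (cis (xi \<bullet> R) * (P xi ^ n / fact n))"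
 have le: "norm (cis (xi \<bullet> R) * (P xi ^ n / fact n)) <= b n" for n xi
 proof -
  have "norm (P xi) ^ n <= ?B ^ n" by (rule power_mono[OF P(2)]) simp
  then show ?thesis unfolding b by (simp add: norm_mult norm_divide norm_power divide_right_mono)
 qed
 have g0: "0 <= gauss r0 xi" for xi :: 'a by (rule gauss_nonneg[OF r0])
 have le': "norm (?f n xi) <= gauss r0 xi * b n" for n xi
  unfolding norm_mult[of "of_real _"] using le g0 by (simp only: norm_of_real abs_of_nonneg mult_left_mono)
 have int: "integrable lborel (?f n)" for n
  by (rule integrable_gauss_mult[OF _ le r0]) measurable
 have gi: "integrable lborel (%xi::'a. gauss r0 xi * b n)" for n by (intro integrable_mult_left integrable_gauss r0)
 have "(%n. integral\<^sup>L lborel (?f n)) sums (LINT xi|lborel. (\<Sum>n. ?f n xi))"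
 proof (rule sums_integral[OF int])
  show "AE xi in lborel. summable (%n. norm (?f n xi))"
  proof (rule AE_I2)
   fix xi show "summable (%n. norm (?f n xi))"
    by (rule summable_comparison_test'[OF summable_mult[OF sb, of "gauss r0 xi"], of 0]) (simp only: real_norm_def abs_norm_cancel le')
  qed
  have "(LINT xi|lborel. norm (?f n xi)) <= (LINT xi::'a|lborel. gauss r0 xi) * b n" for n
   using integral_mono[OF integrable_norm[OF int] gi le'] by simp
  then show "summable (%n. LINT xi|lborel. norm (?f n xi))"
   by (intro summable_comparison_test'[OF summable_mult[OF sb, of "LINT xi::'a|lborel. gauss r0 xi"], of 0]) simp
 qed
 moreover have "(\<Sum>n. ?f n xi) = of_real (gauss r0 xi) * (cis (xi \<bullet> R) * exp (P xi))" for xi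
  by (intro sums_unique[symmetric] sums_mult sums_exp_divide)
 ultimately have s: "(%n. integral\<^sup>L lborel (?f n)) sums (LINT xi|lborel. of_real (gauss r0 xi) * (cis (xi \<bullet> R) * exp (P xi)))" (is "_ sums ?D")
  by (simp only:)
 obtain c where c: "!!n. 0 <= c n" "!!n. (LINT xi|lborel. of_real (gauss r0 xi) * (cis (xi \<bullet> R) * P xi ^ n)) = complex_of_real (c n)"
  using P(1)[of R] by metis
 have fc: "integral\<^sup>L lborel (?f n) = complex_of_real (c n / fact n)" for n
 proof -
  have "?f n xi = of_real (gauss r0 xi) * (cis (xi \<bullet> R) * P xi ^ n) * (1 / fact n)" for xi by simp
  then show ?thesis by (simp only: integral_mult_left_zero c(2)) simp
 qed
 have Re: "(%n. c n / fact n) sums Re ?D" using sums_Re[OF s] unfolding fc Re_complex_of_real .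
 have Im: "(%n. 0) sums Im ?D" using sums_Im[OF s] unfolding fc Im_complex_of_real .
 have "complex_of_real (c 0) = complex_of_real (exp (- ((norm R)^2 / (2 * r0^2))))"
  using c(2)[of 0] integral_gauss_cis[OF r0, of R] by simp
 then have c0: "0 < c 0" by (simp del: of_real_exp)
 have "(\<Sum>n\<in>{0}. c n / fact n) <= (\<Sum>n. c n / fact n)"
  by (rule sum_le_suminf[OF sums_summable[OF Re]]) (auto simp: c(1))
 then have "0 < Re ?D" using c0 sums_unique[OF Re] by simp
 moreover have "?D = complex_of_real (Re ?D)" using sums_unique2[OF Im sums_zero] by (intro complex_eqI) simp_all
 ultimately show ?thesis by blast
qed

context kick_setting
begin

section \<open>The scintillation index\<close>

lemma \<Psi>_spectral:
 assumes "0 <= t"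
 shows "complex_of_real (\<Psi> t (fst xi + snd xi)) =
  (LINT x|(lborel \<Otimes>\<^sub>M K2). of_real (indicator {0..t} (fst x)) * cis (xi \<bullet> (- (fst x / k0) *\<^sub>R snd (snd x), - (fst x / k0) *\<^sub>R snd (snd x))))"
proof -
 let ?J = "{..<1::nat} \<times> (UNIV :: plane set)"
 let ?f = "%u k. indicator ?J k *\<^sub>R cis (- w2 xi (kick2 k) * u)"
 note [measurable] = w_measurable(1)[of xi]
 have [measurable]: "?J \<in> sets K2" by (rule sets_kick) simp
 have m: "(%(u, k). ?f u k) \<in> borel_measurable (lborel \<Otimes>\<^sub>M K2)" by measurable
 have "complex_of_real (\<Psi> t (fst xi + snd xi)) = (LINT u:{0..t}|lborel. (LINT k|K2. ?f u k))"
  unfolding resonance2[symmetric] M2.resonance_def ..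
 also have "\<dots> = (LINT x|(lborel \<Otimes>\<^sub>M K2). indicator {0..t} (fst x) *\<^sub>R ?f (fst x) (snd x))"
  by (rule M2.slab_Fubini(1)[OF m, where B = 1]) (simp add: indicator_def)
 also have "\<dots> = (LINT x|(lborel \<Otimes>\<^sub>M K2). of_real (indicator {0..t} (fst x)) * cis (xi \<bullet> (- (fst x / k0) *\<^sub>R snd (snd x), - (fst x / k0) *\<^sub>R snd (snd x))))"
 proof (rule integral_cong_fun)
  fix x :: "real \<times> nat \<times> plane" assume x: "x \<in> space (lborel \<Otimes>\<^sub>M K2)"
  then have J: "snd x \<in> ?J" by (auto simp: space_pair_measure space_kick)
  have "- w2 xi (kick2 (snd x)) * fst x = xi \<bullet> (- (fst x / k0) *\<^sub>R snd (snd x), - (fst x / k0) *\<^sub>R snd (snd x))"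
   using k0 by (cases xi) (simp add: w2_def kick2_def case_prod_beta' field_simps)
  note e = this
  have ind: "indicator ?J (snd x) = (1::real)" using J by simp
  show "indicator {0..t} (fst x) *\<^sub>R ?f (fst x) (snd x) =
    of_real (indicator {0..t} (fst x)) * cis (xi \<bullet> (- (fst x / k0) *\<^sub>R snd (snd x), - (fst x / k0) *\<^sub>R snd (snd x)))"
   unfolding ind scaleR_one e by (rule scaleR_conv_of_real)
 qed
 finally show ?thesis .
qed

text \<open>The representation of the exponent uses pairs of a kick and its time; over a fixed time
 interval they carry finite mass.\<close>

lemma kick_clock:
 "sigma_finite_measure ((lborel :: real measure) \<Otimes>\<^sub>M K2)"
 "(%x. (- (fst x / k0) *\<^sub>R snd (snd x), - (fst x / k0) *\<^sub>R snd (snd x))) \<in> borel_measurable ((lborel :: real measure) \<Otimes>\<^sub>M K2)"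
 "integrable ((lborel :: real measure) \<Otimes>\<^sub>M K2) (%x. indicator {0..t} (fst x) :: real)"
proof -
 show "sigma_finite_measure ((lborel :: real measure) \<Otimes>\<^sub>M K2)"
  by (rule M2.slab.P.sigma_finite_measure_axioms)
 note [measurable] = kick_measurable(1)[of 1]
 show "(%x. (- (fst x / k0) *\<^sub>R snd (snd x), - (fst x / k0) *\<^sub>R snd (snd x))) \<in> borel_measurable ((lborel :: real measure) \<Otimes>\<^sub>M K2)"
  by measurable
 have "integrable ((lborel :: real measure) \<Otimes>\<^sub>M K2) (%(u, k). indicator {0..t} u *\<^sub>R (1::complex))"
  by (rule M2.slab_integrable[where B = 1]) auto
 from integrable_Re[OF this] show "integrable ((lborel :: real measure) \<Otimes>\<^sub>M K2) (%x. indicator {0..t} (fst x) :: real)"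
  by (simp add: case_prod_beta')
qed

lemma \<Psi>_bounded:
 assumes "0 <= t"
 obtains B where "!!v. \<bar>\<Psi> t v\<bar> <= B"
proof -
 note P = positive_definite_power(2)[OF kick_clock(1) kick_clock(2) kick_clock(3)[of t] indicator_pos_le zero_less_one, folded \<Psi>_spectral[OF assms]]
 show ?thesis
 proof (rule that)
  fix v show "\<bar>\<Psi> t v\<bar> <= (LINT x|(lborel \<Otimes>\<^sub>M K2). indicator {0..t} (fst x))"
   using P[of "(v, 0)"] by simp
 qed
qed

lemma \<Psi>_measurable [measurable]: "\<Psi> t \<in> borel_measurable borel"
proof -
 have [measurable]: "C \<in> borel_measurable borel" using C by auto
 show ?thesis unfolding \<Psi>_def[abs_def] set_lebesgue_integral_def by measurable
qed

definition beam :: "plane => real => plane => complex" where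
 "beam r t v = cis (v \<bullet> r) * exp (of_real (\<Psi> t v))"

lemma beam_measurable [measurable]: "beam r t \<in> borel_measurable borel"
 unfolding beam_def[abs_def] by measurable

lemma beam_bounded:
 assumes "0 <= t"
 obtains B where "!!v. norm (beam r t v) <= B"
proof -
 obtain B where B: "!!v. \<bar>\<Psi> t v\<bar> <= B" using \<Psi>_bounded[OF assms] by blast
 have "norm (beam r t v) <= exp B" for v
  using abs_le_D1[OF B[of v]] by (simp add: beam_def norm_mult)
 then show ?thesis by (rule that)
qed

lemma beam_integral_positive:
 assumes "0 <= t"
 shows "\<exists>d>0. (LINT xi|lborel. of_real (gauss r0 xi) * beam r t (fst xi + snd xi)) = complex_of_real d"
proof -
 have "cis (xi \<bullet> (r, r)) = cis ((fst xi + snd xi) \<bullet> r)" for xi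
  by (cases xi) (simp add: inner_add_left)
 then show ?thesis
  using positive_definite_exp[OF kick_clock(1) kick_clock(2) kick_clock(3)[of t] indicator_pos_le r0, folded \<Psi>_spectral[OF assms], of "(r, r)"]
  unfolding beam_def by simp
qed

lemma beam_integral:
 assumes t: "0 <= t"
 shows "(LINT xi|lborel. of_real (gauss r0 xi) * beam r t (fst xi + snd xi)) =
  1 / (4 * of_real pi) * (LINT w|lborel.
      exp (of_real (k0^2 / 4 * (LINT z':{0..t}|lborel. C ((z' / (k0 * r0)) *\<^sub>R w)))
         - of_real ((norm w)^2 / 4)
         + \<i> * of_real (w \<bullet> (r /\<^sub>R r0))))"
proof -
 obtain B where B: "!!v. norm (beam r t v) <= B" using beam_bounded[OF t] by blast
 have "beam r t ((1 / r0) *\<^sub>R w) * of_real (exp (- ((norm w)^2 / 4))) =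
   exp (of_real (k0^2 / 4 * (LINT z':{0..t}|lborel. C ((z' / (k0 * r0)) *\<^sub>R w)))
         - of_real ((norm w)^2 / 4)
         + \<i> * of_real (w \<bullet> (r /\<^sub>R r0)))" for w
 proof -
  have e: "exp x * exp y * exp z = exp (y + z + x)" for x y z :: complex by (simp add: exp_add)
  have i: "((1 / r0) *\<^sub>R w) \<bullet> r = w \<bullet> (r /\<^sub>R r0)" by (simp add: inverse_eq_divide)
  have P: "\<Psi> t ((1 / r0) *\<^sub>R w) = k0^2 / 4 * (LINT z':{0..t}|lborel. C ((z' / (k0 * r0)) *\<^sub>R w))"
   unfolding \<Psi>_def by (simp add: scaleR_scaleR)
  show ?thesis unfolding beam_def i P cis_conv_exp exp_of_real[symmetric] e by (simp only: of_real_minus diff_conv_add_uminus)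
 qed
 then show ?thesis unfolding integral_gauss_sum[OF beam_measurable B r0] by (simp only:)
qed

end

context vanishing_noise
begin

lemma fourth_moment_value:
 assumes t: "0 <= t"
 shows "(LINT xi|lborel. of_real (gauss r0 xi) * (case xi of (a1, a2, b1, b2) => cis ((a1 + a2 + b1 + b2) \<bullet> r) *
   (exp (of_real (\<Psi> t (a1 + b1) + \<Psi> t (a2 + b2))) + exp (of_real (\<Psi> t (a1 + b2) + \<Psi> t (a2 + b1))) - 1))) =
  2 * (LINT xi|lborel. of_real (gauss r0 xi) * beam r t (fst xi + snd xi))^2 - of_real (exp (- (2 * (norm r)^2 / r0^2)))"
proof -
 obtain B where B: "!!v. norm (beam r t v) <= B" using beam_bounded[OF t] by blast
 have B0: "0 <= B" using B[of 0] norm_ge_zero order_trans by blast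
 have BB: "norm (beam r t x * beam r t y) <= B * B" for x y unfolding norm_mult by (rule mult_mono[OF B B B0]) simp
 let ?A = "%xi. case xi of (a1, a2, b1, b2) => beam r t (a1 + b1) * beam r t (a2 + b2)"
 let ?B = "%xi. case xi of (a1, a2, b1, b2) => beam r t (a1 + b2) * beam r t (a2 + b1)"
 let ?C = "%xi. cis (xi \<bullet> (r, r, r, r))"
 let ?g = "%xi. complex_of_real (gauss r0 (xi :: plane \<times> plane \<times> plane \<times> plane))"
 have eq: "?g xi * (case xi of (a1, a2, b1, b2) => cis ((a1 + a2 + b1 + b2) \<bullet> r) *
   (exp (of_real (\<Psi> t (a1 + b1) + \<Psi> t (a2 + b2))) + exp (of_real (\<Psi> t (a1 + b2) + \<Psi> t (a2 + b1))) - 1)) =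
  ?g xi * ?A xi + ?g xi * ?B xi - ?g xi * ?C xi" for xi
 proof -
  obtain a1 a2 b1 b2 where xi: "xi = (a1, a2, b1, b2)" by (cases xi)
  have c1: "cis ((a1 + b1) \<bullet> r) * cis ((a2 + b2) \<bullet> r) = cis ((a1 + a2 + b1 + b2) \<bullet> r)"
   unfolding cis_mult by (rule arg_cong[of _ _ cis]) (simp add: inner_add_left)
  have c2: "cis ((a1 + b2) \<bullet> r) * cis ((a2 + b1) \<bullet> r) = cis ((a1 + a2 + b1 + b2) \<bullet> r)"
   unfolding cis_mult by (rule arg_cong[of _ _ cis]) (simp add: inner_add_left)
  have c3: "?C xi = cis ((a1 + a2 + b1 + b2) \<bullet> r)" by (simp add: xi inner_add_left add.assoc)
  have A: "?A xi = cis ((a1 + a2 + b1 + b2) \<bullet> r) * exp (of_real (\<Psi> t (a1 + b1) + \<Psi> t (a2 + b2)))"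
   unfolding xi prod.case beam_def c1[symmetric] of_real_add exp_add by (simp only: mult.assoc mult.left_commute)
  have B': "?B xi = cis ((a1 + a2 + b1 + b2) \<bullet> r) * exp (of_real (\<Psi> t (a1 + b2) + \<Psi> t (a2 + b1)))"
   unfolding xi prod.case beam_def c2[symmetric] of_real_add exp_add by (simp only: mult.assoc mult.left_commute)
  show ?thesis unfolding A B' c3 unfolding xi prod.case by (simp only: right_diff_distrib distrib_left mult_1_right)
 qed
 note mi = borel_measurable_times borel_measurable_continuous_arg[OF beam_measurable] continuous_intros
 have iA: "integrable lborel (%xi. ?g xi * ?A xi)"
 proof (rule integrable_gauss_mult[OF _ _ r0])
  show "?A \<in> borel_measurable borel" unfolding case_prod_beta' by (intro mi)
  show "norm (?A xi) <= B * B" for xi by (cases xi) (simp only: prod.case BB)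
 qed
 have iB: "integrable lborel (%xi. ?g xi * ?B xi)"
 proof (rule integrable_gauss_mult[OF _ _ r0])
  show "?B \<in> borel_measurable borel" unfolding case_prod_beta' by (intro mi)
  show "norm (?B xi) <= B * B" for xi by (cases xi) (simp only: prod.case BB)
 qed
 have iC: "integrable lborel (%xi. ?g xi * ?C xi)"
  by (rule integrable_gauss_mult[OF _ _ r0, where B = 1]) (intro borel_measurable_cis borel_measurable_continuous_onI continuous_intros, simp)
 have n: "(norm (r, r, r, r))^2 = 4 * (norm r)^2" by (simp add: norm_Pair)
 have "(LINT xi|lborel. ?g xi * ?A xi + ?g xi * ?B xi - ?g xi * ?C xi) =
   (LINT xi|lborel. ?g xi * ?A xi) + (LINT xi|lborel. ?g xi * ?B xi) - (LINT xi|lborel. ?g xi * ?C xi)"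
  using iA iB iC by (simp only: Bochner_Integration.integral_diff Bochner_Integration.integral_add Bochner_Integration.integrable_add)
 then show ?thesis
  unfolding eq integral_gauss_crossing[OF beam_measurable B r0] integral_gauss_cis[OF r0] n
  by (simp add: power2_eq_square)
qed

text \<open>The factors \<open>exp (c t)\<close> and \<open>exp (2 c t)\<close> split off from the second and the fourth moment
 cancel, because the index is homogeneous.\<close>

theorem scintillation_limit:
 assumes mom: "!!j. moments_solve_equations (M j) k0 C (eps j) (initial_field r0 (eps j)) (u j)" and t: "0 <= t"
 shows "(%j. scintillation_index (M j) (u j) (t / eps j) (r /\<^sub>R eps j)) \<longlonglongrightarrow>
  1 - exp (- (2 * (norm r)^2 / r0^2)) / (cmod (LINT xi|lborel. of_real (gauss r0 xi) * beam r t (fst xi + snd xi)))^2"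
proof -
 define c where "c = k0^2 / 4 * C 0"
 define a where "a j = (LINT \<omega>|M j. (norm (u j (t / eps j) (r /\<^sub>R eps j) \<omega>))^2)" for j
 define b where "b j = (LINT \<omega>|M j. (norm (u j (t / eps j) (r /\<^sub>R eps j) \<omega>)) ^ 4)" for j
 obtain d where d: "d > 0" "(LINT xi|lborel. of_real (gauss r0 xi) * beam r t (fst xi + snd xi)) = complex_of_real d"
  using beam_integral_positive[OF t] by blast
 have tj: "0 <= t / eps j" for j using t eps[of j] by simp
 have sol2: "solves_in_L2 (generator2 k0 C (eps j)) (%(x, y). initial_field r0 (eps j) x * cnj (initial_field r0 (eps j) y)) (moment2 (M j) (u j))"
  and sol4: "solves_in_L2 (generator4 k0 C (eps j)) (%(x1, x2, y1, y2). initial_field r0 (eps j) x1 * initial_field r0 (eps j) x2 *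
     cnj (initial_field r0 (eps j) y1) * cnj (initial_field r0 (eps j) y2)) (moment4 (M j) (u j))"
  and c2: "continuous_on ({0..} \<times> UNIV) (%(z, X). moment2 (M j) (u j) z X)"
  and c4: "continuous_on ({0..} \<times> UNIV) (%(z, X). moment4 (M j) (u j) z X)" for j
  using mom[of j] unfolding moments_solve_equations_def by blast+
 have "continuous_on UNIV (moment2 (M j) (u j) (t / eps j))" for j
 proof -
  have "continuous_on UNIV (%X. (t / eps j, X :: plane \<times> plane))" by (intro continuous_intros)
  from continuous_on_compose2[OF c2[of j] this] show ?thesis using tj[of j] by auto
 qed
 then have k2: "isCont (moment2 (M j) (u j) (t / eps j)) X" for j X
  unfolding continuous_on_eq_continuous_at[OF open_UNIV] by blast
 have "continuous_on UNIV (moment4 (M j) (u j) (t / eps j))" for j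
 proof -
  have "continuous_on UNIV (%X. (t / eps j, X :: plane \<times> plane \<times> plane \<times> plane))" by (intro continuous_intros)
  from continuous_on_compose2[OF c4[of j] this] show ?thesis using tj[of j] by auto
 qed
 then have k4: "isCont (moment4 (M j) (u j) (t / eps j)) X" for j X
  unfolding continuous_on_eq_continuous_at[OF open_UNIV] by blast
 define \<nu>2 where "\<nu>2 j s X = complex_of_real (exp (c * s)) * moment2 (M j) (u j) (s / eps j) X" for j s X
 define \<nu>4 where "\<nu>4 j s X = complex_of_real (exp (2 * c * s)) * moment4 (M j) (u j) (s / eps j) X" for j s X
 have "(%j. \<nu>2 j t (r /\<^sub>R eps j, r /\<^sub>R eps j)) \<longlonglongrightarrow>
  (LINT xi|lborel. of_real (gauss r0 xi) * (cis ((fst xi + snd xi) \<bullet> r) * exp (of_real (\<Psi> t (fst xi + snd xi)))))"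
 proof (rule second_moment_limit[OF _ _ t])
  show "weak_evolution K2 kick2 (%_. 1) (%b. 1 / (2 * k0 * eps j) * sign2 b) (\<nu>2 j)" for j
   unfolding \<nu>2_def[abs_def] c_def by (rule weak_evolution2[OF sol2 eps])
  show "isCont (\<nu>2 j t) (r /\<^sub>R eps j, r /\<^sub>R eps j)" for j
   unfolding \<nu>2_def by (intro continuous_intros k2)
  show "\<nu>2 j 0 = (%X. of_real (exp (- ((eps j)^2 * (norm X)^2 / (2 * r0^2)))))" for j
  proof
   fix X :: "plane \<times> plane" obtain x y where X: "X = (x, y)" by (cases X)
   have "moment2 (M j) (u j) 0 X = initial_field r0 (eps j) x * cnj (initial_field r0 (eps j) y)"
    using sol2[of j] unfolding solves_in_L2_def X by (metis (no_types, lifting) case_prod_conv)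
   also have "\<dots> = of_real (exp (- ((eps j)^2 * (norm X)^2 / (2 * r0^2))))"
    unfolding initial_field_def complex_cnj_complex_of_real of_real_mult[symmetric] exp_add[symmetric]
    by (simp add: X norm_Pair distrib_left add_divide_distrib del: of_real_exp)
   finally show "\<nu>2 j 0 X = of_real (exp (- ((eps j)^2 * (norm X)^2 / (2 * r0^2))))" by (simp add: \<nu>2_def)
  qed
 qed
 moreover have "\<nu>2 j t (r /\<^sub>R eps j, r /\<^sub>R eps j) = complex_of_real (exp (c * t) * a j)" for j
  unfolding \<nu>2_def moment2_def prod.case a_def complex_norm_square[symmetric] of_real_mult
  by (simp only: integral_complex_of_real)
 ultimately have "(%j. complex_of_real (exp (c * t) * a j)) \<longlonglongrightarrow> complex_of_real d"
  unfolding d(2)[symmetric] beam_def by (simp only:)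
 then have la: "(%j. exp (c * t) * a j) \<longlonglongrightarrow> d" by (rule tendsto_of_real_iff[THEN iffD1])
 have "(%j. \<nu>4 j t (r /\<^sub>R eps j, r /\<^sub>R eps j, r /\<^sub>R eps j, r /\<^sub>R eps j)) \<longlonglongrightarrow>
  (LINT xi|lborel. of_real (gauss r0 xi) * (case xi of (a1, a2, b1, b2) => cis ((a1 + a2 + b1 + b2) \<bullet> r) *
   (exp (of_real (\<Psi> t (a1 + b1) + \<Psi> t (a2 + b2))) + exp (of_real (\<Psi> t (a1 + b2) + \<Psi> t (a2 + b1))) - 1)))"
 proof (rule fourth_moment_limit[OF _ _ t])
  show "weak_evolution K4 kick4 kick_sign4 (%b. 1 / (2 * k0 * eps j) * sign4 b) (\<nu>4 j)" for j
   unfolding \<nu>4_def[abs_def] c_def by (rule weak_evolution4[OF sol4 eps])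
  show "isCont (\<nu>4 j t) (r /\<^sub>R eps j, r /\<^sub>R eps j, r /\<^sub>R eps j, r /\<^sub>R eps j)" for j
   unfolding \<nu>4_def by (intro continuous_intros k4)
  show "\<nu>4 j 0 = (%X. of_real (exp (- ((eps j)^2 * (norm X)^2 / (2 * r0^2)))))" for j
  proof
   fix X :: "plane \<times> plane \<times> plane \<times> plane" obtain x1 x2 y1 y2 where X: "X = (x1, x2, y1, y2)" by (cases X)
   have "moment4 (M j) (u j) 0 X = initial_field r0 (eps j) x1 * initial_field r0 (eps j) x2 *
     cnj (initial_field r0 (eps j) y1) * cnj (initial_field r0 (eps j) y2)"
    using sol4[of j] unfolding solves_in_L2_def X by (metis (no_types, lifting) case_prod_conv)
   also have "\<dots> = of_real (exp (- ((eps j)^2 * (norm X)^2 / (2 * r0^2))))"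
    unfolding initial_field_def complex_cnj_complex_of_real of_real_mult[symmetric] exp_add[symmetric]
    by (simp add: X norm_Pair distrib_left add_divide_distrib del: of_real_exp)
   finally show "\<nu>4 j 0 X = of_real (exp (- ((eps j)^2 * (norm X)^2 / (2 * r0^2))))" by (simp add: \<nu>4_def)
  qed
 qed
 moreover have "\<nu>4 j t (r /\<^sub>R eps j, r /\<^sub>R eps j, r /\<^sub>R eps j, r /\<^sub>R eps j) = complex_of_real (exp (2 * c * t) * b j)" for j
 proof -
  have "x * x * cnj x * cnj x = complex_of_real (norm x ^ 4)" for x
  proof -
   have "x * x * cnj x * cnj x = (x * cnj x) * (x * cnj x)" by (simp only: mult.assoc mult.left_commute)
   also have "\<dots> = complex_of_real ((norm x)^2 * (norm x)^2)"
    unfolding complex_norm_square[symmetric] of_real_mult ..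
   finally show ?thesis by (simp flip: power_add)
  qed
  then show ?thesis
   unfolding \<nu>4_def moment4_def prod.case b_def of_real_mult by (simp only: integral_complex_of_real)
 qed
 ultimately have "(%j. complex_of_real (exp (2 * c * t) * b j)) \<longlonglongrightarrow> complex_of_real (2 * d^2 - exp (- (2 * (norm r)^2 / r0^2)))"
  unfolding fourth_moment_value[OF t] d(2) by (simp only: of_real_diff of_real_mult of_real_power of_real_numeral)
 then have lb: "(%j. exp (2 * c * t) * b j) \<longlonglongrightarrow> 2 * d^2 - exp (- (2 * (norm r)^2 / r0^2))" by (rule tendsto_of_real_iff[THEN iffD1])
 have "(%j. (exp (2 * c * t) * b j - (exp (c * t) * a j)^2) / (exp (c * t) * a j)^2) \<longlonglongrightarrow>
   (2 * d^2 - exp (- (2 * (norm r)^2 / r0^2)) - d^2) / d^2"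
  by (intro tendsto_intros la lb) (use d in simp)
 moreover have "(exp (2 * c * t) * b j - (exp (c * t) * a j)^2) / (exp (c * t) * a j)^2 =
   scintillation_index (M j) (u j) (t / eps j) (r /\<^sub>R eps j)" for j
 proof -
  have e: "exp (2 * c * t) = (exp (c * t))^2" by (simp add: mult.assoc flip: exp_double)
  have "(exp (2 * c * t) * b j - (exp (c * t) * a j)^2) / (exp (c * t) * a j)^2 = ((exp (c * t))^2 * (b j - (a j)^2)) / ((exp (c * t))^2 * (a j)^2)"
   unfolding e by (simp add: power_mult_distrib right_diff_distrib)
  then show ?thesis by (simp add: scintillation_index_def a_def b_def)
 qed
 moreover have "(2 * d^2 - exp (- (2 * (norm r)^2 / r0^2)) - d^2) / d^2 = 1 - exp (- (2 * (norm r)^2 / r0^2)) / (cmod (complex_of_real d))^2"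
  using d(1) by (simp add: diff_divide_distrib)
 ultimately show ?thesis unfolding d(2) by (simp only:)
qed

end

theorem proposition10p1:
  fixes k0 r0 z :: real
    and r :: plane
    and C :: "plane \<Rightarrow> real"
    and M :: "real \<Rightarrow> 'a measure"
    and B :: "real \<Rightarrow> real \<Rightarrow> plane \<Rightarrow> 'a \<Rightarrow> real"
    and u :: "real \<Rightarrow> real \<Rightarrow> plane \<Rightarrow> 'a \<Rightarrow> complex"
  assumes "k0 > 0" and "r0 > 0"
    and "covariance_function C"
    and "integrable lborel C"
    and "\<And>\<epsilon>. \<epsilon> > 0 \<Longrightarrow> brownian_field (M \<epsilon>) (\<lambda>x. \<epsilon> * C x) (B \<epsilon>)"
    and "\<And>\<epsilon>. \<epsilon> > 0 \<Longrightarrow> ito_schroedinger_solution (M \<epsilon>) k0 (initial_field r0 \<epsilon>) (B \<epsilon>) (u \<epsilon>)"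
    and "\<And>\<epsilon>. \<epsilon> > 0 \<Longrightarrow> moments_solve_equations (M \<epsilon>) k0 C \<epsilon> (initial_field r0 \<epsilon>) (u \<epsilon>)"
    and "z \<ge> 0"
  shows "((\<lambda>\<epsilon>. scintillation_index (M \<epsilon>) (u \<epsilon>) (z / \<epsilon>) (r /\<^sub>R \<epsilon>)) \<longlongrightarrow>
     1 - exp (- (2 * (norm r)\<^sup>2 / r0\<^sup>2)) /
       (cmod (1 / (4 * of_real pi) *
          (LINT w|lborel.
             exp (of_real (k0\<^sup>2 / 4 * (LINT z':{0..z}|lborel. C ((z' / (k0 * r0)) *\<^sub>R w)))
                  - of_real ((norm w)\<^sup>2 / 4)
                  + \<i> * of_real (w \<bullet> (r /\<^sub>R r0)))))) \<^sup>2) (at_right 0)"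
proof -
 have S: "kick_setting k0 r0 C" by (intro kick_setting.intro assms(1-4))
 note I = kick_setting.beam_integral[OF S assms(8), of r]
 show ?thesis
  unfolding tendsto_at_iff_sequentially o_def I[symmetric]
 proof (intro allI impI)
  fix eps :: "nat => real"
  assume pos: "\<forall>j. eps j \<in> {0<..} - {0}" and lim: "eps \<longlonglongrightarrow> 0"
  have V: "vanishing_noise k0 r0 C eps"
   using pos lim by (intro vanishing_noise.intro[OF S] vanishing_noise_axioms.intro) auto
  show "(%j. scintillation_index (M (eps j)) (u (eps j)) (z / eps j) (r /\<^sub>R eps j)) \<longlonglongrightarrow>
   1 - exp (- (2 * (norm r)^2 / r0^2)) / (cmod (LINT xi|lborel. of_real (gauss r0 xi) * kick_setting.beam k0 C r z (fst xi + snd xi)))^2"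
   by (rule vanishing_noise.scintillation_limit[OF V _ assms(8)]) (use pos assms(7) in auto)
 qed
qed

end
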